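(* Let $R$ be a commutative unitary ring. There exists a model structure on the category $\mathbf{Contr}(R)$ of contractions of cochain complexes of $R$-modules where a morphism $f$ is a weak equivalence (respectively cofibration, fibration) if and only if $\beta\alpha(f)$ is a weak equivalence (respectively cofibration, fibration) in the projective model structure on $\mathbf{coCh}(R)$, and the factorizations depend functorially on the factorizations in $\mathbf{coCh}(R)$.
   Context: Cochain complexes: $\mathbf{coCh}(R)$ is the category of unbounded ($\mathbb{Z}$-graded) cochain complexes of $R$-modules, differential of degree $+1$. Its projective model structure has as weak equivalences the quasi-isomorphisms, as fibrations the degreewise surjective morphisms, and as cofibrations the morphisms having the left lifting property with respect to every morphism that is both a fibration and a weak equivalence (it is a known theorem that this is a model structure). Model structure: for a category $\mathbf{C}$, let $\mathrm{Map}(\mathbf{C})$ be the category whose objects are the morphisms of $\mathbf{C}$ and whose morphisms are commutative squares. A functorial factorization is an ordered pair $(H,K)$ of functors $\mathrm{Map}(\mathbf{C})\to\mathrm{Map}(\mathbf{C})$ such that $f=K(f)\,H(f)$ for every $f$. A model structure on $\mathbf{C}$ consists of three classes of morphisms, called weak equivalences, cofibrations and fibrations, and two functorial factorizations $(C,FW)$ and $(CW,F)$ (these are the factorizations referred to in the claim) such that: (MC1) if $gf$ is defined and two of $f,g,gf$ are weak equivalences, so is the third; (MC2) each of the three classes is closed under retracts; (MC3) trivial cofibrations (cofibrations that are weak equivalences) have the left lifting property with respect to fibrations, and cofibrations have the left lifting property with respect to trivial fibrations (fibrations that are weak equivalences); (MC4) for every morphism $f$, $C(f)$ is a cofibration,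 $FW(f)$ is a trivial fibration, $CW(f)$ is a trivial cofibration and $F(f)$ is a fibration. (Completeness and cocompleteness of $\mathbf{C}$ are not part of the definition of a model structure.) Acyclic retractions: an object of the category $\mathbf{AR}(R)$ is a quadruple $(M,N,\imath,\pi)$ where $M,N\in\mathbf{coCh}(R)$ and $\imath\colon M\to N$, $\pi\colon N\to M$ are quasi-isomorphisms of cochain complexes with $\pi\imath=\mathrm{Id}_M$. A morphism $(M,N,\imath,\pi)\to(A,B,i,p)$ in $\mathbf{AR}(R)$ is a morphism of cochain complexes $f\colon N\to B$ such that $f\imath\pi=ipf$. Contractions: an object of $\mathbf{Contr}(R)$ is a tuple $(M,N,\imath,\pi,h)$ where $(M,N,\imath,\pi)$ is an acyclic retraction and $h$ is an $R$-linear map $N\to N$ of degree $-1$ (a family of $R$-linear maps $N^i\to N^{i-1}$, $i\in\mathbb{Z}$) such that $\imath\pi-\mathrm{Id}_N=d_Nh+hd_N$, $\pi h=h\imath=0$ and $h^2=0$. A morphism $(M,N,\imath,\pi,h)\to(A,B,i,p,k)$ in $\mathbf{Contr}(R)$ is a morphism of cochain complexes $f\colon N\to B$ such that $fh=kf$; every such $f$ is also a morphism of the underlying acyclic retractions. Forgetful functors: $\alpha\colon\mathbf{Contr}(R)\to\mathbf{AR}(R)$ sends $(M,N,\imath,\pi,h)$ to $(M,N,\imath,\pi)$ and $f$ to $f$; $\beta\colon\mathbf{AR}(R)\to\mathbf{coCh}(R)$ sends $(M,N,\imath,\pi)$ to $N$ and $f$ to $f$. *)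

theory Defs
  imports "HOL-Algebra.Module" "HOL-Algebra.AbelCoset" "HOL-Library.FuncSet"
begin

section \<open>Categories and functors\<close>

record ('o, 'm) cat =
  Ob :: "'o set"
  Ar :: "'m set"
  Dom :: "'m \<Rightarrow> 'o"
  Cod :: "'m \<Rightarrow> 'o"
  Ide :: "'o \<Rightarrow> 'm"
  Cmp :: "'m \<Rightarrow> 'm \<Rightarrow> 'm" (infixl \<open>\<cdot>\<index>\<close> 70)

locale category =
  fixes C :: "('o, 'm) cat" (structure)
  assumes Dom_closed: "f \<in> Ar C \<Longrightarrow> Dom C f \<in> Ob C"
    and Cod_closed: "f \<in> Ar C \<Longrightarrow> Cod C f \<in> Ob C"
    and Ide_closed: "X \<in> Ob C \<Longrightarrow> Ide C X \<in> Ar C"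
    and Dom_Ide: "X \<in> Ob C \<Longrightarrow> Dom C (Ide C X) = X"
    and Cod_Ide: "X \<in> Ob C \<Longrightarrow> Cod C (Ide C X) = X"
    and Cmp_closed: "\<lbrakk>f \<in> Ar C; g \<in> Ar C; Cod C f = Dom C g\<rbrakk> \<Longrightarrow> g \<cdot> f \<in> Ar C"
    and Dom_Cmp: "\<lbrakk>f \<in> Ar C; g \<in> Ar C; Cod C f = Dom C g\<rbrakk> \<Longrightarrow> Dom C (g \<cdot> f) = Dom C f"
    and Cod_Cmp: "\<lbrakk>f \<in> Ar C; g \<in> Ar C; Cod C f = Dom C g\<rbrakk> \<Longrightarrow> Cod C (g \<cdot> f) = Cod C g"
    and Cmp_Ide: "f \<in> Ar C \<Longrightarrow> f \<cdot> Ide C (Dom C f) = f"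
    and Ide_Cmp: "f \<in> Ar C \<Longrightarrow> Ide C (Cod C f) \<cdot> f = f"
    and Cmp_assoc: "\<lbrakk>f \<in> Ar C; g \<in> Ar C; h \<in> Ar C; Cod C f = Dom C g; Cod C g = Dom C h\<rbrakk>
                     \<Longrightarrow> h \<cdot> (g \<cdot> f) = (h \<cdot> g) \<cdot> f"

record ('o, 'm, 'p, 'n) functr =
  fob :: "'o \<Rightarrow> 'p"
  far :: "'m \<Rightarrow> 'n"

definition is_functor ::
    "('o, 'm) cat \<Rightarrow> ('p, 'n) cat \<Rightarrow> ('o, 'm, 'p, 'n) functr \<Rightarrow> bool" where
  "is_functor C D F \<longleftrightarrow>
     (\<forall>X \<in> Ob C. fob F X \<in> Ob D \<and> far F (Ide C X) = Ide D (fob F X)) \<and>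
     (\<forall>f \<in> Ar C. far F f \<in> Ar D \<and> Dom D (far F f) = fob F (Dom C f) \<and>
                Cod D (far F f) = fob F (Cod C f)) \<and>
     (\<forall>f \<in> Ar C. \<forall>g \<in> Ar C. Cod C f = Dom C g \<longrightarrow>
                far F (g \<cdot>\<^bsub>C\<^esub> f) = far F g \<cdot>\<^bsub>D\<^esub> far F f)"

definition id_functor :: "('o, 'm, 'o, 'm) functr" where
  "id_functor = \<lparr>fob = \<lambda>X. X, far = \<lambda>f. f\<rparr>"

definition functor_comp ::
    "('p, 'n, 'q, 'k) functr \<Rightarrow> ('o, 'm, 'p, 'n) functr \<Rightarrow> ('o, 'm, 'q, 'k) functr" where
  "functor_comp G F = \<lparr>fob = fob G \<circ> fob F, far = far G \<circ> far F\<rparr>"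

text \<open>A raw morphism together with its source and target.\<close>

datatype ('o, 'm) arrow = Arrow (src: 'o) (mor: 'm) (tgt: 'o)

text \<open>The category \<open>Map(C)\<close>: a morphism \<open>Arrow f (u, v) g\<close> is the commutative square
  \<open>v \<cdot> f = g \<cdot> u\<close>.\<close>

definition map_cat :: "('o, 'm) cat \<Rightarrow> ('m, ('m, 'm \<times> 'm) arrow) cat" where
  "map_cat C = \<lparr>
     Ob = Ar C,
     Ar = {Arrow f (u, v) g | f u v g.
             f \<in> Ar C \<and> g \<in> Ar C \<and> u \<in> Ar C \<and> v \<in> Ar C \<and>
             Dom C u = Dom C f \<and> Cod C u = Dom C g \<and>
             Dom C v = Cod C f \<and> Cod C v = Cod C g \<and> v \<cdot>\<^bsub>C\<^esub> f = g \<cdot>\<^bsub>C\<^esub> u},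
     Dom = src,
     Cod = tgt,
     Ide = (\<lambda>f. Arrow f (Ide C (Dom C f), Ide C (Cod C f)) f),
     Cmp = (\<lambda>b a. Arrow (src a)
              (fst (mor b) \<cdot>\<^bsub>C\<^esub> fst (mor a), snd (mor b) \<cdot>\<^bsub>C\<^esub> snd (mor a)) (tgt b))\<rparr>"

definition map_functor ::
    "('o, 'm, 'p, 'n) functr \<Rightarrow> ('m, ('m, 'm \<times> 'm) arrow, 'n, ('n, 'n \<times> 'n) arrow) functr" where
  "map_functor F = \<lparr>
     fob = far F,
     far = (\<lambda>a. Arrow (far F (src a)) (far F (fst (mor a)), far F (snd (mor a))) (far F (tgt a)))\<rparr>"

text \<open>The category of composable pairs \<open>(H, K)\<close>, where \<open>K \<cdot> H\<close> is defined. A morphism consists of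
  two squares, from \<open>H\<close> to \<open>H'\<close> and from \<open>K\<close> to \<open>K'\<close>, agreeing on the middle objects.\<close>

definition fact_cat ::
    "('o, 'm) cat \<Rightarrow> ('m \<times> 'm, ('m, 'm \<times> 'm) arrow \<times> ('m, 'm \<times> 'm) arrow) cat" where
  "fact_cat C = \<lparr>
     Ob = {(H, K). H \<in> Ar C \<and> K \<in> Ar C \<and> Cod C H = Dom C K},
     Ar = {(a, b). a \<in> Ar (map_cat C) \<and> b \<in> Ar (map_cat C) \<and> snd (mor a) = fst (mor b)},
     Dom = (\<lambda>(a, b). (src a, src b)),
     Cod = (\<lambda>(a, b). (tgt a, tgt b)),
     Ide = (\<lambda>(H, K). (Ide (map_cat C) H, Ide (map_cat C) K)),
     Cmp = (\<lambda>(a', b') (a, b). (a' \<cdot>\<^bsub>map_cat C\<^esub> a, b' \<cdot>\<^bsub>map_cat C\<^esub> b))\<rparr>"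

definition recompose :: "('o, 'm) cat \<Rightarrow>
    ('m \<times> 'm, ('m, 'm \<times> 'm) arrow \<times> ('m, 'm \<times> 'm) arrow, 'm, ('m, 'm \<times> 'm) arrow) functr" where
  "recompose C = \<lparr>
     fob = (\<lambda>(H, K). K \<cdot>\<^bsub>C\<^esub> H),
     far = (\<lambda>(a, b). Arrow (src b \<cdot>\<^bsub>C\<^esub> src a) (fst (mor a), snd (mor b)) (tgt b \<cdot>\<^bsub>C\<^esub> tgt a))\<rparr>"

text \<open>The strict pullback of \<open>F : C \<rightarrow> E\<close> and \<open>G : D \<rightarrow> E\<close>.\<close>

definition pullback_cat ::
    "('o, 'm) cat \<Rightarrow> ('p, 'n) cat \<Rightarrow> ('o, 'm, 'q, 'k) functr \<Rightarrow> ('p, 'n, 'q, 'k) functr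
      \<Rightarrow> ('o \<times> 'p, 'm \<times> 'n) cat" where
  "pullback_cat C D F G = \<lparr>
     Ob = {(X, Y). X \<in> Ob C \<and> Y \<in> Ob D \<and> fob F X = fob G Y},
     Ar = {(f, g). f \<in> Ar C \<and> g \<in> Ar D \<and> far F f = far G g},
     Dom = (\<lambda>(f, g). (Dom C f, Dom D g)),
     Cod = (\<lambda>(f, g). (Cod C f, Cod D g)),
     Ide = (\<lambda>(X, Y). (Ide C X, Ide D Y)),
     Cmp = (\<lambda>(f', g') (f, g). (f' \<cdot>\<^bsub>C\<^esub> f, g' \<cdot>\<^bsub>D\<^esub> g))\<rparr>"

definition fst_functor :: "('o \<times> 'p, 'm \<times> 'n, 'o, 'm) functr" where
  "fst_functor = \<lparr>fob = fst, far = fst\<rparr>"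


section \<open>Functorial factorizations and model structures\<close>

type_synonym ('o, 'm, 'n) functor_pair =
  "('o, 'm, 'n, ('n, 'n \<times> 'n) arrow) functr \<times> ('o, 'm, 'n, ('n, 'n \<times> 'n) arrow) functr"

text \<open>A pair of functors \<open>(H, K)\<close> from \<open>D\<close> to \<open>Map(C)\<close> that factors the functor \<open>U : D \<rightarrow> Map(C)\<close>,
  i.e. \<open>U = K \<cdot> H\<close> on objects and on morphisms of \<open>D\<close>.\<close>

definition factorization_of ::
    "('o, 'm) cat \<Rightarrow> ('p, 'n) cat \<Rightarrow> ('o, 'm, 'n, ('n, 'n \<times> 'n) arrow) functr
      \<Rightarrow> ('o, 'm, 'n) functor_pair \<Rightarrow> bool" where
  "factorization_of D C U = (\<lambda>(H, K).
     is_functor D (map_cat C) H \<and> is_functor D (map_cat C) K \<and>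
     (\<forall>x \<in> Ob D. (fob H x, fob K x) \<in> Ob (fact_cat C) \<and>
                fob (recompose C) (fob H x, fob K x) = fob U x) \<and>
     (\<forall>a \<in> Ar D. (far H a, far K a) \<in> Ar (fact_cat C) \<and>
                far (recompose C) (far H a, far K a) = far U a))"

definition functorial_factorization ::
    "('o, 'm) cat \<Rightarrow> ('m, ('m, 'm \<times> 'm) arrow, 'm) functor_pair \<Rightarrow> bool" where
  "functorial_factorization C = factorization_of (map_cat C) C id_functor"

definition retract_of :: "('o, 'm) cat \<Rightarrow> 'm \<Rightarrow> 'm \<Rightarrow> bool" where
  "retract_of C f g \<longleftrightarrow>
     (\<exists>s \<in> Ar (map_cat C). \<exists>r \<in> Ar (map_cat C). src s = f \<and> tgt s = g \<and> src r = g \<and> tgt r = f \<and>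
        r \<cdot>\<^bsub>map_cat C\<^esub> s = Ide (map_cat C) f)"

definition retract_closed :: "('o, 'm) cat \<Rightarrow> 'm set \<Rightarrow> bool" where
  "retract_closed C S \<longleftrightarrow> (\<forall>f \<in> Ar C. \<forall>g \<in> S. retract_of C f g \<longrightarrow> f \<in> S)"

text \<open>\<open>i\<close> has the left lifting property with respect to \<open>p\<close>.\<close>

definition llp :: "('o, 'm) cat \<Rightarrow> 'm \<Rightarrow> 'm \<Rightarrow> bool" where
  "llp C i p \<longleftrightarrow>
     (\<forall>u v. Arrow i (u, v) p \<in> Ar (map_cat C) \<longrightarrow>
        (\<exists>l \<in> Ar C. Dom C l = Cod C i \<and> Cod C l = Dom C p \<and>
            l \<cdot>\<^bsub>C\<^esub> i = u \<and> p \<cdot>\<^bsub>C\<^esub> l = v))"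

text \<open>In the factorizations \<open>\<phi> = (C, FW)\<close> and \<open>\<psi> = (CW, F)\<close>, the first components are the
  left factors.\<close>

locale model_structure = category C for C :: "('o, 'm) cat" (structure) +
  fixes W Cof Fib :: "'m set"
    and \<phi> \<psi> :: "('m, ('m, 'm \<times> 'm) arrow, 'm) functor_pair"
  assumes W_subset: "W \<subseteq> Ar C" and Cof_subset: "Cof \<subseteq> Ar C" and Fib_subset: "Fib \<subseteq> Ar C"
    and functorial_\<phi>: "functorial_factorization C \<phi>"
    and functorial_\<psi>: "functorial_factorization C \<psi>"
    and two_out_of_three:
      "\<lbrakk>f \<in> Ar C; g \<in> Ar C; Cod C f = Dom C g\<rbrakk> \<Longrightarrow>
         (f \<in> W \<and> g \<in> W \<longrightarrow> g \<cdot> f \<in> W) \<and>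
         (f \<in> W \<and> g \<cdot> f \<in> W \<longrightarrow> g \<in> W) \<and>
         (g \<in> W \<and> g \<cdot> f \<in> W \<longrightarrow> f \<in> W)"
    and retracts: "retract_closed C W" "retract_closed C Cof" "retract_closed C Fib"
    and trivial_cofibration_lifting: "\<lbrakk>i \<in> Cof \<inter> W; p \<in> Fib\<rbrakk> \<Longrightarrow> llp C i p"
    and trivial_fibration_lifting: "\<lbrakk>i \<in> Cof; p \<in> Fib \<inter> W\<rbrakk> \<Longrightarrow> llp C i p"
    and factorization_\<phi>: "f \<in> Ar C \<Longrightarrow> fob (fst \<phi>) f \<in> Cof \<and> fob (snd \<phi>) f \<in> Fib \<inter> W"
    and factorization_\<psi>: "f \<in> Ar C \<Longrightarrow> fob (fst \<psi>) f \<in> Cof \<inter> W \<and> fob (snd \<psi>) f \<in> Fib"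

definition preimage_class ::
    "('o, 'm) cat \<Rightarrow> ('o, 'm, 'p, 'n) functr \<Rightarrow> 'n set \<Rightarrow> 'm set" where
  "preimage_class C F S = {f \<in> Ar C. far F f \<in> S}"


section \<open>Functorial dependence of factorizations\<close>

text \<open>For a functor \<open>F : C \<rightarrow> D\<close>, an object of \<open>factored_cat C D F\<close> is a morphism \<open>f\<close> of \<open>C\<close> together
  with a factorization \<open>F(f) = K \<cdot> H\<close> of its image in \<open>D\<close>; a morphism from \<open>(f, (H, K))\<close> to
  \<open>(f', (H', K'))\<close> is a square from \<open>f\<close> to \<open>f'\<close> in \<open>C\<close> together with a morphism \<open>w\<close> of \<open>D\<close> between the
  middle objects that is compatible with \<open>H\<close>, \<open>H'\<close>, \<open>K\<close>, \<open>K'\<close> and with the image of the square.\<close>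

definition factored_cat ::
    "('o, 'm) cat \<Rightarrow> ('p, 'n) cat \<Rightarrow> ('o, 'm, 'p, 'n) functr \<Rightarrow>
     ('m \<times> ('n \<times> 'n),
      ('m, 'm \<times> 'm) arrow \<times> (('n, 'n \<times> 'n) arrow \<times> ('n, 'n \<times> 'n) arrow)) cat" where
  "factored_cat C D F = pullback_cat (map_cat C) (fact_cat D) (map_functor F) (recompose D)"

text \<open>A functorial way of turning a factorization of \<open>F(f)\<close> in \<open>D\<close> into a factorization of \<open>f\<close>
  in \<open>C\<close>.\<close>

definition factorization_transfer ::
    "('o, 'm) cat \<Rightarrow> ('p, 'n) cat \<Rightarrow> ('o, 'm, 'p, 'n) functr \<Rightarrow>
     ('m \<times> ('n \<times> 'n),
      ('m, 'm \<times> 'm) arrow \<times> (('n, 'n \<times> 'n) arrow \<times> ('n, 'n \<times> 'n) arrow), 'm) functor_pair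
      \<Rightarrow> bool" where
  "factorization_transfer C D F = factorization_of (factored_cat C D F) C fst_functor"

text \<open>The functor \<open>f \<mapsto> (f, (H(F(f)), K(F(f))))\<close> from \<open>Map(C)\<close> to \<open>factored_cat C D F\<close> determined by a
  functorial factorization \<open>(H, K)\<close> on \<open>D\<close>.\<close>

definition factor_image ::
    "('o, 'm, 'p, 'n) functr \<Rightarrow> ('n, ('n, 'n \<times> 'n) arrow, 'n) functor_pair \<Rightarrow>
     ('m, ('m, 'm \<times> 'm) arrow, 'm \<times> ('n \<times> 'n),
      ('m, 'm \<times> 'm) arrow \<times> (('n, 'n \<times> 'n) arrow \<times> ('n, 'n \<times> 'n) arrow)) functr" where
  "factor_image F = (\<lambda>(H, K). \<lparr>
     fob = (\<lambda>f. (f, (fob H (fob (map_functor F) f), fob K (fob (map_functor F) f)))),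
     far = (\<lambda>a. (a, (far H (far (map_functor F) a), far K (far (map_functor F) a))))\<rparr>)"

definition transferred ::
    "('m \<times> ('n \<times> 'n),
      ('m, 'm \<times> 'm) arrow \<times> (('n, 'n \<times> 'n) arrow \<times> ('n, 'n \<times> 'n) arrow), 'm) functor_pair \<Rightarrow>
     ('o, 'm, 'p, 'n) functr \<Rightarrow> ('n, ('n, 'n \<times> 'n) arrow, 'n) functor_pair \<Rightarrow>
     ('m, ('m, 'm \<times> 'm) arrow, 'm) functor_pair" where
  "transferred \<Psi> F \<phi> =
     (functor_comp (fst \<Psi>) (factor_image F \<phi>), functor_comp (snd \<Psi>) (factor_image F \<phi>))"


section \<open>Cochain complexes\<close>

text \<open>The elements of all modules are drawn from a fixed type \<open>'a\<close>, which plays the role of the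
  universe; for free modules and small object arguments to be available in it, \<open>'a\<close> has to be infinite
  and at least as large as the ring. Maps between modules are extensional functions, so that equality of morphisms is
  equality on carriers. The \<open>mult\<close> and \<open>one\<close> fields that the record type of modules inherits from rings
  carry no information.\<close>

definition linear_maps ::
    "('r, 'x) ring_scheme \<Rightarrow> ('r, 'a) module \<Rightarrow> ('r, 'a) module \<Rightarrow> ('a \<Rightarrow> 'a) set" where
  "linear_maps R M N = {f \<in> carrier M \<rightarrow>\<^sub>E carrier N.
     (\<forall>x \<in> carrier M. \<forall>y \<in> carrier M. f (x \<oplus>\<^bsub>M\<^esub> y) = f x \<oplus>\<^bsub>N\<^esub> f y) \<and>
     (\<forall>r \<in> carrier R. \<forall>x \<in> carrier M. f (r \<odot>\<^bsub>M\<^esub> x) = r \<odot>\<^bsub>N\<^esub> f x)}"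

record ('r, 'a) cochain =
  cmod :: "int \<Rightarrow> ('r, 'a) module"
  diff :: "int \<Rightarrow> 'a \<Rightarrow> 'a"

type_synonym 'a graded_map = "int \<Rightarrow> 'a \<Rightarrow> 'a"

locale cochain_complex =
  fixes R :: "('r, 'x) ring_scheme" and N :: "('r, 'a) cochain"
  assumes is_module: "module R (cmod N i)"
    and diff_linear: "diff N i \<in> linear_maps R (cmod N i) (cmod N (i + 1))"
    and diff_diff: "x \<in> carrier (cmod N i) \<Longrightarrow> diff N (i + 1) (diff N i x) = \<zero>\<^bsub>cmod N (i + 1 + 1)\<^esub>"

definition cochain_maps ::
    "('r, 'x) ring_scheme \<Rightarrow> ('r, 'a) cochain \<Rightarrow> ('r, 'a) cochain \<Rightarrow> 'a graded_map set" where
  "cochain_maps R M N = {f. \<forall>i. f i \<in> linear_maps R (cmod M i) (cmod N i) \<and>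
     (\<forall>x \<in> carrier (cmod M i). f (i + 1) (diff M i x) = diff N i (f i x))}"

definition id_map :: "('r, 'a) cochain \<Rightarrow> 'a graded_map" where
  "id_map N = (\<lambda>i. restrict (\<lambda>x. x) (carrier (cmod N i)))"

definition comp_map :: "('r, 'a) cochain \<Rightarrow> 'a graded_map \<Rightarrow> 'a graded_map \<Rightarrow> 'a graded_map" where
  "comp_map M g f = (\<lambda>i. compose (carrier (cmod M i)) (g i) (f i))"

definition coCh ::
    "('r, 'x) ring_scheme \<Rightarrow>
     (('r, 'a) cochain, (('r, 'a) cochain, 'a graded_map) arrow) cat" where
  "coCh R = \<lparr>
     Ob = {N. cochain_complex R N},
     Ar = {Arrow M f N | M f N.
             cochain_complex R M \<and> cochain_complex R N \<and> f \<in> cochain_maps R M N},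
     Dom = src,
     Cod = tgt,
     Ide = (\<lambda>N. Arrow N (id_map N) N),
     Cmp = (\<lambda>g f. Arrow (src f) (comp_map (src f) (mor g) (mor f)) (tgt g))\<rparr>"

definition cocycles :: "('r, 'a) cochain \<Rightarrow> int \<Rightarrow> 'a set" where
  "cocycles N i = {x \<in> carrier (cmod N i). diff N i x = \<zero>\<^bsub>cmod N (i + 1)\<^esub>}"

definition coboundaries :: "('r, 'a) cochain \<Rightarrow> int \<Rightarrow> 'a set" where
  "coboundaries N i = diff N (i - 1) ` carrier (cmod N (i - 1))"

text \<open>Cohomology is taken with its additive group structure only: the induced maps are automatically
  compatible with the scalar action, so they are isomorphisms of modules iff they are isomorphisms
  of groups.\<close>

definition cohomology :: "('r, 'a) cochain \<Rightarrow> int \<Rightarrow> 'a set monoid" where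
  "cohomology N i = (add_monoid (cmod N i)\<lparr>carrier := cocycles N i\<rparr>) Mod (coboundaries N i)"

text \<open>The class of a cocycle \<open>z\<close> is mapped to the class of \<open>f(z)\<close>: the sum of the sets
  \<open>coboundaries N i\<close> and \<open>f ` [z]\<close> is the coset of \<open>f(z)\<close>.\<close>

definition cohomology_map :: "('r, 'a) cochain \<Rightarrow> 'a graded_map \<Rightarrow> int \<Rightarrow> 'a set \<Rightarrow> 'a set" where
  "cohomology_map N f i = (\<lambda>c. coboundaries N i <+>\<^bsub>cmod N i\<^esub> (f i ` c))"

definition quasi_iso ::
    "('r, 'x) ring_scheme \<Rightarrow> ('r, 'a) cochain \<Rightarrow> ('r, 'a) cochain \<Rightarrow> 'a graded_map \<Rightarrow> bool" where
  "quasi_iso R M N f \<longleftrightarrow> f \<in> cochain_maps R M N \<and>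
     (\<forall>i. cohomology_map N f i \<in> iso (cohomology M i) (cohomology N i))"

definition qis :: "('r, 'x) ring_scheme \<Rightarrow> (('r, 'a) cochain, 'a graded_map) arrow set" where
  "qis R = {f \<in> Ar (coCh R). quasi_iso R (src f) (tgt f) (mor f)}"

definition proj_fib :: "('r, 'x) ring_scheme \<Rightarrow> (('r, 'a) cochain, 'a graded_map) arrow set" where
  "proj_fib R = {f \<in> Ar (coCh R).
     \<forall>i. mor f i ` carrier (cmod (src f) i) = carrier (cmod (tgt f) i)}"

definition proj_cof :: "('r, 'x) ring_scheme \<Rightarrow> (('r, 'a) cochain, 'a graded_map) arrow set" where
  "proj_cof R = {f \<in> Ar (coCh R). \<forall>p \<in> proj_fib R \<inter> qis R. llp (coCh R) f p}"


section \<open>Acyclic retractions and contractions\<close>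

record ('r, 'a) retraction =
  small :: "('r, 'a) cochain"
  big :: "('r, 'a) cochain"
  incl :: "'a graded_map"
  proj :: "'a graded_map"

record ('r, 'a) contraction = "('r, 'a) retraction" +
  homot :: "'a graded_map"

locale acyclic_retraction =
  fixes R :: "('r, 'x) ring_scheme" and X :: "('r, 'a, 'z) retraction_scheme"
  assumes small_complex: "cochain_complex R (small X)"
    and big_complex: "cochain_complex R (big X)"
    and incl_quasi_iso: "quasi_iso R (small X) (big X) (incl X)"
    and proj_quasi_iso: "quasi_iso R (big X) (small X) (proj X)"
    and proj_incl: "x \<in> carrier (cmod (small X) i) \<Longrightarrow> proj X i (incl X i x) = x"

locale contraction = acyclic_retraction R X
  for R :: "('r, 'x) ring_scheme" and X :: "('r, 'a) contraction" +
  assumes homot_linear: "homot X i \<in> linear_maps R (cmod (big X) i) (cmod (big X) (i - 1))"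
    and homotopy:
      "x \<in> carrier (cmod (big X) i) \<Longrightarrow>
         incl X i (proj X i x) \<ominus>\<^bsub>cmod (big X) i\<^esub> x =
         diff (big X) (i - 1) (homot X i x) \<oplus>\<^bsub>cmod (big X) i\<^esub> homot X (i + 1) (diff (big X) i x)"
    and proj_homot:
      "x \<in> carrier (cmod (big X) i) \<Longrightarrow> proj X (i - 1) (homot X i x) = \<zero>\<^bsub>cmod (small X) (i - 1)\<^esub>"
    and homot_incl:
      "x \<in> carrier (cmod (small X) i) \<Longrightarrow> homot X i (incl X i x) = \<zero>\<^bsub>cmod (big X) (i - 1)\<^esub>"
    and homot_homot:
      "x \<in> carrier (cmod (big X) i) \<Longrightarrow>
         homot X (i - 1) (homot X i x) = \<zero>\<^bsub>cmod (big X) (i - 1 - 1)\<^esub>"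

definition AR ::
    "('r, 'x) ring_scheme \<Rightarrow>
     (('r, 'a) retraction, (('r, 'a) retraction, 'a graded_map) arrow) cat" where
  "AR R = \<lparr>
     Ob = {X. acyclic_retraction R X},
     Ar = {Arrow X f Y | X f Y.
             acyclic_retraction R X \<and> acyclic_retraction R Y \<and>
             f \<in> cochain_maps R (big X) (big Y) \<and>
             (\<forall>i. \<forall>x \<in> carrier (cmod (big X) i).
                f i (incl X i (proj X i x)) = incl Y i (proj Y i (f i x)))},
     Dom = src,
     Cod = tgt,
     Ide = (\<lambda>X. Arrow X (id_map (big X)) X),
     Cmp = (\<lambda>g f. Arrow (src f) (comp_map (big (src f)) (mor g) (mor f)) (tgt g))\<rparr>"

definition Contr ::
    "('r, 'x) ring_scheme \<Rightarrow>
     (('r, 'a) contraction, (('r, 'a) contraction, 'a graded_map) arrow) cat" where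
  "Contr R = \<lparr>
     Ob = {X. contraction R X},
     Ar = {Arrow X f Y | X f Y.
             contraction R X \<and> contraction R Y \<and>
             f \<in> cochain_maps R (big X) (big Y) \<and>
             (\<forall>i. \<forall>x \<in> carrier (cmod (big X) i).
                f (i - 1) (homot X i x) = homot Y i (f i x))},
     Dom = src,
     Cod = tgt,
     Ide = (\<lambda>X. Arrow X (id_map (big X)) X),
     Cmp = (\<lambda>g f. Arrow (src f) (comp_map (big (src f)) (mor g) (mor f)) (tgt g))\<rparr>"

definition forget_homot ::
    "(('r, 'a) contraction, (('r, 'a) contraction, 'a graded_map) arrow,
      ('r, 'a) retraction, (('r, 'a) retraction, 'a graded_map) arrow) functr" (\<open>\<alpha>\<close>) where
  "\<alpha> = \<lparr>
     fob = retraction.truncate,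
     far = (\<lambda>f. Arrow (retraction.truncate (src f)) (mor f) (retraction.truncate (tgt f)))\<rparr>"

definition forget_retraction ::
    "(('r, 'a) retraction, (('r, 'a) retraction, 'a graded_map) arrow,
      ('r, 'a) cochain, (('r, 'a) cochain, 'a graded_map) arrow) functr" (\<open>\<beta>\<close>) where
  "\<beta> = \<lparr>
     fob = big,
     far = (\<lambda>f. Arrow (big (src f)) (mor f) (big (tgt f)))\<rparr>"

definition forget_contraction ::
    "(('r, 'a) contraction, (('r, 'a) contraction, 'a graded_map) arrow,
      ('r, 'a) cochain, (('r, 'a) cochain, 'a graded_map) arrow) functr" (\<open>\<beta>\<alpha>\<close>) where
  "\<beta>\<alpha> = functor_comp \<beta> \<alpha>"

end

theory Submission
  imports Defs
begin

text \<open>A contraction is the same thing, up to the choice of its small complex, as a complex \<open>N\<close> with a map \<open>h\<close> of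
  degree \<open>-1\<close> such that \<open>h h = 0\<close> and \<open>h d h = -h\<close>. A lift in complexes between such objects can be corrected to
  one that commutes with the homotopies, so the lifting axioms are inherited. A factorization \<open>N \<rightarrow> Q \<rightarrow> B\<close> of the
  complexes underlying a map of contractions is turned into one of contractions by replacing \<open>Q\<close> with the pushout
  of \<open>free N \<rightarrow> free Q\<close> along \<open>free N \<rightarrow> N\<close>, where \<open>free\<close> is left adjoint to the forgetful functor. This keeps
  cofibrations because the forgetful functor also has a right adjoint preserving trivial fibrations, and it keeps weak
  equivalences because \<open>Q\<close> changes only by a contractible complex.

  It remains to produce the projective model structure with all modules inside the universe \<open>'a\<close>. The cells of the
  cofibrant factor of \<open>f : M \<rightarrow> N\<close> are generated inductively: a cell is a name of a pair \<open>(z, y)\<close>, where \<open>z\<close> is a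
  cocycle built from \<open>M\<close> and earlier cells and \<open>y\<close> bounds its image in \<open>N\<close>. Thus the transfinite colimit of the small
  object argument is replaced by a single inductive definition.\<close>


section \<open>Categories of morphisms\<close>

text \<open>The equation \<open>h d h = -h\<close> is the homotopy relation multiplied by
  \<open>h\<close>; with \<open>h h = 0\<close> it makes \<open>e = 1 + d h + h d\<close> an
  idempotent cochain map, whose image serves as the small complex. One transfer has to be fixed
  before any model structure on complexes is given, so the pushout is formed for an arbitrary
  factorization \<open>(H, K)\<close>. What holds only for a cofibration \<open>H\<close> enters
  afterwards and degreewise: comparing \<open>Q\<close> with the pushout uses that \<open>H\<close>
  is injective, and lifting out of the pushout uses that a cochain map on it amounts to a cochain
  map \<open>l\<close> on \<open>Q\<close> and linear maps \<open>s\<close>, the values at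
  \<open>h y\<close>, on which the differential imposes nothing. Both facts come from a section of
  the cellular factorization of \<open>H\<close>. Degrees are unbounded and the boundary of a cell
  of degree \<open>i\<close> lies in degree \<open>i + 1\<close>, so no induction on degrees is
  available. Recursion runs along occurrence in a boundary, which is well-founded because cells are
  generated inductively. A cell is its own name, a code of its boundary and value, so maps of cell
  complexes are computed from names and functoriality is strict.\<close>

lemma map_cat_simps [simp]:
  "Ob (map_cat C) = Ar C" "Dom (map_cat C) = src" "Cod (map_cat C) = tgt"
  "Ide (map_cat C) f = Arrow f (Ide C (Dom C f), Ide C (Cod C f)) f"
  "b \<cdot>\<^bsub>map_cat C\<^esub> a = Arrow (src a) (fst (mor b) \<cdot>\<^bsub>C\<^esub> fst (mor a), snd (mor b) \<cdot>\<^bsub>C\<^esub> snd (mor a)) (tgt b)"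
  by (simp_all add: map_cat_def)

lemma Arrow_in_map_cat [simp]:
  "Arrow f (u, v) g \<in> Ar (map_cat C) \<longleftrightarrow>
     f \<in> Ar C \<and> g \<in> Ar C \<and> u \<in> Ar C \<and> v \<in> Ar C \<and> Dom C u = Dom C f \<and> Cod C u = Dom C g \<and>
     Dom C v = Cod C f \<and> Cod C v = Cod C g \<and> v \<cdot>\<^bsub>C\<^esub> f = g \<cdot>\<^bsub>C\<^esub> u"
  by (auto simp: map_cat_def)

lemma map_catE:
  assumes "a \<in> Ar (map_cat C)"
  obtains f u v g where "a = Arrow f (u, v) g"
    "f \<in> Ar C" "g \<in> Ar C" "u \<in> Ar C" "v \<in> Ar C" "Dom C u = Dom C f" "Cod C u = Dom C g"
    "Dom C v = Cod C f" "Cod C v = Cod C g" "v \<cdot>\<^bsub>C\<^esub> f = g \<cdot>\<^bsub>C\<^esub> u"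
  using assms by (auto simp: map_cat_def)

context category
begin

lemma Ide_in_map_cat: "f \<in> Ar C \<Longrightarrow> Ide (map_cat C) f \<in> Ar (map_cat C)"
  by (simp add: Dom_closed Cod_closed Ide_closed Dom_Ide Cod_Ide Cmp_Ide Ide_Cmp)

lemma map_cat_Cmp_closed:
  assumes "a \<in> Ar (map_cat C)" "b \<in> Ar (map_cat C)" "tgt a = src b"
  shows "b \<cdot>\<^bsub>map_cat C\<^esub> a \<in> Ar (map_cat C)"
proof -
  from assms(1) obtain f u v g where a: "a = Arrow f (u, v) g"
    "f \<in> Ar C" "g \<in> Ar C" "u \<in> Ar C" "v \<in> Ar C" "Dom C u = Dom C f" "Cod C u = Dom C g"
    "Dom C v = Cod C f" "Cod C v = Cod C g" "v \<cdot> f = g \<cdot> u" by (rule map_catE)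
  from assms(2) obtain f' u' v' g' where b: "b = Arrow f' (u', v') g'"
    "f' \<in> Ar C" "g' \<in> Ar C" "u' \<in> Ar C" "v' \<in> Ar C" "Dom C u' = Dom C f'" "Cod C u' = Dom C g'"
    "Dom C v' = Cod C f'" "Cod C v' = Cod C g'" "v' \<cdot> f' = g' \<cdot> u'" by (rule map_catE)
  have eq: "f' = g" using assms(3) a b by simp
  have "(v' \<cdot> v) \<cdot> f = v' \<cdot> (g \<cdot> u)"
    using a b eq by (metis Cmp_assoc)
  also have "\<dots> = (v' \<cdot> g) \<cdot> u" using a b eq by (simp add: Cmp_assoc)
  also have "\<dots> = g' \<cdot> (u' \<cdot> u)" using a b eq by (metis Cmp_assoc)
  finally show ?thesis
    using a b eq by (simp add: Cmp_closed Dom_Cmp Cod_Cmp)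
qed

text \<open>The squares given by the two functors share their middle side, so on morphisms the data
  reduce to one arrow \<open>w a\<close>, and functoriality of the pair reduces to that of
  \<open>w\<close>. The conditions on \<open>D\<close> are spelled out as closure properties because
  they are checked by hand for \<open>factored_cat\<close>.\<close>

lemma factorization_ofI:
  fixes D :: "('p, 'n) cat"
  assumes U: "is_functor D (map_cat C) U"
    and D_closed: "\<And>a. a \<in> Ar D \<Longrightarrow> Dom D a \<in> Ob D" "\<And>a. a \<in> Ar D \<Longrightarrow> Cod D a \<in> Ob D"
    and D_Ide: "\<And>x. x \<in> Ob D \<Longrightarrow> Ide D x \<in> Ar D \<and> Dom D (Ide D x) = x \<and> Cod D (Ide D x) = x"
    and D_Cmp: "\<And>a b. \<lbrakk>a \<in> Ar D; b \<in> Ar D; Cod D a = Dom D b\<rbrakk> \<Longrightarrow>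
      b \<cdot>\<^bsub>D\<^esub> a \<in> Ar D \<and> Dom D (b \<cdot>\<^bsub>D\<^esub> a) = Dom D a \<and> Cod D (b \<cdot>\<^bsub>D\<^esub> a) = Cod D b"
    and hk: "\<And>x. x \<in> Ob D \<Longrightarrow> h x \<in> Ar C \<and> k x \<in> Ar C \<and> Cod C (h x) = Dom C (k x) \<and> k x \<cdot> h x = fob U x"
    and w: "\<And>a. a \<in> Ar D \<Longrightarrow> w a \<in> Ar C \<and> Dom C (w a) = Cod C (h (Dom D a)) \<and>
       Cod C (w a) = Cod C (h (Cod D a)) \<and>
       w a \<cdot> h (Dom D a) = h (Cod D a) \<cdot> fst (mor (far U a)) \<and>
       k (Cod D a) \<cdot> w a = snd (mor (far U a)) \<cdot> k (Dom D a)"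
    and w_Ide: "\<And>x. x \<in> Ob D \<Longrightarrow> w (Ide D x) = Ide C (Cod C (h x))"
    and w_Cmp: "\<And>a b. \<lbrakk>a \<in> Ar D; b \<in> Ar D; Cod D a = Dom D b\<rbrakk> \<Longrightarrow> w (b \<cdot>\<^bsub>D\<^esub> a) = w b \<cdot> w a"
  shows "factorization_of D C U
    (\<lparr>fob = h, far = \<lambda>a. Arrow (h (Dom D a)) (fst (mor (far U a)), w a) (h (Cod D a))\<rparr>,
     \<lparr>fob = k, far = \<lambda>a. Arrow (k (Dom D a)) (w a, snd (mor (far U a))) (k (Cod D a))\<rparr>)"
proof -
  have UA: "far U a \<in> Ar (map_cat C) \<and> src (far U a) = fob U (Dom D a) \<and>
     tgt (far U a) = fob U (Cod D a)" if "a \<in> Ar D" for a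
    using U that unfolding is_functor_def by auto
  have UI: "far U (Ide D x) = Ide (map_cat C) (fob U x)" if "x \<in> Ob D" for x
    using U that unfolding is_functor_def by auto
  have UC: "far U (b \<cdot>\<^bsub>D\<^esub> a) = far U b \<cdot>\<^bsub>map_cat C\<^esub> far U a"
    if "a \<in> Ar D" "b \<in> Ar D" "Cod D a = Dom D b" for a b
    using U that unfolding is_functor_def by auto
  have UD: "Dom C (fob U x) = Dom C (h x) \<and> Cod C (fob U x) = Cod C (k x)" if "x \<in> Ob D" for x
    using hk[OF that] Dom_Cmp Cod_Cmp by metis
  have uv: "fst (mor (far U a)) \<in> Ar C \<and> snd (mor (far U a)) \<in> Ar C \<and>
      Dom C (fst (mor (far U a))) = Dom C (h (Dom D a)) \<and>
      Cod C (fst (mor (far U a))) = Dom C (h (Cod D a)) \<and>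
      Dom C (snd (mor (far U a))) = Cod C (k (Dom D a)) \<and>
      Cod C (snd (mor (far U a))) = Cod C (k (Cod D a)) \<and>
      far U a = Arrow (fob U (Dom D a)) (fst (mor (far U a)), snd (mor (far U a))) (fob U (Cod D a))"
    if a: "a \<in> Ar D" for a
  proof -
    from UA[OF a] have "far U a \<in> Ar (map_cat C)" by simp
    then obtain f u v g where A: "far U a = Arrow f (u, v) g"
      "f \<in> Ar C" "g \<in> Ar C" "u \<in> Ar C" "v \<in> Ar C" "Dom C u = Dom C f" "Cod C u = Dom C g"
      "Dom C v = Cod C f" "Cod C v = Cod C g" "v \<cdot> f = g \<cdot> u" by (rule map_catE)
    show ?thesis using UA[OF a] A UD[OF D_closed(1)[OF a]] UD[OF D_closed(2)[OF a]] by auto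
  qed
  have H: "is_functor D (map_cat C) \<lparr>fob = h, far = \<lambda>a. Arrow (h (Dom D a)) (fst (mor (far U a)), w a) (h (Cod D a))\<rparr>"
    unfolding is_functor_def
    using hk w uv D_closed D_Ide D_Cmp UI UD UC w_Ide w_Cmp by auto
  have K: "is_functor D (map_cat C) \<lparr>fob = k, far = \<lambda>a. Arrow (k (Dom D a)) (w a, snd (mor (far U a))) (k (Cod D a))\<rparr>"
    unfolding is_functor_def
    using hk w uv D_closed D_Ide D_Cmp UI UD UC w_Ide w_Cmp by auto
  have O: "(h x, k x) \<in> Ob (fact_cat C) \<and> fob (recompose C) (h x, k x) = fob U x" if "x \<in> Ob D" for x
    using hk[OF that] by (simp add: fact_cat_def recompose_def)
  have A: "(Arrow (h (Dom D a)) (fst (mor (far U a)), w a) (h (Cod D a)),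
            Arrow (k (Dom D a)) (w a, snd (mor (far U a))) (k (Cod D a))) \<in> Ar (fact_cat C) \<and>
      far (recompose C) (Arrow (h (Dom D a)) (fst (mor (far U a)), w a) (h (Cod D a)),
            Arrow (k (Dom D a)) (w a, snd (mor (far U a))) (k (Cod D a))) = far U a"
    if "a \<in> Ar D" for a
    using hk[OF D_closed(1)[OF that]] hk[OF D_closed(2)[OF that]] w[OF that] uv[OF that]
    by (simp add: fact_cat_def recompose_def)
  show ?thesis unfolding factorization_of_def using H K O A by simp
qed

text \<open>The conclusion records the object parts of the pair, since it is these that the
  factorization axiom of a model structure constrains.\<close>

lemma functorial_factorizationI:
  assumes hk: "\<And>f. f \<in> Ar C \<Longrightarrow> h f \<in> Ar C \<and> k f \<in> Ar C \<and> Cod C (h f) = Dom C (k f) \<and> k f \<cdot> h f = f"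
    and w: "\<And>f u v g. Arrow f (u, v) g \<in> Ar (map_cat C) \<Longrightarrow>
       w (Arrow f (u, v) g) \<in> Ar C \<and> Dom C (w (Arrow f (u, v) g)) = Cod C (h f) \<and>
       Cod C (w (Arrow f (u, v) g)) = Cod C (h g) \<and>
       w (Arrow f (u, v) g) \<cdot> h f = h g \<cdot> u \<and> k g \<cdot> w (Arrow f (u, v) g) = v \<cdot> k f"
    and w_Ide: "\<And>f. f \<in> Ar C \<Longrightarrow> w (Ide (map_cat C) f) = Ide C (Cod C (h f))"
    and w_Cmp: "\<And>a b. \<lbrakk>a \<in> Ar (map_cat C); b \<in> Ar (map_cat C); tgt a = src b\<rbrakk> \<Longrightarrow>
       w (b \<cdot>\<^bsub>map_cat C\<^esub> a) = w b \<cdot> w a"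
  shows "\<exists>\<phi>. functorial_factorization C \<phi> \<and> fob (fst \<phi>) = h \<and> fob (snd \<phi>) = k"
proof -
  let ?U = "id_functor :: ('m, ('m, 'm \<times> 'm) arrow, 'm, ('m, 'm \<times> 'm) arrow) functr"
  have "factorization_of (map_cat C) C ?U
    (\<lparr>fob = h, far = \<lambda>a. Arrow (h (Dom (map_cat C) a)) (fst (mor (far ?U a)), w a) (h (Cod (map_cat C) a))\<rparr>,
     \<lparr>fob = k, far = \<lambda>a. Arrow (k (Dom (map_cat C) a)) (w a, snd (mor (far ?U a))) (k (Cod (map_cat C) a))\<rparr>)"
proof (rule factorization_ofI)
    show "is_functor (map_cat C) (map_cat C) id_functor"
      by (auto simp: is_functor_def id_functor_def elim!: map_catE)
    fix a assume a: "a \<in> Ar (map_cat C)"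
    then show "Dom (map_cat C) a \<in> Ob (map_cat C)" "Cod (map_cat C) a \<in> Ob (map_cat C)"
      by (auto elim!: map_catE)
    from a obtain f u v g where A: "a = Arrow f (u, v) g" by (rule map_catE)
    show "w a \<in> Ar C \<and> Dom C (w a) = Cod C (h (Dom (map_cat C) a)) \<and>
       Cod C (w a) = Cod C (h (Cod (map_cat C) a)) \<and>
       w a \<cdot> h (Dom (map_cat C) a) = h (Cod (map_cat C) a) \<cdot> fst (mor (far ?U a)) \<and>
       k (Cod (map_cat C) a) \<cdot> w a = snd (mor (far ?U a)) \<cdot> k (Dom (map_cat C) a)"
      using w[of f u v g] a unfolding A by (simp add: id_functor_def)
    fix b assume b: "b \<in> Ar (map_cat C)" and ab: "Cod (map_cat C) a = Dom (map_cat C) b"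
    show "b \<cdot>\<^bsub>map_cat C\<^esub> a \<in> Ar (map_cat C) \<and> Dom (map_cat C) (b \<cdot>\<^bsub>map_cat C\<^esub> a) = Dom (map_cat C) a \<and>
       Cod (map_cat C) (b \<cdot>\<^bsub>map_cat C\<^esub> a) = Cod (map_cat C) b"
      using map_cat_Cmp_closed[OF a b] ab by simp
    show "w (b \<cdot>\<^bsub>map_cat C\<^esub> a) = w b \<cdot> w a" using w_Cmp[OF a b] ab by simp
  next
    fix x assume x: "x \<in> Ob (map_cat C)"
    then show "Ide (map_cat C) x \<in> Ar (map_cat C) \<and> Dom (map_cat C) (Ide (map_cat C) x) = x \<and>
         Cod (map_cat C) (Ide (map_cat C) x) = x"
      using Ide_in_map_cat[of x] by simp
    show "w (Ide (map_cat C) x) = Ide C (Cod C (h x))" using w_Ide[of x] x by simp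
  qed (use hk in \<open>auto simp: id_functor_def\<close>)
  then show ?thesis unfolding functorial_factorization_def by (intro exI conjI) (assumption | simp)+
qed

end

section \<open>Lifting properties\<close>

context category
begin

lemma llpI:
  assumes "\<And>u v. \<lbrakk>i \<in> Ar C; p \<in> Ar C; u \<in> Ar C; v \<in> Ar C; Dom C u = Dom C i; Cod C u = Dom C p;
     Dom C v = Cod C i; Cod C v = Cod C p; v \<cdot> i = p \<cdot> u\<rbrakk> \<Longrightarrow>
     \<exists>l \<in> Ar C. Dom C l = Cod C i \<and> Cod C l = Dom C p \<and> l \<cdot> i = u \<and> p \<cdot> l = v"
  shows "llp C i p"
  using assms unfolding llp_def by auto

lemma llpE:
  assumes "llp C i p" "i \<in> Ar C" "p \<in> Ar C" "u \<in> Ar C" "v \<in> Ar C" "Dom C u = Dom C i"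
    "Cod C u = Dom C p" "Dom C v = Cod C i" "Cod C v = Cod C p" "v \<cdot> i = p \<cdot> u"
  obtains l where "l \<in> Ar C" "Dom C l = Cod C i" "Cod C l = Dom C p" "l \<cdot> i = u" "p \<cdot> l = v"
  using assms unfolding llp_def by auto

lemma retract_ofE:
  assumes "retract_of C f g" "f \<in> Ar C"
  obtains s1 s2 r1 r2 where "g \<in> Ar C" "s1 \<in> Ar C" "s2 \<in> Ar C" "r1 \<in> Ar C" "r2 \<in> Ar C"
    "Dom C s1 = Dom C f" "Cod C s1 = Dom C g" "Dom C s2 = Cod C f" "Cod C s2 = Cod C g"
    "Dom C r1 = Dom C g" "Cod C r1 = Dom C f" "Dom C r2 = Cod C g" "Cod C r2 = Cod C f"
    "s2 \<cdot> f = g \<cdot> s1" "r2 \<cdot> g = f \<cdot> r1" "r1 \<cdot> s1 = Ide C (Dom C f)" "r2 \<cdot> s2 = Ide C (Cod C f)"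
proof -
  from assms(1) obtain s r where s: "s \<in> Ar (map_cat C)" and r: "r \<in> Ar (map_cat C)"
    and sr: "src s = f" "tgt s = g" "src r = g" "tgt r = f" "r \<cdot>\<^bsub>map_cat C\<^esub> s = Ide (map_cat C) f"
    unfolding retract_of_def by blast
  from s obtain s1 s2 where s': "s = Arrow f (s1, s2) g" using sr by (auto elim!: map_catE)
  from r obtain r1 r2 where r': "r = Arrow g (r1, r2) f" using sr by (auto elim!: map_catE)
  show ?thesis by (rule that[of s1 s2 r1 r2]) (use s r sr(5) in \<open>auto simp: s' r'\<close>)
qed

lemma retract_ofI:
  assumes "f \<in> Ar C" "g \<in> Ar C" "s1 \<in> Ar C" "s2 \<in> Ar C" "r1 \<in> Ar C" "r2 \<in> Ar C"
    "Dom C s1 = Dom C f" "Cod C s1 = Dom C g" "Dom C s2 = Cod C f" "Cod C s2 = Cod C g"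
    "Dom C r1 = Dom C g" "Cod C r1 = Dom C f" "Dom C r2 = Cod C g" "Cod C r2 = Cod C f"
    "s2 \<cdot> f = g \<cdot> s1" "r2 \<cdot> g = f \<cdot> r1" "r1 \<cdot> s1 = Ide C (Dom C f)" "r2 \<cdot> s2 = Ide C (Cod C f)"
  shows "retract_of C f g"
  unfolding retract_of_def
  by (rule bexI[of _ "Arrow f (s1, s2) g"], rule bexI[of _ "Arrow g (r1, r2) f"]) (use assms in auto)

text \<open>The problem for \<open>i\<close> is composed with the retraction \<open>(r1, r2)\<close>
  to a problem for \<open>j\<close>; a solution \<open>l\<close> of that one, restricted along
  \<open>s2\<close>, solves the original one.\<close>

lemma llp_retract:
  assumes ret: "retract_of C i j" and i: "i \<in> Ar C" and j: "llp C j p"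
  shows "llp C i p"
proof (rule llpI)
  fix u v assume p: "p \<in> Ar C" and u: "u \<in> Ar C" "Dom C u = Dom C i" "Cod C u = Dom C p"
    and v: "v \<in> Ar C" "Dom C v = Cod C i" "Cod C v = Cod C p" and sq: "v \<cdot> i = p \<cdot> u"
  from ret i obtain s1 s2 r1 r2 where A: "j \<in> Ar C" "s1 \<in> Ar C" "s2 \<in> Ar C" "r1 \<in> Ar C" "r2 \<in> Ar C"
    "Dom C s1 = Dom C i" "Cod C s1 = Dom C j" "Dom C s2 = Cod C i" "Cod C s2 = Cod C j"
    "Dom C r1 = Dom C j" "Cod C r1 = Dom C i" "Dom C r2 = Cod C j" "Cod C r2 = Cod C i"
    and B: "s2 \<cdot> i = j \<cdot> s1" "r2 \<cdot> j = i \<cdot> r1" "r1 \<cdot> s1 = Ide C (Dom C i)" "r2 \<cdot> s2 = Ide C (Cod C i)"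
    by (rule retract_ofE) 
  have "(v \<cdot> r2) \<cdot> j = v \<cdot> (i \<cdot> r1)" using A B v i by (metis Cmp_assoc)
  also have "\<dots> = p \<cdot> (u \<cdot> r1)" using A B v i u p sq by (metis Cmp_assoc)
  finally have "(v \<cdot> r2) \<cdot> j = p \<cdot> (u \<cdot> r1)" .
  then obtain l where l: "l \<in> Ar C" "Dom C l = Cod C j" "Cod C l = Dom C p"
    and l2: "l \<cdot> j = u \<cdot> r1" "p \<cdot> l = v \<cdot> r2"
    using llpE[OF j A(1) p, of "u \<cdot> r1" "v \<cdot> r2"] A u v by (auto simp: Cmp_closed Dom_Cmp Cod_Cmp)
  have "(l \<cdot> s2) \<cdot> i = l \<cdot> (j \<cdot> s1)" using A B l i by (metis Cmp_assoc)
  also have "\<dots> = u \<cdot> (r1 \<cdot> s1)" using A l l2 u by (metis Cmp_assoc)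
  also have "\<dots> = u" using B u by (metis Cmp_Ide)
  finally have 1: "(l \<cdot> s2) \<cdot> i = u" .
  have "p \<cdot> (l \<cdot> s2) = v \<cdot> (r2 \<cdot> s2)" using A l l2 p v by (metis Cmp_assoc)
  also have "\<dots> = v" using B v by (metis Cmp_Ide)
  finally have 2: "p \<cdot> (l \<cdot> s2) = v" .
  show "\<exists>l \<in> Ar C. Dom C l = Cod C i \<and> Cod C l = Dom C p \<and> l \<cdot> i = u \<and> p \<cdot> l = v"
    using 1 2 A l by (intro bexI[of _ "l \<cdot> s2"]) (auto simp: Cmp_closed Dom_Cmp Cod_Cmp)
qed

text \<open>Retract argument: lifting the composite against its own right factor, with
  \<open>j\<close> on top and an identity below, gives a section of \<open>p\<close>. The section
  stays in the conclusion because the degreewise properties of cofibrations are read off from it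
  later.\<close>

lemma retract_of_factor:
  assumes j: "j \<in> Ar C" and p: "p \<in> Ar C" and jp: "Cod C j = Dom C p"
    and lift: "llp C (p \<cdot> j) p"
  shows "\<exists>s \<in> Ar C. Dom C s = Cod C p \<and> Cod C s = Dom C p \<and> s \<cdot> (p \<cdot> j) = j \<and> p \<cdot> s = Ide C (Cod C p) \<and>
     retract_of C (p \<cdot> j) j"
proof -
  have i: "p \<cdot> j \<in> Ar C" "Dom C (p \<cdot> j) = Dom C j" "Cod C (p \<cdot> j) = Cod C p"
    using j p jp by (simp_all add: Cmp_closed Dom_Cmp Cod_Cmp)
  obtain s where s: "s \<in> Ar C" "Dom C s = Cod C p" "Cod C s = Dom C p" "s \<cdot> (p \<cdot> j) = j" "p \<cdot> s = Ide C (Cod C p)"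
    using llpE[OF lift i(1) p j, of "Ide C (Cod C p)"] i j p jp
    by (metis Cod_Ide Cod_closed Dom_Ide Ide_Cmp Ide_closed)
  have "retract_of C (p \<cdot> j) j"
    by (rule retract_ofI[of _ _ "Ide C (Dom C j)" s "Ide C (Dom C j)" p])
      (use s i j p jp Cmp_Ide[of "Ide C (Dom C j)"] Cmp_Ide[of "p \<cdot> j"] in \<open>simp_all add: Ide_closed Dom_Ide Cod_Ide Dom_closed Cmp_Ide\<close>)
  then show ?thesis using s by blast
qed

lemma retract_closed_llp:
  assumes "\<And>f. f \<in> S \<longleftrightarrow> f \<in> Ar C \<and> (\<forall>p \<in> P. llp C f p)"
  shows "retract_closed C S"
  using assms llp_retract unfolding retract_closed_def by blast

end

section \<open>Transfer along functors\<close>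

lemma functor_map:
  assumes F: "is_functor C D F" and a: "Arrow f (u, v) g \<in> Ar (map_cat C)"
  shows "Arrow (far F f) (far F u, far F v) (far F g) \<in> Ar (map_cat D)"
proof -
  have "far F y \<cdot>\<^bsub>D\<^esub> far F x = far F (y \<cdot>\<^bsub>C\<^esub> x)" if "x \<in> Ar C" "y \<in> Ar C" "Cod C x = Dom C y" for x y
    using F that unfolding is_functor_def by auto
  moreover have "far F x \<in> Ar D \<and> Dom D (far F x) = fob F (Dom C x) \<and> Cod D (far F x) = fob F (Cod C x)"
    if "x \<in> Ar C" for x
    using F that unfolding is_functor_def by auto
  ultimately show ?thesis using a by simp
qed

lemma retract_of_image:
  assumes "category C" "category D" and F: "is_functor C D F" and "retract_of C f g" "f \<in> Ar C"
  shows "retract_of D (far F f) (far F g)"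
proof -
  interpret C: category C by fact
  interpret D: category D by fact
  from assms(4,5) obtain s1 s2 r1 r2 where "g \<in> Ar C" "s1 \<in> Ar C" "s2 \<in> Ar C" "r1 \<in> Ar C" "r2 \<in> Ar C"
    "Dom C s1 = Dom C f" "Cod C s1 = Dom C g" "Dom C s2 = Cod C f" "Cod C s2 = Cod C g"
    "Dom C r1 = Dom C g" "Cod C r1 = Dom C f" "Dom C r2 = Cod C g" "Cod C r2 = Cod C f"
    "s2 \<cdot>\<^bsub>C\<^esub> f = g \<cdot>\<^bsub>C\<^esub> s1" "r2 \<cdot>\<^bsub>C\<^esub> g = f \<cdot>\<^bsub>C\<^esub> r1" "r1 \<cdot>\<^bsub>C\<^esub> s1 = Ide C (Dom C f)" "r2 \<cdot>\<^bsub>C\<^esub> s2 = Ide C (Cod C f)"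
    by (rule C.retract_ofE)
  note A = this
  have 1: "far F x \<in> Ar D \<and> Dom D (far F x) = fob F (Dom C x) \<and> Cod D (far F x) = fob F (Cod C x)"
    if "x \<in> Ar C" for x
    using F that unfolding is_functor_def by auto
  have 2: "far F y \<cdot>\<^bsub>D\<^esub> far F x = far F (y \<cdot>\<^bsub>C\<^esub> x)" if "x \<in> Ar C" "y \<in> Ar C" "Cod C x = Dom C y" for x y
    using F that unfolding is_functor_def by auto
  have 3: "far F (Ide C X) = Ide D (fob F X)" if "X \<in> Ob C" for X
    using F that unfolding is_functor_def by auto
  show ?thesis
    by (rule D.retract_ofI[of _ _ "far F s1" "far F s2" "far F r1" "far F r2"])
      (use A assms(5) in \<open>simp_all add: 1 2 3 C.Dom_closed C.Cod_closed\<close>)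
qed

lemma retract_closed_preimage:
  assumes "category C" "category D" and F: "is_functor C D F" and S: "retract_closed D S"
  shows "retract_closed C (preimage_class C F S)"
  using retract_of_image[OF assms(1-3)] S F
  unfolding retract_closed_def preimage_class_def is_functor_def by blast

section \<open>Factorizations of the image of an arrow\<close>

lemma factored_cat_simps:
  "Ob (factored_cat C D F) = {(f, H, K). f \<in> Ar C \<and> H \<in> Ar D \<and> K \<in> Ar D \<and> Cod D H = Dom D K \<and> far F f = K \<cdot>\<^bsub>D\<^esub> H}"
  "Ar (factored_cat C D F) = {(a, b). a \<in> Ar (map_cat C) \<and> b \<in> Ar (fact_cat D) \<and>
      far (map_functor F) a = far (recompose D) b}"
  "Dom (factored_cat C D F) = (\<lambda>(a, b, b'). (src a, src b, src b'))"
  "Cod (factored_cat C D F) = (\<lambda>(a, b, b'). (tgt a, tgt b, tgt b'))"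
  "Ide (factored_cat C D F) = (\<lambda>(f, H, K). (Ide (map_cat C) f, Ide (map_cat D) H, Ide (map_cat D) K))"
  "Cmp (factored_cat C D F) = (\<lambda>(b, b1, b2) (a, a1, a2). (b \<cdot>\<^bsub>map_cat C\<^esub> a, b1 \<cdot>\<^bsub>map_cat D\<^esub> a1, b2 \<cdot>\<^bsub>map_cat D\<^esub> a2))"
  unfolding factored_cat_def pullback_cat_def fact_cat_def map_functor_def recompose_def
  by (auto simp: fun_eq_iff)

text \<open>The two squares must recompose to the image of the square in \<open>C\<close>, which
  forces their outer sides to be \<open>far F u\<close> and \<open>far F v\<close>; only the middle
  side \<open>w\<close> is free.\<close>

lemma factored_catE:
  assumes "x \<in> Ar (factored_cat C D F)"
  obtains f u v g H w K H' K' where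
    "x = (Arrow f (u, v) g, Arrow H (far F u, w) H', Arrow K (w, far F v) K')"
    "Arrow f (u, v) g \<in> Ar (map_cat C)" "Arrow H (far F u, w) H' \<in> Ar (map_cat D)"
    "Arrow K (w, far F v) K' \<in> Ar (map_cat D)" "K \<cdot>\<^bsub>D\<^esub> H = far F f" "K' \<cdot>\<^bsub>D\<^esub> H' = far F g"
proof -
  obtain a b c where x: "x = (a, b, c)" by (cases x)
  from assms have a: "a \<in> Ar (map_cat C)" and b: "b \<in> Ar (map_cat D)" and c: "c \<in> Ar (map_cat D)"
    and e: "snd (mor b) = fst (mor c)" "far (map_functor F) a = far (recompose D) (b, c)"
    unfolding x by (auto simp: factored_cat_simps fact_cat_def)
  from a obtain f u v g where A: "a = Arrow f (u, v) g" by (rule map_catE)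
  from b obtain H u' w H' where B: "b = Arrow H (u', w) H'" by (rule map_catE)
  from c obtain K w' v' K' where C: "c = Arrow K (w', v') K'" by (rule map_catE)
  show ?thesis
    by (rule that[of f u v g H w H' K K']) (use a b c e in \<open>auto simp: x A B C map_functor_def recompose_def\<close>)
qed

lemma factored_catI:
  assumes "Arrow f (u, v) g \<in> Ar (map_cat C)" "Arrow H (far F u, w) H' \<in> Ar (map_cat D)"
    "Arrow K (w, far F v) K' \<in> Ar (map_cat D)" "K \<cdot>\<^bsub>D\<^esub> H = far F f" "K' \<cdot>\<^bsub>D\<^esub> H' = far F g"
  shows "(Arrow f (u, v) g, Arrow H (far F u, w) H', Arrow K (w, far F v) K') \<in> Ar (factored_cat C D F)"
  using assms by (simp add: factored_cat_simps fact_cat_def map_functor_def recompose_def)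

text \<open>Here \<open>w x t y\<close> is the arrow between middle objects of \<open>C\<close>
  produced from the arrow \<open>t\<close> between middle objects of \<open>D\<close>. The factored
  arrows \<open>x\<close> and \<open>y\<close> are arguments because \<open>t\<close> does not
  determine them.\<close>

lemma factorization_transferI:
  fixes C :: "('o, 'm) cat" and D :: "('p, 'n) cat"
  assumes "category C" "category D" and F: "is_functor C D F"
    and hk: "\<And>f H K. \<lbrakk>f \<in> Ar C; H \<in> Ar D; K \<in> Ar D; Cod D H = Dom D K; K \<cdot>\<^bsub>D\<^esub> H = far F f\<rbrakk> \<Longrightarrow>
      h (f, H, K) \<in> Ar C \<and> k (f, H, K) \<in> Ar C \<and> Cod C (h (f, H, K)) = Dom C (k (f, H, K)) \<and>
      k (f, H, K) \<cdot>\<^bsub>C\<^esub> h (f, H, K) = f"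
    and w: "\<And>f u v g H t H' K K'. \<lbrakk>Arrow f (u, v) g \<in> Ar (map_cat C); Arrow H (far F u, t) H' \<in> Ar (map_cat D);
      Arrow K (t, far F v) K' \<in> Ar (map_cat D); Cod D H = Dom D K; Cod D H' = Dom D K';
      K \<cdot>\<^bsub>D\<^esub> H = far F f; K' \<cdot>\<^bsub>D\<^esub> H' = far F g\<rbrakk> \<Longrightarrow>
      w (f, H, K) t (g, H', K') \<in> Ar C \<and> Dom C (w (f, H, K) t (g, H', K')) = Cod C (h (f, H, K)) \<and>
      Cod C (w (f, H, K) t (g, H', K')) = Cod C (h (g, H', K')) \<and>
      w (f, H, K) t (g, H', K') \<cdot>\<^bsub>C\<^esub> h (f, H, K) = h (g, H', K') \<cdot>\<^bsub>C\<^esub> u \<and>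
      k (g, H', K') \<cdot>\<^bsub>C\<^esub> w (f, H, K) t (g, H', K') = v \<cdot>\<^bsub>C\<^esub> k (f, H, K)"
    and w_Ide: "\<And>f H K. \<lbrakk>f \<in> Ar C; H \<in> Ar D; K \<in> Ar D; Cod D H = Dom D K; K \<cdot>\<^bsub>D\<^esub> H = far F f\<rbrakk> \<Longrightarrow>
      w (f, H, K) (Ide D (Cod D H)) (f, H, K) = Ide C (Cod C (h (f, H, K)))"
    and w_Cmp: "\<And>f u v g H t H' K K' u' v' g' t' H'' K''.
      \<lbrakk>Arrow f (u, v) g \<in> Ar (map_cat C); Arrow H (far F u, t) H' \<in> Ar (map_cat D);
      Arrow K (t, far F v) K' \<in> Ar (map_cat D); Cod D H = Dom D K; Cod D H' = Dom D K';
      K \<cdot>\<^bsub>D\<^esub> H = far F f; K' \<cdot>\<^bsub>D\<^esub> H' = far F g;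
      Arrow g (u', v') g' \<in> Ar (map_cat C); Arrow H' (far F u', t') H'' \<in> Ar (map_cat D);
      Arrow K' (t', far F v') K'' \<in> Ar (map_cat D); Cod D H'' = Dom D K''; K'' \<cdot>\<^bsub>D\<^esub> H'' = far F g'\<rbrakk> \<Longrightarrow>
      w (f, H, K) (t' \<cdot>\<^bsub>D\<^esub> t) (g', H'', K'') = w (g, H', K') t' (g', H'', K'') \<cdot>\<^bsub>C\<^esub> w (f, H, K) t (g, H', K')"
  shows "\<exists>\<Psi>. factorization_transfer C D F \<Psi> \<and> fob (fst \<Psi>) = h \<and> fob (snd \<Psi>) = k"
proof -
  interpret C: category C by fact
  interpret D: category D by fact
  let ?E = "factored_cat C D F"
  let ?w = "\<lambda>x. w (Dom ?E x) (snd (mor (fst (snd x)))) (Cod ?E x)"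
  let ?U = "fst_functor :: ('m \<times> ('n \<times> 'n), ('m, 'm \<times> 'm) arrow \<times> (('n, 'n \<times> 'n) arrow \<times> ('n, 'n \<times> 'n) arrow),
     'm, ('m, 'm \<times> 'm) arrow) functr"
  have "factorization_of ?E C ?U
    (\<lparr>fob = h, far = \<lambda>a. Arrow (h (Dom ?E a)) (fst (mor (far ?U a)), ?w a) (h (Cod ?E a))\<rparr>,
     \<lparr>fob = k, far = \<lambda>a. Arrow (k (Dom ?E a)) (?w a, snd (mor (far ?U a))) (k (Cod ?E a))\<rparr>)"
  proof (rule C.factorization_ofI)
    show "is_functor ?E (map_cat C) fst_functor"
      by (auto simp: is_functor_def fst_functor_def factored_cat_simps C.Ide_closed C.Dom_closed C.Cod_closed
         elim!: map_catE)
    fix a assume a: "a \<in> Ar ?E"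
    then obtain f u v g H t K H' K' where A:
      "a = (Arrow f (u, v) g, Arrow H (far F u, t) H', Arrow K (t, far F v) K')"
      "Arrow f (u, v) g \<in> Ar (map_cat C)" "Arrow H (far F u, t) H' \<in> Ar (map_cat D)"
      "Arrow K (t, far F v) K' \<in> Ar (map_cat D)" "K \<cdot>\<^bsub>D\<^esub> H = far F f" "K' \<cdot>\<^bsub>D\<^esub> H' = far F g"
      by (rule factored_catE)
    show "Dom ?E a \<in> Ob ?E" "Cod ?E a \<in> Ob ?E"
      using A by (auto simp: factored_cat_simps)
    show "?w a \<in> Ar C \<and> Dom C (?w a) = Cod C (h (Dom ?E a)) \<and>
       Cod C (?w a) = Cod C (h (Cod ?E a)) \<and>
       ?w a \<cdot>\<^bsub>C\<^esub> h (Dom ?E a) = h (Cod ?E a) \<cdot>\<^bsub>C\<^esub> fst (mor (far ?U a)) \<and>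
       k (Cod ?E a) \<cdot>\<^bsub>C\<^esub> ?w a = snd (mor (far ?U a)) \<cdot>\<^bsub>C\<^esub> k (Dom ?E a)"
      using w[OF A(2-4) _ _ A(5,6)] A(2-4) by (simp add: A(1) factored_cat_simps fst_functor_def)
    fix b assume b: "b \<in> Ar ?E" and ab: "Cod ?E a = Dom ?E b"
    from b obtain f' u' v' g' K1 t' K1' H1 H1' where B:
      "b = (Arrow f' (u', v') g', Arrow H1 (far F u', t') H1', Arrow K1 (t', far F v') K1')"
      "Arrow f' (u', v') g' \<in> Ar (map_cat C)" "Arrow H1 (far F u', t') H1' \<in> Ar (map_cat D)"
      "Arrow K1 (t', far F v') K1' \<in> Ar (map_cat D)" "K1 \<cdot>\<^bsub>D\<^esub> H1 = far F f'" "K1' \<cdot>\<^bsub>D\<^esub> H1' = far F g'"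
      by (rule factored_catE)
    have eq: "f' = g" "H1 = H'" "K1 = K'" using ab by (simp_all add: A(1) B(1) factored_cat_simps)
    note B = B[unfolded eq]
    have F2: "far F (u' \<cdot>\<^bsub>C\<^esub> u) = far F u' \<cdot>\<^bsub>D\<^esub> far F u" "far F (v' \<cdot>\<^bsub>C\<^esub> v) = far F v' \<cdot>\<^bsub>D\<^esub> far F v"
      using F A(2) B(2) by (auto simp: is_functor_def)
    have "(Arrow f (u' \<cdot>\<^bsub>C\<^esub> u, v' \<cdot>\<^bsub>C\<^esub> v) g', Arrow H (far F (u' \<cdot>\<^bsub>C\<^esub> u), t' \<cdot>\<^bsub>D\<^esub> t) H1',
       Arrow K (t' \<cdot>\<^bsub>D\<^esub> t, far F (v' \<cdot>\<^bsub>C\<^esub> v)) K1') \<in> Ar ?E"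
      using C.map_cat_Cmp_closed[OF A(2) B(2)] D.map_cat_Cmp_closed[OF A(3) B(3)]
        D.map_cat_Cmp_closed[OF A(4) B(4)] A(5) B(6) F2
      by (intro factored_catI) (simp_all del: Arrow_in_map_cat)
    then show "b \<cdot>\<^bsub>?E\<^esub> a \<in> Ar ?E \<and> Dom ?E (b \<cdot>\<^bsub>?E\<^esub> a) = Dom ?E a \<and> Cod ?E (b \<cdot>\<^bsub>?E\<^esub> a) = Cod ?E b"
      using F2 by (simp add: A(1) B(1) factored_cat_simps(3-))
    show "?w (b \<cdot>\<^bsub>?E\<^esub> a) = ?w b \<cdot>\<^bsub>C\<^esub> ?w a"
      using w_Cmp[OF A(2-4) _ _ A(5,6) B(2-4) _ B(6)] A(2-4) B(2-4)
      by (simp add: A(1) B(1) factored_cat_simps(3-))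
  next
    fix x assume x: "x \<in> Ob ?E"
    obtain f H K where X: "x = (f, H, K)" by (cases x)
    from x have x': "f \<in> Ar C" "H \<in> Ar D" "K \<in> Ar D" "Cod D H = Dom D K" "K \<cdot>\<^bsub>D\<^esub> H = far F f"
      by (auto simp: X factored_cat_simps)
    have dc: "Dom D H = fob F (Dom C f)" "Cod D K = fob F (Cod C f)"
      using F x' D.Dom_Cmp[OF x'(2-4)] D.Cod_Cmp[OF x'(2-4)] by (simp_all add: is_functor_def)
    have i: "far F (Ide C (Dom C f)) = Ide D (Dom D H)" "far F (Ide C (Cod C f)) = Ide D (Cod D K)"
      using F x' dc C.Dom_closed C.Cod_closed by (simp_all add: is_functor_def)
    have "(Arrow f (Ide C (Dom C f), Ide C (Cod C f)) f, Arrow H (far F (Ide C (Dom C f)), Ide D (Cod D H)) H,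
       Arrow K (Ide D (Cod D H), far F (Ide C (Cod C f))) K) \<in> Ar ?E"
      using C.Ide_in_map_cat[OF x'(1)] D.Ide_in_map_cat[OF x'(2)] D.Ide_in_map_cat[OF x'(3)] x' i
      by (intro factored_catI) (simp_all del: Arrow_in_map_cat)
    then show "Ide ?E x \<in> Ar ?E \<and> Dom ?E (Ide ?E x) = x \<and> Cod ?E (Ide ?E x) = x"
      using i x' by (simp add: X factored_cat_simps(3-))
    show "?w (Ide ?E x) = Ide C (Cod C (h x))"
      using w_Ide[OF x'] by (simp add: X factored_cat_simps(3-))
    show "h x \<in> Ar C \<and> k x \<in> Ar C \<and> Cod C (h x) = Dom C (k x) \<and> k x \<cdot>\<^bsub>C\<^esub> h x = fob ?U x"
      using hk[OF x'] by (simp add: X fst_functor_def)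
  qed
  then show ?thesis unfolding factorization_transfer_def by (intro exI conjI) (assumption | simp)+
qed

text \<open>\<open>transferred \<Psi> F \<phi>\<close> is \<open>\<Psi>\<close> after
  \<open>factor_image F \<phi>\<close>, so the point is that the latter is a functor
  (\<open>I1\<close> to \<open>I5\<close>). The factorization identities are then those of
  \<open>\<Psi>\<close>, since the first component of \<open>factor_image\<close> is the given arrow
  or square.\<close>

lemma functorial_factorization_transferred:
  assumes "category C" "category D" and F: "is_functor C D F"
    and \<Psi>: "factorization_transfer C D F \<Psi>" and \<phi>: "functorial_factorization D \<phi>"
  shows "functorial_factorization C (transferred \<Psi> F \<phi>)"
proof -
  interpret C: category C by fact
  interpret D: category D by fact
  let ?E = "factored_cat C D F"
  obtain H K where \<phi>_def: "\<phi> = (H, K)" by (cases \<phi>)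
  obtain P Q where \<Psi>_def: "\<Psi> = (P, Q)" by (cases \<Psi>)
  let ?I = "factor_image F \<phi>"
  from \<phi> have HK: "is_functor (map_cat D) (map_cat D) H" "is_functor (map_cat D) (map_cat D) K"
    "\<And>x. x \<in> Ar D \<Longrightarrow> (fob H x, fob K x) \<in> Ob (fact_cat D) \<and> fob (recompose D) (fob H x, fob K x) = x"
    "\<And>a. a \<in> Ar (map_cat D) \<Longrightarrow> (far H a, far K a) \<in> Ar (fact_cat D) \<and> far (recompose D) (far H a, far K a) = a"
    by (auto simp: functorial_factorization_def factorization_of_def \<phi>_def id_functor_def)
  from \<Psi> have PQ: "is_functor ?E (map_cat C) P" "is_functor ?E (map_cat C) Q"
    "\<And>x. x \<in> Ob ?E \<Longrightarrow> (fob P x, fob Q x) \<in> Ob (fact_cat C) \<and> fob (recompose C) (fob P x, fob Q x) = fst x"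
    "\<And>a. a \<in> Ar ?E \<Longrightarrow> (far P a, far Q a) \<in> Ar (fact_cat C) \<and> far (recompose C) (far P a, far Q a) = fst a"
    by (auto simp: factorization_transfer_def factorization_of_def \<Psi>_def fst_functor_def)
  have mF: "far (map_functor F) a \<in> Ar (map_cat D)" if "a \<in> Ar (map_cat C)" for a
  proof -
    from that obtain f u v g where A: "a = Arrow f (u, v) g" by (rule map_catE)
    show ?thesis
      using functor_map[OF F that[unfolded A]] by (simp only: A map_functor_def functr.select_convs arrow.sel fst_conv snd_conv)
  qed
  have FA: "far F f \<in> Ar D" if "f \<in> Ar C" for f using F that by (simp add: is_functor_def)
  have I1: "fob ?I f \<in> Ob ?E" "fst (fob ?I f) = f" if "f \<in> Ar C" for f
    using that HK(3)[OF FA[OF that]]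
    by (auto simp: factor_image_def \<phi>_def factored_cat_simps(1) map_functor_def fact_cat_def recompose_def)
  have I2: "far ?I a \<in> Ar ?E" "fst (far ?I a) = a" if "a \<in> Ar (map_cat C)" for a
    using that HK(4)[OF mF[OF that]]
    by (simp_all add: factor_image_def \<phi>_def factored_cat_simps(2))
  have I3: "Dom ?E (far ?I a) = fob ?I (src a)" "Cod ?E (far ?I a) = fob ?I (tgt a)" if "a \<in> Ar (map_cat C)" for a
    using mF[OF that] HK(1,2) by (simp_all add: factor_image_def \<phi>_def factored_cat_simps(3-) is_functor_def map_functor_def)
  have I4: "far ?I (Ide (map_cat C) f) = Ide ?E (fob ?I f)" if "f \<in> Ar C" for f
  proof -
    have "far (map_functor F) (Ide (map_cat C) f) = Ide (map_cat D) (far F f)"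
      using F that C.Dom_closed C.Cod_closed by (simp add: is_functor_def map_functor_def)
    then show ?thesis
      using FA[OF that] HK(1,2) by (simp add: factor_image_def \<phi>_def factored_cat_simps(3-) is_functor_def map_functor_def)
  qed
  have I5: "far ?I (b \<cdot>\<^bsub>map_cat C\<^esub> a) = far ?I b \<cdot>\<^bsub>?E\<^esub> far ?I a"
    if a: "a \<in> Ar (map_cat C)" and b: "b \<in> Ar (map_cat C)" and ab: "tgt a = src b" for a b
  proof -
    have 1: "far (map_functor F) (b \<cdot>\<^bsub>map_cat C\<^esub> a) = far (map_functor F) b \<cdot>\<^bsub>map_cat D\<^esub> far (map_functor F) a"
      using F a b ab by (auto elim!: map_catE simp: is_functor_def map_functor_def)
    have 2: "tgt (far (map_functor F) a) = src (far (map_functor F) b)" using ab by (simp add: map_functor_def)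
    have 3: "far H (far (map_functor F) b \<cdot>\<^bsub>map_cat D\<^esub> far (map_functor F) a) = far H (far (map_functor F) b) \<cdot>\<^bsub>map_cat D\<^esub> far H (far (map_functor F) a)"
      "far K (far (map_functor F) b \<cdot>\<^bsub>map_cat D\<^esub> far (map_functor F) a) = far K (far (map_functor F) b) \<cdot>\<^bsub>map_cat D\<^esub> far K (far (map_functor F) a)"
      using HK(1,2) mF[OF a] mF[OF b] 2 unfolding is_functor_def by (simp_all del: map_cat_simps(5))
    show ?thesis unfolding factor_image_def \<phi>_def 
      by (simp add: 1 3 factored_cat_simps(3-) del: map_cat_simps(5))
  qed
  have I: "is_functor (map_cat C) ?E ?I"
    unfolding is_functor_def using I1 I2 I3 I4 I5 by (simp del: map_cat_simps(4,5))
  have comp: "is_functor (map_cat C) (map_cat C) (functor_comp G ?I)" if G: "is_functor ?E (map_cat C) G" for G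
    unfolding is_functor_def functor_comp_def
  proof (simp del: map_cat_simps(4,5), intro conjI ballI impI)
    fix f assume f: "f \<in> Ar C"
    show "fob G (fob ?I f) \<in> Ar C" using G I1(1)[OF f] by (simp add: is_functor_def)
    show "far G (far ?I (Ide (map_cat C) f)) = Ide (map_cat C) (fob G (fob ?I f))"
      unfolding I4[OF f] using G I1(1)[OF f] by (simp add: is_functor_def)
  next
    fix a assume a: "a \<in> Ar (map_cat C)"
    have "far G (far ?I a) \<in> Ar (map_cat C) \<and> src (far G (far ?I a)) = fob G (Dom ?E (far ?I a)) \<and>
      tgt (far G (far ?I a)) = fob G (Cod ?E (far ?I a))"
      using G I2(1)[OF a] by (simp add: is_functor_def)
    then show "far G (far ?I a) \<in> Ar (map_cat C)" "src (far G (far ?I a)) = fob G (fob ?I (src a))"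
       "tgt (far G (far ?I a)) = fob G (fob ?I (tgt a))" using I3[OF a] by simp_all
    fix b assume b: "b \<in> Ar (map_cat C)" and ab: "tgt a = src b"
    have "Cod ?E (far ?I a) = Dom ?E (far ?I b)" using I3 a b ab by simp
    then show "far G (far ?I (b \<cdot>\<^bsub>map_cat C\<^esub> a)) = far G (far ?I b) \<cdot>\<^bsub>map_cat C\<^esub> far G (far ?I a)"
      unfolding I5[OF a b ab] using G I2(1) a b unfolding is_functor_def by blast
  qed
  have O: "(fob P (fob ?I f), fob Q (fob ?I f)) \<in> Ob (fact_cat C) \<and>
      fob (recompose C) (fob P (fob ?I f), fob Q (fob ?I f)) = f" if "f \<in> Ar C" for f
    using PQ(3)[OF I1(1)[OF that]] I1(2)[OF that] by metis
  have A: "(far P (far ?I a), far Q (far ?I a)) \<in> Ar (fact_cat C) \<and>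
      far (recompose C) (far P (far ?I a), far Q (far ?I a)) = a" if "a \<in> Ar (map_cat C)" for a
    using PQ(4)[OF I2(1)[OF that]] I2(2)[OF that] by metis
  have "factorization_of (map_cat C) C id_functor (functor_comp P ?I, functor_comp Q ?I)"
    unfolding factorization_of_def prod.case
    using comp[OF PQ(1)] comp[OF PQ(2)]
    by (simp only: functor_comp_def id_functor_def functr.select_convs comp_apply map_cat_simps simp_thms)
      (rule conjI; rule ballI; (erule O | erule A))
  then show ?thesis
    by (simp only: functorial_factorization_def transferred_def \<Psi>_def fst_conv snd_conv)
qed


section \<open>Linear maps\<close>

lemma (in abelian_group) neg_zero [simp]: "\<ominus> \<zero> = \<zero>"
  by (rule minus_equality) auto

text \<open>Makes the method \<open>algebra\<close> normalize expressions in the additive group of a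
  module.\<close>

lemmas (in abelian_group) abelian_group_simprules
  [algebra abelian_group "zero G" "add G" "a_inv G" "a_minus G"] =
  a_closed zero_closed a_inv_closed minus_closed
  a_assoc l_zero l_neg a_comm minus_eq
  r_zero r_neg r_neg2 r_neg1 minus_add minus_minus neg_zero a_lcomm

text \<open>Unlike \<open>linear_maps\<close>, this allows different element types and arbitrary
  values outside the carrier, so that sums, free modules and modules of formal expressions can be
  used on the way. \<open>lin_restrict\<close> leads back to \<open>linear_maps\<close>.\<close>

definition lin :: "('r, 'x) ring_scheme \<Rightarrow> ('r, 'b) module \<Rightarrow> ('r, 'c) module \<Rightarrow> ('b \<Rightarrow> 'c) \<Rightarrow> bool" where
  "lin R M N f \<longleftrightarrow> module R M \<and> module R N \<and> (\<forall>x \<in> carrier M. f x \<in> carrier N) \<and>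
     (\<forall>x \<in> carrier M. \<forall>y \<in> carrier M. f (x \<oplus>\<^bsub>M\<^esub> y) = f x \<oplus>\<^bsub>N\<^esub> f y) \<and>
     (\<forall>r \<in> carrier R. \<forall>x \<in> carrier M. f (r \<odot>\<^bsub>M\<^esub> x) = r \<odot>\<^bsub>N\<^esub> f x)"

lemma linI:
  assumes "module R M" "module R N" "\<And>x. x \<in> carrier M \<Longrightarrow> f x \<in> carrier N"
    "\<And>x y. x \<in> carrier M \<Longrightarrow> y \<in> carrier M \<Longrightarrow> f (x \<oplus>\<^bsub>M\<^esub> y) = f x \<oplus>\<^bsub>N\<^esub> f y"
    "\<And>r x. r \<in> carrier R \<Longrightarrow> x \<in> carrier M \<Longrightarrow> f (r \<odot>\<^bsub>M\<^esub> x) = r \<odot>\<^bsub>N\<^esub> f x"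
  shows "lin R M N f"
  using assms unfolding lin_def by blast

lemma
  assumes "lin R M N f"
  shows lin_modules: "module R M" "module R N"
    and lin_closed: "x \<in> carrier M \<Longrightarrow> f x \<in> carrier N"
    and lin_add: "x \<in> carrier M \<Longrightarrow> y \<in> carrier M \<Longrightarrow> f (x \<oplus>\<^bsub>M\<^esub> y) = f x \<oplus>\<^bsub>N\<^esub> f y"
    and lin_smult: "r \<in> carrier R \<Longrightarrow> x \<in> carrier M \<Longrightarrow> f (r \<odot>\<^bsub>M\<^esub> x) = r \<odot>\<^bsub>N\<^esub> f x"
  using assms unfolding lin_def by blast+

lemma
  assumes "module R M"
  shows mod_zero: "\<zero>\<^bsub>M\<^esub> \<in> carrier M"
    and mod_add: "x \<in> carrier M \<Longrightarrow> y \<in> carrier M \<Longrightarrow> x \<oplus>\<^bsub>M\<^esub> y \<in> carrier M"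
    and mod_neg: "x \<in> carrier M \<Longrightarrow> \<ominus>\<^bsub>M\<^esub> x \<in> carrier M"
    and mod_smult: "r \<in> carrier R \<Longrightarrow> x \<in> carrier M \<Longrightarrow> r \<odot>\<^bsub>M\<^esub> x \<in> carrier M"
proof -
  interpret module R M by fact
  show "\<zero>\<^bsub>M\<^esub> \<in> carrier M"
    "x \<in> carrier M \<Longrightarrow> y \<in> carrier M \<Longrightarrow> x \<oplus>\<^bsub>M\<^esub> y \<in> carrier M"
    "x \<in> carrier M \<Longrightarrow> \<ominus>\<^bsub>M\<^esub> x \<in> carrier M"
    "r \<in> carrier R \<Longrightarrow> x \<in> carrier M \<Longrightarrow> r \<odot>\<^bsub>M\<^esub> x \<in> carrier M"
    by simp_all
qed

lemma lin_zero: assumes "lin R M N f" shows "f \<zero>\<^bsub>M\<^esub> = \<zero>\<^bsub>N\<^esub>"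
proof -
  interpret M: module R M using lin_modules[OF assms] by simp
  interpret N: module R N using lin_modules[OF assms] by simp
  have "f (\<zero>\<^bsub>R\<^esub> \<odot>\<^bsub>M\<^esub> \<zero>\<^bsub>M\<^esub>) = \<zero>\<^bsub>R\<^esub> \<odot>\<^bsub>N\<^esub> f \<zero>\<^bsub>M\<^esub>" by (rule lin_smult[OF assms]) auto
  then show ?thesis using lin_closed[OF assms, of "\<zero>\<^bsub>M\<^esub>"] by simp
qed

lemma lin_neg: assumes "lin R M N f" and x: "x \<in> carrier M" shows "f (\<ominus>\<^bsub>M\<^esub> x) = \<ominus>\<^bsub>N\<^esub> f x"
proof -
  interpret M: module R M using lin_modules[OF assms(1)] by simp
  interpret N: module R N using lin_modules[OF assms(1)] by simp
  have "f ((\<ominus>\<^bsub>R\<^esub> \<one>\<^bsub>R\<^esub>) \<odot>\<^bsub>M\<^esub> x) = (\<ominus>\<^bsub>R\<^esub> \<one>\<^bsub>R\<^esub>) \<odot>\<^bsub>N\<^esub> f x" by (rule lin_smult[OF assms(1)]) (use x in auto)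
  then show ?thesis using lin_closed[OF assms(1) x] x by (simp add: M.smult_l_minus N.smult_l_minus)
qed

lemma lin_minus:
  assumes "lin R M N f" and "x \<in> carrier M" "y \<in> carrier M"
  shows "f (x \<ominus>\<^bsub>M\<^esub> y) = f x \<ominus>\<^bsub>N\<^esub> f y"
  using assms by (simp add: a_minus_def lin_add lin_neg mod_neg[OF lin_modules(1)])

lemma lin_comp: "lin R M N f \<Longrightarrow> lin R N K g \<Longrightarrow> lin R M K (\<lambda>x. g (f x))"
  by (rule linI) (auto simp: lin_modules lin_closed lin_add lin_smult)

lemma lin_ident: "module R M \<Longrightarrow> lin R M M (\<lambda>x. x)"
  by (rule linI) auto

lemma lin_const_zero: assumes "module R M" "module R N" shows "lin R M N (\<lambda>x. \<zero>\<^bsub>N\<^esub>)"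
proof -
  interpret N: module R N by fact
  show ?thesis by (rule linI) (use assms in auto)
qed

lemma lin_plus:
  assumes f: "lin R M N f" and g: "lin R M N g"
  shows "lin R M N (\<lambda>x. f x \<oplus>\<^bsub>N\<^esub> g x)"
proof -
  interpret N: module R N using lin_modules[OF f] by simp
  note c = lin_closed[OF f] lin_closed[OF g]
  show ?thesis
  proof (rule linI)
    fix x y assume x: "x \<in> carrier M" and y: "y \<in> carrier M"
    show "f (x \<oplus>\<^bsub>M\<^esub> y) \<oplus>\<^bsub>N\<^esub> g (x \<oplus>\<^bsub>M\<^esub> y) = f x \<oplus>\<^bsub>N\<^esub> g x \<oplus>\<^bsub>N\<^esub> (f y \<oplus>\<^bsub>N\<^esub> g y)"
      using c[OF x] c[OF y] by (simp add: lin_add[OF f x y] lin_add[OF g x y] N.a_ac)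
  qed (use c in \<open>auto simp: lin_modules[OF f] lin_smult[OF f] lin_smult[OF g] N.smult_r_distr\<close>)
qed

lemma lin_uminus:
  assumes f: "lin R M N f"
  shows "lin R M N (\<lambda>x. \<ominus>\<^bsub>N\<^esub> f x)"
proof -
  interpret N: module R N using lin_modules[OF f] by simp
  note c = lin_closed[OF f]
  show ?thesis
    by (rule linI) (use c in \<open>auto simp: lin_modules[OF f] lin_add[OF f] lin_smult[OF f] N.minus_add N.smult_r_minus\<close>)
qed

lemma lin_diff:
  assumes f: "lin R M N f" and g: "lin R M N g"
  shows "lin R M N (\<lambda>x. f x \<ominus>\<^bsub>N\<^esub> g x)"
  using lin_plus[OF f lin_uminus[OF g]] by (simp add: a_minus_def)

lemma lin_cong:
  assumes f: "lin R M N f" and g: "\<And>x. x \<in> carrier M \<Longrightarrow> f x = g x"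
  shows "lin R M N g"
  by (rule linI)
    (simp_all add: g[symmetric] lin_modules[OF f] lin_closed[OF f] lin_add[OF f] lin_smult[OF f]
      mod_add[OF lin_modules(1)[OF f]] mod_smult[OF lin_modules(1)[OF f]])

lemma linear_maps_iff:
  "module R M \<Longrightarrow> module R N \<Longrightarrow> f \<in> linear_maps R M N \<longleftrightarrow> lin R M N f \<and> f \<in> extensional (carrier M)"
  unfolding linear_maps_def lin_def PiE_def by auto

lemma lin_restrict: "lin R M N f \<Longrightarrow> restrict f (carrier M) \<in> linear_maps R M N"
  by (subst linear_maps_iff) (auto simp: lin_modules intro: lin_cong)

section \<open>Direct sums\<close>

definition dsum :: "('r, 'b) module \<Rightarrow> ('r, 'c) module \<Rightarrow> ('r, 'b \<times> 'c) module" where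
  "dsum M N = \<lparr>carrier = carrier M \<times> carrier N, mult = undefined, one = undefined,
     zero = (\<zero>\<^bsub>M\<^esub>, \<zero>\<^bsub>N\<^esub>), add = \<lambda>x y. (fst x \<oplus>\<^bsub>M\<^esub> fst y, snd x \<oplus>\<^bsub>N\<^esub> snd y),
     smult = \<lambda>r x. (r \<odot>\<^bsub>M\<^esub> fst x, r \<odot>\<^bsub>N\<^esub> snd x)\<rparr>"

lemma dsum_simps [simp]:
  "carrier (dsum M N) = carrier M \<times> carrier N"
  "\<zero>\<^bsub>dsum M N\<^esub> = (\<zero>\<^bsub>M\<^esub>, \<zero>\<^bsub>N\<^esub>)"
  "x \<oplus>\<^bsub>dsum M N\<^esub> y = (fst x \<oplus>\<^bsub>M\<^esub> fst y, snd x \<oplus>\<^bsub>N\<^esub> snd y)"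
  "r \<odot>\<^bsub>dsum M N\<^esub> x = (r \<odot>\<^bsub>M\<^esub> fst x, r \<odot>\<^bsub>N\<^esub> snd x)"
  by (simp_all add: dsum_def)

lemma module_dsum:
  assumes "module R M" "module R N"
  shows "module R (dsum M N)"
proof -
  interpret M: module R M by fact
  interpret N: module R N by fact
  have "\<exists>y \<in> carrier (dsum M N). y \<oplus>\<^bsub>dsum M N\<^esub> x = \<zero>\<^bsub>dsum M N\<^esub>" if "x \<in> carrier (dsum M N)" for x
    by (rule bexI[of _ "(\<ominus>\<^bsub>M\<^esub> fst x, \<ominus>\<^bsub>N\<^esub> snd x)"]) (use that in \<open>auto simp: M.l_neg N.l_neg\<close>)
  then have "abelian_group (dsum M N)"
    by (intro abelian_groupI) (auto simp: M.a_ac N.a_ac)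
  then show ?thesis
    by (intro moduleI) (auto simp: M.cring_axioms M.smult_l_distr N.smult_l_distr M.smult_r_distr N.smult_r_distr
       M.smult_assoc1 N.smult_assoc1)
qed

lemma dsum_neg [simp]:
  assumes "module R M" "module R N" "x \<in> carrier (dsum M N)"
  shows "\<ominus>\<^bsub>dsum M N\<^esub> x = (\<ominus>\<^bsub>M\<^esub> fst x, \<ominus>\<^bsub>N\<^esub> snd x)"
proof -
  interpret M: module R M by fact
  interpret N: module R N by fact
  interpret S: module R "dsum M N" by (rule module_dsum) fact+
  show ?thesis by (rule S.minus_equality) (use assms(3) in \<open>auto simp: M.l_neg N.l_neg\<close>)
qed

lemma dsum_minus:
  assumes "module R M" "module R N" "x \<in> carrier (dsum M N)" "y \<in> carrier (dsum M N)"
  shows "x \<ominus>\<^bsub>dsum M N\<^esub> y = (fst x \<ominus>\<^bsub>M\<^esub> fst y, snd x \<ominus>\<^bsub>N\<^esub> snd y)"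
  using assms by (simp add: a_minus_def dsum_neg[OF assms(1,2,4)])

lemma lin_fst: "module R M \<Longrightarrow> module R N \<Longrightarrow> lin R (dsum M N) M fst"
  by (rule linI) (auto simp: module_dsum)

lemma lin_snd: "module R M \<Longrightarrow> module R N \<Longrightarrow> lin R (dsum M N) N snd"
  by (rule linI) (auto simp: module_dsum)

lemma lin_pair: "lin R K M f \<Longrightarrow> lin R K N g \<Longrightarrow> lin R K (dsum M N) (\<lambda>x. (f x, g x))"
  by (rule linI) (auto simp: module_dsum lin_modules lin_closed lin_add lin_smult)

section \<open>Free modules\<close>

definition supp :: "('r, 'x) ring_scheme \<Rightarrow> ('a \<Rightarrow> 'r) \<Rightarrow> 'a set" where
  "supp R \<phi> = {x. \<phi> x \<noteq> \<zero>\<^bsub>R\<^esub>}"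

text \<open>The elements are functions on the whole type whatever \<open>S\<close> is. Zero and the
  operations therefore do not depend on \<open>S\<close>, and \<open>free R S\<close> is literally
  contained in \<open>free R T\<close> when \<open>S\<close> is a subset of
  \<open>T\<close>.\<close>

definition free :: "('r, 'x) ring_scheme \<Rightarrow> 'a set \<Rightarrow> ('r, 'a \<Rightarrow> 'r) module" where
  "free R S = \<lparr>carrier = {\<phi>. finite (supp R \<phi>) \<and> supp R \<phi> \<subseteq> S \<and> (\<forall>x. \<phi> x \<in> carrier R)},
     mult = undefined, one = undefined, zero = (\<lambda>x. \<zero>\<^bsub>R\<^esub>), add = \<lambda>\<phi> \<psi> x. \<phi> x \<oplus>\<^bsub>R\<^esub> \<psi> x,
     smult = \<lambda>r \<phi> x. r \<otimes>\<^bsub>R\<^esub> \<phi> x\<rparr>"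

definition single :: "('r, 'x) ring_scheme \<Rightarrow> 'a \<Rightarrow> 'a \<Rightarrow> 'r" where
  "single R x = (\<lambda>y. if y = x then \<one>\<^bsub>R\<^esub> else \<zero>\<^bsub>R\<^esub>)"

definition lincomb :: "('r, 'x) ring_scheme \<Rightarrow> ('r, 'b) module \<Rightarrow> ('a \<Rightarrow> 'b) \<Rightarrow> ('a \<Rightarrow> 'r) \<Rightarrow> 'b" where
  "lincomb R M g \<phi> = finsum M (\<lambda>x. \<phi> x \<odot>\<^bsub>M\<^esub> g x) (supp R \<phi>)"

lemma free_simps:
  "\<phi> \<in> carrier (free R S) \<longleftrightarrow> finite (supp R \<phi>) \<and> supp R \<phi> \<subseteq> S \<and> (\<forall>x. \<phi> x \<in> carrier R)"
  "\<zero>\<^bsub>free R S\<^esub> = (\<lambda>x. \<zero>\<^bsub>R\<^esub>)"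
  "\<phi> \<oplus>\<^bsub>free R S\<^esub> \<psi> = (\<lambda>x. \<phi> x \<oplus>\<^bsub>R\<^esub> \<psi> x)"
  "r \<odot>\<^bsub>free R S\<^esub> \<phi> = (\<lambda>x. r \<otimes>\<^bsub>R\<^esub> \<phi> x)"
  by (simp_all add: free_def)

lemma (in cring) module_free:
  fixes S :: "'c set"
  shows "module R (free R S)"
proof -
  have 1: "supp R (\<lambda>x. \<phi> x \<oplus> \<psi> x) \<subseteq> supp R \<phi> \<union> supp R \<psi>" for \<phi> \<psi> :: "'c \<Rightarrow> 'a"
    unfolding supp_def by auto
  have 2: "supp R (\<lambda>x. r \<otimes> \<phi> x) \<subseteq> supp R \<phi>" if "r \<in> carrier R" for r and \<phi> :: "'c \<Rightarrow> 'a"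
    unfolding supp_def using that by auto
  have 3: "supp R (\<lambda>x. \<ominus> \<phi> x) \<subseteq> supp R \<phi>" for \<phi> :: "'c \<Rightarrow> 'a"
    unfolding supp_def by auto
  have "\<exists>y \<in> carrier (free R S). y \<oplus>\<^bsub>free R S\<^esub> \<phi> = \<zero>\<^bsub>free R S\<^esub>" if "\<phi> \<in> carrier (free R S)" for \<phi> :: "'c \<Rightarrow> 'a"
    by (rule bexI[of _ "\<lambda>x. \<ominus> \<phi> x"])
      (use that 3[of \<phi>] in \<open>auto simp: free_simps l_neg intro: finite_subset\<close>)
  moreover have "\<phi> \<oplus>\<^bsub>free R S\<^esub> \<psi> \<in> carrier (free R S)"
    if "\<phi> \<in> carrier (free R S)" "\<psi> \<in> carrier (free R S)" for \<phi> \<psi> :: "'c \<Rightarrow> 'a"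
    using that 1[of \<phi> \<psi>] finite_subset[OF 1[of \<phi> \<psi>]] by (auto simp: free_simps)
  moreover have "\<zero>\<^bsub>free R S\<^esub> \<in> carrier (free R S)"
    by (auto simp: free_simps supp_def)
  ultimately have ab: "abelian_group (free R S)"
    by (intro abelian_groupI) (auto simp: free_simps a_ac fun_eq_iff)
  have "r \<odot>\<^bsub>free R S\<^esub> \<phi> \<in> carrier (free R S)" if "r \<in> carrier R" "\<phi> \<in> carrier (free R S)" for r and \<phi> :: "'c \<Rightarrow> 'a"
    using that 2[of r \<phi>] finite_subset[OF 2[of r \<phi>]] by (auto simp: free_simps)
  then show ?thesis
    by (intro moduleI ab is_cring) (auto simp: free_simps l_distr r_distr m_assoc fun_eq_iff)
qed

lemma (in cring) supp_single: "supp R (single R x) \<subseteq> {x}"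
  by (auto simp: supp_def single_def split: if_splits)

lemma (in cring) single_closed: "x \<in> S \<Longrightarrow> single R x \<in> carrier (free R S)"
  using supp_single[of x] finite_subset[OF supp_single[of x]] by (auto simp: free_simps single_def)

lemma free_mono: "S \<subseteq> T \<Longrightarrow> carrier (free R S) \<subseteq> carrier (free R T)"
  by (rule subsetI) (simp add: free_simps, blast)

lemma free_eqI:
  assumes f: "lin R (free R S) N f" and g: "lin R (free R S) N g"
    and eq: "\<And>x. x \<in> S \<Longrightarrow> f (single R x) = g (single R x)" and \<phi>: "\<phi> \<in> carrier (free R S)"
  shows "f \<phi> = g \<phi>"
proof -
  interpret F: module R "free R S" using lin_modules[OF f] by simp
  interpret N: module R N using lin_modules[OF f] by simp
  \<comment> \<open>The support is enlarged to an arbitrary finite set \<open>T\<close>, from which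
    points can be removed one at a time whether or not the coefficient there vanishes.\<close>
  have "f \<phi> = g \<phi>" if "finite T" "T \<subseteq> S" "supp R \<phi> \<subseteq> T" "\<forall>x. \<phi> x \<in> carrier R" for T \<phi>
    using that
  proof (induction T arbitrary: \<phi>)
    case empty
    then have "\<phi> = \<zero>\<^bsub>free R S\<^esub>" by (auto simp: supp_def free_simps)
    then show ?case by (simp add: lin_zero[OF f] lin_zero[OF g])
  next
    case (insert x T)
    define \<psi> where "\<psi> = \<phi>(x := \<zero>\<^bsub>R\<^esub>)"
    have \<psi>: "supp R \<psi> \<subseteq> T" "\<forall>y. \<psi> y \<in> carrier R" using insert by (auto simp: \<psi>_def supp_def)
    then have \<psi>': "\<psi> \<in> carrier (free R S)" using insert by (auto simp: free_simps intro: finite_subset)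
    have s: "single R x \<in> carrier (free R S)" using F.R.single_closed[of x S] insert by simp
    have c: "\<phi> x \<in> carrier R" using insert by simp
    have eq': "\<phi> = \<psi> \<oplus>\<^bsub>free R S\<^esub> (\<phi> x \<odot>\<^bsub>free R S\<^esub> single R x)"
      using insert by (auto simp: \<psi>_def free_simps single_def fun_eq_iff)
    have "f \<phi> = f \<psi> \<oplus>\<^bsub>N\<^esub> \<phi> x \<odot>\<^bsub>N\<^esub> f (single R x)"
      by (subst eq') (simp only: lin_add[OF f \<psi>' F.smult_closed[OF c s]] lin_smult[OF f c s])
    moreover have "g \<phi> = g \<psi> \<oplus>\<^bsub>N\<^esub> \<phi> x \<odot>\<^bsub>N\<^esub> g (single R x)"
      by (subst eq') (simp only: lin_add[OF g \<psi>' F.smult_closed[OF c s]] lin_smult[OF g c s])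
    moreover have "f \<psi> = g \<psi>" using insert \<psi> by auto
    ultimately show ?case using eq[of x] insert by simp
  qed
  then show ?thesis using \<phi> by (auto simp: free_simps)
qed

text \<open>For additivity of \<open>lincomb\<close>: combinations with different supports are
  compared by summing over a common finite set, where the extra terms have coefficient zero.\<close>

lemma lincomb_superset:
  assumes "module R M" and T: "finite T" "supp R \<phi> \<subseteq> T" and g: "\<And>x. x \<in> T \<Longrightarrow> g x \<in> carrier M"
    and \<phi>: "\<And>x. \<phi> x \<in> carrier R"
  shows "lincomb R M g \<phi> = finsum M (\<lambda>x. \<phi> x \<odot>\<^bsub>M\<^esub> g x) T"
proof -
  interpret M: module R M by fact
  show ?thesis unfolding lincomb_def
    by (rule M.add.finprod_mono_neutral_cong_left) (use T g \<phi> in \<open>auto simp: supp_def\<close>)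
qed

lemma lin_lincomb:
  assumes "module R M" and g: "\<And>x. x \<in> S \<Longrightarrow> g x \<in> carrier M"
  shows "lin R (free R S) M (lincomb R M g)"
proof -
  interpret M: module R M by fact
  interpret F: module R "free R S" by (rule M.R.module_free)
  show ?thesis
  proof (rule linI)
    fix \<phi> assume "\<phi> \<in> carrier (free R S)"
    then show "lincomb R M g \<phi> \<in> carrier M"
      unfolding lincomb_def using g by (intro M.finsum_closed) (auto simp: free_simps)
  next
    fix \<phi> \<psi> assume \<phi>: "\<phi> \<in> carrier (free R S)" and \<psi>: "\<psi> \<in> carrier (free R S)"
    let ?T = "supp R \<phi> \<union> supp R \<psi>"
    have T: "finite ?T" "?T \<subseteq> S" using \<phi> \<psi> by (auto simp: free_simps)
    have gT: "g x \<in> carrier M" if "x \<in> ?T" for x using T g that by auto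
    have c: "\<phi> x \<in> carrier R" "\<psi> x \<in> carrier R" for x using \<phi> \<psi> by (auto simp: free_simps)
    have "lincomb R M g (\<phi> \<oplus>\<^bsub>free R S\<^esub> \<psi>) = finsum M (\<lambda>x. (\<phi> x \<oplus>\<^bsub>R\<^esub> \<psi> x) \<odot>\<^bsub>M\<^esub> g x) ?T"
      unfolding free_simps by (rule lincomb_superset) (use assms T gT c in \<open>auto simp: supp_def\<close>)
    also have "\<dots> = finsum M (\<lambda>x. \<phi> x \<odot>\<^bsub>M\<^esub> g x \<oplus>\<^bsub>M\<^esub> \<psi> x \<odot>\<^bsub>M\<^esub> g x) ?T"
      by (rule M.finsum_cong) (use gT c in \<open>auto simp: M.smult_l_distr simp_implies_def\<close>)
    also have "\<dots> = finsum M (\<lambda>x. \<phi> x \<odot>\<^bsub>M\<^esub> g x) ?T \<oplus>\<^bsub>M\<^esub> finsum M (\<lambda>x. \<psi> x \<odot>\<^bsub>M\<^esub> g x) ?T"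
      by (rule M.finsum_addf) (use gT c in auto)
    also have "\<dots> = lincomb R M g \<phi> \<oplus>\<^bsub>M\<^esub> lincomb R M g \<psi>"
      using lincomb_superset[OF assms(1) T(1) _ gT c(1)] lincomb_superset[OF assms(1) T(1) _ gT c(2)] by simp
    finally show "lincomb R M g (\<phi> \<oplus>\<^bsub>free R S\<^esub> \<psi>) = lincomb R M g \<phi> \<oplus>\<^bsub>M\<^esub> lincomb R M g \<psi>" .
  next
    fix r \<phi> assume r: "r \<in> carrier R" and \<phi>: "\<phi> \<in> carrier (free R S)"
    have c: "\<phi> x \<in> carrier R" for x using \<phi> by (auto simp: free_simps)
    have gT: "g x \<in> carrier M" if "x \<in> supp R \<phi>" for x using \<phi> g that by (auto simp: free_simps)
    have "lincomb R M g (r \<odot>\<^bsub>free R S\<^esub> \<phi>) = finsum M (\<lambda>x. (r \<otimes>\<^bsub>R\<^esub> \<phi> x) \<odot>\<^bsub>M\<^esub> g x) (supp R \<phi>)"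
      unfolding free_simps by (rule lincomb_superset) (use assms \<phi> r c gT in \<open>auto simp: supp_def free_simps\<close>)
    also have "\<dots> = finsum M (\<lambda>x. r \<odot>\<^bsub>M\<^esub> (\<phi> x \<odot>\<^bsub>M\<^esub> g x)) (supp R \<phi>)"
      by (rule M.finsum_cong) (use gT c r in \<open>auto simp: M.smult_assoc1 simp_implies_def\<close>)
    also have "\<dots> = r \<odot>\<^bsub>M\<^esub> lincomb R M g \<phi>"
      unfolding lincomb_def by (rule M.finsum_smult_ldistr[symmetric]) (use gT c r \<phi> in \<open>auto simp: free_simps\<close>)
    finally show "lincomb R M g (r \<odot>\<^bsub>free R S\<^esub> \<phi>) = r \<odot>\<^bsub>M\<^esub> lincomb R M g \<phi>" .
  qed (rule F.module_axioms, rule assms(1))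
qed

lemma lincomb_single:
  assumes "module R M" and g: "g x \<in> carrier M"
  shows "lincomb R M g (single R x) = g x"
proof -
  interpret M: module R M by fact
  have "lincomb R M g (single R x) = finsum M (\<lambda>y. single R x y \<odot>\<^bsub>M\<^esub> g y) {x}"
    by (rule lincomb_superset[OF assms(1)]) (use M.supp_single[of x] g in \<open>auto simp: single_def\<close>)
  then show ?thesis using g by (simp add: single_def)
qed

lemma lincomb_cong:
  assumes "module R M" "\<phi> \<in> carrier (free R S)" "\<And>x. x \<in> supp R \<phi> \<Longrightarrow> g x = g' x" "\<And>x. x \<in> S \<Longrightarrow> g' x \<in> carrier M"
  shows "lincomb R M g \<phi> = lincomb R M g' \<phi>"
proof -
  interpret M: module R M by fact
  show ?thesis unfolding lincomb_def
    by (rule M.finsum_cong) (use assms in \<open>auto simp: free_simps simp_implies_def\<close>)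
qed

section \<open>Images of modules\<close>

text \<open>The module structure on \<open>q ` carrier P\<close> that makes \<open>q\<close> linear, for a map \<open>q\<close> whose fibres form a
  congruence. It serves both to form quotients and to rename elements.\<close>

definition img_mod :: "('r, 'b) module \<Rightarrow> ('b \<Rightarrow> 'c) \<Rightarrow> ('r, 'c) module" where
  "img_mod P q = \<lparr>carrier = q ` carrier P, mult = undefined, one = undefined, zero = q \<zero>\<^bsub>P\<^esub>,
     add = \<lambda>a b. q (inv_into (carrier P) q a \<oplus>\<^bsub>P\<^esub> inv_into (carrier P) q b),
     smult = \<lambda>r a. q (r \<odot>\<^bsub>P\<^esub> inv_into (carrier P) q a)\<rparr>"

text \<open>Compatibility with addition is stated in one argument; commutativity supplies the
  other.\<close>

definition mod_cong :: "('r, 'x) ring_scheme \<Rightarrow> ('r, 'b) module \<Rightarrow> ('b \<Rightarrow> 'c) \<Rightarrow> bool" where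
  "mod_cong R P q \<longleftrightarrow>
     (\<forall>x \<in> carrier P. \<forall>x' \<in> carrier P. \<forall>y \<in> carrier P. q x = q x' \<longrightarrow> q (x \<oplus>\<^bsub>P\<^esub> y) = q (x' \<oplus>\<^bsub>P\<^esub> y)) \<and>
     (\<forall>r \<in> carrier R. \<forall>x \<in> carrier P. \<forall>x' \<in> carrier P. q x = q x' \<longrightarrow> q (r \<odot>\<^bsub>P\<^esub> x) = q (r \<odot>\<^bsub>P\<^esub> x'))"

lemma mod_cong_inj: "inj_on q (carrier P) \<Longrightarrow> mod_cong R P q"
  unfolding mod_cong_def inj_on_def by blast

lemma mod_cong_lin: "lin R P N q \<Longrightarrow> mod_cong R P q"
  unfolding mod_cong_def by (simp add: lin_add lin_smult)

lemma carrier_img_mod [simp]: "carrier (img_mod P q) = q ` carrier P"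
  by (simp add: img_mod_def)

lemma zero_img_mod [simp]: "\<zero>\<^bsub>img_mod P q\<^esub> = q \<zero>\<^bsub>P\<^esub>"
  by (simp add: img_mod_def)

lemma lin_img_mod:
  assumes "module R P" and q: "mod_cong R P q"
  shows "lin R P (img_mod P q) q"
proof -
  interpret P: module R P by fact
  let ?I = "img_mod P q"
  have inv: "inv_into (carrier P) q (q x) \<in> carrier P \<and> q (inv_into (carrier P) q (q x)) = q x"
    if "x \<in> carrier P" for x
    using that by (metis f_inv_into_f imageI inv_into_into)
  have c1: "q (x \<oplus>\<^bsub>P\<^esub> y) = q (x' \<oplus>\<^bsub>P\<^esub> y')"
    if "x \<in> carrier P" "x' \<in> carrier P" "y \<in> carrier P" "y' \<in> carrier P" "q x = q x'" "q y = q y'" for x x' y y'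
  proof -
    have "q (x \<oplus>\<^bsub>P\<^esub> y) = q (x' \<oplus>\<^bsub>P\<^esub> y)" using q that unfolding mod_cong_def by blast
    also have "\<dots> = q (y \<oplus>\<^bsub>P\<^esub> x')" using that by (simp add: P.a_comm)
    also have "\<dots> = q (y' \<oplus>\<^bsub>P\<^esub> x')" using q that unfolding mod_cong_def by blast
    finally show ?thesis using that by (simp add: P.a_comm)
  qed
  have a: "q x \<oplus>\<^bsub>?I\<^esub> q y = q (x \<oplus>\<^bsub>P\<^esub> y)" if "x \<in> carrier P" "y \<in> carrier P" for x y
    unfolding img_mod_def
    by simp (rule c1[OF _ that(1) _ that(2)]; simp only: inv[OF that(1)] inv[OF that(2)])
  have s: "r \<odot>\<^bsub>?I\<^esub> q x = q (r \<odot>\<^bsub>P\<^esub> x)" if "r \<in> carrier R" "x \<in> carrier P" for r x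
  proof -
    have "r \<odot>\<^bsub>?I\<^esub> q x = q (r \<odot>\<^bsub>P\<^esub> inv_into (carrier P) q (q x))" by (simp add: img_mod_def)
    also have "\<dots> = q (r \<odot>\<^bsub>P\<^esub> x)" using q that(1) inv[OF that(2)] that(2) unfolding mod_cong_def by blast
    finally show ?thesis .
  qed
  have "\<exists>b \<in> carrier ?I. b \<oplus>\<^bsub>?I\<^esub> a' = \<zero>\<^bsub>?I\<^esub>" if "a' \<in> carrier ?I" for a'
  proof -
    from that obtain x where x: "a' = q x" "x \<in> carrier P" by auto
    show ?thesis by (rule bexI[of _ "q (\<ominus>\<^bsub>P\<^esub> x)"]) (use x in \<open>auto simp: a P.l_neg\<close>)
  qed
  then have "abelian_group ?I"
    by (intro abelian_groupI) (auto simp: a P.a_ac)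
  then have "module R ?I"
    by (intro moduleI) (auto simp: a s P.cring_axioms P.smult_l_distr P.smult_r_distr P.smult_assoc1)
  then show ?thesis by (intro linI) (auto simp: assms a s)
qed

text \<open>The value is computed at an arbitrary preimage, so every use is accompanied by a proof
  that \<open>f\<close> is constant on the fibres of \<open>q\<close>.\<close>

definition induced :: "('r, 'b) module \<Rightarrow> ('b \<Rightarrow> 'c) \<Rightarrow> ('b \<Rightarrow> 'd) \<Rightarrow> 'c \<Rightarrow> 'd" where
  "induced P q f = (\<lambda>a. f (inv_into (carrier P) q a))"

lemma induced_eq:
  assumes "\<And>x x'. \<lbrakk>x \<in> carrier P; x' \<in> carrier P; q x = q x'\<rbrakk> \<Longrightarrow> f x = f x'" and "x \<in> carrier P"
  shows "induced P q f (q x) = f x"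
  unfolding induced_def by (rule assms(1)) (use assms(2) in \<open>auto intro: inv_into_into f_inv_into_f\<close>)

lemma lin_induced:
  assumes f: "lin R P N f" and q: "mod_cong R P q"
    and eq: "\<And>x x'. \<lbrakk>x \<in> carrier P; x' \<in> carrier P; q x = q x'\<rbrakk> \<Longrightarrow> f x = f x'"
  shows "lin R (img_mod P q) N (induced P q f)"
proof -
  have P: "module R P" "module R N" using lin_modules[OF f] by auto
  note Q = lin_img_mod[OF P(1) q]
  note I = induced_eq[where f = f, OF eq]
  show ?thesis
  proof (rule linI)
    show "module R (img_mod P q)" "module R N" using Q P by (auto simp: lin_modules)
    fix a assume "a \<in> carrier (img_mod P q)"
    then obtain x where x: "a = q x" "x \<in> carrier P" by auto
    show "induced P q f a \<in> carrier N" using x lin_closed[OF f] by (simp add: I)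
    fix b assume "b \<in> carrier (img_mod P q)"
    then obtain y where y: "b = q y" "y \<in> carrier P" by auto
    show "induced P q f (a \<oplus>\<^bsub>img_mod P q\<^esub> b) = induced P q f a \<oplus>\<^bsub>N\<^esub> induced P q f b"
      using x y by (simp add: lin_add[OF Q, symmetric] I mod_add[OF P(1)] lin_add[OF f])
  next
    fix r a assume r: "r \<in> carrier R" and "a \<in> carrier (img_mod P q)"
    then obtain x where x: "a = q x" "x \<in> carrier P" by auto
    show "induced P q f (r \<odot>\<^bsub>img_mod P q\<^esub> a) = r \<odot>\<^bsub>N\<^esub> induced P q f a"
      using x r by (simp add: lin_smult[OF Q, symmetric] I mod_smult[OF P(1)] lin_smult[OF f])
  qed
qed

text \<open>A choice of representatives modulo the subgroup \<open>S\<close>.\<close>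

definition rep :: "('r, 'b) module \<Rightarrow> 'b set \<Rightarrow> 'b \<Rightarrow> 'b" where
  "rep P S x = (SOME y. y \<in> carrier P \<and> x \<ominus>\<^bsub>P\<^esub> y \<in> S)"

text \<open>For congruent arguments the predicates under \<open>SOME\<close> coincide, hence so do
  the choices; conversely, two elements with the same representative both differ from it by elements
  of \<open>S\<close>.\<close>

lemma
  assumes "module R P" and S: "submodule S R P"
  shows rep_eq_iff: "x \<in> carrier P \<Longrightarrow> y \<in> carrier P \<Longrightarrow> rep P S x = rep P S y \<longleftrightarrow> x \<ominus>\<^bsub>P\<^esub> y \<in> S"
    and mod_cong_rep: "mod_cong R P (rep P S)"
proof -
  interpret P: module R P by fact
  note S' = P.submoduleE[OF S]
  have S0: "\<zero>\<^bsub>P\<^esub> \<in> S" using S'(2,3,5) S'(1) by (metis P.r_neg ex_in_conv subsetD)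
  have ex: "rep P S x \<in> carrier P \<and> x \<ominus>\<^bsub>P\<^esub> rep P S x \<in> S" if x: "x \<in> carrier P" for x
    unfolding rep_def by (rule someI[of _ x]) (use x S0 in \<open>simp add: a_minus_def P.r_neg\<close>)
  have tr: "x \<ominus>\<^bsub>P\<^esub> z \<in> S" if "x \<ominus>\<^bsub>P\<^esub> y \<in> S" "y \<ominus>\<^bsub>P\<^esub> z \<in> S" "x \<in> carrier P" "y \<in> carrier P" "z \<in> carrier P" for x y z
  proof -
    have "x \<ominus>\<^bsub>P\<^esub> z = (x \<ominus>\<^bsub>P\<^esub> y) \<oplus>\<^bsub>P\<^esub> (y \<ominus>\<^bsub>P\<^esub> z)" using that(3-) by algebra
    then show ?thesis using S'(5) that by simp
  qed
  have sy: "y \<ominus>\<^bsub>P\<^esub> x \<in> S" if "x \<ominus>\<^bsub>P\<^esub> y \<in> S" "x \<in> carrier P" "y \<in> carrier P" for x y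
  proof -
    have "y \<ominus>\<^bsub>P\<^esub> x = \<ominus>\<^bsub>P\<^esub> (x \<ominus>\<^bsub>P\<^esub> y)" using that(2-) by algebra
    then show ?thesis using S'(3) that by simp
  qed
  have iff: "rep P S x = rep P S y \<longleftrightarrow> x \<ominus>\<^bsub>P\<^esub> y \<in> S" if x: "x \<in> carrier P" and y: "y \<in> carrier P" for x y
  proof
    assume "rep P S x = rep P S y"
    then show "x \<ominus>\<^bsub>P\<^esub> y \<in> S" using ex[OF x] ex[OF y] tr sy x y by metis
  next
    assume a: "x \<ominus>\<^bsub>P\<^esub> y \<in> S"
    have "(x \<ominus>\<^bsub>P\<^esub> z \<in> S) = (y \<ominus>\<^bsub>P\<^esub> z \<in> S)" if "z \<in> carrier P" for z
      using tr[OF a _ x y that] tr[OF sy[OF a x y] _ y x that] by blast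
    then have "(\<lambda>z. z \<in> carrier P \<and> x \<ominus>\<^bsub>P\<^esub> z \<in> S) = (\<lambda>z. z \<in> carrier P \<and> y \<ominus>\<^bsub>P\<^esub> z \<in> S)" by auto
    then show "rep P S x = rep P S y" by (simp add: rep_def)
  qed
  then show "x \<in> carrier P \<Longrightarrow> y \<in> carrier P \<Longrightarrow> rep P S x = rep P S y \<longleftrightarrow> x \<ominus>\<^bsub>P\<^esub> y \<in> S" for x y .
  show "mod_cong R P (rep P S)"
    unfolding mod_cong_def
  proof (intro conjI ballI impI)
    fix x x' y assume x: "x \<in> carrier P" "x' \<in> carrier P" "y \<in> carrier P" and "rep P S x = rep P S x'"
    then have "x \<ominus>\<^bsub>P\<^esub> x' \<in> S" using iff by simp
    moreover have "(x \<oplus>\<^bsub>P\<^esub> y) \<ominus>\<^bsub>P\<^esub> (x' \<oplus>\<^bsub>P\<^esub> y) = x \<ominus>\<^bsub>P\<^esub> x'" using x by algebra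
    ultimately show "rep P S (x \<oplus>\<^bsub>P\<^esub> y) = rep P S (x' \<oplus>\<^bsub>P\<^esub> y)" using iff x by simp
  next
    fix r x x' assume r: "r \<in> carrier R" and x: "x \<in> carrier P" "x' \<in> carrier P" and "rep P S x = rep P S x'"
    then have "r \<odot>\<^bsub>P\<^esub> (x \<ominus>\<^bsub>P\<^esub> x') \<in> S" using iff S'(4) by simp
    moreover have "r \<odot>\<^bsub>P\<^esub> (x \<ominus>\<^bsub>P\<^esub> x') = r \<odot>\<^bsub>P\<^esub> x \<ominus>\<^bsub>P\<^esub> r \<odot>\<^bsub>P\<^esub> x'"
      using x r by (simp add: a_minus_def P.smult_r_distr P.smult_r_minus)
    ultimately show "rep P S (r \<odot>\<^bsub>P\<^esub> x) = rep P S (r \<odot>\<^bsub>P\<^esub> x')" using iff x r by simp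
  qed
qed

lemma submodule_image:
  assumes f: "lin R M N f"
  shows "submodule (f ` carrier M) R N"
proof -
  interpret M: module R M using lin_modules[OF f] by simp
  interpret N: module R N using lin_modules[OF f] by simp
  show ?thesis
    by (rule N.submoduleI)
      (auto simp: lin_closed[OF f] lin_add[OF f, symmetric] lin_neg[OF f, symmetric] lin_smult[OF f, symmetric]
        intro: rev_image_eqI[of "\<zero>\<^bsub>M\<^esub>"] simp: lin_zero[OF f])
qed


section \<open>Cochain complexes\<close>

definition mk_complex :: "(int \<Rightarrow> ('r, 'b) module) \<Rightarrow> (int \<Rightarrow> 'b \<Rightarrow> 'b) \<Rightarrow> ('r, 'b) cochain" where
  "mk_complex P D = \<lparr>cmod = P, diff = \<lambda>i. restrict (D i) (carrier (P i))\<rparr>"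

lemma mk_complex_simps [simp]:
  "cmod (mk_complex P D) = P" "x \<in> carrier (P i) \<Longrightarrow> diff (mk_complex P D) i x = D i x"
  by (simp_all add: mk_complex_def)

lemma complex_mk_complex:
  assumes D: "\<And>i. lin R (P i) (P (i + 1)) (D i)"
    and DD: "\<And>i x. x \<in> carrier (P i) \<Longrightarrow> D (i + 1) (D i x) = \<zero>\<^bsub>P (i + 1 + 1)\<^esub>"
  shows "cochain_complex R (mk_complex P D)"
proof (rule cochain_complex.intro)
  fix i
  show "module R (cmod (mk_complex P D) i)" using lin_modules[OF D] by simp
  show "diff (mk_complex P D) i \<in> linear_maps R (cmod (mk_complex P D) i) (cmod (mk_complex P D) (i + 1))"
    using lin_restrict[OF D[of i]] by (simp add: mk_complex_def)
  fix x assume "x \<in> carrier (cmod (mk_complex P D) i)"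
  then show "diff (mk_complex P D) (i + 1) (diff (mk_complex P D) i x) = \<zero>\<^bsub>cmod (mk_complex P D) (i + 1 + 1)\<^esub>"
    using DD lin_closed[OF D[of i]] by simp
qed

text \<open>The primed facts are those of degree \<open>i - 1\<close>, written with \<open>i\<close>
  in place of \<open>i - 1 + 1\<close> so that they compose with the unprimed ones.\<close>

lemma
  assumes "cochain_complex R N"
  shows complex_module: "module R (cmod N i)"
    and complex_diff: "lin R (cmod N i) (cmod N (i + 1)) (diff N i)"
    and complex_diff': "lin R (cmod N (i - 1)) (cmod N i) (diff N (i - 1))"
    and complex_dd: "x \<in> carrier (cmod N i) \<Longrightarrow> diff N (i + 1) (diff N i x) = \<zero>\<^bsub>cmod N (i + 1 + 1)\<^esub>"
    and complex_dd': "x \<in> carrier (cmod N (i - 1)) \<Longrightarrow> diff N i (diff N (i - 1) x) = \<zero>\<^bsub>cmod N (i + 1)\<^esub>"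
proof -
  interpret cochain_complex R N by fact
  show "module R (cmod N i)" by (rule is_module)
  show *: "lin R (cmod N i) (cmod N (i + 1)) (diff N i)" for i
    using diff_linear[of i] linear_maps_iff[OF is_module is_module] by blast
  show "lin R (cmod N (i - 1)) (cmod N i) (diff N (i - 1))" using *[of "i - 1"] by simp
  show "x \<in> carrier (cmod N i) \<Longrightarrow> diff N (i + 1) (diff N i x) = \<zero>\<^bsub>cmod N (i + 1 + 1)\<^esub>" by (rule diff_diff)
  show "x \<in> carrier (cmod N (i - 1)) \<Longrightarrow> diff N i (diff N (i - 1) x) = \<zero>\<^bsub>cmod N (i + 1)\<^esub>"
    using diff_diff[of x "i - 1"] by simp
qed

text \<open>Stands to \<open>cochain_maps\<close> as \<open>lin\<close> stands to
  \<open>linear_maps\<close>: element types may differ and values off the carriers are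
  arbitrary.\<close>

definition cm :: "('r, 'x) ring_scheme \<Rightarrow> ('r, 'b) cochain \<Rightarrow> ('r, 'c) cochain \<Rightarrow> (int \<Rightarrow> 'b \<Rightarrow> 'c) \<Rightarrow> bool" where
  "cm R M N f \<longleftrightarrow> cochain_complex R M \<and> cochain_complex R N \<and> (\<forall>i. lin R (cmod M i) (cmod N i) (f i)) \<and>
     (\<forall>i. \<forall>x \<in> carrier (cmod M i). f (i + 1) (diff M i x) = diff N i (f i x))"

lemma cmI:
  assumes "cochain_complex R M" "cochain_complex R N" "\<And>i. lin R (cmod M i) (cmod N i) (f i)"
    "\<And>i x. x \<in> carrier (cmod M i) \<Longrightarrow> f (i + 1) (diff M i x) = diff N i (f i x)"
  shows "cm R M N f"
  using assms unfolding cm_def by blast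

lemma
  assumes "cm R M N f"
  shows cm_complex: "cochain_complex R M" "cochain_complex R N"
    and cm_lin: "lin R (cmod M i) (cmod N i) (f i)"
    and cm_closed: "x \<in> carrier (cmod M i) \<Longrightarrow> f i x \<in> carrier (cmod N i)"
    and cm_diff: "x \<in> carrier (cmod M i) \<Longrightarrow> f (i + 1) (diff M i x) = diff N i (f i x)"
    and cm_diff': "x \<in> carrier (cmod M (i - 1)) \<Longrightarrow> f i (diff M (i - 1) x) = diff N (i - 1) (f (i - 1) x)"
proof -
  show "cochain_complex R M" "cochain_complex R N" and l: "lin R (cmod M i) (cmod N i) (f i)"
    and d: "x \<in> carrier (cmod M i) \<Longrightarrow> f (i + 1) (diff M i x) = diff N i (f i x)" for i x
    using assms unfolding cm_def by blast+
  show "x \<in> carrier (cmod M i) \<Longrightarrow> f i x \<in> carrier (cmod N i)" using lin_closed[OF l] .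
  show "x \<in> carrier (cmod M (i - 1)) \<Longrightarrow> f i (diff M (i - 1) x) = diff N (i - 1) (f (i - 1) x)"
    using d[of x "i - 1"] by simp
qed

lemma cm_comp: "cm R M N f \<Longrightarrow> cm R N K g \<Longrightarrow> cm R M K (\<lambda>i x. g i (f i x))"
  by (rule cmI) (auto simp: cm_complex cm_diff cm_closed intro: lin_comp cm_lin)

lemma cm_ident: "cochain_complex R M \<Longrightarrow> cm R M M (\<lambda>i x. x)"
  by (rule cmI) (auto intro: lin_ident complex_module)

lemma cm_cong:
  assumes f: "cm R M N f" and g: "\<And>i x. x \<in> carrier (cmod M i) \<Longrightarrow> f i x = g i x"
  shows "cm R M N g"
  by (rule cmI)
    (auto simp: cm_complex[OF f] g[symmetric] cm_diff[OF f] lin_closed[OF complex_diff[OF cm_complex(1)[OF f]]]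
      intro: lin_cong[OF cm_lin[OF f] g])

lemma cochain_maps_iff:
  assumes "cochain_complex R M" "cochain_complex R N"
  shows "f \<in> cochain_maps R M N \<longleftrightarrow> cm R M N f \<and> (\<forall>i. f i \<in> extensional (carrier (cmod M i)))"
  using assms unfolding cochain_maps_def cm_def
  by (auto simp: linear_maps_iff[OF complex_module[OF assms(1)] complex_module[OF assms(2)]])

definition restr :: "('r, 'b) cochain \<Rightarrow> (int \<Rightarrow> 'b \<Rightarrow> 'c) \<Rightarrow> int \<Rightarrow> 'b \<Rightarrow> 'c" where
  "restr M f = (\<lambda>i. restrict (f i) (carrier (cmod M i)))"

lemma restr_apply [simp]: "x \<in> carrier (cmod M i) \<Longrightarrow> restr M f i x = f i x"
  by (simp add: restr_def)

lemma cm_restr: "cm R M N f \<Longrightarrow> restr M f \<in> cochain_maps R M N"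
  by (subst cochain_maps_iff) (auto simp: cm_complex intro: cm_cong, simp add: restr_def)

lemma cochain_maps_restr:
  "cochain_complex R M \<Longrightarrow> cochain_complex R N \<Longrightarrow> f \<in> cochain_maps R M N \<Longrightarrow> restr M f = f"
  by (auto simp: cochain_maps_iff restr_def extensional_restrict)

lemma restr_eq_iff: "restr M f = restr M g \<longleftrightarrow> (\<forall>i. \<forall>x \<in> carrier (cmod M i). f i x = g i x)"
  unfolding restr_def fun_eq_iff restrict_def by metis

section \<open>The category of complexes\<close>

text \<open>Identities and composites are put in terms of \<open>restr\<close>, so that
  \<open>restr_eq_iff\<close> turns an equality of arrows into pointwise equality on
  carriers.\<close>

lemma coCh_simps [simp]:
  "Ob (coCh R) = {N. cochain_complex R N}" "Dom (coCh R) = src" "Cod (coCh R) = tgt"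
  "Ide (coCh R) N = Arrow N (restr N (\<lambda>i x. x)) N"
  "g \<cdot>\<^bsub>coCh R\<^esub> f = Arrow (src f) (restr (src f) (\<lambda>i x. mor g i (mor f i x))) (tgt g)"
  by (simp_all add: coCh_def id_map_def comp_map_def restr_def compose_def)

lemma coCh_arrI: "cm R M N f \<Longrightarrow> Arrow M (restr M f) N \<in> Ar (coCh R)"
  using cm_restr[of R M N f] cm_complex[of R M N f] by (simp add: coCh_def)

lemma
  assumes "a \<in> Ar (coCh R)"
  shows coCh_cm: "cm R (src a) (tgt a) (mor a)"
    and coCh_restr: "restr (src a) (mor a) = mor a"
  using assms by (auto simp: coCh_def cochain_maps_iff cochain_maps_restr)

lemma coCh_eqI:
  assumes "a \<in> Ar (coCh R)" "b \<in> Ar (coCh R)" "src a = src b" "tgt a = tgt b"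
    "\<And>i x. x \<in> carrier (cmod (src a) i) \<Longrightarrow> mor a i x = mor b i x"
  shows "a = b"
proof -
  have "mor a = mor b"
    using coCh_restr[OF assms(1)] coCh_restr[OF assms(2)] restr_eq_iff[of "src a" "mor a" "mor b"] assms by auto
  then show ?thesis using assms by (simp add: arrow.expand)
qed

lemma category_coCh: "category (coCh R)"
proof
  fix f assume f: "f \<in> Ar (coCh R)"
  note F = coCh_cm[OF f]
  show "Dom (coCh R) f \<in> Ob (coCh R)" "Cod (coCh R) f \<in> Ob (coCh R)" using cm_complex[OF F] by auto
  have I: "Arrow X (restr X (\<lambda>i x. x)) X \<in> Ar (coCh R)" if "cochain_complex R X" for X
    by (rule coCh_arrI[OF cm_ident[OF that]])
  have r: "Arrow (src f) (restr (src f) (mor f)) (tgt f) = f" using coCh_restr[OF f] by simp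
  show "f \<cdot>\<^bsub>coCh R\<^esub> Ide (coCh R) (Dom (coCh R) f) = f"
    by (subst (3) r[symmetric]) (simp add: restr_eq_iff)
  show "Ide (coCh R) (Cod (coCh R) f) \<cdot>\<^bsub>coCh R\<^esub> f = f"
    by (subst (3) r[symmetric]) (simp add: restr_eq_iff cm_closed[OF F])
  fix g assume g: "g \<in> Ar (coCh R)" and fg: "Cod (coCh R) f = Dom (coCh R) g"
  note G = coCh_cm[OF g]
  show "g \<cdot>\<^bsub>coCh R\<^esub> f \<in> Ar (coCh R)"
    using coCh_arrI[OF cm_comp[OF F]] G fg by simp
  show "Dom (coCh R) (g \<cdot>\<^bsub>coCh R\<^esub> f) = Dom (coCh R) f" "Cod (coCh R) (g \<cdot>\<^bsub>coCh R\<^esub> f) = Cod (coCh R) g"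
    by simp_all
  fix h assume h: "h \<in> Ar (coCh R)" and gh: "Cod (coCh R) g = Dom (coCh R) h"
  show "h \<cdot>\<^bsub>coCh R\<^esub> (g \<cdot>\<^bsub>coCh R\<^esub> f) = h \<cdot>\<^bsub>coCh R\<^esub> g \<cdot>\<^bsub>coCh R\<^esub> f"
    by (simp add: restr_eq_iff cm_closed[OF F] fg[simplified, symmetric])
next
  fix X assume "X \<in> Ob (coCh R)"
  then show "Ide (coCh R) X \<in> Ar (coCh R)" using coCh_arrI[OF cm_ident, of R X] by simp
qed simp_all

section \<open>Quasi-isomorphisms\<close>

definition cohomologous :: "('r, 'b) cochain \<Rightarrow> int \<Rightarrow> 'b \<Rightarrow> 'b \<Rightarrow> bool" where
  "cohomologous N i x y \<longleftrightarrow> x \<ominus>\<^bsub>cmod N i\<^esub> y \<in> coboundaries N i"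

lemma cocycle_iff:
  "x \<in> cocycles N i \<longleftrightarrow> x \<in> carrier (cmod N i) \<and> diff N i x = \<zero>\<^bsub>cmod N (i + 1)\<^esub>"
  by (simp add: cocycles_def)

lemma coboundary_iff:
  "x \<in> coboundaries N i \<longleftrightarrow> (\<exists>b \<in> carrier (cmod N (i - 1)). x = diff N (i - 1) b)"
  by (auto simp: coboundaries_def)

lemma
  assumes N: "cochain_complex R N"
  shows coboundaries_submodule: "submodule (coboundaries N i) R (cmod N i)"
    and cocycles_submodule: "submodule (cocycles N i) R (cmod N i)"
proof -
  interpret Ni: module R "cmod N i" by (rule complex_module[OF N])
  interpret Nj: module R "cmod N (i + 1)" by (rule complex_module[OF N])
  show "submodule (coboundaries N i) R (cmod N i)"
    unfolding coboundaries_def by (rule submodule_image[OF complex_diff'[OF N]])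
  note d = complex_diff[OF N, of i]
  show "submodule (cocycles N i) R (cmod N i)"
    by (rule Ni.submoduleI) (auto simp: cocycle_iff lin_zero[OF d] lin_neg[OF d] lin_add[OF d] lin_smult[OF d] Nj.neg_zero)
qed

text \<open>By \<open>rep_eq_iff\<close>, being cohomologous is equality of representatives modulo
  coboundaries, hence an equivalence relation.\<close>

lemma
  assumes N: "cochain_complex R N"
  shows coh_refl: "x \<in> carrier (cmod N i) \<Longrightarrow> cohomologous N i x x"
    and coh_sym: "\<lbrakk>cohomologous N i x y; x \<in> carrier (cmod N i); y \<in> carrier (cmod N i)\<rbrakk> \<Longrightarrow> cohomologous N i y x"
    and coh_trans: "\<lbrakk>cohomologous N i x y; cohomologous N i y z; x \<in> carrier (cmod N i); y \<in> carrier (cmod N i);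
       z \<in> carrier (cmod N i)\<rbrakk> \<Longrightarrow> cohomologous N i x z"
  using rep_eq_iff[OF complex_module[OF N] coboundaries_submodule[OF N]]
  by (simp_all add: cohomologous_def, metis+)

lemma
  assumes f: "cm R M N f"
  shows cm_cocycle: "x \<in> cocycles M i \<Longrightarrow> f i x \<in> cocycles N i"
    and cm_coh: "\<lbrakk>cohomologous M i x y; x \<in> carrier (cmod M i); y \<in> carrier (cmod M i)\<rbrakk> \<Longrightarrow> cohomologous N i (f i x) (f i y)"
    and cm_coboundary: "x \<in> coboundaries M i \<Longrightarrow> f i x \<in> coboundaries N i"
proof -
  show "x \<in> cocycles M i \<Longrightarrow> f i x \<in> cocycles N i"
    using cm_diff[OF f, of x i] by (simp add: cocycle_iff cm_closed[OF f] lin_zero[OF cm_lin[OF f]])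
  show B: "x \<in> coboundaries M i \<Longrightarrow> f i x \<in> coboundaries N i" for x
    using cm_diff'[OF f] cm_closed[OF f] unfolding coboundary_iff by blast
  show "\<lbrakk>cohomologous M i x y; x \<in> carrier (cmod M i); y \<in> carrier (cmod M i)\<rbrakk> \<Longrightarrow> cohomologous N i (f i x) (f i y)"
    using B unfolding cohomologous_def by (simp add: lin_minus[OF cm_lin[OF f], symmetric])
qed

section \<open>Cohomology classes as cosets\<close>

definition coh_class :: "('r, 'b) cochain \<Rightarrow> int \<Rightarrow> 'b \<Rightarrow> 'b set" where
  "coh_class N i z = (\<lambda>b. b \<oplus>\<^bsub>cmod N i\<^esub> z) ` coboundaries N i"

lemma carrier_cohomology: "carrier (cohomology N i) = coh_class N i ` cocycles N i"
  by (auto simp: cohomology_def FactGroup_def RCOSETS_def r_coset_def coh_class_def)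

lemma coh_class_eq_iff:
  assumes N: "cochain_complex R N" and x: "x \<in> carrier (cmod N i)" and y: "y \<in> carrier (cmod N i)"
  shows "coh_class N i x = coh_class N i y \<longleftrightarrow> cohomologous N i x y"
proof -
  interpret Ni: module R "cmod N i" by (rule complex_module[OF N])
  note S = Ni.submoduleE[OF coboundaries_submodule[OF N]]
  have B: "b \<in> carrier (cmod N i)" if "b \<in> coboundaries N i" for b using S(1) that by blast
  have z: "\<zero>\<^bsub>cmod N i\<^esub> \<in> coboundaries N i" using S(2,3,5) B by (metis Ni.r_neg ex_in_conv)
  have sub: "coh_class N i x \<subseteq> coh_class N i y"
    if xy: "x \<ominus>\<^bsub>cmod N i\<^esub> y \<in> coboundaries N i" and x: "x \<in> carrier (cmod N i)" and y: "y \<in> carrier (cmod N i)" for x y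
  proof
    fix u assume "u \<in> coh_class N i x"
    then obtain b where b: "b \<in> coboundaries N i" "u = b \<oplus>\<^bsub>cmod N i\<^esub> x" by (auto simp: coh_class_def)
    have "b \<oplus>\<^bsub>cmod N i\<^esub> (x \<ominus>\<^bsub>cmod N i\<^esub> y) \<in> coboundaries N i" using S(5) b xy by blast
    moreover have "u = (b \<oplus>\<^bsub>cmod N i\<^esub> (x \<ominus>\<^bsub>cmod N i\<^esub> y)) \<oplus>\<^bsub>cmod N i\<^esub> y"
      using B[OF b(1)] x y unfolding b(2) by algebra
    ultimately show "u \<in> coh_class N i y" by (auto simp: coh_class_def)
  qed
  show ?thesis
  proof
    assume "coh_class N i x = coh_class N i y"
    moreover have "x \<in> coh_class N i x" using z x by (force simp: coh_class_def)
    ultimately obtain b where "b \<in> coboundaries N i" "x = b \<oplus>\<^bsub>cmod N i\<^esub> y" by (auto simp: coh_class_def)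
    then have "x \<ominus>\<^bsub>cmod N i\<^esub> y = b" using B y by (simp add: a_minus_def Ni.a_assoc Ni.r_neg)
    then show "cohomologous N i x y" using \<open>b \<in> coboundaries N i\<close> by (simp add: cohomologous_def)
  next
    assume c: "cohomologous N i x y"
    then show "coh_class N i x = coh_class N i y"
      using sub[of x y] sub[of y x] coh_sym[OF N c x y] x y by (auto simp: cohomologous_def)
  qed
qed

lemma mult_cohomology:
  assumes N: "cochain_complex R N" and x: "x \<in> carrier (cmod N i)" and y: "y \<in> carrier (cmod N i)"
  shows "coh_class N i x \<otimes>\<^bsub>cohomology N i\<^esub> coh_class N i y = coh_class N i (x \<oplus>\<^bsub>cmod N i\<^esub> y)"
proof -
  interpret Ni: module R "cmod N i" by (rule complex_module[OF N])
  note S = Ni.submoduleE[OF coboundaries_submodule[OF N]]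
  have B: "b \<in> carrier (cmod N i)" if "b \<in> coboundaries N i" for b using S(1) that by blast
  have z: "\<zero>\<^bsub>cmod N i\<^esub> \<in> coboundaries N i" using S(2,3,5) B by (metis Ni.r_neg ex_in_conv)
  have "coh_class N i x \<otimes>\<^bsub>cohomology N i\<^esub> coh_class N i y =
      {b \<oplus>\<^bsub>cmod N i\<^esub> x \<oplus>\<^bsub>cmod N i\<^esub> (c \<oplus>\<^bsub>cmod N i\<^esub> y) | b c. b \<in> coboundaries N i \<and> c \<in> coboundaries N i}"
    by (auto simp: cohomology_def FactGroup_def set_mult_def coh_class_def)
  also have "\<dots> = coh_class N i (x \<oplus>\<^bsub>cmod N i\<^esub> y)"
  proof (rule equalityI; rule subsetI)
    fix u assume "u \<in> {b \<oplus>\<^bsub>cmod N i\<^esub> x \<oplus>\<^bsub>cmod N i\<^esub> (c \<oplus>\<^bsub>cmod N i\<^esub> y) | b c. b \<in> coboundaries N i \<and> c \<in> coboundaries N i}"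
    then obtain b c where bc: "b \<in> coboundaries N i" "c \<in> coboundaries N i" and u: "u = b \<oplus>\<^bsub>cmod N i\<^esub> x \<oplus>\<^bsub>cmod N i\<^esub> (c \<oplus>\<^bsub>cmod N i\<^esub> y)" by blast
    have "u = (b \<oplus>\<^bsub>cmod N i\<^esub> c) \<oplus>\<^bsub>cmod N i\<^esub> (x \<oplus>\<^bsub>cmod N i\<^esub> y)"
      unfolding u using B[OF bc(1)] B[OF bc(2)] x y by algebra
    then show "u \<in> coh_class N i (x \<oplus>\<^bsub>cmod N i\<^esub> y)" using S(5) bc by (auto simp: coh_class_def)
  next
    fix u assume "u \<in> coh_class N i (x \<oplus>\<^bsub>cmod N i\<^esub> y)"
    then obtain b where b: "b \<in> coboundaries N i" and u: "u = b \<oplus>\<^bsub>cmod N i\<^esub> (x \<oplus>\<^bsub>cmod N i\<^esub> y)" by (auto simp: coh_class_def)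
    have "u = b \<oplus>\<^bsub>cmod N i\<^esub> x \<oplus>\<^bsub>cmod N i\<^esub> (\<zero>\<^bsub>cmod N i\<^esub> \<oplus>\<^bsub>cmod N i\<^esub> y)"
      unfolding u using B[OF b] x y by algebra
    then show "u \<in> {b \<oplus>\<^bsub>cmod N i\<^esub> x \<oplus>\<^bsub>cmod N i\<^esub> (c \<oplus>\<^bsub>cmod N i\<^esub> y) | b c. b \<in> coboundaries N i \<and> c \<in> coboundaries N i}"
      using b z by blast
  qed
  finally show ?thesis .
qed

lemma cohomology_map_class:
  assumes f: "cm R M N f" and x: "x \<in> carrier (cmod M i)"
  shows "cohomology_map N f i (coh_class M i x) = coh_class N i (f i x)"
proof -
  note MN = cm_complex[OF f]
  interpret Mi: module R "cmod M i" by (rule complex_module[OF MN(1)])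
  interpret Ni: module R "cmod N i" by (rule complex_module[OF MN(2)])
  note S = Ni.submoduleE[OF coboundaries_submodule[OF MN(2)]]
  note S' = Mi.submoduleE[OF coboundaries_submodule[OF MN(1)]]
  have B: "b \<in> carrier (cmod N i)" if "b \<in> coboundaries N i" for b using S(1) that by blast
  have B': "b \<in> carrier (cmod M i)" if "b \<in> coboundaries M i" for b using S'(1) that by blast
  have z: "\<zero>\<^bsub>cmod M i\<^esub> \<in> coboundaries M i" using S'(2,3,5) B' by (metis Mi.r_neg ex_in_conv)
  have "cohomology_map N f i (coh_class M i x) =
      {c \<oplus>\<^bsub>cmod N i\<^esub> f i (b \<oplus>\<^bsub>cmod M i\<^esub> x) | b c. b \<in> coboundaries M i \<and> c \<in> coboundaries N i}"
    by (auto simp: cohomology_map_def set_add_def set_mult_def coh_class_def)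
  also have "\<dots> = coh_class N i (f i x)"
  proof (rule equalityI; rule subsetI)
    fix u assume "u \<in> {c \<oplus>\<^bsub>cmod N i\<^esub> f i (b \<oplus>\<^bsub>cmod M i\<^esub> x) | b c. b \<in> coboundaries M i \<and> c \<in> coboundaries N i}"
    then obtain b c where bc: "b \<in> coboundaries M i" "c \<in> coboundaries N i" and u: "u = c \<oplus>\<^bsub>cmod N i\<^esub> f i (b \<oplus>\<^bsub>cmod M i\<^esub> x)" by blast
    have "u = (c \<oplus>\<^bsub>cmod N i\<^esub> f i b) \<oplus>\<^bsub>cmod N i\<^esub> f i x"
      unfolding u using B[OF bc(2)] B'[OF bc(1)] x cm_closed[OF f] by (simp add: lin_add[OF cm_lin[OF f]] Ni.a_assoc)
    then show "u \<in> coh_class N i (f i x)" using S(5) bc cm_coboundary[OF f bc(1)] by (auto simp: coh_class_def)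
  next
    fix u assume "u \<in> coh_class N i (f i x)"
    then obtain b where b: "b \<in> coboundaries N i" and u: "u = b \<oplus>\<^bsub>cmod N i\<^esub> f i x" by (auto simp: coh_class_def)
    have "u = b \<oplus>\<^bsub>cmod N i\<^esub> f i (\<zero>\<^bsub>cmod M i\<^esub> \<oplus>\<^bsub>cmod M i\<^esub> x)" using u x by simp
    then show "u \<in> {c \<oplus>\<^bsub>cmod N i\<^esub> f i (b \<oplus>\<^bsub>cmod M i\<^esub> x) | b c. b \<in> coboundaries M i \<and> c \<in> coboundaries N i}"
      using b z by blast
  qed
  finally show ?thesis .
qed

text \<open>Bijectivity on cohomology without quotients. It makes sense between complexes with
  different element types and for maps that are not extensional, to which \<open>quasi_iso\<close>
  does not apply.\<close>

definition coh_bij :: "('r, 'b) cochain \<Rightarrow> ('r, 'c) cochain \<Rightarrow> (int \<Rightarrow> 'b \<Rightarrow> 'c) \<Rightarrow> bool" where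
  "coh_bij M N f \<longleftrightarrow> (\<forall>i. (\<forall>z \<in> cocycles M i. \<forall>z' \<in> cocycles M i. cohomologous N i (f i z) (f i z') \<longrightarrow> cohomologous M i z z') \<and>
     (\<forall>w \<in> cocycles N i. \<exists>z \<in> cocycles M i. cohomologous N i (f i z) w))"

lemma cocycle_closed: "z \<in> cocycles N i \<Longrightarrow> z \<in> carrier (cmod N i)"
  by (simp add: cocycle_iff)

lemma cocycle_add:
  assumes "cochain_complex R N" "x \<in> cocycles N i" "y \<in> cocycles N i"
  shows "x \<oplus>\<^bsub>cmod N i\<^esub> y \<in> cocycles N i"
  using module.submoduleE(5)[OF complex_module[OF assms(1)] cocycles_submodule[OF assms(1)]] assms by blast

lemma cocycle_minus:
  assumes "cochain_complex R N" "x \<in> cocycles N i" "y \<in> cocycles N i"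
  shows "x \<ominus>\<^bsub>cmod N i\<^esub> y \<in> cocycles N i"
  using module.submoduleE(3,5)[OF complex_module[OF assms(1)] cocycles_submodule[OF assms(1)]] assms
  unfolding a_minus_def by blast

text \<open>The induced map is a homomorphism in any case, so that being an isomorphism amounts to
  injectivity and surjectivity on cosets; \<open>coh_class_eq_iff\<close> translates these into the
  two halves of \<open>coh_bij\<close>.\<close>

lemma quasi_iso_iff:
  assumes MN: "cochain_complex R M" "cochain_complex R N"
  shows "quasi_iso R M N f \<longleftrightarrow> f \<in> cochain_maps R M N \<and> coh_bij M N f"
proof (cases "f \<in> cochain_maps R M N")
  case True
  then have f: "cm R M N f" using cochain_maps_iff[OF MN] by blast
  have "cohomology_map N f i \<in> iso (cohomology M i) (cohomology N i) \<longleftrightarrow>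
    (\<forall>z \<in> cocycles M i. \<forall>z' \<in> cocycles M i. cohomologous N i (f i z) (f i z') \<longrightarrow> cohomologous M i z z') \<and>
     (\<forall>w \<in> cocycles N i. \<exists>z \<in> cocycles M i. cohomologous N i (f i z) w)" for i
  proof -
    have eq: "cohomology_map N f i (coh_class M i z) = coh_class N i (f i z)" if "z \<in> cocycles M i" for z
      using cohomology_map_class[OF f cocycle_closed[OF that]] .
    have hom: "cohomology_map N f i \<in> hom (cohomology M i) (cohomology N i)"
      by (rule homI)
        (auto simp: carrier_cohomology eq cm_cocycle[OF f] mult_cohomology[OF MN(1)] mult_cohomology[OF MN(2)]
          cocycle_add[OF MN(1)] cocycle_closed cm_closed[OF f] lin_add[OF cm_lin[OF f]])
    have inj: "inj_on (cohomology_map N f i) (carrier (cohomology M i)) \<longleftrightarrow>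
      (\<forall>z \<in> cocycles M i. \<forall>z' \<in> cocycles M i. cohomologous N i (f i z) (f i z') \<longrightarrow> cohomologous M i z z')"
      unfolding inj_on_def carrier_cohomology
      by (simp add: eq coh_class_eq_iff[OF MN(1)] coh_class_eq_iff[OF MN(2)] cocycle_closed cm_closed[OF f])
    have "cohomology_map N f i ` carrier (cohomology M i) \<subseteq> carrier (cohomology N i)"
      by (auto simp: carrier_cohomology eq cm_cocycle[OF f])
    then have "cohomology_map N f i ` carrier (cohomology M i) = carrier (cohomology N i) \<longleftrightarrow>
      (\<forall>w \<in> cocycles N i. coh_class N i w \<in> cohomology_map N f i ` coh_class M i ` cocycles M i)"
      by (auto simp: carrier_cohomology)
    also have "\<dots> \<longleftrightarrow> (\<forall>w \<in> cocycles N i. \<exists>z \<in> cocycles M i. cohomologous N i (f i z) w)"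
    proof (rule ball_cong[OF refl])
      fix w assume w: "w \<in> cocycles N i"
      have "coh_class N i w \<in> cohomology_map N f i ` coh_class M i ` cocycles M i \<longleftrightarrow>
        (\<exists>z \<in> cocycles M i. coh_class N i w = coh_class N i (f i z))"
        by (simp add: image_image eq image_iff cong: bex_cong)
      also have "\<dots> \<longleftrightarrow> (\<exists>z \<in> cocycles M i. coh_class N i (f i z) = coh_class N i w)" by metis
      also have "\<dots> \<longleftrightarrow> (\<exists>z \<in> cocycles M i. cohomologous N i (f i z) w)"
        by (rule bex_cong[OF refl]) (simp add: coh_class_eq_iff[OF MN(2)] cocycle_closed w cm_closed[OF f])
      finally show "coh_class N i w \<in> cohomology_map N f i ` coh_class M i ` cocycles M i \<longleftrightarrow>
        (\<exists>z \<in> cocycles M i. cohomologous N i (f i z) w)" .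
    qed
    finally show ?thesis using inj hom by (auto simp: iso_def bij_betw_def)
  qed
  then show ?thesis using True by (simp add: quasi_iso_def coh_bij_def)
qed (simp add: quasi_iso_def)

lemma qis_iff: "a \<in> qis R \<longleftrightarrow> a \<in> Ar (coCh R) \<and> coh_bij (src a) (tgt a) (mor a)"
proof -
  have "mor a \<in> cochain_maps R (src a) (tgt a)" if "a \<in> Ar (coCh R)"
    using cm_restr[OF coCh_cm[OF that]] coCh_restr[OF that] by simp
  then show ?thesis
    using quasi_iso_iff[OF cm_complex[OF coCh_cm]] by (auto simp: qis_def)
qed

lemma coh_bij_cong:
  assumes "\<And>i x. x \<in> carrier (cmod M i) \<Longrightarrow> f i x = g i x"
  shows "coh_bij M N f \<longleftrightarrow> coh_bij M N g"
  unfolding coh_bij_def by (simp add: assms[OF cocycle_closed] cong: ball_cong bex_cong)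

lemma
  assumes f: "cm R M N f" and g: "cm R N K g"
  shows coh_bij_comp: "coh_bij M N f \<Longrightarrow> coh_bij N K g \<Longrightarrow> coh_bij M K (\<lambda>i x. g i (f i x))"
    and coh_bij_cancel_right: "coh_bij M N f \<Longrightarrow> coh_bij M K (\<lambda>i x. g i (f i x)) \<Longrightarrow> coh_bij N K g"
    and coh_bij_cancel_left: "coh_bij N K g \<Longrightarrow> coh_bij M K (\<lambda>i x. g i (f i x)) \<Longrightarrow> coh_bij M N f"
proof -
  note c = cocycle_closed cm_closed[OF f] cm_closed[OF g] cm_cocycle[OF f] cm_cocycle[OF g]
  note N = cm_complex(2)[OF f] and K = cm_complex(2)[OF g]
  show "coh_bij M K (\<lambda>i x. g i (f i x))" if F: "coh_bij M N f" and G: "coh_bij N K g"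
    unfolding coh_bij_def
  proof (intro allI conjI ballI impI)
    fix i z z' assume "z \<in> cocycles M i" "z' \<in> cocycles M i" "cohomologous K i (g i (f i z)) (g i (f i z'))"
    then show "cohomologous M i z z'" using F G cm_cocycle[OF f] unfolding coh_bij_def by blast
  next
    fix i w assume w: "w \<in> cocycles K i"
    then obtain y where y: "y \<in> cocycles N i" "cohomologous K i (g i y) w" using G unfolding coh_bij_def by blast
    then obtain z where z: "z \<in> cocycles M i" "cohomologous N i (f i z) y" using F unfolding coh_bij_def by blast
    have "cohomologous K i (g i (f i z)) (g i y)" by (rule cm_coh[OF g z(2)]) (use z(1) y in \<open>simp_all add: c\<close>)
    then have "cohomologous K i (g i (f i z)) w" using coh_trans[OF K _ y(2)] y(1) z(1) w by (simp add: c)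
    then show "\<exists>z \<in> cocycles M i. cohomologous K i (g i (f i z)) w" using z by blast
  qed
  show "coh_bij N K g" if F: "coh_bij M N f" and G: "coh_bij M K (\<lambda>i x. g i (f i x))"
    unfolding coh_bij_def
  proof (intro allI conjI ballI impI)
    fix i y y' assume y: "y \<in> cocycles N i" "y' \<in> cocycles N i" and e: "cohomologous K i (g i y) (g i y')"
    obtain z where z: "z \<in> cocycles M i" "cohomologous N i (f i z) y" using F y unfolding coh_bij_def by blast
    obtain z' where z': "z' \<in> cocycles M i" "cohomologous N i (f i z') y'" using F y unfolding coh_bij_def by blast
    have 1: "cohomologous K i (g i (f i z)) (g i y)" by (rule cm_coh[OF g z(2)]) (use z(1) y in \<open>simp_all add: c\<close>)
    have 2: "cohomologous K i (g i (f i z')) (g i y')" by (rule cm_coh[OF g z'(2)]) (use z'(1) y in \<open>simp_all add: c\<close>)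
    have "cohomologous K i (g i (f i z)) (g i (f i z'))"
      using coh_trans[OF K coh_trans[OF K 1 e] coh_sym[OF K 2]] y z(1) z'(1) by (simp add: c)
    then have "cohomologous M i z z'" using G z z' unfolding coh_bij_def by blast
    then have 3: "cohomologous N i (f i z) (f i z')" using cm_coh[OF f] z(1) z'(1) by (simp add: c)
    show "cohomologous N i y y'"
      using coh_trans[OF N coh_trans[OF N coh_sym[OF N z(2)] 3] z'(2)] y z(1) z'(1) by (simp add: c)
  next
    fix i w assume w: "w \<in> cocycles K i"
    then obtain z where z: "z \<in> cocycles M i" "cohomologous K i (g i (f i z)) w" using G unfolding coh_bij_def by blast
    then show "\<exists>y \<in> cocycles N i. cohomologous K i (g i y) w" using cm_cocycle[OF f] by blast
  qed
  show "coh_bij M N f" if F: "coh_bij N K g" and G: "coh_bij M K (\<lambda>i x. g i (f i x))"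
    unfolding coh_bij_def
  proof (intro allI conjI ballI impI)
    fix i z z' assume z: "z \<in> cocycles M i" "z' \<in> cocycles M i" and e: "cohomologous N i (f i z) (f i z')"
    then have "cohomologous K i (g i (f i z)) (g i (f i z'))" using cm_coh[OF g e] by (simp add: c)
    then show "cohomologous M i z z'" using G z unfolding coh_bij_def by blast
  next
    fix i w assume w: "w \<in> cocycles N i"
    then obtain z where z: "z \<in> cocycles M i" "cohomologous K i (g i (f i z)) (g i w)"
      using G cm_cocycle[OF g w] unfolding coh_bij_def by blast
    have "cohomologous N i (f i z) w"
      using F w z(2) cm_cocycle[OF f z(1)] unfolding coh_bij_def by blast
    then show "\<exists>z \<in> cocycles M i. cohomologous N i (f i z) w" using z(1) by blast
  qed
qed

text \<open>An element chase: for injectivity, classes are pushed forward along \<open>s2\<close>,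
  compared under \<open>g\<close> and pulled back along \<open>r1\<close>; for surjectivity,
  \<open>s2 w\<close> is lifted along \<open>g\<close> and the lift is sent back along
  \<open>r1\<close>.\<close>

lemma coh_bij_retract:
  assumes f: "cm R M N f" and g: "cm R M' N' g" and s1: "cm R M M' s1" and s2: "cm R N N' s2"
    and r1: "cm R M' M r1" and r2: "cm R N' N r2"
    and sf: "\<And>i x. x \<in> carrier (cmod M i) \<Longrightarrow> s2 i (f i x) = g i (s1 i x)"
    and rg: "\<And>i x. x \<in> carrier (cmod M' i) \<Longrightarrow> r2 i (g i x) = f i (r1 i x)"
    and rs1: "\<And>i x. x \<in> carrier (cmod M i) \<Longrightarrow> r1 i (s1 i x) = x"
    and rs2: "\<And>i x. x \<in> carrier (cmod N i) \<Longrightarrow> r2 i (s2 i x) = x"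
    and G: "coh_bij M' N' g"
  shows "coh_bij M N f"
  unfolding coh_bij_def
proof (intro allI conjI ballI impI)
  note c = cocycle_closed cm_closed[OF f] cm_closed[OF g] cm_cocycle[OF f] cm_cocycle[OF g] cm_cocycle[OF s1]
    cm_cocycle[OF s2] cm_cocycle[OF r1] cm_cocycle[OF r2] cm_closed[OF s1] cm_closed[OF s2] cm_closed[OF r1] cm_closed[OF r2]
  fix i
  {
    fix z z' assume z: "z \<in> cocycles M i" "z' \<in> cocycles M i" and e: "cohomologous N i (f i z) (f i z')"
    have "cohomologous N' i (s2 i (f i z)) (s2 i (f i z'))" by (rule cm_coh[OF s2 e]) (use z in \<open>simp_all add: c\<close>)
    then have "cohomologous N' i (g i (s1 i z)) (g i (s1 i z'))" using sf z by (simp add: c)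
    then have "cohomologous M' i (s1 i z) (s1 i z')" using G cm_cocycle[OF s1] z unfolding coh_bij_def by blast
    then have "cohomologous M i (r1 i (s1 i z)) (r1 i (s1 i z'))" using cm_coh[OF r1] z by (simp add: c)
    then show "cohomologous M i z z'" using rs1 z by (simp add: c)
  next
    fix w assume w: "w \<in> cocycles N i"
    then obtain z where z: "z \<in> cocycles M' i" "cohomologous N' i (g i z) (s2 i w)"
      using G cm_cocycle[OF s2 w] unfolding coh_bij_def by blast
    then have "cohomologous N i (r2 i (g i z)) (r2 i (s2 i w))" using cm_coh[OF r2 z(2)] w z(1) by (simp add: c)
    then have "cohomologous N i (f i (r1 i z)) w" using rs2 rg z(1) w by (simp add: c)
    then show "\<exists>z \<in> cocycles M i. cohomologous N i (f i z) w" using cm_cocycle[OF r1 z(1)] by blast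
  }
qed

text \<open>Trivial fibrations are the maps with the right lifting property with respect to the inclusions of
  spheres into disks.\<close>

lemma triv_fib_iff:
  assumes f: "cm R M N f"
  shows "(\<forall>i. f i ` carrier (cmod M i) = carrier (cmod N i)) \<and> coh_bij M N f \<longleftrightarrow>
    (\<forall>i. \<forall>z \<in> cocycles M (i + 1). \<forall>y \<in> carrier (cmod N i). f (i + 1) z = diff N i y \<longrightarrow>
       (\<exists>x \<in> carrier (cmod M i). diff M i x = z \<and> f i x = y))" (is "?L \<longleftrightarrow> ?R")
proof
  note M = cm_complex(1)[OF f] and N = cm_complex(2)[OF f]
  {
    assume L: ?L
    show ?R
    proof (intro allI ballI impI)
      fix i z y assume z: "z \<in> cocycles M (i + 1)" and y: "y \<in> carrier (cmod N i)" and e: "f (i + 1) z = diff N i y"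
      interpret Mi: module R "cmod M i" by (rule complex_module[OF M])
      interpret Mj: module R "cmod M (i + 1)" by (rule complex_module[OF M])
      interpret Ni: module R "cmod N i" by (rule complex_module[OF N])
      interpret Nj: module R "cmod N (i + 1)" by (rule complex_module[OF N])
      have z0: "\<zero>\<^bsub>cmod M (i + 1)\<^esub> \<in> cocycles M (i + 1)"
        by (simp add: cocycle_iff lin_zero[OF complex_diff[OF M]])
      have "cohomologous N (i + 1) (f (i + 1) z) (f (i + 1) \<zero>\<^bsub>cmod M (i + 1)\<^esub>)"
        unfolding cohomologous_def coboundary_iff lin_zero[OF cm_lin[OF f]] e
        by (rule bexI[of _ y]) (use y lin_closed[OF complex_diff[OF N]] in \<open>auto simp: a_minus_def Nj.neg_zero\<close>)
      then have "cohomologous M (i + 1) z \<zero>\<^bsub>cmod M (i + 1)\<^esub>" using L z z0 unfolding coh_bij_def by blast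
      then obtain x0 where x0: "x0 \<in> carrier (cmod M i)" "z = diff M i x0"
      proof -
        have "z \<ominus>\<^bsub>cmod M (i + 1)\<^esub> \<zero>\<^bsub>cmod M (i + 1)\<^esub> = z" using cocycle_closed[OF z] Mj.zero_closed by algebra
        then show ?thesis using that \<open>cohomologous M (i + 1) z \<zero>\<^bsub>cmod M (i + 1)\<^esub>\<close>
          by (auto simp: cohomologous_def coboundary_iff)
      qed
      \<comment> \<open>\<open>x0\<close> has the right boundary but the wrong image. The error
        \<open>?w\<close> is a cocycle, hence the image of a cocycle \<open>c\<close> up to a
        boundary \<open>d b\<close>; surjectivity lifts \<open>b\<close> to \<open>b'\<close>, and
        \<open>c - d b'\<close> is the correction that maps to \<open>?w\<close> exactly.\<close>
      let ?w = "y \<ominus>\<^bsub>cmod N i\<^esub> f i x0"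
      have fx: "f i x0 \<in> carrier (cmod N i)" by (rule cm_closed[OF f x0(1)])
      have "?w \<in> cocycles N i"
        using y fx e x0 by (simp add: cocycle_iff lin_minus[OF complex_diff[OF N]] cm_diff[OF f, symmetric])
          (simp add: a_minus_def Nj.r_neg lin_closed[OF complex_diff[OF N]])
      then have "\<exists>c \<in> cocycles M i. cohomologous N i (f i c) ?w" using L[THEN conjunct2, unfolded coh_bij_def] by simp
      then obtain c where c: "c \<in> cocycles M i" "cohomologous N i (f i c) ?w" by blast
      have c': "c \<in> carrier (cmod M i)" "f i c \<in> carrier (cmod N i)" using c(1) by (simp_all add: cocycle_closed cm_closed[OF f])
      obtain b where b: "b \<in> carrier (cmod N (i - 1))" "f i c \<ominus>\<^bsub>cmod N i\<^esub> ?w = diff N (i - 1) b"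
        using c(2) by (auto simp: cohomologous_def coboundary_iff)
      obtain b' where b': "b' \<in> carrier (cmod M (i - 1))" "b = f (i - 1) b'"
        using b(1) L[THEN conjunct1, rule_format, of "i - 1"] by (metis imageE)
      have db: "diff M (i - 1) b' \<in> carrier (cmod M i)" using lin_closed[OF complex_diff'[OF M] b'(1)] .
      let ?x = "x0 \<oplus>\<^bsub>cmod M i\<^esub> (c \<ominus>\<^bsub>cmod M i\<^esub> diff M (i - 1) b')"
      have fb: "f i (diff M (i - 1) b') = f i c \<ominus>\<^bsub>cmod N i\<^esub> ?w" using cm_diff'[OF f b'(1)] b b' by simp
      have "f i ?x = f i x0 \<oplus>\<^bsub>cmod N i\<^esub> (f i c \<ominus>\<^bsub>cmod N i\<^esub> (f i c \<ominus>\<^bsub>cmod N i\<^esub> ?w))"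
        using x0 c' db by (simp add: lin_add[OF cm_lin[OF f]] lin_minus[OF cm_lin[OF f]] fb)
      also have "\<dots> = y" using fx c' y by algebra
      finally have 1: "f i ?x = y" .
      have "diff M i ?x = z"
        using x0 c' db c(1) b'(1)
        by (simp add: lin_add[OF complex_diff[OF M]] lin_neg[OF complex_diff[OF M]] complex_dd'[OF M] cocycle_iff
          a_minus_def Mj.neg_zero lin_closed[OF complex_diff[OF M]])
      then show "\<exists>x \<in> carrier (cmod M i). diff M i x = z \<and> f i x = y"
        using 1 x0 c' db by (intro bexI[of _ ?x]) auto
    qed
  next
    assume Rr: ?R
    have z0: "\<zero>\<^bsub>cmod M (i + 1)\<^esub> \<in> cocycles M (i + 1)" for i
      by (simp add: cocycle_iff lin_zero[OF complex_diff[OF M]] mod_zero[OF complex_module[OF M]])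
    \<comment> \<open>The lifting property at \<open>z = 0\<close>: cocycles lift to
      cocycles.\<close>
    have cyc: "\<exists>x \<in> cocycles M i. f i x = w" if "w \<in> cocycles N i" for i w
      using Rr[rule_format, OF z0, of w i] that by (auto simp: cocycle_iff lin_zero[OF cm_lin[OF f]])
    have surj: "\<exists>x \<in> carrier (cmod M i). f i x = y" if y: "y \<in> carrier (cmod N i)" for i y
    proof -
      \<comment> \<open>The boundary of \<open>y\<close> is a cocycle, so it lifts to a cocycle
        \<open>z\<close>, and now \<open>y\<close> lifts to an element with boundary
        \<open>z\<close>.\<close>
      have "diff N i y \<in> cocycles N (i + 1)"
        using y by (simp add: cocycle_iff complex_dd[OF N] lin_closed[OF complex_diff[OF N]])
      then obtain z where "z \<in> cocycles M (i + 1)" "f (i + 1) z = diff N i y" using cyc by blast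
      then show ?thesis using Rr y by blast
    qed
    show ?L
    proof
      show "\<forall>i. f i ` carrier (cmod M i) = carrier (cmod N i)"
        using surj cm_closed[OF f] by blast
      show "coh_bij M N f"
        unfolding coh_bij_def
      proof (intro allI conjI ballI impI)
        fix i z z' assume z: "z \<in> cocycles M i" "z' \<in> cocycles M i" and e: "cohomologous N i (f i z) (f i z')"
        interpret Mi: module R "cmod M i" by (rule complex_module[OF M])
        interpret Mj: module R "cmod M (i + 1)" by (rule complex_module[OF M])
        obtain y where y: "y \<in> carrier (cmod N (i - 1))" "f i z \<ominus>\<^bsub>cmod N i\<^esub> f i z' = diff N (i - 1) y"
          using e by (auto simp: cohomologous_def coboundary_iff)
        \<comment> \<open>Degree \<open>i\<close> is written as \<open>i - 1 + 1\<close> to match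
          the lifting property, which here produces an element of degree \<open>i - 1\<close>
          bounding the difference.\<close>
        have "z \<ominus>\<^bsub>cmod M i\<^esub> z' \<in> cocycles M (i - 1 + 1)"
          using cocycle_minus[OF M z] by simp
        moreover have "f (i - 1 + 1) (z \<ominus>\<^bsub>cmod M i\<^esub> z') = diff N (i - 1) y"
          using y z by (simp add: lin_minus[OF cm_lin[OF f]] cocycle_closed)
        ultimately show "cohomologous M i z z'"
          using Rr[rule_format, of "z \<ominus>\<^bsub>cmod M i\<^esub> z'" "i - 1" y] y(1)
          unfolding cohomologous_def coboundary_iff by (metis (no_types))
      next
        fix i w assume w: "w \<in> cocycles N i"
        then obtain x where "x \<in> cocycles M i" "f i x = w" using cyc by blast
        then show "\<exists>z \<in> cocycles M i. cohomologous N i (f i z) w"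
          using coh_refl[OF N] cocycle_closed[OF w] by blast
      qed
    qed
  }
qed


section \<open>Images of complexes\<close>

definition complex_cong :: "('r, 'x) ring_scheme \<Rightarrow> ('r, 'b) cochain \<Rightarrow> (int \<Rightarrow> 'b \<Rightarrow> 'c) \<Rightarrow> bool" where
  "complex_cong R P q \<longleftrightarrow> cochain_complex R P \<and> (\<forall>i. mod_cong R (cmod P i) (q i)) \<and>
     (\<forall>i. \<forall>x \<in> carrier (cmod P i). \<forall>x' \<in> carrier (cmod P i).
        q i x = q i x' \<longrightarrow> q (i + 1) (diff P i x) = q (i + 1) (diff P i x'))"

definition img_complex :: "('r, 'b) cochain \<Rightarrow> (int \<Rightarrow> 'b \<Rightarrow> 'c) \<Rightarrow> ('r, 'c) cochain" where
  "img_complex P q = mk_complex (\<lambda>i. img_mod (cmod P i) (q i))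
     (\<lambda>i. induced (cmod P i) (q i) (\<lambda>x. q (i + 1) (diff P i x)))"

lemma cmod_img_complex [simp]: "cmod (img_complex P q) i = img_mod (cmod P i) (q i)"
  by (simp add: img_complex_def)

definition descend :: "('r, 'b) cochain \<Rightarrow> (int \<Rightarrow> 'b \<Rightarrow> 'c) \<Rightarrow> (int \<Rightarrow> 'b \<Rightarrow> 'd) \<Rightarrow> int \<Rightarrow> 'c \<Rightarrow> 'd" where
  "descend P q f i = induced (cmod P i) (q i) (f i)"

lemma cm_img_complex:
  assumes q: "complex_cong R P q"
  shows "cm R P (img_complex P q) q"
proof -
  have P: "cochain_complex R P" and mc: "mod_cong R (cmod P i) (q i)"
    and dq: "\<lbrakk>x \<in> carrier (cmod P i); x' \<in> carrier (cmod P i); q i x = q i x'\<rbrakk> \<Longrightarrow> q (i + 1) (diff P i x) = q (i + 1) (diff P i x')" for i x x'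
    using q unfolding complex_cong_def by blast+
  have ql: "lin R (cmod P i) (img_mod (cmod P i) (q i)) (q i)" for i
    by (rule lin_img_mod[OF complex_module[OF P] mc])
  have dl: "lin R (cmod P i) (img_mod (cmod P (i + 1)) (q (i + 1))) (\<lambda>x. q (i + 1) (diff P i x))" for i
    by (rule lin_comp[OF complex_diff[OF P] ql])
  have ind: "induced (cmod P i) (q i) (\<lambda>x. q (i + 1) (diff P i x)) (q i x) = q (i + 1) (diff P i x)"
    if "x \<in> carrier (cmod P i)" for i x
    by (rule induced_eq[OF dq that])
  have C: "cochain_complex R (img_complex P q)"
    unfolding img_complex_def
  proof (rule complex_mk_complex)
    show "lin R (img_mod (cmod P i) (q i)) (img_mod (cmod P (i + 1)) (q (i + 1)))
       (induced (cmod P i) (q i) (\<lambda>x. q (i + 1) (diff P i x)))" for i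
      by (rule lin_induced[OF dl mc dq])
    fix i a assume "a \<in> carrier (img_mod (cmod P i) (q i))"
    then obtain x where x: "x \<in> carrier (cmod P i)" "a = q i x" by auto
    have "diff P i x \<in> carrier (cmod P (i + 1))" by (rule lin_closed[OF complex_diff[OF P] x(1)])
    then show "induced (cmod P (i + 1)) (q (i + 1)) (\<lambda>x. q (i + 1 + 1) (diff P (i + 1) x))
       (induced (cmod P i) (q i) (\<lambda>x. q (i + 1) (diff P i x)) a) = \<zero>\<^bsub>img_mod (cmod P (i + 1 + 1)) (q (i + 1 + 1))\<^esub>"
      by (simp only: x(2) ind[OF x(1)] ind complex_dd[OF P x(1)] zero_img_mod)
  qed
  show ?thesis
  proof (rule cmI[OF P C])
    fix i x assume x: "x \<in> carrier (cmod P i)"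
    show "q (i + 1) (diff P i x) = diff (img_complex P q) i (q i x)"
      using x by (simp add: img_complex_def ind)
  qed (simp add: ql)
qed

lemma descend_eq:
  assumes "\<And>x x'. \<lbrakk>x \<in> carrier (cmod P i); x' \<in> carrier (cmod P i); q i x = q i x'\<rbrakk> \<Longrightarrow> f i x = f i x'"
    and "x \<in> carrier (cmod P i)"
  shows "descend P q f i (q i x) = f i x"
  unfolding descend_def by (rule induced_eq[OF assms])

lemma cm_descend:
  assumes q: "complex_cong R P q" and f: "cm R P N f"
    and eq: "\<And>i x x'. \<lbrakk>x \<in> carrier (cmod P i); x' \<in> carrier (cmod P i); q i x = q i x'\<rbrakk> \<Longrightarrow> f i x = f i x'"
  shows "cm R (img_complex P q) N (descend P q f)"
proof (rule cmI)
  note Q = cm_img_complex[OF q]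
  show "cochain_complex R (img_complex P q)" "cochain_complex R N" using cm_complex[OF Q] cm_complex[OF f] by auto
  show "lin R (cmod (img_complex P q) i) (cmod N i) (descend P q f i)" for i
    unfolding descend_def cmod_img_complex
    by (rule lin_induced[OF cm_lin[OF f] _ eq]) (use q in \<open>simp_all add: complex_cong_def\<close>)
  fix i a assume "a \<in> carrier (cmod (img_complex P q) i)"
  then obtain x where x: "x \<in> carrier (cmod P i)" "a = q i x" by auto
  have D: "diff (img_complex P q) i a = q (i + 1) (diff P i x)" using cm_diff[OF Q x(1)] x(2) by simp
  have dx: "diff P i x \<in> carrier (cmod P (i + 1))" by (rule lin_closed[OF complex_diff[OF cm_complex(1)[OF f]] x(1)])
  show "descend P q f (i + 1) (diff (img_complex P q) i a) = diff N i (descend P q f i a)"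
    unfolding D by (simp add: x(2) descend_eq[where f = f, OF eq] dx x(1) cm_diff[OF f])
qed

lemma complex_cong_inj:
  assumes "cochain_complex R P" "\<And>i. inj_on (q i) (carrier (cmod P i))"
  shows "complex_cong R P q"
  using assms mod_cong_inj unfolding complex_cong_def inj_on_def by metis

lemma coh_bij_iso:
  assumes f: "cm R M N f" and g: "cm R N M g"
    and gf: "\<And>i x. x \<in> carrier (cmod M i) \<Longrightarrow> g i (f i x) = x"
    and fg: "\<And>i x. x \<in> carrier (cmod N i) \<Longrightarrow> f i (g i x) = x"
  shows "coh_bij M N f"
  unfolding coh_bij_def
proof (intro allI conjI ballI impI)
  fix i z z' assume z: "z \<in> cocycles M i" "z' \<in> cocycles M i" "cohomologous N i (f i z) (f i z')"
  then have "cohomologous M i (g i (f i z)) (g i (f i z'))"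
    using cm_coh[OF g] by (simp add: cocycle_closed cm_closed[OF f])
  then show "cohomologous M i z z'" using z by (simp add: gf cocycle_closed)
next
  fix i w assume w: "w \<in> cocycles N i"
  show "\<exists>z \<in> cocycles M i. cohomologous N i (f i z) w"
    by (rule bexI[of _ "g i w"]) (use w in \<open>simp_all add: fg cocycle_closed cm_cocycle[OF g] coh_refl[OF cm_complex(2)[OF f]]\<close>)
qed

text \<open>Renaming the elements of a complex along an injection \<open>q\<close>; the inverse is \<open>descend P q (\<lambda>i x. x)\<close>.\<close>

lemma
  assumes P: "cochain_complex R P" and q: "\<And>i. inj_on (q i) (carrier (cmod P i))"
  shows cm_rename: "cm R P (img_complex P q) q"
    and cm_unname: "cm R (img_complex P q) P (descend P q (\<lambda>i x. x))"
    and unname: "x \<in> carrier (cmod P i) \<Longrightarrow> descend P q (\<lambda>i x. x) i (q i x) = x"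
    and coh_bij_rename: "coh_bij P (img_complex P q) q"
    and coh_bij_unname: "coh_bij (img_complex P q) P (descend P q (\<lambda>i x. x))"
proof -
  note c = complex_cong_inj[where q = q, OF P q]
  show 1: "cm R P (img_complex P q) q" by (rule cm_img_complex[OF c])
  show 2: "cm R (img_complex P q) P (descend P q (\<lambda>i x. x))"
    by (rule cm_descend[OF c cm_ident[OF P]]) (use q in \<open>auto dest: inj_onD\<close>)
  show 3: "x \<in> carrier (cmod P i) \<Longrightarrow> descend P q (\<lambda>i x. x) i (q i x) = x" for i x
    by (rule descend_eq) (use q in \<open>auto dest: inj_onD\<close>)
  show "coh_bij P (img_complex P q) q"
    by (rule coh_bij_iso[OF 1 2]) (auto simp: 3)
  show "coh_bij (img_complex P q) P (descend P q (\<lambda>i x. x))"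
    by (rule coh_bij_iso[OF 2 1]) (auto simp: 3)
qed

section \<open>Adjoining contractible complexes\<close>

text \<open>For a graded module \<open>G\<close>, an element \<open>(x, y, z)\<close> of degree \<open>i\<close> stands for \<open>x + y + d z\<close>, with \<open>y\<close> a
  generator from \<open>G (i + 1)\<close> placed in degree \<open>i\<close> and \<open>z\<close> one from \<open>G i\<close> placed in degree \<open>i - 1\<close>.\<close>

definition add_disks :: "('r, 'b) cochain \<Rightarrow> (int \<Rightarrow> ('r, 'c) module) \<Rightarrow> ('r, 'b \<times> 'c \<times> 'c) cochain" where
  "add_disks M G = mk_complex (\<lambda>i. dsum (cmod M i) (dsum (G (i + 1)) (G i)))
     (\<lambda>i (x, y, z). (diff M i x, \<zero>\<^bsub>G (i + 1 + 1)\<^esub>, y))"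

text \<open>The extension of \<open>l\<close> with values \<open>s\<close> on the generators. Its
  value on the third component is forced, as \<open>z\<close> stands for a boundary. Since a
  generator from \<open>G (i + 1)\<close> sits in degree \<open>i\<close>, the map
  \<open>s i\<close> goes from \<open>G (i + 1)\<close> to degree \<open>i\<close> of
  \<open>Z\<close>.\<close>

definition disk_out :: "('r, 'd) cochain \<Rightarrow> (int \<Rightarrow> 'b \<Rightarrow> 'd) \<Rightarrow> (int \<Rightarrow> 'c \<Rightarrow> 'd) \<Rightarrow> int \<Rightarrow> 'b \<times> 'c \<times> 'c \<Rightarrow> 'd" where
  "disk_out Z l s i = (\<lambda>(x, y, z). l i x \<oplus>\<^bsub>cmod Z i\<^esub> (s i y \<oplus>\<^bsub>cmod Z i\<^esub> diff Z (i - 1) (s (i - 1) z)))"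

lemma cmod_add_disks [simp]: "cmod (add_disks M G) i = dsum (cmod M i) (dsum (G (i + 1)) (G i))"
  by (simp add: add_disks_def)

lemma diff_add_disks:
  "\<lbrakk>x \<in> carrier (cmod M i); y \<in> carrier (G (i + 1)); z \<in> carrier (G i)\<rbrakk> \<Longrightarrow>
    diff (add_disks M G) i (x, y, z) = (diff M i x, \<zero>\<^bsub>G (i + 1 + 1)\<^esub>, y)"
  by (simp add: add_disks_def)

lemma complex_add_disks:
  assumes M: "cochain_complex R M" and G: "\<And>i. module R (G i)"
  shows "cochain_complex R (add_disks M G)"
  unfolding add_disks_def
proof (rule complex_mk_complex)
  fix i
  have G2: "module R (dsum (G (i + 1)) (G i))" for i using module_dsum[OF G G] .
  note l = lin_fst[OF complex_module[OF M] G2] lin_snd[OF complex_module[OF M] G2]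
  have "lin R (dsum (cmod M i) (dsum (G (i + 1)) (G i))) (dsum (cmod M (i + 1)) (dsum (G (i + 1 + 1)) (G (i + 1))))
     (\<lambda>x. (diff M i (fst x), \<zero>\<^bsub>G (i + 1 + 1)\<^esub>, fst (snd x)))"
    by (intro lin_pair lin_comp[OF l(1) complex_diff[OF M]] lin_comp[OF l(2) lin_fst[OF G G]]
       lin_const_zero[OF module_dsum[OF complex_module[OF M] G2] G])
  then show "lin R (dsum (cmod M i) (dsum (G (i + 1)) (G i))) (dsum (cmod M (i + 1)) (dsum (G (i + 1 + 1)) (G (i + 1))))
     (\<lambda>(x, y, z). (diff M i x, \<zero>\<^bsub>G (i + 1 + 1)\<^esub>, y))"
    by (simp add: case_prod_unfold)
qed (auto simp: complex_dd[OF M])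

lemma cm_disk_incl:
  assumes M: "cochain_complex R M" and G: "\<And>i. module R (G i)"
  shows "cm R M (add_disks M G) (\<lambda>i x. (x, \<zero>\<^bsub>G (i + 1)\<^esub>, \<zero>\<^bsub>G i\<^esub>))"
proof (rule cmI[OF M complex_add_disks[OF M G]])
  show "lin R (cmod M i) (cmod (add_disks M G) i) (\<lambda>x. (x, \<zero>\<^bsub>G (i + 1)\<^esub>, \<zero>\<^bsub>G i\<^esub>))" for i
    unfolding cmod_add_disks
    by (intro lin_pair lin_ident lin_const_zero complex_module[OF M] G)
  fix i x assume "x \<in> carrier (cmod M i)"
  then show "(diff M i x, \<zero>\<^bsub>G (i + 1 + 1)\<^esub>, \<zero>\<^bsub>G (i + 1)\<^esub>) = diff (add_disks M G) i (x, \<zero>\<^bsub>G (i + 1)\<^esub>, \<zero>\<^bsub>G i\<^esub>)"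
    by (simp add: diff_add_disks mod_zero[OF G])
qed

lemma cm_disk_out:
  assumes l: "cm R M Z l" and G: "\<And>i. module R (G i)" and s: "\<And>i. lin R (G (i + 1)) (cmod Z i) (s i)"
  shows "cm R (add_disks M G) Z (disk_out Z l s)"
proof (rule cmI)
  note M = cm_complex(1)[OF l] and Z = cm_complex(2)[OF l]
  show "cochain_complex R (add_disks M G)" "cochain_complex R Z" by (rule complex_add_disks[OF M G], rule Z)
  fix i
  have G2: "module R (dsum (G (i + 1)) (G i))" using module_dsum[OF G G] .
  note p = lin_fst[OF complex_module[OF M] G2] lin_snd[OF complex_module[OF M] G2]
  have s': "lin R (G i) (cmod Z (i - 1)) (s (i - 1))" using s[of "i - 1"] by simp
  show "lin R (cmod (add_disks M G) i) (cmod Z i) (disk_out Z l s i)"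
    unfolding disk_out_def case_prod_unfold cmod_add_disks
    by (intro lin_plus lin_comp[OF p(1) cm_lin[OF l]] lin_comp[OF lin_comp[OF p(2) lin_fst[OF G G]] s]
      lin_comp[OF lin_comp[OF lin_comp[OF p(2) lin_snd[OF G G]] s'] complex_diff'[OF Z]])
  fix a assume "a \<in> carrier (cmod (add_disks M G) i)"
  then obtain x y z where a: "a = (x, y, z)" "x \<in> carrier (cmod M i)" "y \<in> carrier (G (i + 1))" "z \<in> carrier (G i)" by auto
  interpret Zj: module R "cmod Z (i + 1)" by (rule complex_module[OF Z])
  note c = cm_closed[OF l a(2)] lin_closed[OF s a(3)] lin_closed[OF s' a(4)]
  note c' = lin_closed[OF complex_diff[OF Z] c(1)] lin_closed[OF complex_diff[OF Z] c(2)] lin_closed[OF complex_diff'[OF Z] c(3)]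
  have "disk_out Z l s (i + 1) (diff (add_disks M G) i a) = l (i + 1) (diff M i x) \<oplus>\<^bsub>cmod Z (i + 1)\<^esub> diff Z i (s i y)"
    using a c' lin_zero[OF s[of "i + 1"]] by (simp add: diff_add_disks disk_out_def cm_diff[OF l])
  also have "\<dots> = diff Z i (disk_out Z l s i a)"
    using c c' by (simp add: a disk_out_def lin_add[OF complex_diff[OF Z]] mod_add[OF complex_module[OF Z]] complex_dd'[OF Z] cm_diff[OF l a(2)])
  finally show "disk_out Z l s (i + 1) (diff (add_disks M G) i a) = diff Z i (disk_out Z l s i a)" .
qed

lemma disk_out_incl:
  assumes l: "cm R M Z l" and G: "\<And>i. module R (G i)" and s: "\<And>i. lin R (G (i + 1)) (cmod Z i) (s i)"
    and x: "x \<in> carrier (cmod M i)"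
  shows "disk_out Z l s i (x, \<zero>\<^bsub>G (i + 1)\<^esub>, \<zero>\<^bsub>G i\<^esub>) = l i x"
proof -
  interpret Zi: module R "cmod Z i" by (rule complex_module[OF cm_complex(2)[OF l]])
  have s': "lin R (G i) (cmod Z (i - 1)) (s (i - 1))" using s[of "i - 1"] by simp
  show ?thesis
    using cm_closed[OF l x] by (simp add: disk_out_def lin_zero[OF s] lin_zero[OF s'] lin_zero[OF complex_diff'[OF cm_complex(2)[OF l]]])
qed

text \<open>Every element is a sum of one from \<open>M\<close>, a generator, and the boundary of a
  generator; agreement on the first two kinds propagates to the third because both maps commute with
  the differentials.\<close>

lemma add_disks_eqI:
  assumes f: "cm R (add_disks M G) Z f" and g: "cm R (add_disks M G) Z g" and M: "cochain_complex R M"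
    and G: "\<And>i. module R (G i)"
    and 1: "\<And>i x. x \<in> carrier (cmod M i) \<Longrightarrow> f i (x, \<zero>\<^bsub>G (i + 1)\<^esub>, \<zero>\<^bsub>G i\<^esub>) = g i (x, \<zero>\<^bsub>G (i + 1)\<^esub>, \<zero>\<^bsub>G i\<^esub>)"
    and 2: "\<And>i y. y \<in> carrier (G (i + 1)) \<Longrightarrow> f i (\<zero>\<^bsub>cmod M i\<^esub>, y, \<zero>\<^bsub>G i\<^esub>) = g i (\<zero>\<^bsub>cmod M i\<^esub>, y, \<zero>\<^bsub>G i\<^esub>)"
    and z: "z \<in> carrier (cmod (add_disks M G) i)"
  shows "f i z = g i z"
proof -
  let ?A = "add_disks M G"
  interpret Mi: module R "cmod M i" by (rule complex_module[OF M])
  interpret Gi: module R "G i" by (rule G)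
  interpret Gj: module R "G (i + 1)" by (rule G)
  note zM = mod_zero[OF complex_module[OF M]] and zG = mod_zero[OF G]
  obtain x a b where xab: "z = (x, a, b)" "x \<in> carrier (cmod M i)" "a \<in> carrier (G (i + 1))" "b \<in> carrier (G i)"
    using z by auto
  let ?x = "(x, \<zero>\<^bsub>G (i + 1)\<^esub>, \<zero>\<^bsub>G i\<^esub>)" and ?a = "(\<zero>\<^bsub>cmod M i\<^esub>, a, \<zero>\<^bsub>G i\<^esub>)"
  let ?b' = "(\<zero>\<^bsub>cmod M (i - 1)\<^esub>, b, \<zero>\<^bsub>G (i - 1)\<^esub>)"
  have b': "?b' \<in> carrier (cmod ?A (i - 1))" using xab zM zG by simp
  have db: "diff ?A (i - 1) ?b' = (\<zero>\<^bsub>cmod M i\<^esub>, \<zero>\<^bsub>G (i + 1)\<^esub>, b)"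
    using xab zM zG diff_add_disks[of "\<zero>\<^bsub>cmod M (i - 1)\<^esub>" M "i - 1" b G "\<zero>\<^bsub>G (i - 1)\<^esub>"] by (simp add: lin_zero[OF complex_diff'[OF M]])
  have e: "z = ?x \<oplus>\<^bsub>cmod ?A i\<^esub> (?a \<oplus>\<^bsub>cmod ?A i\<^esub> diff ?A (i - 1) ?b')"
    unfolding db using xab by simp
  have c: "?x \<in> carrier (cmod ?A i)" "?a \<in> carrier (cmod ?A i)" "diff ?A (i - 1) ?b' \<in> carrier (cmod ?A i)"
    unfolding db using xab by simp_all
  have c': "?a \<oplus>\<^bsub>cmod ?A i\<^esub> diff ?A (i - 1) ?b' \<in> carrier (cmod ?A i)"
    unfolding db using xab by simp
  have "f (i - 1) ?b' = g (i - 1) ?b'" using 2[of b "i - 1"] xab by simp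
  then have b: "f i (diff ?A (i - 1) ?b') = g i (diff ?A (i - 1) ?b')"
    by (simp only: cm_diff'[OF f b'] cm_diff'[OF g b'])
  show ?thesis
    unfolding e lin_add[OF cm_lin[OF f] c(1) c'] lin_add[OF cm_lin[OF g] c(1) c'] lin_add[OF cm_lin[OF f] c(2,3)]
      lin_add[OF cm_lin[OF g] c(2,3)] b 1[OF xab(2)] 2[OF xab(3)] ..
qed

lemma disk_out_gen:
  assumes l: "cm R M Z l" and G: "\<And>i. module R (G i)" and s: "\<And>i. lin R (G (i + 1)) (cmod Z i) (s i)"
    and y: "y \<in> carrier (G (i + 1))"
  shows "disk_out Z l s i (\<zero>\<^bsub>cmod M i\<^esub>, y, \<zero>\<^bsub>G i\<^esub>) = s i y"
proof -
  interpret Zi: module R "cmod Z i" by (rule complex_module[OF cm_complex(2)[OF l]])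
  have s': "lin R (G i) (cmod Z (i - 1)) (s (i - 1))" using s[of "i - 1"] by simp
  show ?thesis
    using lin_closed[OF s y] by (simp add: disk_out_def lin_zero[OF s'] lin_zero[OF cm_lin[OF l]] lin_zero[OF complex_diff'[OF cm_complex(2)[OF l]]])
qed

lemma cm_disk_map:
  assumes u: "cm R M M' u" and \<gamma>: "\<And>i. lin R (G i) (G' i) (\<gamma> i)"
  shows "cm R (add_disks M G) (add_disks M' G') (\<lambda>i (x, y, z). (u i x, \<gamma> (i + 1) y, \<gamma> i z))"
proof (rule cmI)
  note M = cm_complex(1)[OF u] and M' = cm_complex(2)[OF u] and G = lin_modules(1)[OF \<gamma>] and G' = lin_modules(2)[OF \<gamma>]
  show "cochain_complex R (add_disks M G)" "cochain_complex R (add_disks M' G')"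
    by (rule complex_add_disks[OF M G], rule complex_add_disks[OF M' G'])
  fix i
  have G2: "module R (dsum (G (i + 1)) (G i))" using module_dsum[OF G G] .
  note p = lin_fst[OF complex_module[OF M] G2] lin_snd[OF complex_module[OF M] G2]
  show "lin R (cmod (add_disks M G) i) (cmod (add_disks M' G') i) (\<lambda>(x, y, z). (u i x, \<gamma> (i + 1) y, \<gamma> i z))"
    unfolding case_prod_unfold cmod_add_disks
    by (intro lin_pair lin_comp[OF p(1) cm_lin[OF u]] lin_comp[OF lin_comp[OF p(2) lin_fst[OF G G]] \<gamma>]
       lin_comp[OF lin_comp[OF p(2) lin_snd[OF G G]] \<gamma>])
  fix a assume "a \<in> carrier (cmod (add_disks M G) i)"
  then obtain x y z where a: "a = (x, y, z)" "x \<in> carrier (cmod M i)" "y \<in> carrier (G (i + 1))" "z \<in> carrier (G i)" by auto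
  show "(case diff (add_disks M G) i a of (x, y, z) \<Rightarrow> (u (i + 1) x, \<gamma> (i + 1 + 1) y, \<gamma> (i + 1) z)) =
     diff (add_disks M' G') i (case a of (x, y, z) \<Rightarrow> (u i x, \<gamma> (i + 1) y, \<gamma> i z))"
    using a by (simp add: diff_add_disks cm_diff[OF u] cm_closed[OF u] lin_closed[OF \<gamma>] lin_zero[OF \<gamma>])
qed

text \<open>A cocycle \<open>(x, y, z)\<close> has \<open>y = 0\<close>, and
  \<open>(0, 0, -z)\<close> is the boundary of \<open>(0, -z, 0)\<close>; so it is cohomologous to
  \<open>(x, 0, 0)\<close>. Conversely, the first component of a boundary is a boundary in
  \<open>M\<close>.\<close>

lemma coh_bij_disk_incl:
  assumes M: "cochain_complex R M" and G: "\<And>i. module R (G i)"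
  shows "coh_bij M (add_disks M G) (\<lambda>i x. (x, \<zero>\<^bsub>G (i + 1)\<^esub>, \<zero>\<^bsub>G i\<^esub>))"
  unfolding coh_bij_def
proof (intro allI conjI ballI impI)
  let ?A = "add_disks M G"
  have G2: "module R (dsum (G (i + 1)) (G i))" for i using module_dsum[OF G G] .
  have di: "diff ?A (i - 1) (a, b, c) = (diff M (i - 1) a, \<zero>\<^bsub>G (i + 1)\<^esub>, b)"
    if "a \<in> carrier (cmod M (i - 1))" "b \<in> carrier (G i)" "c \<in> carrier (G (i - 1))" for i a b c
    using diff_add_disks[of a M "i - 1" b G c] that by simp
  have mi: "(x, y, z) \<ominus>\<^bsub>cmod ?A i\<^esub> (x', y', z') = (x \<ominus>\<^bsub>cmod M i\<^esub> x', y \<ominus>\<^bsub>G (i + 1)\<^esub> y', z \<ominus>\<^bsub>G i\<^esub> z')"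
    if "x \<in> carrier (cmod M i)" "y \<in> carrier (G (i + 1))" "z \<in> carrier (G i)"
      "x' \<in> carrier (cmod M i)" "y' \<in> carrier (G (i + 1))" "z' \<in> carrier (G i)" for i x y z x' y' z'
    using that by (simp add: dsum_minus[OF complex_module[OF M] G2] dsum_minus[OF G G])
  {
    fix i z z' assume z: "z \<in> cocycles M i" "z' \<in> cocycles M i"
      and "cohomologous ?A i (z, \<zero>\<^bsub>G (i + 1)\<^esub>, \<zero>\<^bsub>G i\<^esub>) (z', \<zero>\<^bsub>G (i + 1)\<^esub>, \<zero>\<^bsub>G i\<^esub>)"
    then obtain a b c where abc: "a \<in> carrier (cmod M (i - 1))" "b \<in> carrier (G i)" "c \<in> carrier (G (i - 1))"
      and "(z, \<zero>\<^bsub>G (i + 1)\<^esub>, \<zero>\<^bsub>G i\<^esub>) \<ominus>\<^bsub>cmod ?A i\<^esub> (z', \<zero>\<^bsub>G (i + 1)\<^esub>, \<zero>\<^bsub>G i\<^esub>) = diff ?A (i - 1) (a, b, c)"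
      unfolding cohomologous_def coboundary_iff by auto
    then have "z \<ominus>\<^bsub>cmod M i\<^esub> z' = diff M (i - 1) a"
      using mi[of z i "\<zero>\<^bsub>G (i + 1)\<^esub>" "\<zero>\<^bsub>G i\<^esub>" z' "\<zero>\<^bsub>G (i + 1)\<^esub>" "\<zero>\<^bsub>G i\<^esub>"] di[OF abc] z
      by (simp add: cocycle_closed mod_zero[OF G])
    then show "cohomologous M i z z'" using abc unfolding cohomologous_def coboundary_iff by blast
  next
    fix i w assume w: "w \<in> cocycles ?A i"
    then obtain x y z where xyz: "w = (x, y, z)" "x \<in> carrier (cmod M i)" "y \<in> carrier (G (i + 1))" "z \<in> carrier (G i)"
      by (auto simp: cocycle_iff)
    then have d: "diff M i x = \<zero>\<^bsub>cmod M (i + 1)\<^esub>" "y = \<zero>\<^bsub>G (i + 1)\<^esub>"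
      using w by (auto simp: cocycle_iff diff_add_disks)
    interpret Mi: module R "cmod M i" by (rule complex_module[OF M])
    interpret Mk: module R "cmod M (i - 1)" by (rule complex_module[OF M])
    interpret Gi: module R "G i" by (rule G)
    interpret Gj: module R "G (i + 1)" by (rule G)
    interpret Gk: module R "G (i - 1)" by (rule G)
    have "(x, \<zero>\<^bsub>G (i + 1)\<^esub>, \<zero>\<^bsub>G i\<^esub>) \<ominus>\<^bsub>cmod ?A i\<^esub> w =
      (x \<ominus>\<^bsub>cmod M i\<^esub> x, \<zero>\<^bsub>G (i + 1)\<^esub> \<ominus>\<^bsub>G (i + 1)\<^esub> \<zero>\<^bsub>G (i + 1)\<^esub>, \<zero>\<^bsub>G i\<^esub> \<ominus>\<^bsub>G i\<^esub> z)"
      unfolding xyz(1) d(2) by (rule mi) (use xyz in auto)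
    also have "\<dots> = (\<zero>\<^bsub>cmod M i\<^esub>, \<zero>\<^bsub>G (i + 1)\<^esub>, \<ominus>\<^bsub>G i\<^esub> z)"
      using xyz by (simp add: a_minus_def Mi.r_neg)
    also have "\<dots> = diff ?A (i - 1) (\<zero>\<^bsub>cmod M (i - 1)\<^esub>, \<ominus>\<^bsub>G i\<^esub> z, \<zero>\<^bsub>G (i - 1)\<^esub>)"
      using xyz by (simp add: di lin_zero[OF complex_diff'[OF M]])
    finally have "cohomologous ?A i (x, \<zero>\<^bsub>G (i + 1)\<^esub>, \<zero>\<^bsub>G i\<^esub>) w"
      unfolding cohomologous_def coboundary_iff
      by (rule bexI) (use xyz in auto)
    then show "\<exists>z \<in> cocycles M i. cohomologous ?A i (z, \<zero>\<^bsub>G (i + 1)\<^esub>, \<zero>\<^bsub>G i\<^esub>) w"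
      using xyz d by (intro bexI[of _ x]) (auto simp: cocycle_iff)
  }
qed

section \<open>Maps out of a direct sum with a free module\<close>

definition ext_map :: "('r, 'x) ring_scheme \<Rightarrow> ('r, 'd) module \<Rightarrow> ('b \<Rightarrow> 'd) \<Rightarrow> ('a \<Rightarrow> 'd) \<Rightarrow> 'b \<times> ('a \<Rightarrow> 'r) \<Rightarrow> 'd" where
  "ext_map R B f g z = f (fst z) \<oplus>\<^bsub>B\<^esub> lincomb R B g (snd z)"

lemma module_free_over: assumes "module R A" shows "module R (free R S)"
proof -
  interpret module R A by fact
  show ?thesis by (rule R.module_free)
qed

lemma module_sum_free: "module R A \<Longrightarrow> module R (dsum A (free R S))"
  by (rule module_dsum[OF _ module_free_over])

lemma lin_ext_map:
  assumes f: "lin R A B f" and g: "\<And>x. x \<in> S \<Longrightarrow> g x \<in> carrier B"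
  shows "lin R (dsum A (free R S)) B (ext_map R B f g)"
proof -
  have F: "module R (free R S)" by (rule module_free_over[OF lin_modules(1)[OF f]])
  show ?thesis
    unfolding ext_map_def
    by (intro lin_plus lin_comp[OF lin_fst f] lin_comp[OF lin_snd lin_lincomb] lin_modules[OF f] F g)
qed

lemma ext_map_incl:
  assumes f: "lin R A B f" and a: "a \<in> carrier A"
  shows "ext_map R B f g (a, \<zero>\<^bsub>free R S\<^esub>) = f a"
proof -
  interpret B: module R B using lin_modules[OF f] by simp
  have "supp R \<zero>\<^bsub>free R S\<^esub> = {}" by (simp add: supp_def free_simps)
  then show ?thesis using lin_closed[OF f a] by (simp add: ext_map_def lincomb_def)
qed

lemma ext_map_single:
  assumes f: "lin R A B f" and g: "g x \<in> carrier B"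
  shows "ext_map R B f g (\<zero>\<^bsub>A\<^esub>, single R x) = g x"
proof -
  interpret B: module R B using lin_modules[OF f] by simp
  show ?thesis using g by (simp add: ext_map_def lin_zero[OF f] lincomb_single[where g = g and x = x, OF B.module_axioms g])
qed

text \<open>Only the values of \<open>g\<close> on the support of \<open>z\<close> count. In
  recursions over cells this is how masked values are replaced by the true ones.\<close>

lemma ext_map_cong:
  assumes B: "module R B" and z: "snd z \<in> carrier (free R S)" and g: "\<And>x. x \<in> supp R (snd z) \<Longrightarrow> g x = g' x"
    and g': "\<And>x. x \<in> S \<Longrightarrow> g' x \<in> carrier B"
  shows "ext_map R B f g z = ext_map R B f g' z"
  unfolding ext_map_def using lincomb_cong[OF B z g g'] by simp

lemma sum_free_eqI:
  assumes f: "lin R (dsum A (free R S)) B f" and g: "lin R (dsum A (free R S)) B g" and A: "module R A"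
    and 1: "\<And>a. a \<in> carrier A \<Longrightarrow> f (a, \<zero>\<^bsub>free R S\<^esub>) = g (a, \<zero>\<^bsub>free R S\<^esub>)"
    and 2: "\<And>x. x \<in> S \<Longrightarrow> f (\<zero>\<^bsub>A\<^esub>, single R x) = g (\<zero>\<^bsub>A\<^esub>, single R x)"
    and z: "z \<in> carrier (dsum A (free R S))"
  shows "f z = g z"
proof -
  interpret A: module R A by fact
  interpret F: module R "free R S" by (rule A.module_free)
  obtain a \<phi> where z': "z = (a, \<phi>)" "a \<in> carrier A" "\<phi> \<in> carrier (free R S)" using z by auto
  have i: "lin R (free R S) (dsum A (free R S)) (\<lambda>\<phi>. (\<zero>\<^bsub>A\<^esub>, \<phi>))"
    by (intro lin_pair lin_const_zero lin_ident F.module_axioms A.module_axioms)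
  have "f (\<zero>\<^bsub>A\<^esub>, \<phi>) = g (\<zero>\<^bsub>A\<^esub>, \<phi>)"
    by (rule free_eqI[OF lin_comp[OF i f] lin_comp[OF i g] 2 z'(3)])
  moreover have "z = (a, \<zero>\<^bsub>free R S\<^esub>) \<oplus>\<^bsub>dsum A (free R S)\<^esub> (\<zero>\<^bsub>A\<^esub>, \<phi>)" using z' by simp
  moreover have "(a, \<zero>\<^bsub>free R S\<^esub>) \<in> carrier (dsum A (free R S))" "(\<zero>\<^bsub>A\<^esub>, \<phi>) \<in> carrier (dsum A (free R S))"
    using z' by auto
  ultimately show ?thesis using lin_add[OF f] lin_add[OF g] 1[OF z'(2)] by metis
qed

text \<open>That \<open>A'\<close> is a submodule of \<open>A\<close> is expressed by linearity of
  the identity function from \<open>A'\<close> to \<open>A\<close>, so that inclusions compose like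
  any other map.\<close>

lemma lin_sub:
  assumes f: "lin R A B f" and A: "lin R A' A (\<lambda>x. x)" and B: "lin R B' B (\<lambda>x. x)"
    and c: "\<And>x. x \<in> carrier A' \<Longrightarrow> f x \<in> carrier B'"
  shows "lin R A' B' f"
proof (rule linI)
  show "module R A'" "module R B'" using lin_modules[OF A] lin_modules[OF B] by auto
  fix x assume x: "x \<in> carrier A'"
  show "f x \<in> carrier B'" by (rule c[OF x])
  note xA = lin_closed[OF A x]
  fix y assume y: "y \<in> carrier A'"
  note yA = lin_closed[OF A y]
  show "f (x \<oplus>\<^bsub>A'\<^esub> y) = f x \<oplus>\<^bsub>B'\<^esub> f y"
    using lin_add[OF A x y] lin_add[OF f xA yA] lin_add[OF B c[OF x] c[OF y]] by simp
next
  fix r x assume r: "r \<in> carrier R" and x: "x \<in> carrier A'"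
  show "f (r \<odot>\<^bsub>A'\<^esub> x) = r \<odot>\<^bsub>B'\<^esub> f x"
    using lin_smult[OF A r x] lin_smult[OF f r lin_closed[OF A x]] lin_smult[OF B r c[OF x]] by simp
qed

lemma lin_free_mono:
  assumes A: "module R A" and "S \<subseteq> T"
  shows "lin R (dsum A (free R S)) (dsum A (free R T)) (\<lambda>x. x)"
  by (rule linI) (use free_mono[OF assms(2), of R] module_sum_free[OF A] in \<open>auto simp: free_simps(2-)\<close>)

text \<open>The image of a map on generators lies in a submodule as soon as the images of the generators do.\<close>

lemma sum_free_closed:
  assumes f: "lin R (dsum A (free R S)) B f" and A: "module R A" and B': "lin R B' B (\<lambda>x. x)"
    and 1: "\<And>a. a \<in> carrier A \<Longrightarrow> f (a, \<zero>\<^bsub>free R S\<^esub>) \<in> carrier B'"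
    and 2: "\<And>x. x \<in> S \<Longrightarrow> f (\<zero>\<^bsub>A\<^esub>, single R x) \<in> carrier B'"
    and z: "z \<in> carrier (dsum A (free R S))"
  shows "f z \<in> carrier B'"
proof -
  interpret A: module R A by fact
  interpret F: module R "free R S" by (rule A.module_free)
  have i: "lin R A (dsum A (free R S)) (\<lambda>a. (a, \<zero>\<^bsub>free R S\<^esub>))"
    by (intro lin_pair lin_const_zero lin_ident F.module_axioms A.module_axioms)
  have fA: "lin R A B' (\<lambda>a. f (a, \<zero>\<^bsub>free R S\<^esub>))"
    by (rule lin_sub[OF lin_comp[OF i f] lin_ident[OF A] B' 1])
  \<comment> \<open>The map is rebuilt with values in \<open>B'\<close> from its values on
    generators; uniqueness of maps into \<open>B\<close> then identifies the two.\<close>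
  have e: "lin R (dsum A (free R S)) B' (ext_map R B' (\<lambda>a. f (a, \<zero>\<^bsub>free R S\<^esub>)) (\<lambda>x. f (\<zero>\<^bsub>A\<^esub>, single R x)))"
    by (rule lin_ext_map[OF fA 2])
  have "f z = ext_map R B' (\<lambda>a. f (a, \<zero>\<^bsub>free R S\<^esub>)) (\<lambda>x. f (\<zero>\<^bsub>A\<^esub>, single R x)) z"
    by (rule sum_free_eqI[OF f lin_comp[OF e B'] A _ _ z])
      (simp_all add: ext_map_incl[OF fA] ext_map_single[OF fA, where g = "\<lambda>x. f (\<zero>\<^bsub>A\<^esub>, single R x)"] 2)
  then show ?thesis using lin_closed[OF e z] by simp
qed


section \<open>Cell complexes\<close>

text \<open>Elements of direct sums and formal linear combinations have to be named by elements of the universe \<open>'a\<close>.\<close>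

locale universe = cring R for R :: "('r, 'x) ring_scheme" (structure) +
  fixes pr :: "'a \<times> 'a \<Rightarrow> 'a" and fr :: "('a \<Rightarrow> 'r) \<Rightarrow> 'a"
  assumes inj_pr: "inj pr" and inj_fr: "inj_on fr (carrier (free R UNIV))"
begin

definition enc :: "'a \<times> ('a \<Rightarrow> 'r) \<Rightarrow> 'a" where
  "enc z = pr (fst z, fr (snd z))"

lemma inj_enc: "inj_on enc {z. snd z \<in> carrier (free R UNIV)}"
proof (rule inj_onI)
  fix y z assume "y \<in> {z. snd z \<in> carrier (free R UNIV)}" "z \<in> {z. snd z \<in> carrier (free R UNIV)}" "enc y = enc z"
  then have "fst y = fst z" "fr (snd y) = fr (snd z)" "snd y \<in> carrier (free R UNIV)" "snd z \<in> carrier (free R UNIV)"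
    using injD[OF inj_pr] unfolding enc_def by auto
  then show "y = z" using inj_onD[OF inj_fr] by (simp add: prod_eq_iff)
qed

text \<open>A cell with boundary \<open>z\<close> and value \<open>y\<close>.\<close>

definition cell_name :: "'a \<times> ('a \<Rightarrow> 'r) \<Rightarrow> 'a \<Rightarrow> 'a" where
  "cell_name z y = pr (enc z, y)"

definition bd :: "'a \<Rightarrow> 'a \<times> ('a \<Rightarrow> 'r)" where
  "bd x = inv_into {z. snd z \<in> carrier (free R UNIV)} enc (fst (inv_into UNIV pr x))"

definition val :: "'a \<Rightarrow> 'a" where
  "val x = snd (inv_into UNIV pr x)"

lemma bd_cell_name: "snd z \<in> carrier (free R UNIV) \<Longrightarrow> bd (cell_name z y) = z"
  by (simp add: bd_def cell_name_def inv_into_f_f[OF inj_pr] inv_into_f_f[OF inj_enc])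

lemma val_cell_name: "val (cell_name z y) = y"
  by (simp add: val_def cell_name_def inv_into_f_f[OF inj_pr])

text \<open>Formal expressions in which every element of the universe may occur as a cell.
  Boundaries have to be written down before it is known which names are cells, so the structure maps
  are defined on all of \<open>pre\<close>.\<close>

definition pre :: "('r, 'a) cochain \<Rightarrow> int \<Rightarrow> ('r, 'a \<times> ('a \<Rightarrow> 'r)) module" where
  "pre M i = dsum (cmod M i) (free R UNIV)"

text \<open>Names that are not cells decode to arbitrary data; the default value zero keeps
  \<open>cell_diff\<close> and \<open>cell_proj\<close> linear on all of \<open>pre\<close>.\<close>

definition guard :: "('r, 'b) module \<Rightarrow> 'b \<Rightarrow> 'b" where
  "guard B y = (if y \<in> carrier B then y else \<zero>\<^bsub>B\<^esub>)"

definition cell_diff :: "('r, 'a) cochain \<Rightarrow> int \<Rightarrow> 'a \<times> ('a \<Rightarrow> 'r) \<Rightarrow> 'a \<times> ('a \<Rightarrow> 'r)" where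
  "cell_diff M i = ext_map R (pre M (i + 1)) (\<lambda>m. (diff M i m, \<zero>\<^bsub>free R UNIV\<^esub>)) (\<lambda>x. guard (pre M (i + 1)) (bd x))"

definition cell_proj :: "('r, 'a) cochain \<Rightarrow> 'a graded_map \<Rightarrow> int \<Rightarrow> 'a \<times> ('a \<Rightarrow> 'r) \<Rightarrow> 'a" where
  "cell_proj N f i = ext_map R (cmod N i) (f i) (\<lambda>x. guard (cmod N i) (val x))"

text \<open>The boundary of a cell of degree \<open>i\<close> has degree \<open>i + 1\<close>, so
  generation does not proceed along the degree. The predicate occurs only positively, for the names
  in the support of the boundary, since \<open>cell_diff\<close> and \<open>cell_proj\<close> were
  defined without reference to it.\<close>

inductive cell :: "('r, 'a) cochain \<Rightarrow> ('r, 'a) cochain \<Rightarrow> 'a graded_map \<Rightarrow> int \<Rightarrow> 'a \<Rightarrow> bool" for M N f where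
  "\<lbrakk>z \<in> carrier (pre M (i + 1)); \<forall>x \<in> supp R (snd z). cell M N f (i + 1) x;
    cell_diff M (i + 1) z = \<zero>\<^bsub>pre M (i + 1 + 1)\<^esub>; y \<in> carrier (cmod N i); cell_proj N f (i + 1) z = diff N i y\<rbrakk>
    \<Longrightarrow> cell M N f i (cell_name z y)"

section \<open>Induction and recursion over cells\<close>

lemma cell_cases:
  assumes "cell M N f i x"
  shows "bd x \<in> carrier (pre M (i + 1))" "\<And>x'. x' \<in> supp R (snd (bd x)) \<Longrightarrow> cell M N f (i + 1) x'"
    "cell_diff M (i + 1) (bd x) = \<zero>\<^bsub>pre M (i + 1 + 1)\<^esub>" "val x \<in> carrier (cmod N i)"
    "cell_proj N f (i + 1) (bd x) = diff N i (val x)" "x = cell_name (bd x) (val x)"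
  using assms by (induction rule: cell.cases) (auto simp: bd_cell_name val_cell_name pre_def)

text \<open>The induction rule in terms of the decoded boundary: the hypothesis is available for the
  cells that occur there.\<close>

lemma cell_induct [consumes 1]:
  assumes "cell M N f i x"
    and "\<And>i x. \<lbrakk>cell M N f i x; \<And>x'. x' \<in> supp R (snd (bd x)) \<Longrightarrow> P (i + 1) x'\<rbrakk> \<Longrightarrow> P i x"
  shows "P i x"
  using assms(1)
proof (induction rule: cell.induct)
  case (1 z i y)
  have b: "bd (cell_name z y) = z" using 1(1) by (auto simp: bd_cell_name pre_def)
  show ?case
  proof (rule assms(2))
    show "cell M N f i (cell_name z y)"
      by (rule cell.intros[OF 1(1) _ 1(2-4)]) (use 1(5) in blast)
    show "P (i + 1) x'" if "x' \<in> supp R (snd (bd (cell_name z y)))" for x'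
      using 1(5) that unfolding b by blast
  qed
qed

definition mask :: "('a \<Rightarrow> 'b) \<Rightarrow> 'a \<Rightarrow> 'a \<Rightarrow> 'b" where
  "mask r x = (\<lambda>x'. if x' \<in> supp R (snd (bd x)) then r x' else undefined)"

text \<open>Recursion along occurrence in a boundary; \<open>cell_induct\<close> is the
  well-foundedness of this relation. The mask limits \<open>F\<close> to values at the names in the
  boundary, which are exactly the recursive calls that \<open>wfrec\<close> permits.\<close>

lemma cell_rec:
  fixes F :: "int \<Rightarrow> 'a \<Rightarrow> ('a \<Rightarrow> 'b) \<Rightarrow> 'b"
  shows "\<exists>r. \<forall>i x. cell M N f i x \<longrightarrow> r i x = F i x (mask (r (i + 1)) x)"
proof -
  define rel where "rel = {((j, x'), (i, x)). cell M N f i x \<and> j = i + 1 \<and> x' \<in> supp R (snd (bd x))}"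
  have "wf rel"
  proof (rule wfUNIVI)
    fix P and p :: "int \<times> 'a"
    assume prog: "\<forall>x. (\<forall>y. (y, x) \<in> rel \<longrightarrow> P y) \<longrightarrow> P x"
    have cellP: "P (i, x)" if "cell M N f i x" for i x
      using that
    proof (induction rule: cell_induct)
      case (1 i x)
      have "\<forall>y. (y, (i, x)) \<in> rel \<longrightarrow> P y" using 1 by (auto simp: rel_def)
      then show ?case using prog by blast
    qed
    obtain i x where p: "p = (i, x)" by (cases p)
    show "P p"
    proof (cases "cell M N f i x")
      case True then show ?thesis using cellP p by simp
    next
      case False
      \<comment> \<open>A name that is not a cell has no predecessors.\<close>
      then have "\<forall>y. (y, p) \<in> rel \<longrightarrow> P y" by (auto simp: rel_def p)
      then show ?thesis using prog by blast
    qed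
  qed
  define r where "r = wfrec rel (\<lambda>r (i, x). F i x (mask (\<lambda>x'. r (i + 1, x')) x))"
  have "r (i, x) = F i x (mask (\<lambda>x'. r (i + 1, x')) x)" if "cell M N f i x" for i x
  proof -
    have "r (i, x) = F i x (mask (\<lambda>x'. cut r rel (i, x) (i + 1, x')) x)"
      unfolding r_def by (subst wfrec[OF \<open>wf rel\<close>]) (simp add: r_def)
    \<comment> \<open>Every name that the mask lets through is a predecessor, so the cut changes
      nothing.\<close>
    also have "mask (\<lambda>x'. cut r rel (i, x) (i + 1, x')) x = mask (\<lambda>x'. r (i + 1, x')) x"
      unfolding mask_def using that by (auto simp: fun_eq_iff cut_def rel_def)
    finally show ?thesis .
  qed
  then show ?thesis by (intro exI[of _ "\<lambda>i x. r (i, x)"]) auto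
qed

section \<open>The structure maps on generators\<close>

lemma guard_closed: "module R B \<Longrightarrow> guard B y \<in> carrier B"
  by (simp add: guard_def mod_zero)

lemma guard_eq: "y \<in> carrier B \<Longrightarrow> guard B y = y"
  by (simp add: guard_def)

lemma module_freeR: "module R (free R S)"
  by (rule module_free)

lemma module_pre: "cochain_complex R M \<Longrightarrow> module R (pre M i)"
  unfolding pre_def by (rule module_sum_free[OF complex_module])

lemma lin_pre_incl: "lin R A (cmod M i) g \<Longrightarrow> lin R A (pre M i) (\<lambda>m. (g m, \<zero>\<^bsub>free R UNIV\<^esub>))"
  unfolding pre_def by (intro lin_pair lin_const_zero module_freeR lin_modules(1))

lemma lin_cell_diff: "cochain_complex R M \<Longrightarrow> lin R (pre M i) (pre M (i + 1)) (cell_diff M i)"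
  unfolding cell_diff_def pre_def[of M i]
  by (intro lin_ext_map lin_pre_incl complex_diff guard_closed module_pre)

lemma lin_cell_proj: "cm R M N f \<Longrightarrow> lin R (pre M i) (cmod N i) (cell_proj N f i)"
  unfolding cell_proj_def pre_def
  by (intro lin_ext_map cm_lin guard_closed) (auto intro: complex_module cm_complex)

lemma cell_diff_incl: "cochain_complex R M \<Longrightarrow> m \<in> carrier (cmod M i) \<Longrightarrow>
    cell_diff M i (m, \<zero>\<^bsub>free R S\<^esub>) = (diff M i m, \<zero>\<^bsub>free R UNIV\<^esub>)"
  unfolding cell_diff_def by (subst ext_map_incl[OF lin_pre_incl[OF complex_diff]]) auto

lemma cell_proj_incl: "cm R M N f \<Longrightarrow> m \<in> carrier (cmod M i) \<Longrightarrow> cell_proj N f i (m, \<zero>\<^bsub>free R S\<^esub>) = f i m"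
  unfolding cell_proj_def by (subst ext_map_incl[OF cm_lin]) auto

lemma cell_diff_single:
  assumes M: "cochain_complex R M" and x: "bd x \<in> carrier (pre M (i + 1))"
  shows "cell_diff M i (\<zero>\<^bsub>cmod M i\<^esub>, single R x) = bd x"
  unfolding cell_diff_def
  by (subst ext_map_single[OF lin_pre_incl[OF complex_diff[OF M]]]) (simp_all add: guard_closed[OF module_pre[OF M]] guard_eq x)

lemma cell_proj_single:
  assumes f: "cm R M N f" and x: "val x \<in> carrier (cmod N i)"
  shows "cell_proj N f i (\<zero>\<^bsub>cmod M i\<^esub>, single R x) = val x"
  unfolding cell_proj_def
  by (subst ext_map_single[OF cm_lin[OF f]]) (simp_all add: guard_closed complex_module[OF cm_complex(2)[OF f]] guard_eq x)

section \<open>The complex spanned by the cells\<close>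

definition cell_sum :: "('r, 'a) cochain \<Rightarrow> ('r, 'a) cochain \<Rightarrow> 'a graded_map \<Rightarrow> int \<Rightarrow> ('r, 'a \<times> ('a \<Rightarrow> 'r)) module" where
  "cell_sum M N f i = dsum (cmod M i) (free R {x. cell M N f i x})"

definition cell_complex :: "('r, 'a) cochain \<Rightarrow> ('r, 'a) cochain \<Rightarrow> 'a graded_map \<Rightarrow> ('r, 'a \<times> ('a \<Rightarrow> 'r)) cochain" where
  "cell_complex M N f = mk_complex (cell_sum M N f) (cell_diff M)"

lemma cmod_cell_complex [simp]: "cmod (cell_complex M N f) i = cell_sum M N f i"
  by (simp add: cell_complex_def)

lemma diff_cell_complex: "z \<in> carrier (cell_sum M N f i) \<Longrightarrow> diff (cell_complex M N f) i z = cell_diff M i z"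
  by (simp add: cell_complex_def)

lemma lin_cell_sum_pre: "cochain_complex R M \<Longrightarrow> lin R (cell_sum M N f i) (pre M i) (\<lambda>z. z)"
  unfolding cell_sum_def pre_def by (rule lin_free_mono[OF complex_module]) auto

lemma module_cell_sum: "cochain_complex R M \<Longrightarrow> module R (cell_sum M N f i)"
  using lin_modules(1)[OF lin_cell_sum_pre] .

lemma bd_in_cell_sum:
  assumes "cell M N f i x"
  shows "bd x \<in> carrier (cell_sum M N f (i + 1))"
proof -
  have "bd x \<in> carrier (pre M (i + 1))" by (rule cell_cases(1)[OF assms])
  then show ?thesis
    using cell_cases(2)[OF assms] unfolding cell_sum_def pre_def by (auto simp: free_simps(1))
qed

lemma incl_in_cell_sum: "m \<in> carrier (cmod M i) \<Longrightarrow> (m, \<zero>\<^bsub>free R S\<^esub>) \<in> carrier (cell_sum M N f i)"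
  using mod_zero[OF module_freeR, of "{x. cell M N f i x}"] by (simp add: cell_sum_def free_simps(2))

lemma single_in_cell_sum: "cochain_complex R M \<Longrightarrow> cell M N f i x \<Longrightarrow> (\<zero>\<^bsub>cmod M i\<^esub>, single R x) \<in> carrier (cell_sum M N f i)"
  using mod_zero[OF complex_module] by (simp add: cell_sum_def single_closed)

lemma cell_diff_closed:
  assumes M: "cochain_complex R M" and z: "z \<in> carrier (cell_sum M N f i)"
  shows "cell_diff M i z \<in> carrier (cell_sum M N f (i + 1))"
proof (rule sum_free_closed[where f = "cell_diff M i" and A = "cmod M i" and S = "{x. cell M N f i x}" and B = "pre M (i + 1)"])
  show "lin R (dsum (cmod M i) (free R {x. cell M N f i x})) (pre M (i + 1)) (cell_diff M i)"
    using lin_comp[OF lin_cell_sum_pre[OF M] lin_cell_diff[OF M]] unfolding cell_sum_def .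
  show "lin R (cell_sum M N f (i + 1)) (pre M (i + 1)) (\<lambda>x. x)" by (rule lin_cell_sum_pre[OF M])
  fix a assume "a \<in> carrier (cmod M i)"
  then show "cell_diff M i (a, \<zero>\<^bsub>free R {x. cell M N f i x}\<^esub>) \<in> carrier (cell_sum M N f (i + 1))"
    by (simp add: cell_diff_incl[OF M] incl_in_cell_sum lin_closed[OF complex_diff[OF M]])
next
  fix x assume "x \<in> {x. cell M N f i x}"
  then show "cell_diff M i (\<zero>\<^bsub>cmod M i\<^esub>, single R x) \<in> carrier (cell_sum M N f (i + 1))"
    by (simp add: cell_diff_single[OF M cell_cases(1)] bd_in_cell_sum)
qed (use z complex_module[OF M] in \<open>simp_all add: cell_sum_def\<close>)

lemma cell_sum_eqI:
  assumes f: "lin R (cell_sum M N h i) B f" and g: "lin R (cell_sum M N h i) B g" and M: "cochain_complex R M"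
    and 1: "\<And>a. a \<in> carrier (cmod M i) \<Longrightarrow> f (a, \<zero>\<^bsub>free R UNIV\<^esub>) = g (a, \<zero>\<^bsub>free R UNIV\<^esub>)"
    and 2: "\<And>x. cell M N h i x \<Longrightarrow> f (\<zero>\<^bsub>cmod M i\<^esub>, single R x) = g (\<zero>\<^bsub>cmod M i\<^esub>, single R x)"
    and z: "z \<in> carrier (cell_sum M N h i)"
  shows "f z = g z"
  by (rule sum_free_eqI[OF f[unfolded cell_sum_def] g[unfolded cell_sum_def] complex_module[OF M]])
    (use 1 2 z in \<open>simp_all add: cell_sum_def free_simps(2)\<close>)

text \<open>The corresponding principle on the span of the cells in a given boundary, needed inside inductions over cells.\<close>

lemma bd_eqI:
  assumes f: "lin R (pre M i) B f" and g: "lin R (pre M i) B g" and M: "cochain_complex R M"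
    and 1: "\<And>a. a \<in> carrier (cmod M i) \<Longrightarrow> f (a, \<zero>\<^bsub>free R UNIV\<^esub>) = g (a, \<zero>\<^bsub>free R UNIV\<^esub>)"
    and 2: "\<And>x. x \<in> supp R (snd z) \<Longrightarrow> f (\<zero>\<^bsub>cmod M i\<^esub>, single R x) = g (\<zero>\<^bsub>cmod M i\<^esub>, single R x)"
    and z: "z \<in> carrier (pre M i)"
  shows "f z = g z"
proof (rule sum_free_eqI)
  have l: "lin R (dsum (cmod M i) (free R (supp R (snd z)))) (pre M i) (\<lambda>x. x)"
    unfolding pre_def by (rule lin_free_mono[OF complex_module[OF M]]) auto
  show "lin R (dsum (cmod M i) (free R (supp R (snd z)))) B f" by (rule lin_comp[OF l f])
  show "lin R (dsum (cmod M i) (free R (supp R (snd z)))) B g" by (rule lin_comp[OF l g])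
qed (use z 1 2 complex_module[OF M] in \<open>auto simp: pre_def free_simps\<close>)

text \<open>On a cell, \<open>d d = 0\<close> is the condition in \<open>cell\<close> that the
  boundary be a cocycle; on \<open>M\<close> it is inherited. In the same way, compatibility of
  \<open>cell_proj\<close> with the differentials will be the last premise of
  \<open>cell\<close>.\<close>

lemma complex_cell_complex:
  assumes M: "cochain_complex R M"
  shows "cochain_complex R (cell_complex M N f)"
  unfolding cell_complex_def
proof (rule complex_mk_complex)
  have l: "lin R (cell_sum M N f i) (cell_sum M N f (i + 1)) (cell_diff M i)" for i
    by (rule lin_sub[OF lin_cell_diff[OF M] lin_cell_sum_pre[OF M] lin_cell_sum_pre[OF M] cell_diff_closed[OF M]])
  show "lin R (cell_sum M N f i) (cell_sum M N f (i + 1)) (cell_diff M i)" for i by (rule l)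
  fix i z assume z: "z \<in> carrier (cell_sum M N f i)"
  have 0: "\<zero>\<^bsub>pre M j\<^esub> = \<zero>\<^bsub>cell_sum M N f j\<^esub>" for j by (simp add: pre_def cell_sum_def free_simps)
  show "cell_diff M (i + 1) (cell_diff M i z) = \<zero>\<^bsub>cell_sum M N f (i + 1 + 1)\<^esub>"
  proof (rule cell_sum_eqI[OF lin_comp[OF l l] lin_const_zero M _ _ z])
    fix a assume a: "a \<in> carrier (cmod M i)"
    then show "cell_diff M (i + 1) (cell_diff M i (a, \<zero>\<^bsub>free R UNIV\<^esub>)) = \<zero>\<^bsub>cell_sum M N f (i + 1 + 1)\<^esub>"
      by (simp only: cell_diff_incl[OF M] lin_closed[OF complex_diff[OF M]] complex_dd[OF M])
        (simp add: cell_sum_def free_simps)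
  next
    fix x assume x: "cell M N f i x"
    show "cell_diff M (i + 1) (cell_diff M i (\<zero>\<^bsub>cmod M i\<^esub>, single R x)) = \<zero>\<^bsub>cell_sum M N f (i + 1 + 1)\<^esub>"
      using cell_cases(3)[OF x] by (simp only: cell_diff_single[OF M cell_cases(1)[OF x]] 0)
  qed (auto intro: module_cell_sum[OF M])
qed

lemma cm_cell_incl:
  assumes M: "cochain_complex R M"
  shows "cm R M (cell_complex M N f) (\<lambda>i m. (m, \<zero>\<^bsub>free R UNIV\<^esub>))"
proof (rule cmI[OF M complex_cell_complex[OF M]])
  fix i
  have z: "\<zero>\<^bsub>free R UNIV\<^esub> = \<zero>\<^bsub>free R S\<^esub>" for S by (simp add: free_simps)
  have "lin R (cmod M i) (cell_sum M N f i) (\<lambda>m. (m, \<zero>\<^bsub>free R {x. cell M N f i x}\<^esub>))"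
    unfolding cell_sum_def by (intro lin_pair lin_ident lin_const_zero complex_module[OF M] module_freeR)
  then show "lin R (cmod M i) (cmod (cell_complex M N f) i) (\<lambda>m. (m, \<zero>\<^bsub>free R UNIV\<^esub>))" by (simp add: free_simps(2))
  fix m assume "m \<in> carrier (cmod M i)"
  then show "(diff M i m, \<zero>\<^bsub>free R UNIV\<^esub>) = diff (cell_complex M N f) i (m, \<zero>\<^bsub>free R UNIV\<^esub>)"
    by (simp add: diff_cell_complex incl_in_cell_sum cell_diff_incl[OF M])
qed

lemma cm_cell_proj:
  assumes f: "cm R M N f"
  shows "cm R (cell_complex M N f) N (cell_proj N f)"
proof (rule cmI)
  note M = cm_complex(1)[OF f] and N = cm_complex(2)[OF f]
  show C: "cochain_complex R (cell_complex M N f)" "cochain_complex R N" by (rule complex_cell_complex[OF M], rule N)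
  have l: "lin R (cell_sum M N f i) (cmod N i) (cell_proj N f i)" for i
    by (rule lin_comp[OF lin_cell_sum_pre[OF M] lin_cell_proj[OF f]])
  then show "lin R (cmod (cell_complex M N f) i) (cmod N i) (cell_proj N f i)" for i by simp
  fix i z assume z: "z \<in> carrier (cmod (cell_complex M N f) i)"
  have d: "lin R (cell_sum M N f i) (cell_sum M N f (i + 1)) (cell_diff M i)"
    by (rule lin_sub[OF lin_cell_diff[OF M] lin_cell_sum_pre[OF M] lin_cell_sum_pre[OF M] cell_diff_closed[OF M]])
  have "cell_proj N f (i + 1) (cell_diff M i z) = diff N i (cell_proj N f i z)"
  proof (rule cell_sum_eqI[OF lin_comp[OF d l] lin_comp[OF l complex_diff[OF N]] M])
    fix a assume "a \<in> carrier (cmod M i)"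
    then show "cell_proj N f (i + 1) (cell_diff M i (a, \<zero>\<^bsub>free R UNIV\<^esub>)) = diff N i (cell_proj N f i (a, \<zero>\<^bsub>free R UNIV\<^esub>))"
      by (simp add: cell_diff_incl[OF M] cell_proj_incl[OF f] cm_diff[OF f] lin_closed[OF complex_diff[OF M]])
  next
    fix x assume x: "cell M N f i x"
    show "cell_proj N f (i + 1) (cell_diff M i (\<zero>\<^bsub>cmod M i\<^esub>, single R x)) = diff N i (cell_proj N f i (\<zero>\<^bsub>cmod M i\<^esub>, single R x))"
      by (simp only: cell_diff_single[OF M cell_cases(1)[OF x]] cell_proj_single[OF f cell_cases(4)[OF x]] cell_cases(5)[OF x])
  qed (use z in simp)
  then show "cell_proj N f (i + 1) (diff (cell_complex M N f) i z) = diff N i (cell_proj N f i z)"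
    using z by (simp add: diff_cell_complex)
qed

text \<open>Each lifting problem \<open>(z, y)\<close> of the criterion is itself the datum of a
  cell, and that cell solves it. As the set of cells is closed under its generating rule, there is
  no further stage of attaching cells.\<close>

lemma triv_fib_cell_proj:
  assumes f: "cm R M N f"
  shows "(\<forall>i. cell_proj N f i ` carrier (cmod (cell_complex M N f) i) = carrier (cmod N i)) \<and>
    coh_bij (cell_complex M N f) N (cell_proj N f)"
  unfolding triv_fib_iff[OF cm_cell_proj[OF f]]
proof (intro allI ballI impI)
  note M = cm_complex(1)[OF f]
  fix i z y assume z: "z \<in> cocycles (cell_complex M N f) (i + 1)" and y: "y \<in> carrier (cmod N i)"
    and e: "cell_proj N f (i + 1) z = diff N i y"
  have zs: "z \<in> carrier (cell_sum M N f (i + 1))" and dz: "cell_diff M (i + 1) z = \<zero>\<^bsub>cell_sum M N f (i + 1 + 1)\<^esub>"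
    using z by (auto simp: cocycle_iff diff_cell_complex)
  have zp: "z \<in> carrier (pre M (i + 1))" by (rule lin_closed[OF lin_cell_sum_pre[OF M] zs])
  let ?x = "cell_name z y"
  have x: "cell M N f i ?x"
    by (rule cell.intros) (use zs zp dz y e in \<open>auto simp: cell_sum_def pre_def free_simps\<close>)
  have b: "bd ?x = z" using zp by (auto simp: bd_cell_name pre_def)
  show "\<exists>w \<in> carrier (cmod (cell_complex M N f) i). diff (cell_complex M N f) i w = z \<and> cell_proj N f i w = y"
  proof (intro bexI conjI)
    show s: "(\<zero>\<^bsub>cmod M i\<^esub>, single R ?x) \<in> carrier (cmod (cell_complex M N f) i)"
      using single_in_cell_sum[OF M x] by simp
    show "diff (cell_complex M N f) i (\<zero>\<^bsub>cmod M i\<^esub>, single R ?x) = z"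
      using s cell_diff_single[OF M cell_cases(1)[OF x]] by (simp add: diff_cell_complex b)
    show "cell_proj N f i (\<zero>\<^bsub>cmod M i\<^esub>, single R ?x) = y"
      using cell_proj_single[OF f cell_cases(4)[OF x]] by (simp add: val_cell_name)
  qed
qed

text \<open>At a cell, the lift already given on the boundary is a cocycle with the right image, so
  \<open>triv_fib_iff\<close> provides a value. The selection \<open>F\<close> is made
  unconditionally, which separates the recursion from the proof by induction (\<open>good\<close>)
  that every selection succeeds.\<close>

lemma cell_lift:
  fixes Z :: "('r, 'b) cochain"
  assumes M: "cochain_complex R M" and g: "cm R M Z g" and t: "cm R (cell_complex M N f) Z' t" and p: "cm R Z Z' p"
    and triv: "(\<forall>i. p i ` carrier (cmod Z i) = carrier (cmod Z' i)) \<and> coh_bij Z Z' p"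
    and sq: "\<And>i m. m \<in> carrier (cmod M i) \<Longrightarrow> t i (m, \<zero>\<^bsub>free R UNIV\<^esub>) = p i (g i m)"
  shows "\<exists>l. cm R (cell_complex M N f) Z l \<and> (\<forall>i. \<forall>m \<in> carrier (cmod M i). l i (m, \<zero>\<^bsub>free R UNIV\<^esub>) = g i m) \<and>
    (\<forall>i. \<forall>z \<in> carrier (cmod (cell_complex M N f) i). p i (l i z) = t i z)"
proof -
  let ?Q = "cell_complex M N f"
  note Z = cm_complex(2)[OF g]
  define E where "E i r = ext_map R (cmod Z i) (g i) (\<lambda>x. guard (cmod Z i) (r x))"
    for i and r :: "'a \<Rightarrow> 'b"
  define F where "F i x r = (SOME e. e \<in> carrier (cmod Z i) \<and> diff Z i e = E (i + 1) r (bd x) \<and>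
     p i e = t i (\<zero>\<^bsub>cmod M i\<^esub>, single R x))" for i x r
  obtain r where r: "\<And>i x. cell M N f i x \<Longrightarrow> r i x = F i x (mask (r (i + 1)) x)"
    using cell_rec[of M N f F] by blast
  let ?l = "\<lambda>i. E i (r i)"
  have El: "lin R (pre M i) (cmod Z i) (E i s)" for i s
    unfolding E_def pre_def by (intro lin_ext_map cm_lin[OF g] guard_closed complex_module[OF Z])
  have Ei: "E i s (m, \<zero>\<^bsub>free R UNIV\<^esub>) = g i m" if "m \<in> carrier (cmod M i)" for i s m
    unfolding E_def by (rule ext_map_incl[OF cm_lin[OF g] that])
  have Es: "E i s (\<zero>\<^bsub>cmod M i\<^esub>, single R x) = s x" if "s x \<in> carrier (cmod Z i)" for i s x
    unfolding E_def by (subst ext_map_single[OF cm_lin[OF g]]) (simp_all add: guard_closed complex_module[OF Z] guard_eq that)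
  have Em: "E (i + 1) (mask s x) (bd x) = E (i + 1) s (bd x)" if "cell M N f i x" for i s x
    unfolding E_def
    by (rule ext_map_cong[where S = UNIV])
      (use cell_cases(1)[OF that] complex_module[OF Z] in \<open>auto simp: mask_def pre_def guard_closed\<close>)
  have r': "r i x = (SOME e. e \<in> carrier (cmod Z i) \<and> diff Z i e = E (i + 1) (r (i + 1)) (bd x) \<and>
     p i e = t i (\<zero>\<^bsub>cmod M i\<^esub>, single R x))" if "cell M N f i x" for i x
    unfolding r[OF that] F_def Em[OF that] ..
  have good: "r i x \<in> carrier (cmod Z i) \<and> diff Z i (r i x) = E (i + 1) (r (i + 1)) (bd x) \<and>
     p i (r i x) = t i (\<zero>\<^bsub>cmod M i\<^esub>, single R x)" if "cell M N f i x" for i x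
    using that
  proof (induction rule: cell_induct)
    case (1 i x)
    note x = 1(1) and IH = 1(2)
    let ?z = "bd x" and ?j = "i + 1"
    note zp = cell_cases(1)[OF x]
    have sub: "cell M N f ?j x'" if "x' \<in> supp R (snd ?z)" for x' by (rule cell_cases(2)[OF x that])
    \<comment> \<open>\<open>?l\<close> is not yet known to be a cochain map. The identity is wanted
      only on the span of \<open>M\<close> and the cells in \<open>?z\<close>, to which the
      induction hypothesis applies.\<close>
    have "diff Z ?j (?l ?j ?z) = ?l (?j + 1) (cell_diff M ?j ?z)"
    proof (rule bd_eqI[OF lin_comp[OF El complex_diff[OF Z]] lin_comp[OF lin_cell_diff[OF M] El] M _ _ zp])
      fix a assume a: "a \<in> carrier (cmod M ?j)"
      show "diff Z ?j (?l ?j (a, \<zero>\<^bsub>free R UNIV\<^esub>)) = ?l (?j + 1) (cell_diff M ?j (a, \<zero>\<^bsub>free R UNIV\<^esub>))"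
        by (simp only: Ei[OF a] cell_diff_incl[OF M a] Ei[OF lin_closed[OF complex_diff[OF M] a]] cm_diff[OF g a])
    next
      fix x' assume x': "x' \<in> supp R (snd ?z)"
      show "diff Z ?j (?l ?j (\<zero>\<^bsub>cmod M ?j\<^esub>, single R x')) = ?l (?j + 1) (cell_diff M ?j (\<zero>\<^bsub>cmod M ?j\<^esub>, single R x'))"
        using IH[OF x'] by (simp only: Es cell_diff_single[OF M cell_cases(1)[OF sub[OF x']]])
    qed
    also have "\<dots> = \<zero>\<^bsub>cmod Z (?j + 1)\<^esub>" by (simp only: cell_cases(3)[OF x] lin_zero[OF El])
    finally have cyc: "?l ?j ?z \<in> cocycles Z ?j" using lin_closed[OF El zp] by (simp add: cocycle_iff)
    have zs: "?z \<in> carrier (cmod ?Q ?j)" using bd_in_cell_sum[OF x] by simp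
    have "p ?j (?l ?j ?z) = t ?j ?z"
    proof (rule sum_free_eqI)
      let ?S = "supp R (snd ?z)"
      have l: "lin R (dsum (cmod M ?j) (free R ?S)) (pre M ?j) (\<lambda>x. x)"
        unfolding pre_def by (rule lin_free_mono[OF complex_module[OF M]]) auto
      have l': "lin R (dsum (cmod M ?j) (free R ?S)) (cmod ?Q ?j) (\<lambda>x. x)"
        unfolding cmod_cell_complex cell_sum_def by (rule lin_free_mono[OF complex_module[OF M]]) (use sub in auto)
      show "lin R (dsum (cmod M ?j) (free R ?S)) (cmod Z' ?j) (\<lambda>z. p ?j (?l ?j z))"
        by (rule lin_comp[OF lin_comp[OF l El] cm_lin[OF p]])
      show "lin R (dsum (cmod M ?j) (free R ?S)) (cmod Z' ?j) (t ?j)" by (rule lin_comp[OF l' cm_lin[OF t]])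
      show "module R (cmod M ?j)" by (rule complex_module[OF M])
      fix a assume a: "a \<in> carrier (cmod M ?j)"
      show "p ?j (?l ?j (a, \<zero>\<^bsub>free R ?S\<^esub>)) = t ?j (a, \<zero>\<^bsub>free R ?S\<^esub>)"
        using Ei[OF a] sq[OF a] by (simp add: free_simps(2))
    next
      fix x' assume x': "x' \<in> supp R (snd ?z)"
      show "p ?j (?l ?j (\<zero>\<^bsub>cmod M ?j\<^esub>, single R x')) = t ?j (\<zero>\<^bsub>cmod M ?j\<^esub>, single R x')"
        using IH[OF x'] by (simp only: Es)
    next
      show "?z \<in> carrier (dsum (cmod M ?j) (free R (supp R (snd ?z))))"
        using zp by (auto simp: pre_def free_simps)
    qed
    also have "t ?j ?z = diff Z' i (t i (\<zero>\<^bsub>cmod M i\<^esub>, single R x))"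
      using cm_diff[OF t, of "(\<zero>\<^bsub>cmod M i\<^esub>, single R x)" i] single_in_cell_sum[OF M x]
      by (simp add: diff_cell_complex cell_diff_single[OF M zp])
    finally have "\<exists>e \<in> carrier (cmod Z i). diff Z i e = ?l ?j ?z \<and> p i e = t i (\<zero>\<^bsub>cmod M i\<^esub>, single R x)"
      using triv[unfolded triv_fib_iff[OF p]] cyc cm_closed[OF t] single_in_cell_sum[OF M x] by simp
    then show ?case
      unfolding r'[OF x] by - (rule someI_ex, blast)
  qed
  have L: "cm R ?Q Z ?l"
  proof (rule cmI[OF complex_cell_complex[OF M] Z])
    have l: "lin R (cell_sum M N f i) (cmod Z i) (?l i)" for i by (rule lin_comp[OF lin_cell_sum_pre[OF M] El])
    then show "lin R (cmod ?Q i) (cmod Z i) (?l i)" for i by simp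
    have d: "lin R (cell_sum M N f i) (cell_sum M N f (i + 1)) (cell_diff M i)" for i
      by (rule lin_sub[OF lin_cell_diff[OF M] lin_cell_sum_pre[OF M] lin_cell_sum_pre[OF M] cell_diff_closed[OF M]])
    fix i z assume z: "z \<in> carrier (cmod ?Q i)"
    have "?l (i + 1) (cell_diff M i z) = diff Z i (?l i z)"
    proof (rule cell_sum_eqI[OF lin_comp[OF d l] lin_comp[OF l complex_diff[OF Z]] M])
      fix a assume a: "a \<in> carrier (cmod M i)"
      show "?l (i + 1) (cell_diff M i (a, \<zero>\<^bsub>free R UNIV\<^esub>)) = diff Z i (?l i (a, \<zero>\<^bsub>free R UNIV\<^esub>))"
        by (simp only: Ei[OF a] cell_diff_incl[OF M a] Ei[OF lin_closed[OF complex_diff[OF M] a]] cm_diff[OF g a])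
    next
      fix x assume x: "cell M N f i x"
      show "?l (i + 1) (cell_diff M i (\<zero>\<^bsub>cmod M i\<^esub>, single R x)) = diff Z i (?l i (\<zero>\<^bsub>cmod M i\<^esub>, single R x))"
        using good[OF x] by (simp only: Es cell_diff_single[OF M cell_cases(1)[OF x]])
    qed (use z in simp)
    then show "?l (i + 1) (diff ?Q i z) = diff Z i (?l i z)" using z by (simp add: diff_cell_complex)
  qed
  have "p i (?l i z) = t i z" if z: "z \<in> carrier (cmod ?Q i)" for i z
  proof (rule cell_sum_eqI[OF _ _ M])
    show "lin R (cell_sum M N f i) (cmod Z' i) (\<lambda>z. p i (?l i z))" using lin_comp[OF cm_lin[OF L] cm_lin[OF p]] by simp
    show "lin R (cell_sum M N f i) (cmod Z' i) (t i)" using cm_lin[OF t] by simp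
  qed (use z good in \<open>simp_all add: Ei sq Es\<close>)
  then show ?thesis using L Ei by blast
qed

end


section \<open>The projective model structure\<close>

text \<open>Reduces lifting problems to conditions \<open>cm\<close>, so that solutions may be given
  by functions with arbitrary values off the carriers.\<close>

lemma coCh_llpI:
  assumes i: "i \<in> Ar (coCh R)" and p: "p \<in> Ar (coCh R)"
    and lift: "\<And>u v. \<lbrakk>cm R (src i) (src p) u; cm R (tgt i) (tgt p) v;
       \<And>j x. x \<in> carrier (cmod (src i) j) \<Longrightarrow> v j (mor i j x) = mor p j (u j x)\<rbrakk> \<Longrightarrow>
       \<exists>l. cm R (tgt i) (src p) l \<and> (\<forall>j. \<forall>x \<in> carrier (cmod (src i) j). l j (mor i j x) = u j x) \<and>
         (\<forall>j. \<forall>y \<in> carrier (cmod (tgt i) j). mor p j (l j y) = v j y)"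
  shows "llp (coCh R) i p"
proof (rule category.llpI[OF category_coCh])
  fix u v assume u: "u \<in> Ar (coCh R)" "Dom (coCh R) u = Dom (coCh R) i" "Cod (coCh R) u = Dom (coCh R) p"
    and v: "v \<in> Ar (coCh R)" "Dom (coCh R) v = Cod (coCh R) i" "Cod (coCh R) v = Cod (coCh R) p"
    and sq: "v \<cdot>\<^bsub>coCh R\<^esub> i = p \<cdot>\<^bsub>coCh R\<^esub> u"
  have sq': "mor v j (mor i j x) = mor p j (mor u j x)" if "x \<in> carrier (cmod (src i) j)" for j x
  proof -
    have "restr (src i) (\<lambda>j x. mor v j (mor i j x)) = restr (src i) (\<lambda>j x. mor p j (mor u j x))"
      using sq by (simp add: u(2)[simplified])
    then show ?thesis using that unfolding restr_eq_iff by blast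
  qed
  have "cm R (src i) (src p) (mor u)" "cm R (tgt i) (tgt p) (mor v)"
    using coCh_cm[OF u(1)] coCh_cm[OF v(1)] u v by simp_all
  then obtain l where l: "cm R (tgt i) (src p) l" "\<And>j x. x \<in> carrier (cmod (src i) j) \<Longrightarrow> l j (mor i j x) = mor u j x"
    "\<And>j y. y \<in> carrier (cmod (tgt i) j) \<Longrightarrow> mor p j (l j y) = mor v j y"
    using lift[of "mor u" "mor v"] sq' by blast
  let ?l = "Arrow (tgt i) (restr (tgt i) l) (src p)"
  have L: "?l \<in> Ar (coCh R)" by (rule coCh_arrI[OF l(1)])
  note C = category.Cmp_closed[OF category_coCh]
  show "\<exists>l \<in> Ar (coCh R). Dom (coCh R) l = Cod (coCh R) i \<and> Cod (coCh R) l = Dom (coCh R) p \<and> l \<cdot>\<^bsub>coCh R\<^esub> i = u \<and> p \<cdot>\<^bsub>coCh R\<^esub> l = v"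
  proof (intro bexI[OF _ L] conjI)
    show "?l \<cdot>\<^bsub>coCh R\<^esub> i = u"
      by (rule coCh_eqI[OF C[OF i L] u(1)]) (use u l cm_closed[OF coCh_cm[OF i]] in simp_all)
    show "p \<cdot>\<^bsub>coCh R\<^esub> ?l = v"
      by (rule coCh_eqI[OF C[OF L p] v(1)]) (use v l in simp_all)
  qed simp_all
qed

lemma coCh_llpE:
  assumes "llp (coCh R) i p" and i: "i \<in> Ar (coCh R)" and p: "p \<in> Ar (coCh R)"
    and u: "cm R (src i) (src p) u" and v: "cm R (tgt i) (tgt p) v"
    and sq: "\<And>j x. x \<in> carrier (cmod (src i) j) \<Longrightarrow> v j (mor i j x) = mor p j (u j x)"
  obtains l where "cm R (tgt i) (src p) l" "\<And>j x. x \<in> carrier (cmod (src i) j) \<Longrightarrow> l j (mor i j x) = u j x"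
    "\<And>j y. y \<in> carrier (cmod (tgt i) j) \<Longrightarrow> mor p j (l j y) = v j y"
proof -
  have e: "Arrow (tgt i) (restr (tgt i) v) (tgt p) \<cdot>\<^bsub>coCh R\<^esub> i = p \<cdot>\<^bsub>coCh R\<^esub> Arrow (src i) (restr (src i) u) (src p)"
    using sq cm_closed[OF coCh_cm[OF i]] by (simp add: restr_eq_iff)
  obtain l where l: "l \<in> Ar (coCh R)" "Dom (coCh R) l = Cod (coCh R) i" "Cod (coCh R) l = Dom (coCh R) p"
    "l \<cdot>\<^bsub>coCh R\<^esub> i = Arrow (src i) (restr (src i) u) (src p)" "p \<cdot>\<^bsub>coCh R\<^esub> l = Arrow (tgt i) (restr (tgt i) v) (tgt p)"
    by (rule category.llpE[OF category_coCh assms(1) i p coCh_arrI[OF u] coCh_arrI[OF v] _ _ _ _ e]) simp_all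
  show ?thesis
  proof (rule that[of "mor l"])
    show "cm R (tgt i) (src p) (mor l)" using coCh_cm[OF l(1)] l(2,3) by simp
    show "mor l j (mor i j x) = u j x" if "x \<in> carrier (cmod (src i) j)" for j x
      using l(4) that by (simp add: restr_eq_iff)
    show "mor p j (mor l j y) = v j y" if "y \<in> carrier (cmod (tgt i) j)" for j y
      using l(2,5) that by (simp add: restr_eq_iff)
  qed
qed

lemma proj_fib_iff: "p \<in> proj_fib R \<longleftrightarrow> p \<in> Ar (coCh R) \<and> (\<forall>i. mor p i ` carrier (cmod (src p) i) = carrier (cmod (tgt p) i))"
  by (simp add: proj_fib_def)

text \<open>The middle complex \<open>Q\<close> of a factorization has elements of a compound type.
  The injection \<open>e\<close> renames them by elements of the universe, and the arrows of the
  factorization run through the renamed complex.\<close>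

abbreviation named_incl :: "('r, 'a) cochain \<Rightarrow> ('r, 'b) cochain \<Rightarrow> (int \<Rightarrow> 'b \<Rightarrow> 'a) \<Rightarrow> (int \<Rightarrow> 'a \<Rightarrow> 'b) \<Rightarrow> (('r, 'a) cochain, 'a graded_map) arrow" where
  "named_incl M Q e h \<equiv> Arrow M (restr M (\<lambda>i x. e i (h i x))) (img_complex Q e)"

abbreviation named_proj :: "('r, 'b) cochain \<Rightarrow> ('r, 'a) cochain \<Rightarrow> (int \<Rightarrow> 'b \<Rightarrow> 'a) \<Rightarrow> (int \<Rightarrow> 'b \<Rightarrow> 'a) \<Rightarrow> (('r, 'a) cochain, 'a graded_map) arrow" where
  "named_proj Q N e k \<equiv> Arrow (img_complex Q e) (restr (img_complex Q e) (\<lambda>i a. k i (descend Q e (\<lambda>i x. x) i a))) N"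

lemma
  assumes h: "cm R M Q h" and e: "\<And>i. inj_on (e i) (carrier (cmod Q i))"
  shows named_incl_arr: "named_incl M Q e h \<in> Ar (coCh R)"
    and named_incl_qis: "coh_bij M Q h \<Longrightarrow> named_incl M Q e h \<in> qis R"
proof -
  note E = cm_rename[where q = e, OF cm_complex(2)[OF h] e]
  show A: "named_incl M Q e h \<in> Ar (coCh R)" by (rule coCh_arrI[OF cm_comp[OF h E]])
  assume "coh_bij M Q h"
  then have "coh_bij M (img_complex Q e) (\<lambda>i x. e i (h i x))"
    by (rule coh_bij_comp[OF h E]) (rule coh_bij_rename[where q = e, OF cm_complex(2)[OF h] e])
  then have "coh_bij M (img_complex Q e) (restr M (\<lambda>i x. e i (h i x)))"
    by (subst coh_bij_cong[where g = "\<lambda>i x. e i (h i x)"]) simp_all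
  then show "named_incl M Q e h \<in> qis R" using A by (simp add: qis_iff)
qed

lemma named_incl_llp:
  assumes h: "cm R M Q h" and e: "\<And>i. inj_on (e i) (carrier (cmod Q i))" and p: "p \<in> Ar (coCh R)"
    and lift: "\<And>u v. \<lbrakk>cm R M (src p) u; cm R Q (tgt p) v; \<And>j x. x \<in> carrier (cmod M j) \<Longrightarrow> v j (h j x) = mor p j (u j x)\<rbrakk> \<Longrightarrow>
      \<exists>l. cm R Q (src p) l \<and> (\<forall>j. \<forall>x \<in> carrier (cmod M j). l j (h j x) = u j x) \<and>
        (\<forall>j. \<forall>z \<in> carrier (cmod Q j). mor p j (l j z) = v j z)"
  shows "llp (coCh R) (named_incl M Q e h) p"
proof (rule coCh_llpI[OF named_incl_arr[OF h e] p], unfold arrow.sel)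
  note Q = cm_complex(2)[OF h]
  note E = cm_rename[where q = e, OF Q e] and D = cm_unname[where q = e, OF Q e] and ed = unname[where q = e, OF Q e]
  fix u v assume u: "cm R M (src p) u" and v: "cm R (img_complex Q e) (tgt p) v"
    and sq: "\<And>j x. x \<in> carrier (cmod M j) \<Longrightarrow> v j (restr M (\<lambda>i x. e i (h i x)) j x) = mor p j (u j x)"
  obtain l where l: "cm R Q (src p) l" "\<And>j x. x \<in> carrier (cmod M j) \<Longrightarrow> l j (h j x) = u j x"
    "\<And>j z. z \<in> carrier (cmod Q j) \<Longrightarrow> mor p j (l j z) = v j (e j z)"
    using lift[OF u cm_comp[OF E v]] sq by auto
  show "\<exists>l. cm R (img_complex Q e) (src p) l \<and> (\<forall>j. \<forall>x \<in> carrier (cmod M j). l j (restr M (\<lambda>i x. e i (h i x)) j x) = u j x) \<and>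
      (\<forall>j. \<forall>y \<in> carrier (cmod (img_complex Q e) j). mor p j (l j y) = v j y)"
    by (rule exI[of _ "\<lambda>i a. l i (descend Q e (\<lambda>i x. x) i a)"])
      (auto simp: ed l(2,3) cm_closed[OF h] intro: cm_comp[OF D l(1)])
qed

lemma
  assumes k: "cm R Q N k" and e: "\<And>i. inj_on (e i) (carrier (cmod Q i))"
    and surj: "\<forall>i. k i ` carrier (cmod Q i) = carrier (cmod N i)"
  shows named_proj_fib: "named_proj Q N e k \<in> proj_fib R"
    and named_proj_qis: "coh_bij Q N k \<Longrightarrow> named_proj Q N e k \<in> qis R"
proof -
  note Q = cm_complex(1)[OF k]
  note E = cm_rename[where q = e, OF Q e] and D = cm_unname[where q = e, OF Q e] and ed = unname[where q = e, OF Q e]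
  have A: "named_proj Q N e k \<in> Ar (coCh R)" by (rule coCh_arrI[OF cm_comp[OF D k]])
  have "restr (img_complex Q e) (\<lambda>i a. k i (descend Q e (\<lambda>i x. x) i a)) i ` carrier (cmod (img_complex Q e) i) = k i ` carrier (cmod Q i)" for i
    by (force simp: ed image_iff)
  then show "named_proj Q N e k \<in> proj_fib R" using A surj by (simp add: proj_fib_iff)
  assume "coh_bij Q N k"
  then have "coh_bij (img_complex Q e) N (\<lambda>i a. k i (descend Q e (\<lambda>i x. x) i a))"
    by (rule coh_bij_comp[OF D k coh_bij_unname[where q = e, OF Q e]])
  then have "coh_bij (img_complex Q e) N (restr (img_complex Q e) (\<lambda>i a. k i (descend Q e (\<lambda>i x. x) i a)))"
    by (subst coh_bij_cong[where g = "\<lambda>i a. k i (descend Q e (\<lambda>i x. x) i a)"]) simp_all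
  then show "named_proj Q N e k \<in> qis R" using A by (simp add: qis_iff)
qed

lemma map_coChE:
  assumes "Arrow f (u, v) g \<in> Ar (map_cat (coCh R))"
  shows "cm R (src f) (tgt f) (mor f)" "cm R (src g) (tgt g) (mor g)" "cm R (src f) (src g) (mor u)" "cm R (tgt f) (tgt g) (mor v)"
    "src u = src f" "tgt u = src g" "src v = tgt f" "tgt v = tgt g"
    "\<And>i x. x \<in> carrier (cmod (src f) i) \<Longrightarrow> mor g i (mor u i x) = mor v i (mor f i x)"
proof -
  have A: "f \<in> Ar (coCh R)" "g \<in> Ar (coCh R)" "u \<in> Ar (coCh R)" "v \<in> Ar (coCh R)"
    and s: "src u = src f" "tgt u = src g" "src v = tgt f" "tgt v = tgt g" and e: "v \<cdot>\<^bsub>coCh R\<^esub> f = g \<cdot>\<^bsub>coCh R\<^esub> u"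
    using assms unfolding Arrow_in_map_cat by (simp_all del: coCh_simps(5) add: coCh_simps(1-4))
  show "cm R (src f) (tgt f) (mor f)" "cm R (src g) (tgt g) (mor g)" "cm R (src f) (src g) (mor u)" "cm R (tgt f) (tgt g) (mor v)"
    "src u = src f" "tgt u = src g" "src v = tgt f" "tgt v = tgt g"
    using coCh_cm[OF A(1)] coCh_cm[OF A(2)] coCh_cm[OF A(3)] coCh_cm[OF A(4)] s by simp_all
  show "mor g i (mor u i x) = mor v i (mor f i x)" if "x \<in> carrier (cmod (src f) i)" for i x
    using e that s by (auto simp: restr_eq_iff)
qed

text \<open>Functoriality is checked on the complexes \<open>Q f\<close> before renaming.
  Conjugation of \<open>w\<close> with the renaming and its inverse transports it, the codes in
  between cancelling by \<open>ed\<close>.\<close>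

lemma coCh_factorizationI:
  fixes R :: "('r, 'x) ring_scheme" and Q :: "(('r, 'a) cochain, 'a graded_map) arrow \<Rightarrow> ('r, 'b) cochain"
  assumes e: "\<And>f i. f \<in> Ar (coCh R) \<Longrightarrow> inj_on (e i) (carrier (cmod (Q f) i))"
    and hk: "\<And>f. f \<in> Ar (coCh R) \<Longrightarrow> cm R (src f) (Q f) (h f) \<and> cm R (Q f) (tgt f) (k f) \<and>
       (\<forall>i. \<forall>x \<in> carrier (cmod (src f) i). k f i (h f i x) = mor f i x)"
    and w: "\<And>f u v g. Arrow f (u, v) g \<in> Ar (map_cat (coCh R)) \<Longrightarrow> cm R (Q f) (Q g) (w f u v g) \<and>
       (\<forall>i. \<forall>x \<in> carrier (cmod (src f) i). w f u v g i (h f i x) = h g i (mor u i x)) \<and>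
       (\<forall>i. \<forall>z \<in> carrier (cmod (Q f) i). k g i (w f u v g i z) = mor v i (k f i z))"
    and w_Ide: "\<And>f i z. \<lbrakk>f \<in> Ar (coCh R); z \<in> carrier (cmod (Q f) i)\<rbrakk> \<Longrightarrow>
       w f (Ide (coCh R) (src f)) (Ide (coCh R) (tgt f)) f i z = z"
    and w_Cmp: "\<And>f u v g u' v' g' i z. \<lbrakk>Arrow f (u, v) g \<in> Ar (map_cat (coCh R));
       Arrow g (u', v') g' \<in> Ar (map_cat (coCh R)); z \<in> carrier (cmod (Q f) i)\<rbrakk> \<Longrightarrow>
       w f (u' \<cdot>\<^bsub>coCh R\<^esub> u) (v' \<cdot>\<^bsub>coCh R\<^esub> v) g' i z = w g u' v' g' i (w f u v g i z)"
  shows "\<exists>\<phi>. functorial_factorization (coCh R) \<phi> \<and> fob (fst \<phi>) = (\<lambda>f. named_incl (src f) (Q f) e (h f)) \<and>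
     fob (snd \<phi>) = (\<lambda>f. named_proj (Q f) (tgt f) e (k f))"
proof -
  interpret C: category "coCh R" by (rule category_coCh)
  let ?I = "\<lambda>f. img_complex (Q f) e"
  let ?d = "\<lambda>f. descend (Q f) e (\<lambda>i x. x)"
  have E: "cm R (Q f) (?I f) e" and D: "cm R (?I f) (Q f) (?d f)"
    and ed: "\<And>i x. x \<in> carrier (cmod (Q f) i) \<Longrightarrow> ?d f i (e i x) = x" if "f \<in> Ar (coCh R)" for f :: "(('r, 'a) cochain, 'a graded_map) arrow"
    using hk[OF that] cm_rename[where q = e, OF _ e[OF that]] cm_unname[where q = e, OF _ e[OF that]]
      unname[where q = e, OF _ e[OF that]] cm_complex by blast+
  let ?w = "\<lambda>a. Arrow (?I (src a)) (restr (?I (src a)) (\<lambda>i x. e i (w (src a) (fst (mor a)) (snd (mor a)) (tgt a) i (?d (src a) i x)))) (?I (tgt a))"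
  have wA: "?w (Arrow f (u, v) g) \<in> Ar (coCh R)" if "Arrow f (u, v) g \<in> Ar (map_cat (coCh R))"
    for f u v g :: "(('r, 'a) cochain, 'a graded_map) arrow"
  proof -
    from that have f: "f \<in> Ar (coCh R)" and g: "g \<in> Ar (coCh R)" unfolding Arrow_in_map_cat by blast+
    show ?thesis unfolding arrow.sel fst_conv snd_conv
      by (rule coCh_arrI[OF cm_comp[OF cm_comp[OF D[OF f] w[OF that, THEN conjunct1]] E[OF g]]])
  qed
  show ?thesis
  proof (rule C.functorial_factorizationI[where w = ?w])
    fix f :: "(('r, 'a) cochain, 'a graded_map) arrow"
    assume f: "f \<in> Ar (coCh R)"
    have h: "cm R (src f) (Q f) (h f)" and k: "cm R (Q f) (tgt f) (k f)"
      and kh: "\<And>i x. x \<in> carrier (cmod (src f) i) \<Longrightarrow> k f i (h f i x) = mor f i x" using hk[OF f] by auto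
    let ?h = "named_incl (src f) (Q f) e (h f)" and ?k = "named_proj (Q f) (tgt f) e (k f)"
    have hA: "?h \<in> Ar (coCh R)" by (rule named_incl_arr[OF h e[OF f]])
    have kA: "?k \<in> Ar (coCh R)" by (rule coCh_arrI[OF cm_comp[OF D[OF f] k]])
    have "?k \<cdot>\<^bsub>coCh R\<^esub> ?h = f"
      by (rule coCh_eqI[OF C.Cmp_closed[OF hA kA] f]) (simp_all add: cm_closed[OF h] ed[OF f] kh)
    then show "?h \<in> Ar (coCh R) \<and> ?k \<in> Ar (coCh R) \<and> Cod (coCh R) ?h = Dom (coCh R) ?k \<and> ?k \<cdot>\<^bsub>coCh R\<^esub> ?h = f"
      using hA kA by simp
    have i: "Arrow f (Ide (coCh R) (src f), Ide (coCh R) (tgt f)) f \<in> Ar (map_cat (coCh R))"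
      using C.Ide_in_map_cat[OF f] by simp
    have "cochain_complex R (?I f)" using cm_complex[OF E[OF f]] by simp
    then have I: "Ide (coCh R) (?I f) \<in> Ar (coCh R)" using C.Ide_closed[of "?I f"] by simp
    have "?w (Arrow f (Ide (coCh R) (src f), Ide (coCh R) (tgt f)) f) = Ide (coCh R) (?I f)"
      by (rule coCh_eqI[OF wA[OF i] I]) (auto simp: ed[OF f] w_Ide[OF f, simplified])
    then show "?w (Ide (map_cat (coCh R)) f) = Ide (coCh R) (Cod (coCh R) ?h)" by simp
  next
    fix f u v g :: "(('r, 'a) cochain, 'a graded_map) arrow"
    assume a: "Arrow f (u, v) g \<in> Ar (map_cat (coCh R))"
    then have f: "f \<in> Ar (coCh R)" and g: "g \<in> Ar (coCh R)" and u: "u \<in> Ar (coCh R)" and v: "v \<in> Ar (coCh R)"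
      unfolding Arrow_in_map_cat by blast+
    note uv = map_coChE(5-8)[OF a]
    have h: "cm R (src f) (Q f) (h f)" and k: "cm R (Q f) (tgt f) (k f)" using hk[OF f] by auto
    have h': "cm R (src g) (Q g) (h g)" and k': "cm R (Q g) (tgt g) (k g)" using hk[OF g] by auto
    let ?h = "\<lambda>f. named_incl (src f) (Q f) e (h f)" and ?k = "\<lambda>f. named_proj (Q f) (tgt f) e (k f)"
    note W = wA[OF a]
    have w': "cm R (Q f) (Q g) (w f u v g)"
       "\<And>i x. x \<in> carrier (cmod (src f) i) \<Longrightarrow> w f u v g i (h f i x) = h g i (mor u i x)"
       "\<And>i z. z \<in> carrier (cmod (Q f) i) \<Longrightarrow> k g i (w f u v g i z) = mor v i (k f i z)" using w[OF a] by auto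
    have hA: "?h f \<in> Ar (coCh R)" "?h g \<in> Ar (coCh R)" by (rule named_incl_arr[OF h e[OF f]], rule named_incl_arr[OF h' e[OF g]])
    have kA: "?k f \<in> Ar (coCh R)" "?k g \<in> Ar (coCh R)"
      by (rule coCh_arrI[OF cm_comp[OF D[OF f] k]], rule coCh_arrI[OF cm_comp[OF D[OF g] k']])
    have uc: "mor u i x \<in> carrier (cmod (src g) i)" if "x \<in> carrier (cmod (src f) i)" for i x
      using cm_closed[OF coCh_cm[OF u]] uv that by simp
    have 1: "?w (Arrow f (u, v) g) \<cdot>\<^bsub>coCh R\<^esub> ?h f = ?h g \<cdot>\<^bsub>coCh R\<^esub> u"
      by (rule coCh_eqI[OF C.Cmp_closed[OF hA(1) W] C.Cmp_closed[OF u hA(2)]])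
        (simp_all add: uv uc cm_closed[OF h] ed[OF f] w')
    have 2: "?k g \<cdot>\<^bsub>coCh R\<^esub> ?w (Arrow f (u, v) g) = v \<cdot>\<^bsub>coCh R\<^esub> ?k f"
      by (rule coCh_eqI[OF C.Cmp_closed[OF W kA(2)] C.Cmp_closed[OF kA(1) v]])
        (auto simp: uv cm_closed[OF w'(1)] ed[OF f] ed[OF g] w' cm_closed[OF h] cm_closed[OF k])
    show "?w (Arrow f (u, v) g) \<in> Ar (coCh R) \<and> Dom (coCh R) (?w (Arrow f (u, v) g)) = Cod (coCh R) (?h f) \<and>
       Cod (coCh R) (?w (Arrow f (u, v) g)) = Cod (coCh R) (?h g) \<and>
       ?w (Arrow f (u, v) g) \<cdot>\<^bsub>coCh R\<^esub> ?h f = ?h g \<cdot>\<^bsub>coCh R\<^esub> u \<and> ?k g \<cdot>\<^bsub>coCh R\<^esub> ?w (Arrow f (u, v) g) = v \<cdot>\<^bsub>coCh R\<^esub> ?k f"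
      using W 1 2 by (simp del: coCh_simps(5))
  next
    fix a b :: "((('r, 'a) cochain, 'a graded_map) arrow, (('r, 'a) cochain, 'a graded_map) arrow \<times> (('r, 'a) cochain, 'a graded_map) arrow) arrow"
    assume a: "a \<in> Ar (map_cat (coCh R))" and b: "b \<in> Ar (map_cat (coCh R))" and ab: "tgt a = src b"
    obtain f u v g where A: "a = Arrow f (u, v) g" using a by (rule map_catE)
    obtain u' v' g' where B: "b = Arrow g (u', v') g'" using b ab A by (auto elim!: map_catE)
    note a = a[unfolded A] and b = b[unfolded B]
    have f: "f \<in> Ar (coCh R)" and g: "g \<in> Ar (coCh R)" using a unfolding Arrow_in_map_cat by blast+
    have w': "cm R (Q f) (Q g) (w f u v g)" using w[OF a] by auto
    have c: "Arrow f (u' \<cdot>\<^bsub>coCh R\<^esub> u, v' \<cdot>\<^bsub>coCh R\<^esub> v) g' \<in> Ar (map_cat (coCh R))"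
      using C.map_cat_Cmp_closed[OF a b] by (simp only: map_cat_simps(5) arrow.sel fst_conv snd_conv simp_thms)
    have "?w (Arrow f (u' \<cdot>\<^bsub>coCh R\<^esub> u, v' \<cdot>\<^bsub>coCh R\<^esub> v) g') = ?w (Arrow g (u', v') g') \<cdot>\<^bsub>coCh R\<^esub> ?w (Arrow f (u, v) g)"
      by (rule coCh_eqI[OF wA[OF c] C.Cmp_closed[OF wA[OF a] wA[OF b]]])
        (auto simp: ed[OF f] ed[OF g] cm_closed[OF w'] w_Cmp[OF a b, simplified])
    then show "?w (b \<cdot>\<^bsub>map_cat (coCh R)\<^esub> a) = ?w b \<cdot>\<^bsub>coCh R\<^esub> ?w a" by (simp only: A B map_cat_simps arrow.sel fst_conv snd_conv)
  qed
qed

context universe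
begin

subsection \<open>Functoriality of cell complexes\<close>

definition cell_push :: "('r, 'a) cochain \<Rightarrow> 'a graded_map \<Rightarrow> 'a graded_map \<Rightarrow> int \<Rightarrow> 'a \<times> ('a \<Rightarrow> 'r) \<Rightarrow> 'a \<times> ('a \<Rightarrow> 'r)" where
  "cell_push M' u \<gamma> i = ext_map R (pre M' i) (\<lambda>m. (u i m, \<zero>\<^bsub>free R UNIV\<^esub>)) (\<lambda>x. (\<zero>\<^bsub>cmod M' i\<^esub>, single R (\<gamma> i x)))"

text \<open>The cell named by \<open>(z, y)\<close> goes to the one named by the images of
  \<open>z\<close> and \<open>y\<close>. By induction over cells this equation determines all values
  at cells, so the choice leaves no freedom there.\<close>

definition cell_map :: "('r, 'a) cochain \<Rightarrow> ('r, 'a) cochain \<Rightarrow> 'a graded_map \<Rightarrow> ('r, 'a) cochain \<Rightarrow> 'a graded_map \<Rightarrow>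
    'a graded_map \<Rightarrow> 'a graded_map" where
  "cell_map M N f M' u v = (SOME \<gamma>. \<forall>i x. cell M N f i x \<longrightarrow>
     \<gamma> i x = cell_name (cell_push M' u \<gamma> (i + 1) (bd x)) (v i (val x)))"

lemma single_in_pre: "cochain_complex R M' \<Longrightarrow> (\<zero>\<^bsub>cmod M' i\<^esub>, single R x) \<in> carrier (pre M' i)"
  using mod_zero[OF complex_module] by (simp add: pre_def single_closed)

text \<open>\<open>cell_rec\<close> solves the masked equation; the values hidden by the mask lie
  off the support of the boundary, so its solution satisfies the equation that specifies
  \<open>cell_map\<close>.\<close>

lemma cell_map_eq:
  assumes M': "cochain_complex R M'" and x: "cell M N f i x"
  shows "cell_map M N f M' u v i x = cell_name (cell_push M' u (cell_map M N f M' u v) (i + 1) (bd x)) (v i (val x))"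
proof -
  define F where "F i x r = cell_name (ext_map R (pre M' (i + 1)) (\<lambda>m. (u (i + 1) m, \<zero>\<^bsub>free R UNIV\<^esub>))
     (\<lambda>x'. (\<zero>\<^bsub>cmod M' (i + 1)\<^esub>, single R (r x'))) (bd x)) (v i (val x))" for i x and r :: "'a \<Rightarrow> 'a"
  obtain r where r: "\<And>i x. cell M N f i x \<Longrightarrow> r i x = F i x (mask (r (i + 1)) x)"
    using cell_rec[of M N f F] by blast
  have "F i x (mask (r (i + 1)) x) = F i x (r (i + 1))" if "cell M N f i x" for i x
    unfolding F_def
    by (subst ext_map_cong[where S = UNIV and g' = "\<lambda>x'. (\<zero>\<^bsub>cmod M' (i + 1)\<^esub>, single R (r (i + 1) x'))"])
      (use cell_cases(1)[OF that] module_pre[OF M'] in \<open>auto simp: mask_def pre_def single_in_pre[OF M', unfolded pre_def dsum_simps]\<close>,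
       auto simp: mod_zero[OF complex_module[OF M']] single_closed)
  then have "\<exists>\<gamma>. \<forall>i x. cell M N f i x \<longrightarrow> \<gamma> i x = cell_name (cell_push M' u \<gamma> (i + 1) (bd x)) (v i (val x))"
    using r by (intro exI[of _ r]) (auto simp: F_def cell_push_def)
  from someI_ex[OF this] show ?thesis using x unfolding cell_map_def[symmetric] by blast
qed

lemma lin_cell_push: "cm R M M' u \<Longrightarrow> lin R (pre M i) (pre M' i) (cell_push M' u \<gamma> i)"
  unfolding cell_push_def pre_def[of M i]
  by (intro lin_ext_map lin_pre_incl cm_lin) (auto intro: single_in_pre cm_complex)

lemma cell_push_incl: "cm R M M' u \<Longrightarrow> m \<in> carrier (cmod M i) \<Longrightarrow>
    cell_push M' u \<gamma> i (m, \<zero>\<^bsub>free R S\<^esub>) = (u i m, \<zero>\<^bsub>free R UNIV\<^esub>)"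
  unfolding cell_push_def by (subst ext_map_incl[OF lin_pre_incl[OF cm_lin]]) auto

lemma cell_push_single: "cm R M M' u \<Longrightarrow>
    cell_push M' u \<gamma> i (\<zero>\<^bsub>cmod M i\<^esub>, single R x) = (\<zero>\<^bsub>cmod M' i\<^esub>, single R (\<gamma> i x))"
  unfolding cell_push_def by (subst ext_map_single[OF lin_pre_incl[OF cm_lin]]) (auto intro: single_in_pre cm_complex)

lemma bd_cell_map:
  assumes u: "cm R M M' u" and x: "cell M N f i x"
  shows "bd (cell_map M N f M' u v i x) = cell_push M' u (cell_map M N f M' u v) (i + 1) (bd x)"
    and "val (cell_map M N f M' u v i x) = v i (val x)"
proof -
  have "cell_push M' u (cell_map M N f M' u v) (i + 1) (bd x) \<in> carrier (pre M' (i + 1))"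
    by (rule lin_closed[OF lin_cell_push[OF u] cell_cases(1)[OF x]])
  then show "bd (cell_map M N f M' u v i x) = cell_push M' u (cell_map M N f M' u v) (i + 1) (bd x)"
    "val (cell_map M N f M' u v i x) = v i (val x)"
    unfolding cell_map_eq[OF cm_complex(2)[OF u] x] by (auto simp: bd_cell_name val_cell_name pre_def)
qed

lemma cell_push_closed:
  assumes u: "cm R M M' u" and sub: "\<And>x. x \<in> supp R (snd z) \<Longrightarrow> cell M' N' f' i (\<gamma> i x)" and z: "z \<in> carrier (pre M i)"
  shows "cell_push M' u \<gamma> i z \<in> carrier (cell_sum M' N' f' i)"
proof (rule sum_free_closed[where f = "cell_push M' u \<gamma> i" and A = "cmod M i" and S = "supp R (snd z)" and B = "pre M' i"])
  note M = cm_complex(1)[OF u] and M' = cm_complex(2)[OF u]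
  have "lin R (dsum (cmod M i) (free R (supp R (snd z)))) (pre M i) (\<lambda>x. x)"
    unfolding pre_def by (rule lin_free_mono[OF complex_module[OF M]]) auto
  then show "lin R (dsum (cmod M i) (free R (supp R (snd z)))) (pre M' i) (cell_push M' u \<gamma> i)"
    by (rule lin_comp[OF _ lin_cell_push[OF u]])
  show "lin R (cell_sum M' N' f' i) (pre M' i) (\<lambda>x. x)" by (rule lin_cell_sum_pre[OF M'])
  show "module R (cmod M i)" by (rule complex_module[OF M])
  show "cell_push M' u \<gamma> i (a, \<zero>\<^bsub>free R (supp R (snd z))\<^esub>) \<in> carrier (cell_sum M' N' f' i)" if "a \<in> carrier (cmod M i)" for a
    by (simp only: cell_push_incl[OF u that] incl_in_cell_sum[OF cm_closed[OF u that]])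
  show "cell_push M' u \<gamma> i (\<zero>\<^bsub>cmod M i\<^esub>, single R x) \<in> carrier (cell_sum M' N' f' i)" if "x \<in> supp R (snd z)" for x
    by (simp only: cell_push_single[OF u] single_in_cell_sum[OF M' sub[OF that]])
  show "z \<in> carrier (dsum (cmod M i) (free R (supp R (snd z))))" using z by (auto simp: pre_def free_simps)
qed

text \<open>Cells go to cells by induction: on the boundary of a cell, pushing forward commutes with
  \<open>cell_diff\<close> and \<open>cell_proj\<close>, because it does so on \<open>M\<close>
  (\<open>wa\<close>) and, by the induction hypothesis, on the cells involved
  (\<open>ws\<close>).\<close>

lemma
  assumes f: "cm R M N f" and f': "cm R M' N' f'" and u: "cm R M M' u" and v: "cm R N N' v"
    and sq: "\<And>i x. x \<in> carrier (cmod M i) \<Longrightarrow> f' i (u i x) = v i (f i x)"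
  shows cell_map_cell: "cell M N f i x \<Longrightarrow> cell M' N' f' i (cell_map M N f M' u v i x)"
    and cm_cell_push: "cm R (cell_complex M N f) (cell_complex M' N' f') (cell_push M' u (cell_map M N f M' u v))"
    and cell_proj_push: "z \<in> carrier (cmod (cell_complex M N f) i) \<Longrightarrow>
      cell_proj N' f' i (cell_push M' u (cell_map M N f M' u v) i z) = v i (cell_proj N f i z)"
proof -
  note M = cm_complex(1)[OF f] and N = cm_complex(2)[OF f] and M' = cm_complex(1)[OF f'] and N' = cm_complex(2)[OF f']
  let ?\<gamma> = "cell_map M N f M' u v"
  let ?w = "cell_push M' u ?\<gamma>"
  note P = lin_cell_push[OF u, of _ ?\<gamma>]
  have wa: "cell_diff M' i (?w i (a, \<zero>\<^bsub>free R UNIV\<^esub>)) = ?w (i + 1) (cell_diff M i (a, \<zero>\<^bsub>free R UNIV\<^esub>))"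
     "cell_proj N' f' i (?w i (a, \<zero>\<^bsub>free R UNIV\<^esub>)) = v i (cell_proj N f i (a, \<zero>\<^bsub>free R UNIV\<^esub>))"
    if a: "a \<in> carrier (cmod M i)" for a i
    by (simp_all only: cell_push_incl[OF u a] cell_diff_incl[OF M' cm_closed[OF u a]] cell_diff_incl[OF M a]
       cell_push_incl[OF u lin_closed[OF complex_diff[OF M] a]] cm_diff[OF u a] cell_proj_incl[OF f a]
       cell_proj_incl[OF f' cm_closed[OF u a]] sq[OF a])
  have ws: "cell_diff M' i (?w i (\<zero>\<^bsub>cmod M i\<^esub>, single R x)) = ?w (i + 1) (cell_diff M i (\<zero>\<^bsub>cmod M i\<^esub>, single R x))"
     "cell_proj N' f' i (?w i (\<zero>\<^bsub>cmod M i\<^esub>, single R x)) = v i (cell_proj N f i (\<zero>\<^bsub>cmod M i\<^esub>, single R x))"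
    if x: "cell M N f i x" and \<gamma>x: "cell M' N' f' i (?\<gamma> i x)" for i x
    by (simp_all only: cell_push_single[OF u] cell_diff_single[OF M' cell_cases(1)[OF \<gamma>x]]
       cell_diff_single[OF M cell_cases(1)[OF x]] bd_cell_map[OF u x] cell_proj_single[OF f' cell_cases(4)[OF \<gamma>x]]
       cell_proj_single[OF f cell_cases(4)[OF x]])
  have cells: "cell M' N' f' i (?\<gamma> i x)" if "cell M N f i x" for i x
    using that
  proof (induction rule: cell_induct)
    case (1 i x)
    note x = 1(1) and IH = 1(2)
    let ?j = "i + 1" and ?z = "bd x"
    note z = cell_cases(1)[OF x]
    have sub: "cell M N f ?j x'" if "x' \<in> supp R (snd ?z)" for x' by (rule cell_cases(2)[OF x that])
    have wz: "?w ?j ?z \<in> carrier (cell_sum M' N' f' ?j)"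
      by (rule cell_push_closed[where \<gamma> = ?\<gamma>, OF u IH z])
    have "cell_diff M' ?j (?w ?j ?z) = ?w (?j + 1) (cell_diff M ?j ?z)"
      by (rule bd_eqI[OF lin_comp[OF P lin_cell_diff[OF M']] lin_comp[OF lin_cell_diff[OF M] P] M wa(1) ws(1)[OF sub IH] z])
    then have d: "cell_diff M' ?j (?w ?j ?z) = \<zero>\<^bsub>pre M' (?j + 1)\<^esub>"
      by (simp only: cell_cases(3)[OF x] lin_zero[OF P])
    have "cell_proj N' f' ?j (?w ?j ?z) = v ?j (cell_proj N f ?j ?z)"
      by (rule bd_eqI[OF lin_comp[OF P lin_cell_proj[OF f']] lin_comp[OF lin_cell_proj[OF f] cm_lin[OF v]] M wa(2) ws(2)[OF sub IH] z])
    then have p: "cell_proj N' f' ?j (?w ?j ?z) = diff N' i (v i (val x))"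
      by (simp only: cell_cases(5)[OF x] cm_diff[OF v cell_cases(4)[OF x]])
    show ?case
      unfolding cell_map_eq[OF M' x]
    proof (rule cell.intros[OF lin_closed[OF P z] _ d cm_closed[OF v cell_cases(4)[OF x]] p])
      show "\<forall>y \<in> supp R (snd (?w ?j ?z)). cell M' N' f' ?j y"
        using wz unfolding cell_sum_def by (auto simp: free_simps(1))
    qed
  qed
  then show "cell M N f i x \<Longrightarrow> cell M' N' f' i (?\<gamma> i x)" .
  have closed: "?w i z \<in> carrier (cell_sum M' N' f' i)" if "z \<in> carrier (cell_sum M N f i)" for i z
    by (rule cell_push_closed[where \<gamma> = ?\<gamma>, OF u cells lin_closed[OF lin_cell_sum_pre[OF M] that]])
      (use that in \<open>auto simp: cell_sum_def free_simps(1)\<close>)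
  have l: "lin R (cell_sum M N f i) (cell_sum M' N' f' i) (?w i)" for i
    by (rule lin_sub[OF P lin_cell_sum_pre[OF M] lin_cell_sum_pre[OF M'] closed])
  have dl: "lin R (cell_sum M N f i) (pre M (i + 1)) (cell_diff M i)" for i
    by (rule lin_comp[OF lin_cell_sum_pre[OF M] lin_cell_diff[OF M]])
  have wl: "lin R (cell_sum M N f i) (pre M' i) (?w i)" for i
    by (rule lin_comp[OF lin_cell_sum_pre[OF M] P])
  show "cm R (cell_complex M N f) (cell_complex M' N' f') ?w"
  proof (rule cmI[OF complex_cell_complex[OF M] complex_cell_complex[OF M']])
    show "lin R (cmod (cell_complex M N f) i) (cmod (cell_complex M' N' f') i) (?w i)" for i using l by simp
    fix i z assume z: "z \<in> carrier (cmod (cell_complex M N f) i)"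
    have "cell_diff M' i (?w i z) = ?w (i + 1) (cell_diff M i z)"
      by (rule cell_sum_eqI[OF lin_comp[OF wl lin_cell_diff[OF M']] lin_comp[OF dl P] M wa(1) ws(1)[OF _ cells]]) (use z in simp_all)
    then show "?w (i + 1) (diff (cell_complex M N f) i z) = diff (cell_complex M' N' f') i (?w i z)"
      using z closed by (simp add: diff_cell_complex)
  qed
  show "cell_proj N' f' i (?w i z) = v i (cell_proj N f i z)" if z: "z \<in> carrier (cmod (cell_complex M N f) i)" for i z
    by (rule cell_sum_eqI[OF lin_comp[OF wl lin_cell_proj[OF f']] lin_comp[OF lin_comp[OF lin_cell_sum_pre[OF M] lin_cell_proj[OF f]] cm_lin[OF v]]
         M wa(2) ws(2)[OF _ cells]]) (use z in simp_all)
qed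

lemma cell_push_ident:
  assumes f: "cm R M N f" and u: "cm R M M u" and u1: "\<And>i x. x \<in> carrier (cmod M i) \<Longrightarrow> u i x = x"
    and v1: "\<And>i x. x \<in> carrier (cmod N i) \<Longrightarrow> v i x = x" and z: "z \<in> carrier (cmod (cell_complex M N f) i)"
  shows "cell_push M u (cell_map M N f M u v) i z = z"
proof -
  note M = cm_complex(1)[OF f]
  let ?\<gamma> = "cell_map M N f M u v"
  note P = lin_cell_push[OF u, of _ ?\<gamma>]
  have id: "?\<gamma> i x = x" if "cell M N f i x" for i x
    using that
  proof (induction rule: cell_induct)
    case (1 i x)
    have "cell_push M u ?\<gamma> (i + 1) (bd x) = bd x"
      by (rule bd_eqI[OF P lin_ident[OF module_pre[OF M]] M _ _ cell_cases(1)[OF 1(1)]])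
        (simp_all add: cell_push_incl[OF u] u1 cell_push_single[OF u] 1(2))
    then show ?case
      unfolding cell_map_eq[OF M 1(1)] using cell_cases(4,6)[OF 1(1)] by (simp add: v1)
  qed
  show ?thesis
    by (rule cell_sum_eqI[OF lin_comp[OF lin_cell_sum_pre[OF M] P] lin_cell_sum_pre[OF M] M])
      (use z in \<open>simp_all add: cell_push_incl[OF u] u1 cell_push_single[OF u] id\<close>)
qed

text \<open>Holds on the nose: by induction both sides name the cell with the same pushed boundary
  and the same value. This strictness is what a functorial factorization demands.\<close>

lemma cell_push_comp:
  assumes f: "cm R M N f" and f': "cm R M' N' f'" and u: "cm R M M' u" and v: "cm R N N' v"
    and sq: "\<And>i x. x \<in> carrier (cmod M i) \<Longrightarrow> f' i (u i x) = v i (f i x)"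
    and u': "cm R M' M'' u'" and u'': "cm R M M'' u''"
    and uu: "\<And>i x. x \<in> carrier (cmod M i) \<Longrightarrow> u'' i x = u' i (u i x)"
    and vv: "\<And>i x. x \<in> carrier (cmod N i) \<Longrightarrow> v'' i x = v' i (v i x)" and z: "z \<in> carrier (cmod (cell_complex M N f) i)"
  shows "cell_push M'' u'' (cell_map M N f M'' u'' v'') i z =
    cell_push M'' u' (cell_map M' N' f' M'' u' v') i (cell_push M' u (cell_map M N f M' u v) i z)"
proof -
  note M = cm_complex(1)[OF f]
  let ?\<gamma> = "cell_map M N f M' u v" and ?\<gamma>' = "cell_map M' N' f' M'' u' v'" and ?\<gamma>'' = "cell_map M N f M'' u'' v''"
  note P = lin_cell_push[OF u, of _ ?\<gamma>] and P' = lin_cell_push[OF u', of _ ?\<gamma>'] and P'' = lin_cell_push[OF u'', of _ ?\<gamma>'']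
  note simps = cell_push_incl[OF u] cell_push_incl[OF u'] cell_push_incl[OF u''] cell_push_single[OF u]
    cell_push_single[OF u'] cell_push_single[OF u''] uu cm_closed[OF u]
  have id: "?\<gamma>'' i x = ?\<gamma>' i (?\<gamma> i x)" if "cell M N f i x" for i x
    using that
  proof (induction rule: cell_induct)
    case (1 i x)
    note x' = cell_map_cell[OF f f' u v sq 1(1)]
    have "cell_push M'' u'' ?\<gamma>'' (i + 1) (bd x) = cell_push M'' u' ?\<gamma>' (i + 1) (cell_push M' u ?\<gamma> (i + 1) (bd x))"
      by (rule bd_eqI[OF P'' lin_comp[OF P P'] M _ _ cell_cases(1)[OF 1(1)]]) (simp_all add: simps 1(2))
    moreover have "?\<gamma>'' i x = cell_name (cell_push M'' u'' ?\<gamma>'' (i + 1) (bd x)) (v'' i (val x))"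
      by (rule cell_map_eq[OF cm_complex(2)[OF u''] 1(1)])
    moreover have "?\<gamma>' i (?\<gamma> i x) = cell_name (cell_push M'' u' ?\<gamma>' (i + 1) (bd (?\<gamma> i x))) (v' i (val (?\<gamma> i x)))"
      by (rule cell_map_eq[OF cm_complex(2)[OF u'] x'])
    ultimately show ?case
      by (simp only: bd_cell_map[OF u 1(1)] vv[OF cell_cases(4)[OF 1(1)]])
  qed
  show ?thesis
    by (rule cell_sum_eqI[OF lin_comp[OF lin_cell_sum_pre[OF M] P''] lin_comp[OF lin_comp[OF lin_cell_sum_pre[OF M] P] P'] M])
      (use z in \<open>simp_all add: simps id\<close>)
qed

lemma inj_enc_cells: "inj_on enc (carrier (cmod (cell_complex M N f) i))"
  by (rule inj_on_subset[OF inj_enc]) (auto simp: cell_sum_def free_simps)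

abbreviation cell_incl_arr where
  "cell_incl_arr f \<equiv> named_incl (src f) (cell_complex (src f) (tgt f) (mor f)) (\<lambda>_. enc) (\<lambda>i m. (m, \<zero>\<^bsub>free R UNIV\<^esub>))"

abbreviation cell_proj_arr where
  "cell_proj_arr f \<equiv> named_proj (cell_complex (src f) (tgt f) (mor f)) (tgt f) (\<lambda>_. enc) (cell_proj (tgt f) (mor f))"

lemma cell_factorization:
  "\<exists>\<phi>. functorial_factorization (coCh R) \<phi> \<and> fob (fst \<phi>) = cell_incl_arr \<and> fob (snd \<phi>) = cell_proj_arr"
proof (rule coCh_factorizationI[where w = "\<lambda>f u v g. cell_push (src g) (mor u) (cell_map (src f) (tgt f) (mor f) (src g) (mor u) (mor v))"])
  fix f :: "(('r, 'a) cochain, 'a graded_map) arrow" assume f: "f \<in> Ar (coCh R)"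
  note F = coCh_cm[OF f]
  show "inj_on enc (carrier (cmod (cell_complex (src f) (tgt f) (mor f)) i))" for i by (rule inj_enc_cells)
  show "cm R (src f) (cell_complex (src f) (tgt f) (mor f)) (\<lambda>i m. (m, \<zero>\<^bsub>free R UNIV\<^esub>)) \<and>
     cm R (cell_complex (src f) (tgt f) (mor f)) (tgt f) (cell_proj (tgt f) (mor f)) \<and>
     (\<forall>i. \<forall>x \<in> carrier (cmod (src f) i). cell_proj (tgt f) (mor f) i (x, \<zero>\<^bsub>free R UNIV\<^esub>) = mor f i x)"
    using cm_cell_incl[OF cm_complex(1)[OF F]] cm_cell_proj[OF F] cell_proj_incl[OF F] by blast
  show "cell_push (src f) (mor (Ide (coCh R) (src f))) (cell_map (src f) (tgt f) (mor f) (src f) (mor (Ide (coCh R) (src f))) (mor (Ide (coCh R) (tgt f)))) i z = z"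
    if "z \<in> carrier (cmod (cell_complex (src f) (tgt f) (mor f)) i)" for i z
    by (rule cell_push_ident[OF F _ _ _ that])
      (auto intro: cm_cong[OF cm_ident[OF cm_complex(1)[OF F]]])
next
  fix f u v g :: "(('r, 'a) cochain, 'a graded_map) arrow"
  assume a: "Arrow f (u, v) g \<in> Ar (map_cat (coCh R))"
  note A = map_coChE[OF a]
  show "cm R (cell_complex (src f) (tgt f) (mor f)) (cell_complex (src g) (tgt g) (mor g))
       (cell_push (src g) (mor u) (cell_map (src f) (tgt f) (mor f) (src g) (mor u) (mor v))) \<and>
     (\<forall>i. \<forall>x \<in> carrier (cmod (src f) i). cell_push (src g) (mor u) (cell_map (src f) (tgt f) (mor f) (src g) (mor u) (mor v)) i (x, \<zero>\<^bsub>free R UNIV\<^esub>) =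
        (mor u i x, \<zero>\<^bsub>free R UNIV\<^esub>)) \<and>
     (\<forall>i. \<forall>z \<in> carrier (cmod (cell_complex (src f) (tgt f) (mor f)) i).
        cell_proj (tgt g) (mor g) i (cell_push (src g) (mor u) (cell_map (src f) (tgt f) (mor f) (src g) (mor u) (mor v)) i z) =
        mor v i (cell_proj (tgt f) (mor f) i z))"
    using cm_cell_push[OF A(1-4) A(9)] cell_proj_push[OF A(1-4) A(9)] cell_push_incl[OF A(3)] by blast
  fix u' v' g' :: "(('r, 'a) cochain, 'a graded_map) arrow" and i z
  assume b: "Arrow g (u', v') g' \<in> Ar (map_cat (coCh R))"
    and z: "z \<in> carrier (cmod (cell_complex (src f) (tgt f) (mor f)) i)"
  note B = map_coChE[OF b]
  show "cell_push (src g') (mor (u' \<cdot>\<^bsub>coCh R\<^esub> u)) (cell_map (src f) (tgt f) (mor f) (src g') (mor (u' \<cdot>\<^bsub>coCh R\<^esub> u)) (mor (v' \<cdot>\<^bsub>coCh R\<^esub> v))) i z =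
     cell_push (src g') (mor u') (cell_map (src g) (tgt g) (mor g) (src g') (mor u') (mor v')) i
      (cell_push (src g) (mor u) (cell_map (src f) (tgt f) (mor f) (src g) (mor u) (mor v)) i z)"
  proof (rule cell_push_comp[OF A(1-4) A(9) B(3) _ _ _ z])
    show "cm R (src f) (src g') (mor (u' \<cdot>\<^bsub>coCh R\<^esub> u))"
      by (rule cm_cong[OF cm_comp[OF A(3) B(3)]]) (simp add: A(5))
  qed (simp_all add: A(5,7))
qed

subsection \<open>The second factorization\<close>

text \<open>One disk per element of \<open>N\<close>. Since \<open>add_disks\<close> places
  \<open>G (i + 1)\<close> in degree \<open>i\<close>, the generators with index \<open>j\<close>
  are the elements of degree \<open>j - 1\<close>. Freeness on the underlying set is what lets these
  disks be lifted against every surjection.\<close>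

definition disk_gens :: "('r, 'a) cochain \<Rightarrow> int \<Rightarrow> ('r, 'a \<Rightarrow> 'r) module" where
  "disk_gens N j = free R (carrier (cmod N (j - 1)))"

definition disk_eval :: "('r, 'a) cochain \<Rightarrow> int \<Rightarrow> ('a \<Rightarrow> 'r) \<Rightarrow> 'a" where
  "disk_eval N i = lincomb R (cmod N i) (\<lambda>y. y)"

definition disk_push :: "('r, 'a) cochain \<Rightarrow> 'a graded_map \<Rightarrow> int \<Rightarrow> ('a \<Rightarrow> 'r) \<Rightarrow> 'a \<Rightarrow> 'r" where
  "disk_push N' v j = lincomb R (disk_gens N' j) (\<lambda>y. single R (v (j - 1) y))"

definition enc_disk :: "'a \<times> ('a \<Rightarrow> 'r) \<times> ('a \<Rightarrow> 'r) \<Rightarrow> 'a" where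
  "enc_disk = (\<lambda>(x, \<phi>, \<psi>). pr (x, pr (fr \<phi>, fr \<psi>)))"

lemma module_disk_gens: "module R (disk_gens N j)"
  by (simp add: disk_gens_def module_free)

lemma single_disk_gens: "y \<in> carrier (cmod N i) \<Longrightarrow> single R y \<in> carrier (disk_gens N (i + 1))"
  by (simp add: disk_gens_def single_closed)

lemma disk_gens_eqI:
  assumes "lin R (disk_gens N (i + 1)) B f" "lin R (disk_gens N (i + 1)) B g"
    and "\<And>y. y \<in> carrier (cmod N i) \<Longrightarrow> f (single R y) = g (single R y)" and "\<phi> \<in> carrier (disk_gens N (i + 1))"
  shows "f \<phi> = g \<phi>"
  by (rule free_eqI[where S = "carrier (cmod N i)" and N = B and f = f and g = g]) (use assms in \<open>simp_all add: disk_gens_def\<close>)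

lemma lin_disk_lincomb:
  "module R B \<Longrightarrow> (\<And>y. y \<in> carrier (cmod N i) \<Longrightarrow> g y \<in> carrier B) \<Longrightarrow> lin R (disk_gens N (i + 1)) B (lincomb R B g)"
  unfolding disk_gens_def by (rule lin_lincomb) simp_all

lemma lin_disk_eval: "cochain_complex R N \<Longrightarrow> lin R (disk_gens N (i + 1)) (cmod N i) (disk_eval N i)"
  unfolding disk_eval_def by (rule lin_disk_lincomb[OF complex_module])

lemma lin_disk_push: "cm R N N' v \<Longrightarrow> lin R (disk_gens N j) (disk_gens N' j) (disk_push N' v j)"
  using lin_disk_lincomb[OF module_disk_gens, of N "j - 1" "\<lambda>y. single R (v (j - 1) y)" N' j]
    single_disk_gens[of _ N' "j - 1"] cm_closed[of R N N' v]
  by (simp add: disk_push_def)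

lemma disk_push_single: "cm R N N' v \<Longrightarrow> y \<in> carrier (cmod N i) \<Longrightarrow> disk_push N' v (i + 1) (single R y) = single R (v i y)"
  unfolding disk_push_def
  by (subst lincomb_single[OF module_disk_gens]) (simp_all add: single_disk_gens cm_closed)

lemma disk_eval_single: "cochain_complex R N \<Longrightarrow> y \<in> carrier (cmod N i) \<Longrightarrow> disk_eval N i (single R y) = y"
  unfolding disk_eval_def by (rule lincomb_single[OF complex_module])

lemma inj_enc_disk: "inj_on enc_disk (carrier (cmod (add_disks M (disk_gens N)) i))"
proof (rule inj_onI)
  fix y z assume yz: "y \<in> carrier (cmod (add_disks M (disk_gens N)) i)" "z \<in> carrier (cmod (add_disks M (disk_gens N)) i)"
    and e: "enc_disk y = enc_disk z"
  have pr: "\<And>a b. pr a = pr b \<Longrightarrow> a = b" using inj_pr by (auto dest: injD)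
  have fr: "\<And>a b. a \<in> carrier (free R UNIV) \<Longrightarrow> b \<in> carrier (free R UNIV) \<Longrightarrow> fr a = fr b \<Longrightarrow> a = b"
    using inj_fr by (auto dest: inj_onD)
  obtain y1 y2 y3 z1 z2 z3 where y: "y = (y1, y2, y3)" "z = (z1, z2, z3)" by (cases y, cases z)
  have "y1 = z1" "fr y2 = fr z2" "fr y3 = fr z3" using e by (auto simp: enc_disk_def y dest!: pr)
  moreover have "y2 \<in> carrier (free R UNIV)" "y3 \<in> carrier (free R UNIV)" "z2 \<in> carrier (free R UNIV)" "z3 \<in> carrier (free R UNIV)"
    using yz by (auto simp: y disk_gens_def free_simps)
  ultimately show "y = z" using fr by (simp add: y)
qed

abbreviation "disk_zero N i \<equiv> \<zero>\<^bsub>disk_gens N i\<^esub>"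

text \<open>By \<open>cm_disk_out\<close> only a linear map on the generators has to be found, and
  these form free modules; so one preimage is chosen for each element of \<open>N\<close>.\<close>

lemma disk_lift:
  fixes Z :: "('r, 'a) cochain"
  assumes g: "cm R M Z g" and t: "cm R (add_disks M (disk_gens N)) Z' t" and p: "cm R Z Z' p"
    and surj: "\<forall>i. p i ` carrier (cmod Z i) = carrier (cmod Z' i)"
    and sq: "\<And>i m. m \<in> carrier (cmod M i) \<Longrightarrow> t i (m, disk_zero N (i + 1), disk_zero N i) = p i (g i m)"
  shows "\<exists>l. cm R (add_disks M (disk_gens N)) Z l \<and> (\<forall>i. \<forall>m \<in> carrier (cmod M i). l i (m, disk_zero N (i + 1), disk_zero N i) = g i m) \<and>
    (\<forall>i. \<forall>z \<in> carrier (cmod (add_disks M (disk_gens N)) i). p i (l i z) = t i z)"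
proof -
  note M = cm_complex(1)[OF g] and Z = cm_complex(2)[OF g] and Z' = cm_complex(2)[OF p]
  let ?A = "add_disks M (disk_gens N)" and ?t = "\<lambda>i y. t i (\<zero>\<^bsub>cmod M i\<^esub>, y, disk_zero N i)"
  define \<sigma> where "\<sigma> i y = (SOME e. e \<in> carrier (cmod Z i) \<and> p i e = ?t i (single R y))" for i y
  have tl: "lin R (disk_gens N (i + 1)) (cmod Z' i) (?t i)" for i
  proof (rule lin_comp[OF _ cm_lin[OF t]])
    show "lin R (disk_gens N (i + 1)) (cmod ?A i) (\<lambda>y. (\<zero>\<^bsub>cmod M i\<^esub>, y, disk_zero N i))"
      unfolding cmod_add_disks by (intro lin_pair lin_const_zero lin_ident module_disk_gens complex_module[OF M])
  qed
  have \<sigma>: "\<sigma> i y \<in> carrier (cmod Z i) \<and> p i (\<sigma> i y) = ?t i (single R y)" if y: "y \<in> carrier (cmod N i)" for i y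
  proof -
    have "?t i (single R y) \<in> p i ` carrier (cmod Z i)"
      using surj lin_closed[OF tl single_disk_gens[OF y]] by simp
    then have "\<exists>e. e \<in> carrier (cmod Z i) \<and> p i e = ?t i (single R y)" by auto
    then show ?thesis unfolding \<sigma>_def by (rule someI_ex)
  qed
  let ?s = "\<lambda>i. lincomb R (cmod Z i) (\<sigma> i)"
  have s: "lin R (disk_gens N (i + 1)) (cmod Z i) (?s i)" for i
    by (rule lin_disk_lincomb[OF complex_module[OF Z]]) (use \<sigma> in blast)
  note L = cm_disk_out[where G = "disk_gens N" and s = ?s, OF g module_disk_gens s]
  have ps: "p i (?s i y) = ?t i y" if "y \<in> carrier (disk_gens N (i + 1))" for i y
    by (rule disk_gens_eqI[OF lin_comp[OF s cm_lin[OF p]] tl _ that])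
      (use \<sigma> in \<open>simp add: lincomb_single[where g = "\<sigma> i", OF complex_module[OF Z]]\<close>)
  have "p i (disk_out Z g ?s i z) = t i z" if z: "z \<in> carrier (cmod ?A i)" for i z
    by (rule add_disks_eqI[where f = "\<lambda>i z. p i (disk_out Z g ?s i z)", OF cm_comp[OF L p] t M module_disk_gens _ _ z])
      (simp_all add: disk_out_incl[where G = "disk_gens N" and s = ?s, OF g module_disk_gens s]
        disk_out_gen[where G = "disk_gens N" and s = ?s, OF g module_disk_gens s] sq ps)
  then show ?thesis
    using L disk_out_incl[where G = "disk_gens N" and s = ?s, OF g module_disk_gens s] by blast
qed

lemma disk_eval_surj:
  assumes f: "cm R M N f"
  shows "\<forall>i. disk_out N f (disk_eval N) i ` carrier (cmod (add_disks M (disk_gens N)) i) = carrier (cmod N i)"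
proof
  fix i
  note N = cm_complex(2)[OF f]
  note D = cm_disk_out[where G = "disk_gens N" and s = "disk_eval N", OF f module_disk_gens lin_disk_eval[OF N]]
  show "disk_out N f (disk_eval N) i ` carrier (cmod (add_disks M (disk_gens N)) i) = carrier (cmod N i)"
  proof (rule equalityI; rule subsetI)
    fix y assume y: "y \<in> carrier (cmod N i)"
    have "disk_out N f (disk_eval N) i (\<zero>\<^bsub>cmod M i\<^esub>, single R y, disk_zero N i) = y"
      using disk_out_gen[where G = "disk_gens N" and s = "disk_eval N", OF f module_disk_gens lin_disk_eval[OF N] single_disk_gens[OF y]]
        disk_eval_single[OF N y] by simp
    moreover have "(\<zero>\<^bsub>cmod M i\<^esub>, single R y, disk_zero N i) \<in> carrier (cmod (add_disks M (disk_gens N)) i)"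
      using mod_zero[OF complex_module[OF cm_complex(1)[OF f]]] mod_zero[OF module_disk_gens] single_disk_gens[OF y] by simp
    ultimately show "y \<in> disk_out N f (disk_eval N) i ` carrier (cmod (add_disks M (disk_gens N)) i)" by (metis image_eqI)
  next
    fix y assume "y \<in> disk_out N f (disk_eval N) i ` carrier (cmod (add_disks M (disk_gens N)) i)"
    then show "y \<in> carrier (cmod N i)" using cm_closed[OF D] by auto
  qed
qed

abbreviation disk_incl_arr where
  "disk_incl_arr f \<equiv> named_incl (src f) (add_disks (src f) (disk_gens (tgt f))) (\<lambda>_. enc_disk)
     (\<lambda>i m. (m, disk_zero (tgt f) (i + 1), disk_zero (tgt f) i))"

abbreviation disk_proj_arr where
  "disk_proj_arr f \<equiv> named_proj (add_disks (src f) (disk_gens (tgt f))) (tgt f) (\<lambda>_. enc_disk)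
     (disk_out (tgt f) (mor f) (disk_eval (tgt f)))"

lemma disk_factorization:
  "\<exists>\<psi>. functorial_factorization (coCh R) \<psi> \<and> fob (fst \<psi>) = disk_incl_arr \<and> fob (snd \<psi>) = disk_proj_arr"
proof (rule coCh_factorizationI[where w = "\<lambda>f u v g i (x, y, z). (mor u i x, disk_push (tgt g) (mor v) (i + 1) y, disk_push (tgt g) (mor v) i z)"])
  fix f :: "(('r, 'a) cochain, 'a graded_map) arrow" assume f: "f \<in> Ar (coCh R)"
  note F = coCh_cm[OF f]
  note M = cm_complex(1)[OF F] and N = cm_complex(2)[OF F]
  let ?G = "disk_gens (tgt f)"
  show "inj_on enc_disk (carrier (cmod (add_disks (src f) (disk_gens (tgt f))) i))" for i by (rule inj_enc_disk)
  show "cm R (src f) (add_disks (src f) ?G) (\<lambda>i m. (m, disk_zero (tgt f) (i + 1), disk_zero (tgt f) i)) \<and>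
     cm R (add_disks (src f) ?G) (tgt f) (disk_out (tgt f) (mor f) (disk_eval (tgt f))) \<and>
     (\<forall>i. \<forall>x \<in> carrier (cmod (src f) i). disk_out (tgt f) (mor f) (disk_eval (tgt f)) i (x, disk_zero (tgt f) (i + 1), disk_zero (tgt f) i) = mor f i x)"
    using cm_disk_incl[where G = ?G, OF M module_disk_gens]
      cm_disk_out[where G = ?G and s = "disk_eval (tgt f)", OF F module_disk_gens lin_disk_eval[OF N]]
      disk_out_incl[where G = ?G and s = "disk_eval (tgt f)", OF F module_disk_gens lin_disk_eval[OF N]] by blast
  fix i z assume z: "z \<in> carrier (cmod (add_disks (src f) ?G) i)"
  let ?v = "mor (Ide (coCh R) (tgt f))"
  have v: "cm R (tgt f) (tgt f) ?v" by (rule cm_cong[OF cm_ident[OF N]]) simp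
  have id: "disk_push (tgt f) ?v (j + 1) \<phi> = \<phi>" if "\<phi> \<in> carrier (?G (j + 1))" for j \<phi>
    by (rule disk_gens_eqI[OF lin_disk_push[OF v] lin_ident[OF module_disk_gens] _ that])
      (simp only: disk_push_single[OF v], simp)
  \<comment> \<open>The previous fact has indices of the form \<open>j + 1\<close>; the third
    component of a disk element has index \<open>i\<close>, which is reached with
    \<open>j = i - 1\<close>.\<close>
  have "disk_push (tgt f) ?v i \<phi> = \<phi>" if "\<phi> \<in> carrier (?G i)" for \<phi> using id[of \<phi> "i - 1"] that by simp
  then show "(case z of (x, y, z) \<Rightarrow> (mor (Ide (coCh R) (src f)) i x, disk_push (tgt f) ?v (i + 1) y, disk_push (tgt f) ?v i z)) = z"
    using z id by auto
next
  fix f u v g :: "(('r, 'a) cochain, 'a graded_map) arrow"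
  assume a: "Arrow f (u, v) g \<in> Ar (map_cat (coCh R))"
  note A = map_coChE[OF a]
  note M = cm_complex(1)[OF A(1)] and N = cm_complex(2)[OF A(1)] and M' = cm_complex(1)[OF A(2)] and N' = cm_complex(2)[OF A(2)]
  let ?G = "disk_gens (tgt f)" and ?G' = "disk_gens (tgt g)"
  let ?w = "\<lambda>i (x, y, z). (mor u i x, disk_push (tgt g) (mor v) (i + 1) y, disk_push (tgt g) (mor v) i z)"
  let ?k = "disk_out (tgt f) (mor f) (disk_eval (tgt f))" and ?k' = "disk_out (tgt g) (mor g) (disk_eval (tgt g))"
  note W = cm_disk_map[where \<gamma> = "disk_push (tgt g) (mor v)", OF A(3) lin_disk_push[OF A(4)]]
  note K = cm_disk_out[where G = ?G and s = "disk_eval (tgt f)", OF A(1) module_disk_gens lin_disk_eval[OF N]]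
  note K' = cm_disk_out[where G = ?G' and s = "disk_eval (tgt g)", OF A(2) module_disk_gens lin_disk_eval[OF N']]
  have z0: "disk_push (tgt g) (mor v) i (disk_zero (tgt f) i) = disk_zero (tgt g) i" for i
    by (rule lin_zero[OF lin_disk_push[OF A(4)]])
  have ev: "disk_eval (tgt g) i (disk_push (tgt g) (mor v) (i + 1) y) = mor v i (disk_eval (tgt f) i y)"
    if "y \<in> carrier (?G (i + 1))" for i y
    by (rule disk_gens_eqI[OF lin_comp[OF lin_disk_push[OF A(4)] lin_disk_eval[OF N']] lin_comp[OF lin_disk_eval[OF N] cm_lin[OF A(4)]] _ that])
      (simp only: disk_push_single[OF A(4)] disk_eval_single[OF N] disk_eval_single[OF N' cm_closed[OF A(4)]])
  have kw: "?k' i (?w i z) = mor v i (?k i z)" if z: "z \<in> carrier (cmod (add_disks (src f) ?G) i)" for i z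
  proof (rule add_disks_eqI[where f = "\<lambda>i z. ?k' i (?w i z)" and g = "\<lambda>i z. mor v i (?k i z)", OF cm_comp[OF W K'] cm_comp[OF K A(4)] M module_disk_gens _ _ z])
    fix i x assume x: "x \<in> carrier (cmod (src f) i)"
    show "?k' i (?w i (x, disk_zero (tgt f) (i + 1), disk_zero (tgt f) i)) = mor v i (?k i (x, disk_zero (tgt f) (i + 1), disk_zero (tgt f) i))"
      by (simp only: prod.case z0 disk_out_incl[where G = ?G and s = "disk_eval (tgt f)", OF A(1) module_disk_gens lin_disk_eval[OF N] x]
        disk_out_incl[where G = ?G' and s = "disk_eval (tgt g)", OF A(2) module_disk_gens lin_disk_eval[OF N'] cm_closed[OF A(3) x]] A(9)[OF x])
  next
    fix i y assume y: "y \<in> carrier (?G (i + 1))"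
    show "?k' i (?w i (\<zero>\<^bsub>cmod (src f) i\<^esub>, y, disk_zero (tgt f) i)) = mor v i (?k i (\<zero>\<^bsub>cmod (src f) i\<^esub>, y, disk_zero (tgt f) i))"
      by (simp only: prod.case z0 lin_zero[OF cm_lin[OF A(3)]] disk_out_gen[where G = ?G and s = "disk_eval (tgt f)", OF A(1) module_disk_gens lin_disk_eval[OF N] y]
        disk_out_gen[where G = ?G' and s = "disk_eval (tgt g)", OF A(2) module_disk_gens lin_disk_eval[OF N'] lin_closed[OF lin_disk_push[OF A(4)] y]] ev[OF y])
  qed
  show "cm R (add_disks (src f) ?G) (add_disks (src g) ?G') ?w \<and>
     (\<forall>i. \<forall>x \<in> carrier (cmod (src f) i). ?w i (x, disk_zero (tgt f) (i + 1), disk_zero (tgt f) i) = (mor u i x, disk_zero (tgt g) (i + 1), disk_zero (tgt g) i)) \<and>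
     (\<forall>i. \<forall>z \<in> carrier (cmod (add_disks (src f) ?G) i). ?k' i (?w i z) = mor v i (?k i z))"
    using W kw z0 by simp
  fix u' v' g' :: "(('r, 'a) cochain, 'a graded_map) arrow" and i z
  assume b: "Arrow g (u', v') g' \<in> Ar (map_cat (coCh R))" and z: "z \<in> carrier (cmod (add_disks (src f) ?G) i)"
  note B = map_coChE[OF b]
  let ?v = "mor (v' \<cdot>\<^bsub>coCh R\<^esub> v)"
  have v: "cm R (tgt f) (tgt g') ?v" by (rule cm_cong[OF cm_comp[OF A(4) B(4)]]) (simp add: A(7))
  have c: "disk_push (tgt g') ?v (j + 1) \<phi> = disk_push (tgt g') (mor v') (j + 1) (disk_push (tgt g) (mor v) (j + 1) \<phi>)"
    if "\<phi> \<in> carrier (?G (j + 1))" for j \<phi>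
    by (rule disk_gens_eqI[OF lin_disk_push[OF v] lin_comp[OF lin_disk_push[OF A(4)] lin_disk_push[OF B(4)]] _ that])
      (simp only: disk_push_single[OF v] disk_push_single[OF A(4)] disk_push_single[OF B(4) cm_closed[OF A(4)]], simp add: A(7))
  have "disk_push (tgt g') ?v i \<phi> = disk_push (tgt g') (mor v') i (disk_push (tgt g) (mor v) i \<phi>)" if "\<phi> \<in> carrier (?G i)" for \<phi>
    using c[of \<phi> "i - 1"] that by simp
  then show "(case z of (x, y, z) \<Rightarrow> (mor (u' \<cdot>\<^bsub>coCh R\<^esub> u) i x, disk_push (tgt g') ?v (i + 1) y, disk_push (tgt g') ?v i z)) =
     (case ?w i z of (x, y, z) \<Rightarrow> (mor u' i x, disk_push (tgt g') (mor v') (i + 1) y, disk_push (tgt g') (mor v') i z))"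
    using z c A(5) by auto
qed

end


section \<open>Two-out-of-three and closure under retracts\<close>

lemma coh_bij_mor_comp:
  assumes f: "f \<in> Ar (coCh R)" and g: "g \<in> Ar (coCh R)" and fg: "tgt f = src g"
  shows "coh_bij (src f) (tgt g) (mor (g \<cdot>\<^bsub>coCh R\<^esub> f)) \<longleftrightarrow> coh_bij (src f) (tgt g) (\<lambda>i x. mor g i (mor f i x))"
  by (rule coh_bij_cong) simp

lemma qis_two_out_of_three:
  assumes f: "f \<in> Ar (coCh R)" and g: "g \<in> Ar (coCh R)" and fg: "Cod (coCh R) f = Dom (coCh R) g"
  shows "f \<in> qis R \<and> g \<in> qis R \<longrightarrow> g \<cdot>\<^bsub>coCh R\<^esub> f \<in> qis R"
    and "f \<in> qis R \<and> g \<cdot>\<^bsub>coCh R\<^esub> f \<in> qis R \<longrightarrow> g \<in> qis R"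
    and "g \<in> qis R \<and> g \<cdot>\<^bsub>coCh R\<^esub> f \<in> qis R \<longrightarrow> f \<in> qis R"
proof -
  have gf: "g \<cdot>\<^bsub>coCh R\<^esub> f \<in> Ar (coCh R)" by (rule category.Cmp_closed[OF category_coCh f g fg])
  have s: "tgt f = src g" using fg by simp
  have F: "cm R (src f) (tgt f) (mor f)" and G: "cm R (tgt f) (tgt g) (mor g)" using coCh_cm[OF f] coCh_cm[OF g] s by simp_all
  have 1: "f \<in> qis R \<longleftrightarrow> coh_bij (src f) (tgt f) (mor f)" using f by (simp add: qis_iff)
  have 2: "g \<in> qis R \<longleftrightarrow> coh_bij (tgt f) (tgt g) (mor g)" using g s by (simp add: qis_iff)
  have 3: "g \<cdot>\<^bsub>coCh R\<^esub> f \<in> qis R \<longleftrightarrow> coh_bij (src f) (tgt g) (\<lambda>i x. mor g i (mor f i x))"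
    using gf coh_bij_mor_comp[OF f g s] by (simp add: qis_iff del: coCh_simps(5)) simp
  show "f \<in> qis R \<and> g \<in> qis R \<longrightarrow> g \<cdot>\<^bsub>coCh R\<^esub> f \<in> qis R"
    "f \<in> qis R \<and> g \<cdot>\<^bsub>coCh R\<^esub> f \<in> qis R \<longrightarrow> g \<in> qis R"
    "g \<in> qis R \<and> g \<cdot>\<^bsub>coCh R\<^esub> f \<in> qis R \<longrightarrow> f \<in> qis R"
    unfolding 1 2 3 using coh_bij_comp[OF F G] coh_bij_cancel_right[OF F G] coh_bij_cancel_left[OF F G] by blast+
qed

lemma coCh_retractE:
  assumes "retract_of (coCh R) f g" "f \<in> Ar (coCh R)"
  obtains s1 s2 r1 r2 where "g \<in> Ar (coCh R)" "cm R (src f) (src g) s1" "cm R (tgt f) (tgt g) s2" "cm R (src g) (src f) r1" "cm R (tgt g) (tgt f) r2"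
    "\<forall>i. \<forall>x \<in> carrier (cmod (src f) i). s2 i (mor f i x) = mor g i (s1 i x)"
    "\<forall>i. \<forall>x \<in> carrier (cmod (src g) i). r2 i (mor g i x) = mor f i (r1 i x)"
    "\<forall>i. \<forall>x \<in> carrier (cmod (src f) i). r1 i (s1 i x) = x"
    "\<forall>i. \<forall>x \<in> carrier (cmod (tgt f) i). r2 i (s2 i x) = x"
proof -
  obtain s1 s2 r1 r2 where A: "g \<in> Ar (coCh R)" "s1 \<in> Ar (coCh R)" "s2 \<in> Ar (coCh R)" "r1 \<in> Ar (coCh R)" "r2 \<in> Ar (coCh R)"
    and d: "src s1 = src f" "tgt s1 = src g" "src s2 = tgt f" "tgt s2 = tgt g"
    "src r1 = src g" "tgt r1 = src f" "src r2 = tgt g" "tgt r2 = tgt f"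
    and e: "s2 \<cdot>\<^bsub>coCh R\<^esub> f = g \<cdot>\<^bsub>coCh R\<^esub> s1" "r2 \<cdot>\<^bsub>coCh R\<^esub> g = f \<cdot>\<^bsub>coCh R\<^esub> r1"
     "r1 \<cdot>\<^bsub>coCh R\<^esub> s1 = Ide (coCh R) (src f)" "r2 \<cdot>\<^bsub>coCh R\<^esub> s2 = Ide (coCh R) (tgt f)"
    by (rule category.retract_ofE[OF category_coCh assms, unfolded coCh_simps(2,3)])
  show ?thesis
  proof (rule that[OF A(1), of "mor s1" "mor s2" "mor r1" "mor r2"])
    show "cm R (src f) (src g) (mor s1)" "cm R (tgt f) (tgt g) (mor s2)" "cm R (src g) (src f) (mor r1)" "cm R (tgt g) (tgt f) (mor r2)"
      using coCh_cm[OF A(2)] coCh_cm[OF A(3)] coCh_cm[OF A(4)] coCh_cm[OF A(5)] d by simp_all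
    show "\<forall>i. \<forall>x \<in> carrier (cmod (src f) i). mor s2 i (mor f i x) = mor g i (mor s1 i x)"
      "\<forall>i. \<forall>x \<in> carrier (cmod (src g) i). mor r2 i (mor g i x) = mor f i (mor r1 i x)"
      "\<forall>i. \<forall>x \<in> carrier (cmod (src f) i). mor r1 i (mor s1 i x) = x"
      "\<forall>i. \<forall>x \<in> carrier (cmod (tgt f) i). mor r2 i (mor s2 i x) = x"
      using arg_cong[OF e(1), of mor] arg_cong[OF e(2), of mor] arg_cong[OF e(3), of mor] arg_cong[OF e(4), of mor] d
      by (simp_all add: restr_eq_iff)
  qed
qed

lemma retract_closed_qis: "retract_closed (coCh R) (qis R)"
  unfolding retract_closed_def
proof (intro ballI impI)
  fix f g assume f: "f \<in> Ar (coCh R)" and g: "g \<in> qis R" and r: "retract_of (coCh R) f g"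
  obtain s1 s2 r1 r2 where A: "g \<in> Ar (coCh R)" "cm R (src f) (src g) s1" "cm R (tgt f) (tgt g) s2" "cm R (src g) (src f) r1" "cm R (tgt g) (tgt f) r2"
    "\<forall>i. \<forall>x \<in> carrier (cmod (src f) i). s2 i (mor f i x) = mor g i (s1 i x)"
    "\<forall>i. \<forall>x \<in> carrier (cmod (src g) i). r2 i (mor g i x) = mor f i (r1 i x)"
    "\<forall>i. \<forall>x \<in> carrier (cmod (src f) i). r1 i (s1 i x) = x"
    "\<forall>i. \<forall>x \<in> carrier (cmod (tgt f) i). r2 i (s2 i x) = x"
    by (rule coCh_retractE[OF r f])
  have G: "coh_bij (src g) (tgt g) (mor g)" using g unfolding qis_iff by blast
  have "coh_bij (src f) (tgt f) (mor f)"
    by (rule coh_bij_retract[OF coCh_cm[OF f] coCh_cm[OF A(1)] A(2-5) _ _ _ _ G])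
      (simp_all only: A(6-9)[rule_format])
  then show "f \<in> qis R" using f by (simp add: qis_iff)
qed

lemma retract_closed_proj_fib: "retract_closed (coCh R) (proj_fib R)"
  unfolding retract_closed_def
proof (intro ballI impI)
  fix f g assume f: "f \<in> Ar (coCh R)" and g: "g \<in> proj_fib R" and r: "retract_of (coCh R) f g"
  obtain s1 s2 r1 r2 where A: "g \<in> Ar (coCh R)" "cm R (src f) (src g) s1" "cm R (tgt f) (tgt g) s2" "cm R (src g) (src f) r1" "cm R (tgt g) (tgt f) r2"
    "\<forall>i. \<forall>x \<in> carrier (cmod (src f) i). s2 i (mor f i x) = mor g i (s1 i x)"
    "\<forall>i. \<forall>x \<in> carrier (cmod (src g) i). r2 i (mor g i x) = mor f i (r1 i x)"
    "\<forall>i. \<forall>x \<in> carrier (cmod (src f) i). r1 i (s1 i x) = x"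
    "\<forall>i. \<forall>x \<in> carrier (cmod (tgt f) i). r2 i (s2 i x) = x"
    by (rule coCh_retractE[OF r f])
  have "\<exists>x \<in> carrier (cmod (src f) i). mor f i x = y" if y: "y \<in> carrier (cmod (tgt f) i)" for i y
  proof -
    have "s2 i y \<in> mor g i ` carrier (cmod (src g) i)" using g cm_closed[OF A(3) y] by (simp add: proj_fib_iff)
    then obtain x where x: "x \<in> carrier (cmod (src g) i)" "mor g i x = s2 i y" by auto
    have "mor f i (r1 i x) = y" using A(7)[rule_format, OF x(1)] A(9)[rule_format, OF y] x(2) by simp
    then show ?thesis using cm_closed[OF A(4) x(1)] by blast
  qed
  then show "f \<in> proj_fib R" using f cm_closed[OF coCh_cm[OF f]] unfolding proj_fib_iff by blast
qed

lemma triv_fib_arr: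
  assumes "p \<in> proj_fib R \<inter> qis R"
  shows "(\<forall>i. mor p i ` carrier (cmod (src p) i) = carrier (cmod (tgt p) i)) \<and> coh_bij (src p) (tgt p) (mor p)"
  using assms by (simp add: proj_fib_iff qis_iff)

section \<open>Lifting properties of the two factorizations\<close>

context universe
begin

lemma cell_incl_cof:
  assumes f: "f \<in> Ar (coCh R)"
  shows "cell_incl_arr f \<in> proj_cof R"
proof -
  note F = coCh_cm[OF f]
  note h = cm_cell_incl[where N = "tgt f" and f = "mor f", OF cm_complex(1)[OF F]]
  have "llp (coCh R) (cell_incl_arr f) p" if p: "p \<in> proj_fib R \<inter> qis R" for p
  proof (rule named_incl_llp[OF h inj_enc_cells])
    show P: "p \<in> Ar (coCh R)" using p by (simp add: proj_fib_iff)
    fix u v assume u: "cm R (src f) (src p) u" and v: "cm R (cell_complex (src f) (tgt f) (mor f)) (tgt p) v"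
      and sq: "\<And>j x. x \<in> carrier (cmod (src f) j) \<Longrightarrow> v j (x, \<zero>\<^bsub>free R UNIV\<^esub>) = mor p j (u j x)"
    show "\<exists>l. cm R (cell_complex (src f) (tgt f) (mor f)) (src p) l \<and> (\<forall>j. \<forall>x \<in> carrier (cmod (src f) j). l j (x, \<zero>\<^bsub>free R UNIV\<^esub>) = u j x) \<and>
        (\<forall>j. \<forall>z \<in> carrier (cmod (cell_complex (src f) (tgt f) (mor f)) j). mor p j (l j z) = v j z)"
      by (rule cell_lift[OF cm_complex(1)[OF F] u v coCh_cm[OF P] triv_fib_arr[OF p] sq])
  qed
  then show ?thesis using named_incl_arr[OF h inj_enc_cells] by (simp add: proj_cof_def)
qed

lemma cell_proj_triv_fib:
  assumes f: "f \<in> Ar (coCh R)"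
  shows "cell_proj_arr f \<in> proj_fib R \<inter> qis R"
  using named_proj_fib[OF cm_cell_proj[OF coCh_cm[OF f]] inj_enc_cells]
    named_proj_qis[OF cm_cell_proj[OF coCh_cm[OF f]] inj_enc_cells] triv_fib_cell_proj[OF coCh_cm[OF f]] by blast

lemma
  assumes f: "f \<in> Ar (coCh R)"
  shows disk_incl_llp: "p \<in> proj_fib R \<Longrightarrow> llp (coCh R) (disk_incl_arr f) p"
    and disk_incl_triv_cof: "disk_incl_arr f \<in> proj_cof R \<inter> qis R"
proof -
  note F = coCh_cm[OF f]
  note M = cm_complex(1)[OF F]
  note h = cm_disk_incl[where G = "disk_gens (tgt f)", OF M module_disk_gens]
  show L: "llp (coCh R) (disk_incl_arr f) p" if p: "p \<in> proj_fib R" for p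
  proof (rule named_incl_llp[OF h inj_enc_disk])
    show P: "p \<in> Ar (coCh R)" using p by (simp add: proj_fib_iff)
    fix u v assume u: "cm R (src f) (src p) u" and v: "cm R (add_disks (src f) (disk_gens (tgt f))) (tgt p) v"
      and sq: "\<And>j x. x \<in> carrier (cmod (src f) j) \<Longrightarrow> v j (x, disk_zero (tgt f) (j + 1), disk_zero (tgt f) j) = mor p j (u j x)"
    show "\<exists>l. cm R (add_disks (src f) (disk_gens (tgt f))) (src p) l \<and>
        (\<forall>j. \<forall>x \<in> carrier (cmod (src f) j). l j (x, disk_zero (tgt f) (j + 1), disk_zero (tgt f) j) = u j x) \<and>
        (\<forall>j. \<forall>z \<in> carrier (cmod (add_disks (src f) (disk_gens (tgt f))) j). mor p j (l j z) = v j z)"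
      by (rule disk_lift[OF u v coCh_cm[OF P] _ sq]) (use p in \<open>simp add: proj_fib_iff\<close>)
  qed
  show "disk_incl_arr f \<in> proj_cof R \<inter> qis R"
    using L named_incl_arr[OF h inj_enc_disk]
      named_incl_qis[OF h inj_enc_disk coh_bij_disk_incl[where G = "disk_gens (tgt f)", OF M module_disk_gens]]
    by (simp add: proj_cof_def)
qed

lemma disk_proj_fib:
  assumes f: "f \<in> Ar (coCh R)"
  shows "disk_proj_arr f \<in> proj_fib R"
proof -
  note F = coCh_cm[OF f]
  show ?thesis
    by (rule named_proj_fib[OF cm_disk_out[where G = "disk_gens (tgt f)" and s = "disk_eval (tgt f)", OF F module_disk_gens lin_disk_eval[OF cm_complex(2)[OF F]]]
        inj_enc_disk disk_eval_surj[OF F]])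
qed

lemma retract_closed_proj_cof: "retract_closed (coCh R) (proj_cof R)"
  by (rule category.retract_closed_llp[OF category_coCh, where P = "proj_fib R \<inter> qis R"]) (auto simp: proj_cof_def)

lemma disk_factor:
  assumes "f \<in> Ar (coCh R)"
  shows "disk_incl_arr f \<in> Ar (coCh R)" "disk_proj_arr f \<in> Ar (coCh R)" "disk_proj_arr f \<cdot>\<^bsub>coCh R\<^esub> disk_incl_arr f = f"
    and "Cod (coCh R) (disk_incl_arr f) = Dom (coCh R) (disk_proj_arr f)"
proof -
  obtain \<psi> where \<psi>: "functorial_factorization (coCh R) \<psi>" "fob (fst \<psi>) = disk_incl_arr" "fob (snd \<psi>) = disk_proj_arr"
    using disk_factorization by blast
  then show "disk_incl_arr f \<in> Ar (coCh R)" "disk_proj_arr f \<in> Ar (coCh R)" "disk_proj_arr f \<cdot>\<^bsub>coCh R\<^esub> disk_incl_arr f = f"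
    "Cod (coCh R) (disk_incl_arr f) = Dom (coCh R) (disk_proj_arr f)"
    using assms unfolding functorial_factorization_def factorization_of_def
    by (auto simp: fact_cat_def recompose_def id_functor_def split_beta simp del: coCh_simps(5) dest!: bspec[of _ _ f])
qed

lemma cell_factor:
  assumes "f \<in> Ar (coCh R)"
  shows "cell_incl_arr f \<in> Ar (coCh R)" "cell_proj_arr f \<in> Ar (coCh R)" "cell_proj_arr f \<cdot>\<^bsub>coCh R\<^esub> cell_incl_arr f = f"
    and "Cod (coCh R) (cell_incl_arr f) = Dom (coCh R) (cell_proj_arr f)"
proof -
  obtain \<phi> where \<phi>: "functorial_factorization (coCh R) \<phi>" "fob (fst \<phi>) = cell_incl_arr" "fob (snd \<phi>) = cell_proj_arr"
    using cell_factorization by blast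
  then show "cell_incl_arr f \<in> Ar (coCh R)" "cell_proj_arr f \<in> Ar (coCh R)" "cell_proj_arr f \<cdot>\<^bsub>coCh R\<^esub> cell_incl_arr f = f"
    "Cod (coCh R) (cell_incl_arr f) = Dom (coCh R) (cell_proj_arr f)"
    using assms unfolding functorial_factorization_def factorization_of_def
    by (auto simp: fact_cat_def recompose_def id_functor_def split_beta simp del: coCh_simps(5) dest!: bspec[of _ _ f])
qed

text \<open>The usual retract argument: a trivial cofibration is a retract of the first factor in its second factorization.\<close>

lemma triv_cof_llp:
  fixes i p :: "(('r, 'a) cochain, 'a graded_map) arrow"
  assumes i: "i \<in> proj_cof R \<inter> qis R" and p: "p \<in> proj_fib R"
  shows "llp (coCh R) i p"
proof -
  interpret C: category "coCh R" by (rule category_coCh)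
  have iA: "i \<in> Ar (coCh R)" using i by (simp add: proj_cof_def)
  note D = disk_factor[OF iA]
  have "disk_proj_arr i \<in> qis R"
    using qis_two_out_of_three(2)[OF D(1,2,4)] disk_incl_triv_cof[OF iA] i unfolding D(3) by blast
  then have "llp (coCh R) (disk_proj_arr i \<cdot>\<^bsub>coCh R\<^esub> disk_incl_arr i) (disk_proj_arr i)"
    unfolding D(3) using i disk_proj_fib[OF iA] unfolding proj_cof_def by blast
  then have "retract_of (coCh R) i (disk_incl_arr i)"
    using C.retract_of_factor[OF D(1,2,4)] unfolding D(3) by blast
  then show ?thesis by (rule C.llp_retract[OF _ iA disk_incl_llp[OF iA p]])
qed

lemma coCh_model:
  "\<exists>\<phi> \<psi>. model_structure (coCh R :: (('r, 'a) cochain, _) cat) (qis R) (proj_cof R) (proj_fib R) \<phi> \<psi>"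
proof -
  obtain \<phi> where \<phi>: "functorial_factorization (coCh R) \<phi>" "fob (fst \<phi>) = cell_incl_arr" "fob (snd \<phi>) = cell_proj_arr"
    using cell_factorization by blast
  obtain \<psi> where \<psi>: "functorial_factorization (coCh R) \<psi>" "fob (fst \<psi>) = disk_incl_arr" "fob (snd \<psi>) = disk_proj_arr"
    using disk_factorization by blast
  have "model_structure (coCh R) (qis R) (proj_cof R) (proj_fib R) \<phi> \<psi>"
  proof (rule model_structure.intro[OF category_coCh], unfold_locales)
    show "qis R \<subseteq> Ar (coCh R)" "proj_cof R \<subseteq> Ar (coCh R)" "proj_fib R \<subseteq> Ar (coCh R)"
      by (auto simp: qis_def proj_cof_def proj_fib_def)
    show "llp (coCh R) i p" if "i \<in> proj_cof R" "p \<in> proj_fib R \<inter> qis R" for i p :: "(('r, 'a) cochain, 'a graded_map) arrow"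
      using that unfolding proj_cof_def by blast
    fix f :: "(('r, 'a) cochain, 'a graded_map) arrow" assume f: "f \<in> Ar (coCh R)"
    show "fob (fst \<phi>) f \<in> proj_cof R \<and> fob (snd \<phi>) f \<in> proj_fib R \<inter> qis R"
      unfolding \<phi> using cell_incl_cof[OF f] cell_proj_triv_fib[OF f] by blast
    show "fob (fst \<psi>) f \<in> proj_cof R \<inter> qis R \<and> fob (snd \<psi>) f \<in> proj_fib R"
      unfolding \<psi> using disk_incl_triv_cof[OF f] disk_proj_fib[OF f] by blast
    fix g :: "(('r, 'a) cochain, 'a graded_map) arrow" assume g: "g \<in> Ar (coCh R)" "Cod (coCh R) f = Dom (coCh R) g"
    show "(f \<in> qis R \<and> g \<in> qis R \<longrightarrow> g \<cdot>\<^bsub>coCh R\<^esub> f \<in> qis R) \<and>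
         (f \<in> qis R \<and> g \<cdot>\<^bsub>coCh R\<^esub> f \<in> qis R \<longrightarrow> g \<in> qis R) \<and> (g \<in> qis R \<and> g \<cdot>\<^bsub>coCh R\<^esub> f \<in> qis R \<longrightarrow> f \<in> qis R)"
      using qis_two_out_of_three[OF f g] by blast
  qed (rule \<phi> \<psi> retract_closed_qis retract_closed_proj_cof retract_closed_proj_fib triv_cof_llp | assumption)+
  then show ?thesis by blast
qed

text \<open>Degreewise, a cofibration is a retract of the inclusion into a direct sum with a free module.\<close>

lemma
  fixes i :: "(('r, 'a) cochain, 'a graded_map) arrow"
  assumes i: "i \<in> proj_cof R"
  shows cof_inj: "\<lbrakk>x \<in> carrier (cmod (src i) j); x' \<in> carrier (cmod (src i) j); mor i j x = mor i j x'\<rbrakk> \<Longrightarrow> x = x'"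
    and cof_lift: "\<lbrakk>lin R (cmod (src i) j) A g; lin R (cmod (tgt i) j) B t; lin R A B p; p ` carrier A = carrier B;
      \<And>x. x \<in> carrier (cmod (src i) j) \<Longrightarrow> t (mor i j x) = p (g x)\<rbrakk> \<Longrightarrow>
      \<exists>s. lin R (cmod (tgt i) j) A s \<and> (\<forall>x \<in> carrier (cmod (src i) j). s (mor i j x) = g x) \<and>
        (\<forall>y \<in> carrier (cmod (tgt i) j). p (s y) = t y)"
proof -
  have iA: "i \<in> Ar (coCh R)" using i by (simp add: proj_cof_def)
  interpret C: category "coCh R" by (rule category_coCh)
  note F = coCh_cm[OF iA]
  note M = cm_complex(1)[OF F]
  note D = cell_factor[OF iA]
  let ?Q = "cell_complex (src i) (tgt i) (mor i)"
  have eQ: "inj_on ((\<lambda>_. enc) k) (carrier (cmod ?Q k))" for k :: int using inj_enc_cells by simp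
  note h = cm_cell_incl[where N = "tgt i" and f = "mor i", OF M] and k = cm_cell_proj[OF F]
  note U = cm_unname[where q = "\<lambda>_. enc", OF complex_cell_complex[OF M] eQ]
  note ue = unname[where q = "\<lambda>_. enc", OF complex_cell_complex[OF M] eQ]
  let ?u = "descend ?Q (\<lambda>_. enc) (\<lambda>i x. x)"
  \<comment> \<open>\<open>i\<close> lifts against the right factor of its own cellular
    factorization, a trivial fibration; this yields a section \<open>S\<close> of that factor that
    sends \<open>i\<close> to the left factor.\<close>
  have "llp (coCh R) (cell_proj_arr i \<cdot>\<^bsub>coCh R\<^esub> cell_incl_arr i) (cell_proj_arr i)"
    unfolding D(3) using i cell_proj_triv_fib[OF iA] unfolding proj_cof_def by blast
  then obtain S where S: "S \<in> Ar (coCh R)" "Dom (coCh R) S = Cod (coCh R) (cell_proj_arr i)" "Cod (coCh R) S = Dom (coCh R) (cell_proj_arr i)"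
    "S \<cdot>\<^bsub>coCh R\<^esub> i = cell_incl_arr i" "cell_proj_arr i \<cdot>\<^bsub>coCh R\<^esub> S = Ide (coCh R) (Cod (coCh R) (cell_proj_arr i))"
    using C.retract_of_factor[OF D(1,2,4)] unfolding D(3) by blast
  have SC: "cm R (tgt i) (img_complex ?Q (\<lambda>_. enc)) (mor S)" using coCh_cm[OF S(1)] S(2,3) by simp
  \<comment> \<open>\<open>S\<close> with the renaming undone: by \<open>si\<close> it carries
    \<open>i\<close> to the inclusion of the first summand, and by \<open>ks\<close> it is a section
    of \<open>cell_proj\<close>.\<close>
  define s where "s j y = ?u j (mor S j y)" for j y
  have sC: "cm R (tgt i) ?Q s" unfolding s_def by (rule cm_comp[OF SC U])
  have si: "s j (mor i j x) = (x, \<zero>\<^bsub>free R UNIV\<^esub>)" if x: "x \<in> carrier (cmod (src i) j)" for j x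
  proof -
    have "mor S j (mor i j x) = enc (x, \<zero>\<^bsub>free R UNIV\<^esub>)"
      using arg_cong[OF S(4), of mor] x by (simp add: restr_eq_iff)
    then show ?thesis unfolding s_def using ue[OF cm_closed[OF h x]] by simp
  qed
  have ks: "cell_proj (tgt i) (mor i) j (s j y) = y" if y: "y \<in> carrier (cmod (tgt i) j)" for j y
  proof -
    have "restr (tgt i) (\<lambda>j y. cell_proj (tgt i) (mor i) j (s j y)) = restr (tgt i) (\<lambda>j y. y)"
      using arg_cong[OF S(5), of mor] S(2) cm_closed[OF SC] by (simp add: restr_eq_iff s_def)
    then show ?thesis using y by (simp add: restr_eq_iff)
  qed
  show "x = x'" if "x \<in> carrier (cmod (src i) j)" "x' \<in> carrier (cmod (src i) j)" "mor i j x = mor i j x'"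
    using trans[OF si[OF that(1), symmetric] trans[OF arg_cong[OF that(3), of "s j"] si[OF that(2)]]] by blast
  assume g: "lin R (cmod (src i) j) A g" and t: "lin R (cmod (tgt i) j) B t" and p: "lin R A B p" and surj: "p ` carrier A = carrier B"
    and sq: "\<And>x. x \<in> carrier (cmod (src i) j) \<Longrightarrow> t (mor i j x) = p (g x)"
  let ?c = "{x. cell (src i) (tgt i) (mor i) j x}"
  have kl: "lin R (cell_sum (src i) (tgt i) (mor i) j) (cmod (tgt i) j) (cell_proj (tgt i) (mor i) j)" using cm_lin[OF k] by simp
  \<comment> \<open>One preimage is chosen for each cell of degree \<open>j\<close>. The cells form
    a basis of the free summand, so linear extension lifts \<open>t\<close> after
    \<open>cell_proj\<close>, and composing with \<open>s\<close> returns to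
    \<open>tgt i\<close>.\<close>
  define c where "c x = (SOME a. a \<in> carrier A \<and> p a = t (cell_proj (tgt i) (mor i) j (\<zero>\<^bsub>cmod (src i) j\<^esub>, single R x)))" for x
  have c: "c x \<in> carrier A \<and> p (c x) = t (cell_proj (tgt i) (mor i) j (\<zero>\<^bsub>cmod (src i) j\<^esub>, single R x))"
    if "cell (src i) (tgt i) (mor i) j x" for x
  proof -
    have "t (cell_proj (tgt i) (mor i) j (\<zero>\<^bsub>cmod (src i) j\<^esub>, single R x)) \<in> p ` carrier A"
      unfolding surj by (rule lin_closed[OF t lin_closed[OF kl single_in_cell_sum[OF M that]]])
    then have "\<exists>a. a \<in> carrier A \<and> p a = t (cell_proj (tgt i) (mor i) j (\<zero>\<^bsub>cmod (src i) j\<^esub>, single R x))" by auto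
    then show ?thesis unfolding c_def by (rule someI_ex)
  qed
  have el: "lin R (cell_sum (src i) (tgt i) (mor i) j) A (ext_map R A g c)"
    unfolding cell_sum_def by (rule lin_ext_map[OF g]) (use c in simp)
  have pe: "p (ext_map R A g c z) = t (cell_proj (tgt i) (mor i) j z)" if z: "z \<in> carrier (cell_sum (src i) (tgt i) (mor i) j)" for z
  proof (rule cell_sum_eqI[OF lin_comp[OF el p] lin_comp[OF kl t] M _ _ z])
    fix a assume a: "a \<in> carrier (cmod (src i) j)"
    show "p (ext_map R A g c (a, \<zero>\<^bsub>free R UNIV\<^esub>)) = t (cell_proj (tgt i) (mor i) j (a, \<zero>\<^bsub>free R UNIV\<^esub>))"
      by (simp only: ext_map_incl[OF g a] cell_proj_incl[OF F a] sq[OF a])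
  next
    fix x assume x: "cell (src i) (tgt i) (mor i) j x"
    show "p (ext_map R A g c (\<zero>\<^bsub>cmod (src i) j\<^esub>, single R x)) = t (cell_proj (tgt i) (mor i) j (\<zero>\<^bsub>cmod (src i) j\<^esub>, single R x))"
      using ext_map_single[where g = c, OF g] c[OF x] by simp
  qed
  show "\<exists>s. lin R (cmod (tgt i) j) A s \<and> (\<forall>x \<in> carrier (cmod (src i) j). s (mor i j x) = g x) \<and> (\<forall>y \<in> carrier (cmod (tgt i) j). p (s y) = t y)"
  proof (intro exI conjI ballI)
    show "lin R (cmod (tgt i) j) A (\<lambda>y. ext_map R A g c (s j y))"
      by (rule lin_comp[OF _ el]) (use cm_lin[OF sC, of j] in simp)
    show "ext_map R A g c (s j (mor i j x)) = g x" if "x \<in> carrier (cmod (src i) j)" for x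
      by (simp only: si[OF that] ext_map_incl[OF g that])
    show "p (ext_map R A g c (s j y)) = t y" if "y \<in> carrier (cmod (tgt i) j)" for y
      using pe[of "s j y"] cm_closed[OF sC that] ks[OF that] by simp
  qed
qed

end


section \<open>Complexes with a contracting homotopy\<close>

text \<open>The added term \<open>d \<tau> + \<tau> d\<close> commutes with the differentials, since
  composing it with \<open>d\<close> on either side leaves \<open>d \<tau> d\<close>.\<close>

lemma cm_homotopy:
  assumes f: "cm R M N f" and \<tau>: "\<And>i. lin R (cmod M i) (cmod N (i - 1)) (\<tau> i)"
  shows "cm R M N (\<lambda>i x. f i x \<oplus>\<^bsub>cmod N i\<^esub> (diff N (i - 1) (\<tau> i x) \<oplus>\<^bsub>cmod N i\<^esub> \<tau> (i + 1) (diff M i x)))"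
proof (rule cmI)
  note M = cm_complex(1)[OF f] and N = cm_complex(2)[OF f]
  show "cochain_complex R M" "cochain_complex R N" by (rule M, rule N)
  fix i
  have \<tau>': "lin R (cmod M (i + 1)) (cmod N i) (\<tau> (i + 1))" for i using \<tau>[of "i + 1"] by simp
  show "lin R (cmod M i) (cmod N i) (\<lambda>x. f i x \<oplus>\<^bsub>cmod N i\<^esub> (diff N (i - 1) (\<tau> i x) \<oplus>\<^bsub>cmod N i\<^esub> \<tau> (i + 1) (diff M i x)))"
    by (intro lin_plus cm_lin[OF f] lin_comp[OF \<tau> complex_diff'[OF N]] lin_comp[OF complex_diff[OF M] \<tau>'])
  fix x assume x: "x \<in> carrier (cmod M i)"
  interpret Nj: module R "cmod N (i + 1)" by (rule complex_module[OF N])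
  note dx = lin_closed[OF complex_diff[OF M] x]
  note c = cm_closed[OF f x] lin_closed[OF complex_diff'[OF N] lin_closed[OF \<tau> x]] lin_closed[OF \<tau>' dx]
  note c2 = lin_closed[OF complex_diff[OF N] c(1)] lin_closed[OF complex_diff[OF N] c(3)]
  have z: "\<tau> (i + 1 + 1) (diff M (i + 1) (diff M i x)) = \<zero>\<^bsub>cmod N (i + 1)\<^esub>"
    by (simp only: complex_dd[OF M x] lin_zero[OF \<tau>'])
  have "f (i + 1) (diff M i x) \<oplus>\<^bsub>cmod N (i + 1)\<^esub> (diff N (i + 1 - 1) (\<tau> (i + 1) (diff M i x)) \<oplus>\<^bsub>cmod N (i + 1)\<^esub> \<tau> (i + 1 + 1) (diff M (i + 1) (diff M i x))) =
    diff N i (f i x) \<oplus>\<^bsub>cmod N (i + 1)\<^esub> diff N i (\<tau> (i + 1) (diff M i x))"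
    unfolding z using c2 by (simp add: cm_diff[OF f x])
  also have "\<dots> = diff N i (f i x \<oplus>\<^bsub>cmod N i\<^esub> (diff N (i - 1) (\<tau> i x) \<oplus>\<^bsub>cmod N i\<^esub> \<tau> (i + 1) (diff M i x)))"
    using c c2 by (simp add: lin_add[OF complex_diff[OF N]] mod_add[OF complex_module[OF N]] complex_dd'[OF N lin_closed[OF \<tau> x]])
  finally show "f (i + 1) (diff M i x) \<oplus>\<^bsub>cmod N (i + 1)\<^esub> (diff N (i + 1 - 1) (\<tau> (i + 1) (diff M i x)) \<oplus>\<^bsub>cmod N (i + 1)\<^esub> \<tau> (i + 1 + 1) (diff M (i + 1) (diff M i x))) =
    diff N i (f i x \<oplus>\<^bsub>cmod N i\<^esub> (diff N (i - 1) (\<tau> i x) \<oplus>\<^bsub>cmod N i\<^esub> \<tau> (i + 1) (diff M i x)))" .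
qed

text \<open>A contraction is determined, up to the choice of the small complex, by a homotopy \<open>h\<close> with \<open>h h = 0\<close> and
  \<open>h d h = -h\<close>: the small complex is the image of the idempotent \<open>e = 1 + d h + h d\<close>.\<close>

locale h_complex =
  fixes R :: "('r, 'x) ring_scheme" and N :: "('r, 'b) cochain" and h :: "int \<Rightarrow> 'b \<Rightarrow> 'b"
  assumes complex: "cochain_complex R N"
    and h_lin: "lin R (cmod N i) (cmod N (i - 1)) (h i)"
    and h_h: "x \<in> carrier (cmod N i) \<Longrightarrow> h (i - 1) (h i x) = \<zero>\<^bsub>cmod N (i - 1 - 1)\<^esub>"
    and h_d_h: "x \<in> carrier (cmod N i) \<Longrightarrow> h i (diff N (i - 1) (h i x)) = \<ominus>\<^bsub>cmod N (i - 1)\<^esub> h i x"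
begin

lemma h_lin': "lin R (cmod N (i + 1)) (cmod N i) (h (i + 1))"
  using h_lin[of "i + 1"] by simp

lemmas mod = complex_module[OF complex]
lemmas d_lin = complex_diff[OF complex]
lemmas d_lin' = complex_diff'[OF complex]
lemmas h_closed = lin_closed[OF h_lin]
lemmas h_closed' = lin_closed[OF h_lin']
lemmas d_closed = lin_closed[OF d_lin]
lemmas d_closed' = lin_closed[OF d_lin']

lemma h_h': "x \<in> carrier (cmod N (i + 1)) \<Longrightarrow> h i (h (i + 1) x) = \<zero>\<^bsub>cmod N (i - 1)\<^esub>"
  using h_h[of x "i + 1"] by simp

definition e :: "int \<Rightarrow> 'b \<Rightarrow> 'b" where
  "e i x = x \<oplus>\<^bsub>cmod N i\<^esub> (diff N (i - 1) (h i x) \<oplus>\<^bsub>cmod N i\<^esub> h (i + 1) (diff N i x))"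

lemma cm_e: "cm R N N e"
  using cm_homotopy[OF cm_ident[OF complex] h_lin] by (simp add: e_def[abs_def])

lemmas e_closed = cm_closed[OF cm_e]

text \<open>\<open>h d h = -h\<close> cancels the leading term of \<open>e h\<close>, and
  \<open>h h = 0\<close> removes the remaining one.\<close>

lemma e_h: assumes x: "x \<in> carrier (cmod N i)" shows "e (i - 1) (h i x) = \<zero>\<^bsub>cmod N (i - 1)\<^esub>"
proof -
  interpret Nk: module R "cmod N (i - 1)" by (rule mod)
  have "e (i - 1) (h i x) = h i x \<oplus>\<^bsub>cmod N (i - 1)\<^esub> (diff N (i - 1 - 1) (h (i - 1) (h i x)) \<oplus>\<^bsub>cmod N (i - 1)\<^esub> h i (diff N (i - 1) (h i x)))"
    by (simp add: e_def)
  also have "\<dots> = \<zero>\<^bsub>cmod N (i - 1)\<^esub>"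
    using h_closed[OF x] by (simp only: h_h[OF x] h_d_h[OF x] lin_zero[OF d_lin']) (simp add: Nk.r_neg)
  finally show ?thesis .
qed

lemma h_e: assumes x: "x \<in> carrier (cmod N i)" shows "h i (e i x) = \<zero>\<^bsub>cmod N (i - 1)\<^esub>"
proof -
  interpret Nk: module R "cmod N (i - 1)" by (rule mod)
  note c = h_closed[OF x] d_closed'[OF h_closed[OF x]] d_closed[OF x] h_closed'[OF d_closed[OF x]]
  have "h i (e i x) = h i x \<oplus>\<^bsub>cmod N (i - 1)\<^esub> (h i (diff N (i - 1) (h i x)) \<oplus>\<^bsub>cmod N (i - 1)\<^esub> h i (h (i + 1) (diff N i x)))"
    using c x by (simp add: e_def lin_add[OF h_lin] mod_add[OF mod])
  also have "\<dots> = \<zero>\<^bsub>cmod N (i - 1)\<^esub>"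
    using c(1) by (simp only: h_h'[OF c(3)] h_d_h[OF x]) (simp add: Nk.r_neg)
  finally show ?thesis .
qed

text \<open>\<open>e\<close> commutes with \<open>d\<close> and \<open>h e = 0\<close>, so both
  correction terms of \<open>e\<close> vanish on its image.\<close>

lemma e_e: assumes x: "x \<in> carrier (cmod N i)" shows "e i (e i x) = e i x"
proof -
  interpret Ni: module R "cmod N i" by (rule mod)
  have "diff N i (e i x) = e (i + 1) (diff N i x)" by (rule cm_diff[OF cm_e x, symmetric])
  then have "h (i + 1) (diff N i (e i x)) = \<zero>\<^bsub>cmod N i\<^esub>" using h_e[OF d_closed[OF x]] by simp
  moreover have "diff N (i - 1) (h i (e i x)) = \<zero>\<^bsub>cmod N i\<^esub>" by (simp add: h_e[OF x] lin_zero[OF d_lin'])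
  ultimately show ?thesis using e_closed[OF x] by (subst e_def) simp
qed

text \<open>The identity \<open>1 = e - d h - h d\<close> seen through \<open>g\<close>, with the
  terms in the shape in which the corrected lift of \<open>llp_Contr\<close> produces them.\<close>

lemma e_decomp:
  assumes g: "cm R N A g" and x: "x \<in> carrier (cmod N i)"
  shows "g i (e i x) \<oplus>\<^bsub>cmod A i\<^esub> (diff A (i - 1) (\<ominus>\<^bsub>cmod A (i - 1)\<^esub> g (i - 1) (h i x)) \<oplus>\<^bsub>cmod A i\<^esub>
     \<ominus>\<^bsub>cmod A i\<^esub> g i (h (i + 1) (diff N i x))) = g i x"
proof -
  note A = cm_complex(2)[OF g]
  interpret Ai: module R "cmod A i" by (rule complex_module[OF A])
  note c = h_closed[OF x] d_closed'[OF h_closed[OF x]] h_closed'[OF d_closed[OF x]]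
  note gc = cm_closed[OF g x] cm_closed[OF g c(2)] cm_closed[OF g c(3)]
  have "g i (e i x) = g i x \<oplus>\<^bsub>cmod A i\<^esub> (g i (diff N (i - 1) (h i x)) \<oplus>\<^bsub>cmod A i\<^esub> g i (h (i + 1) (diff N i x)))"
    unfolding e_def using c x by (simp add: lin_add[OF cm_lin[OF g]] mod_add[OF mod])
  moreover have "diff A (i - 1) (\<ominus>\<^bsub>cmod A (i - 1)\<^esub> g (i - 1) (h i x)) = \<ominus>\<^bsub>cmod A i\<^esub> g i (diff N (i - 1) (h i x))"
    using lin_neg[OF complex_diff'[OF A] cm_closed[OF g c(1)]] by (simp add: cm_diff'[OF g c(1)])
  ultimately show ?thesis using gc by (simp only:) algebra
qed

lemma e_cohomologous:
  assumes x: "x \<in> cocycles N i" shows "cohomologous N i (e i x) x"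
proof -
  interpret Ni: module R "cmod N i" by (rule mod)
  have x': "x \<in> carrier (cmod N i)" by (rule cocycle_closed[OF x])
  note c = d_closed'[OF h_closed[OF x']]
  have "e i x = x \<oplus>\<^bsub>cmod N i\<^esub> diff N (i - 1) (h i x)"
    using x c by (simp add: e_def cocycle_iff lin_zero[OF h_lin'])
  then have "e i x \<ominus>\<^bsub>cmod N i\<^esub> x = (x \<oplus>\<^bsub>cmod N i\<^esub> diff N (i - 1) (h i x)) \<ominus>\<^bsub>cmod N i\<^esub> x" by simp
  also have "\<dots> = diff N (i - 1) (h i x)" using x' c by algebra
  finally show ?thesis unfolding cohomologous_def coboundary_iff using h_closed[OF x'] by blast
qed

end

text \<open>The composite on \<open>N\<close> has to be the identity only up to coboundaries and
  only on cocycles, which is the information given by \<open>e_cohomologous\<close>.\<close>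

lemma
  assumes f: "cm R M N f" and g: "cm R N M g"
    and gf: "\<And>i x. x \<in> carrier (cmod M i) \<Longrightarrow> g i (f i x) = x"
    and fg: "\<And>i x. x \<in> cocycles N i \<Longrightarrow> cohomologous N i (f i (g i x)) x"
  shows coh_bij_section: "coh_bij M N f" and coh_bij_retraction: "coh_bij N M g"
proof -
  note N = cm_complex(2)[OF f] and M = cm_complex(1)[OF f]
  show "coh_bij M N f"
    unfolding coh_bij_def
  proof (intro allI conjI ballI impI)
    fix i z z' assume z: "z \<in> cocycles M i" "z' \<in> cocycles M i" "cohomologous N i (f i z) (f i z')"
    then have "cohomologous M i (g i (f i z)) (g i (f i z'))"
      using cm_coh[OF g] by (simp add: cocycle_closed cm_closed[OF f])
    then show "cohomologous M i z z'" using z by (simp add: gf cocycle_closed)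
  next
    fix i w assume w: "w \<in> cocycles N i"
    show "\<exists>z \<in> cocycles M i. cohomologous N i (f i z) w" using fg[OF w] cm_cocycle[OF g w] by blast
  qed
  show "coh_bij N M g"
    unfolding coh_bij_def
  proof (intro allI conjI ballI impI)
    fix i z z' assume z: "z \<in> cocycles N i" "z' \<in> cocycles N i" "cohomologous M i (g i z) (g i z')"
    have c: "z \<in> carrier (cmod N i)" "z' \<in> carrier (cmod N i)" using z by (simp_all add: cocycle_closed)
    have c': "f i (g i z) \<in> carrier (cmod N i)" "f i (g i z') \<in> carrier (cmod N i)"
      using cm_closed[OF f cm_closed[OF g c(1)]] cm_closed[OF f cm_closed[OF g c(2)]] .
    have "cohomologous N i (f i (g i z)) (f i (g i z'))"
      by (rule cm_coh[OF f z(3) cm_closed[OF g c(1)] cm_closed[OF g c(2)]])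
    then have "cohomologous N i z (f i (g i z'))"
      using coh_trans[OF N coh_sym[OF N fg[OF z(1)] c'(1) c(1)] _ c(1) c'] by blast
    then show "cohomologous N i z z'" using coh_trans[OF N _ fg[OF z(2)] c(1) c'(2) c(2)] by blast
  next
    fix i w assume w: "w \<in> cocycles M i"
    have "g i (f i w) = w" by (rule gf[OF cocycle_closed[OF w]])
    then show "\<exists>z \<in> cocycles N i. cohomologous M i (g i z) w"
      using cm_cocycle[OF f w] coh_refl[OF M cocycle_closed[OF w]] by (intro bexI[of _ "f i w"]) simp_all
  qed
qed

lemma quasi_iso_restr: "cm R M N f \<Longrightarrow> coh_bij M N f \<Longrightarrow> quasi_iso R M N (restr M f)"
  using cm_restr[of R M N f] coh_bij_cong[of M f "restr M f" N] by (simp add: quasi_iso_iff cm_complex)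

section \<open>From homotopies to contractions and back\<close>

context h_complex
begin

text \<open>The image of \<open>e\<close> consists of elements of \<open>N\<close>, so
  \<open>e\<close> itself serves as projection and the identity function as inclusion;
  \<open>restr\<close> only makes the maps extensional.\<close>

definition contr :: "('r, 'b) contraction" where
  "contr = \<lparr>small = img_complex N e, big = N, incl = restr (img_complex N e) (\<lambda>i x. x), proj = restr N e, homot = restr N h\<rparr>"

lemma contr_simps [simp]: "big contr = N" "homot contr = restr N h"
  by (simp_all add: contr_def)

lemma contraction_contr: "contraction R contr"
proof -
  have q: "complex_cong R N e"
    using mod_cong_lin[OF cm_lin[OF cm_e]] cm_diff[OF cm_e] complex by (simp add: complex_cong_def)
  note P = cm_img_complex[OF q]
  have D: "cm R (img_complex N e) N (descend N e e)" by (rule cm_descend[OF q cm_e])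
  have De: "descend N e e i (e i x) = e i x" if "x \<in> carrier (cmod N i)" for i x
    by (rule descend_eq[OF _ that])
  \<comment> \<open>On the image of \<open>e\<close> the descent of \<open>e\<close> agrees with the
    identity function and so passes its linearity on to it.\<close>
  have I: "cm R (img_complex N e) N (\<lambda>i x. x)"
    by (rule cm_cong[OF D]) (auto simp: De)
  have gf: "e i a = a" if "a \<in> carrier (cmod (img_complex N e) i)" for i a
    using that e_e by auto
  have sec: "coh_bij (img_complex N e) N (\<lambda>i x. x)" "coh_bij N (img_complex N e) e"
    using coh_bij_section[OF I P gf e_cohomologous] coh_bij_retraction[OF I P gf e_cohomologous] by blast+
  have "acyclic_retraction R contr"
  proof (rule acyclic_retraction.intro)
    show "cochain_complex R (small contr)" "cochain_complex R (big contr)"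
      using cm_complex[OF P] by (simp_all add: contr_def)
    show "quasi_iso R (small contr) (big contr) (incl contr)" "quasi_iso R (big contr) (small contr) (proj contr)"
      using quasi_iso_restr[OF I sec(1)] quasi_iso_restr[OF P sec(2)] by (simp_all add: contr_def)
    show "proj contr i (incl contr i x) = x" if x: "x \<in> carrier (cmod (small contr) i)" for x i
    proof -
      obtain y where "y \<in> carrier (cmod N i)" "x = e i y" using x by (auto simp: contr_def)
      then show ?thesis using e_closed e_e by (simp add: contr_def)
    qed
  qed
  moreover have "contraction_axioms R contr"
  proof (rule contraction_axioms.intro)
    fix i
    show "homot contr i \<in> linear_maps R (cmod (big contr) i) (cmod (big contr) (i - 1))"
      using lin_restrict[OF h_lin[of i]] by (simp add: restr_def)
    show "homot contr i (incl contr i x) = \<zero>\<^bsub>cmod (big contr) (i - 1)\<^esub>" if x: "x \<in> carrier (cmod (small contr) i)" for x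
    proof -
      obtain y where "y \<in> carrier (cmod N i)" "x = e i y" using x by (auto simp: contr_def)
      then show ?thesis using e_closed h_e by (simp add: contr_def)
    qed
    fix x assume "x \<in> carrier (cmod (big contr) i)"
    then have x: "x \<in> carrier (cmod N i)" by simp
    interpret Ni: module R "cmod N i" by (rule mod)
    note c = d_closed'[OF h_closed[OF x]] h_closed'[OF d_closed[OF x]]
    show "proj contr (i - 1) (homot contr i x) = \<zero>\<^bsub>cmod (small contr) (i - 1)\<^esub>"
      using x h_closed[OF x] e_h[OF x] lin_zero[OF cm_lin[OF cm_e]] by (simp add: contr_def)
    show "homot contr (i - 1) (homot contr i x) = \<zero>\<^bsub>cmod (big contr) (i - 1 - 1)\<^esub>"
      using x h_closed[OF x] h_h[OF x] by simp
    have "incl contr i (proj contr i x) = e i x" using x by (simp add: contr_def)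
    moreover have "e i x \<ominus>\<^bsub>cmod N i\<^esub> x = diff N (i - 1) (h i x) \<oplus>\<^bsub>cmod N i\<^esub> h (i + 1) (diff N i x)"
      unfolding e_def using x c by algebra
    ultimately show "incl contr i (proj contr i x) \<ominus>\<^bsub>cmod (big contr) i\<^esub> x =
       diff (big contr) (i - 1) (homot contr i x) \<oplus>\<^bsub>cmod (big contr) i\<^esub> homot contr (i + 1) (diff (big contr) i x)"
      using x d_closed[OF x] by simp
  qed
  ultimately show ?thesis by (rule contraction.intro)
qed

end

text \<open>\<open>h\<close> is applied to both sides of the homotopy relation: the left side
  becomes \<open>-h\<close> because \<open>h\<close> kills the inclusion, the right side
  \<open>h d h\<close> because \<open>h h = 0\<close>.\<close>

lemma h_complex_contraction:
  assumes X: "contraction R X"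
  shows "h_complex R (big X) (homot X)"
proof -
  interpret contraction R X by fact
  note N = big_complex and M = small_complex
  have hl: "lin R (cmod (big X) i) (cmod (big X) (i - 1)) (homot X i)" for i
    using homot_linear[of i] linear_maps_iff[OF complex_module[OF N] complex_module[OF N]] by blast
  have hl': "lin R (cmod (big X) (i + 1)) (cmod (big X) i) (homot X (i + 1))" for i
    using hl[of "i + 1"] by simp
  have I: "cm R (small X) (big X) (incl X)" and P: "cm R (big X) (small X) (proj X)"
    using incl_quasi_iso proj_quasi_iso cochain_maps_iff[OF M N] cochain_maps_iff[OF N M] by (auto simp: quasi_iso_def)
  show ?thesis
  proof (rule h_complex.intro[OF N hl homot_homot])
    fix x i assume x: "x \<in> carrier (cmod (big X) i)"
    interpret Nk: module R "cmod (big X) (i - 1)" by (rule complex_module[OF N])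
    let ?hx = "homot X i x" and ?dx = "diff (big X) i x"
    note c = lin_closed[OF hl x] lin_closed[OF complex_diff[OF N] x]
    note c' = lin_closed[OF complex_diff'[OF N] c(1)] lin_closed[OF hl' c(2)]
    have ip: "incl X i (proj X i x) \<in> carrier (cmod (big X) i)" by (rule cm_closed[OF I cm_closed[OF P x]])
    have hh: "homot X i (homot X (i + 1) ?dx) = \<zero>\<^bsub>cmod (big X) (i - 1)\<^esub>" using homot_homot[OF c(2)] by simp
    have "homot X i (incl X i (proj X i x) \<ominus>\<^bsub>cmod (big X) i\<^esub> x) = \<ominus>\<^bsub>cmod (big X) (i - 1)\<^esub> ?hx"
      using c(1) by (simp add: lin_minus[OF hl ip x] homot_incl[OF cm_closed[OF P x]]) (simp add: a_minus_def)
    moreover have "homot X i (incl X i (proj X i x) \<ominus>\<^bsub>cmod (big X) i\<^esub> x) = homot X i (diff (big X) (i - 1) ?hx)"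
      unfolding homotopy[OF x] lin_add[OF hl c'] hh using lin_closed[OF hl c'(1)] by simp
    ultimately show "homot X i (diff (big X) (i - 1) ?hx) = \<ominus>\<^bsub>cmod (big X) (i - 1)\<^esub> ?hx" by simp
  qed
qed

section \<open>The category of contractions\<close>

lemma Contr_simps [simp]:
  "Ob (Contr R) = {X. contraction R X}" "Dom (Contr R) = src" "Cod (Contr R) = tgt"
  "Ide (Contr R) X = Arrow X (restr (big X) (\<lambda>i x. x)) X"
  "g \<cdot>\<^bsub>Contr R\<^esub> f = Arrow (src f) (restr (big (src f)) (\<lambda>i x. mor g i (mor f i x))) (tgt g)"
  by (simp_all add: Contr_def id_map_def comp_map_def restr_def compose_def)

lemma \<beta>\<alpha>_simps [simp]: "fob \<beta>\<alpha> X = big X" "far \<beta>\<alpha> f = Arrow (big (src f)) (mor f) (big (tgt f))"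
  by (simp_all add: forget_contraction_def functor_comp_def forget_retraction_def forget_homot_def retraction.truncate_def)

lemma Contr_arrI:
  assumes "contraction R X" "contraction R Y" and f: "cm R (big X) (big Y) f"
    and h: "\<And>i x. x \<in> carrier (cmod (big X) i) \<Longrightarrow> f (i - 1) (homot X i x) = homot Y i (f i x)"
  shows "Arrow X (restr (big X) f) Y \<in> Ar (Contr R)"
  using assms cm_restr[OF f] lin_closed[OF h_complex.h_lin[OF h_complex_contraction[OF assms(1)]]] by (simp add: Contr_def)

lemma
  assumes "a \<in> Ar (Contr R)"
  shows Contr_obs: "contraction R (src a)" "contraction R (tgt a)"
    and Contr_coCh: "far \<beta>\<alpha> a \<in> Ar (coCh R)"
    and Contr_cm: "cm R (big (src a)) (big (tgt a)) (mor a)"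
    and Contr_restr: "restr (big (src a)) (mor a) = mor a"
    and Contr_h: "x \<in> carrier (cmod (big (src a)) i) \<Longrightarrow> mor a (i - 1) (homot (src a) i x) = homot (tgt a) i (mor a i x)"
proof -
  from assms have A: "contraction R (src a)" "contraction R (tgt a)" "mor a \<in> cochain_maps R (big (src a)) (big (tgt a))"
    and h: "\<And>i x. x \<in> carrier (cmod (big (src a)) i) \<Longrightarrow> mor a (i - 1) (homot (src a) i x) = homot (tgt a) i (mor a i x)"
    by (auto simp: Contr_def)
  then show "contraction R (src a)" "contraction R (tgt a)" by blast+
  show "x \<in> carrier (cmod (big (src a)) i) \<Longrightarrow> mor a (i - 1) (homot (src a) i x) = homot (tgt a) i (mor a i x)" by (rule h)
  note N = h_complex.complex[OF h_complex_contraction[OF A(1)]] h_complex.complex[OF h_complex_contraction[OF A(2)]]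
  show "far \<beta>\<alpha> a \<in> Ar (coCh R)" using A(3) N by (simp add: coCh_def)
  show "cm R (big (src a)) (big (tgt a)) (mor a)" using A(3) cochain_maps_iff[OF N] by blast
  show "restr (big (src a)) (mor a) = mor a" by (rule cochain_maps_restr[OF N A(3)])
qed

lemma Contr_eqI:
  assumes "a \<in> Ar (Contr R)" "b \<in> Ar (Contr R)" "src a = src b" "tgt a = tgt b"
    "\<And>i x. x \<in> carrier (cmod (big (src a)) i) \<Longrightarrow> mor a i x = mor b i x"
  shows "a = b"
proof -
  have "mor a = mor b"
    using Contr_restr[OF assms(1)] Contr_restr[OF assms(2)] restr_eq_iff[of "big (src a)" "mor a" "mor b"] assms by auto
  then show ?thesis using assms by (simp add: arrow.expand)
qed

lemma category_Contr: "category (Contr R)"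
proof
  fix f assume f: "f \<in> Ar (Contr R)"
  note F = Contr_cm[OF f]
  show "Dom (Contr R) f \<in> Ob (Contr R)" "Cod (Contr R) f \<in> Ob (Contr R)" using Contr_obs[OF f] by auto
  have r: "Arrow (src f) (restr (big (src f)) (mor f)) (tgt f) = f" using Contr_restr[OF f] by simp
  show "f \<cdot>\<^bsub>Contr R\<^esub> Ide (Contr R) (Dom (Contr R) f) = f"
    by (subst (3) r[symmetric]) (simp add: restr_eq_iff)
  show "Ide (Contr R) (Cod (Contr R) f) \<cdot>\<^bsub>Contr R\<^esub> f = f"
    by (subst (3) r[symmetric]) (simp add: restr_eq_iff cm_closed[OF F])
  fix g assume g: "g \<in> Ar (Contr R)" and fg: "Cod (Contr R) f = Dom (Contr R) g"
  note G = Contr_cm[OF g]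
  have s: "src g = tgt f" using fg by simp
  show "g \<cdot>\<^bsub>Contr R\<^esub> f \<in> Ar (Contr R)"
    unfolding Contr_simps
  proof (rule Contr_arrI[OF Contr_obs(1)[OF f] Contr_obs(2)[OF g] cm_comp[OF F G[unfolded s]]])
    show "mor g (i - 1) (mor f (i - 1) (homot (src f) i x)) = homot (tgt g) i (mor g i (mor f i x))"
      if "x \<in> carrier (cmod (big (src f)) i)" for i x
      using Contr_h[OF f that] Contr_h[OF g, of "mor f i x" i] cm_closed[OF F that] by (simp add: s)
  qed
  show "Dom (Contr R) (g \<cdot>\<^bsub>Contr R\<^esub> f) = Dom (Contr R) f" "Cod (Contr R) (g \<cdot>\<^bsub>Contr R\<^esub> f) = Cod (Contr R) g"
    by simp_all
  fix h assume h: "h \<in> Ar (Contr R)" and gh: "Cod (Contr R) g = Dom (Contr R) h"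
  show "h \<cdot>\<^bsub>Contr R\<^esub> (g \<cdot>\<^bsub>Contr R\<^esub> f) = h \<cdot>\<^bsub>Contr R\<^esub> g \<cdot>\<^bsub>Contr R\<^esub> f"
    by (simp add: restr_eq_iff cm_closed[OF F] fg[simplified, symmetric])
next
  fix X assume "X \<in> Ob (Contr R)"
  then have X: "contraction R X" by simp
  show "Ide (Contr R) X \<in> Ar (Contr R)"
    unfolding Contr_simps
    by (rule Contr_arrI[OF X X cm_ident[OF h_complex.complex[OF h_complex_contraction[OF X]]]]) simp
qed simp_all

lemma functor_\<beta>\<alpha>: "is_functor (Contr R) (coCh R) \<beta>\<alpha>"
  unfolding is_functor_def
  using h_complex.complex[OF h_complex_contraction] Contr_coCh by (auto simp del: \<beta>\<alpha>_simps(2)) auto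

text \<open>A lift \<open>l\<close> of complexes is made compatible with the homotopies by passing to
  \<open>e l e + d \<tau> + \<tau> d\<close>, where \<open>\<tau> = h d l h\<close>.\<close>

lemma llp_Contr:
  assumes i: "i \<in> Ar (Contr R)" and p: "p \<in> Ar (Contr R)" and lift: "llp (coCh R) (far \<beta>\<alpha> i) (far \<beta>\<alpha> p)"
  shows "llp (Contr R) i p"
proof (rule category.llpI[OF category_Contr])
  fix u v assume u: "u \<in> Ar (Contr R)" "Dom (Contr R) u = Dom (Contr R) i" "Cod (Contr R) u = Dom (Contr R) p"
    and v: "v \<in> Ar (Contr R)" "Dom (Contr R) v = Cod (Contr R) i" "Cod (Contr R) v = Cod (Contr R) p"
    and sq: "v \<cdot>\<^bsub>Contr R\<^esub> i = p \<cdot>\<^bsub>Contr R\<^esub> u"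
  define N Q Z B where "N = big (src i)" and "Q = big (tgt i)" and "Z = big (src p)" and "B = big (tgt p)"
  define hN hQ hZ hB where "hN = homot (src i)" and "hQ = homot (tgt i)" and "hZ = homot (src p)" and "hB = homot (tgt p)"
  note defs = N_def Q_def Z_def B_def hN_def hQ_def hZ_def hB_def
  interpret N: h_complex R N hN unfolding defs by (rule h_complex_contraction[OF Contr_obs(1)[OF i]])
  interpret Q: h_complex R Q hQ unfolding defs by (rule h_complex_contraction[OF Contr_obs(2)[OF i]])
  interpret Z: h_complex R Z hZ unfolding defs by (rule h_complex_contraction[OF Contr_obs(1)[OF p]])
  interpret B: h_complex R B hB unfolding defs by (rule h_complex_contraction[OF Contr_obs(2)[OF p]])
  have su: "src u = src i" "tgt u = src p" "src v = tgt i" "tgt v = tgt p" using u v by simp_all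
  have I: "cm R N Q (mor i)" and P: "cm R Z B (mor p)" and U: "cm R N Z (mor u)" and V: "cm R Q B (mor v)"
    using Contr_cm[OF i] Contr_cm[OF p] Contr_cm[OF u(1)] Contr_cm[OF v(1)] by (simp_all add: defs su)
  have Ih: "mor i (j - 1) (hN j x) = hQ j (mor i j x)" and Uh: "mor u (j - 1) (hN j x) = hZ j (mor u j x)"
    if "x \<in> carrier (cmod N j)" for j x
    using Contr_h[OF i, of x j] Contr_h[OF u(1), of x j] that by (simp_all add: defs su)
  have Ph: "mor p (j - 1) (hZ j x) = hB j (mor p j x)" if "x \<in> carrier (cmod Z j)" for j x
    using Contr_h[OF p, of x j] that by (simp add: defs)
  have Vh: "mor v (j - 1) (hQ j x) = hB j (mor v j x)" if "x \<in> carrier (cmod Q j)" for j x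
    using Contr_h[OF v(1), of x j] that by (simp add: defs su)
  have sq': "mor v j (mor i j x) = mor p j (mor u j x)" if "x \<in> carrier (cmod N j)" for j x
  proof -
    have "restr N (\<lambda>j x. mor v j (mor i j x)) = restr N (\<lambda>j x. mor p j (mor u j x))"
      using sq by (simp add: defs su)
    then show ?thesis using that unfolding restr_eq_iff by blast
  qed
  obtain l0 where l0: "cm R Q Z l0" "\<And>j x. x \<in> carrier (cmod N j) \<Longrightarrow> l0 j (mor i j x) = mor u j x"
    "\<And>j y. y \<in> carrier (cmod Q j) \<Longrightarrow> mor p j (l0 j y) = mor v j y"
    by (rule coCh_llpE[OF lift Contr_coCh[OF i] Contr_coCh[OF p], of "mor u" "mor v"])
      (use U V sq' in \<open>simp_all add: defs\<close>)
  \<comment> \<open>\<open>e l0 e\<close> commutes with the homotopies, both composites being zero,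
    but along \<open>i\<close> it gives \<open>u e\<close> instead of \<open>u\<close>. There
    \<open>\<tau>\<close> becomes \<open>u h d h = -u h\<close>, so the added terms
    \<open>d \<tau> + \<tau> d\<close> restore the missing part \<open>-d u h - u h d\<close>; the
    same computation works after \<open>p\<close>.\<close>
  define \<tau> where "\<tau> j y = hZ j (diff Z (j - 1) (l0 (j - 1) (hQ j y)))" for j y
  define l where "l j y = Z.e j (l0 j (Q.e j y)) \<oplus>\<^bsub>cmod Z j\<^esub> (diff Z (j - 1) (\<tau> j y) \<oplus>\<^bsub>cmod Z j\<^esub> \<tau> (j + 1) (diff Q j y))" for j y
  have \<tau>: "lin R (cmod Q j) (cmod Z (j - 1)) (\<tau> j)" for j
    unfolding \<tau>_def by (rule lin_comp[OF lin_comp[OF lin_comp[OF Q.h_lin cm_lin[OF l0(1)]] Z.d_lin'] Z.h_lin])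
  have \<tau>': "lin R (cmod Q (j + 1)) (cmod Z j) (\<tau> (j + 1))" for j using \<tau>[of "j + 1"] by simp
  have L: "cm R Q Z l"
    unfolding l_def by (rule cm_homotopy[OF cm_comp[OF cm_comp[OF Q.cm_e l0(1)] Z.cm_e] \<tau>])
  \<comment> \<open>Both sides equal \<open>-h d l0 h\<close>: in \<open>l h\<close> only
    \<open>\<tau> d h\<close> survives and in \<open>h l\<close> only \<open>h d \<tau>\<close>, and
    each is simplified by \<open>h d h = -h\<close>.\<close>
  have Lh: "l (j - 1) (hQ j y) = hZ j (l j y)" if y: "y \<in> carrier (cmod Q j)" for j y
  proof -
    interpret Zk: module R "cmod Z (j - 1)" by (rule Z.mod)
    let ?w = "l0 (j - 1) (hQ j y)"
    have w: "?w \<in> carrier (cmod Z (j - 1))" by (rule cm_closed[OF l0(1) Q.h_closed[OF y]])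
    note dw = Z.d_closed'[OF w]
    note hdw = Z.h_closed[OF dw]
    have dy: "diff Q j y \<in> carrier (cmod Q (j + 1))" by (rule Q.d_closed[OF y])
    have "\<tau> (j - 1) (hQ j y) = hZ (j - 1) (diff Z (j - 1 - 1) (l0 (j - 1 - 1) \<zero>\<^bsub>cmod Q (j - 1 - 1)\<^esub>))"
      by (simp only: \<tau>_def Q.h_h[OF y])
    then have 1: "\<tau> (j - 1) (hQ j y) = \<zero>\<^bsub>cmod Z (j - 1 - 1)\<^esub>"
      by (simp only: lin_zero[OF cm_lin[OF l0(1)]] lin_zero[OF Z.d_lin'] lin_zero[OF Z.h_lin])
    have "\<tau> j (diff Q (j - 1) (hQ j y)) = hZ j (diff Z (j - 1) (l0 (j - 1) (\<ominus>\<^bsub>cmod Q (j - 1)\<^esub> hQ j y)))"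
      by (simp only: \<tau>_def Q.h_d_h[OF y])
    then have 2: "\<tau> j (diff Q (j - 1) (hQ j y)) = \<ominus>\<^bsub>cmod Z (j - 1)\<^esub> hZ j (diff Z (j - 1) ?w)"
      by (simp only: lin_neg[OF cm_lin[OF l0(1)] Q.h_closed[OF y]] lin_neg[OF Z.d_lin' w] lin_neg[OF Z.h_lin dw])
    have "l (j - 1) (hQ j y) = \<ominus>\<^bsub>cmod Z (j - 1)\<^esub> hZ j (diff Z (j - 1) ?w)"
      using hdw 2 by (simp only: l_def Q.e_h[OF y] lin_zero[OF cm_lin[OF l0(1)]] lin_zero[OF cm_lin[OF Z.cm_e]] 1 lin_zero[OF Z.d_lin'])
          simp
    moreover have "hZ j (l j y) = \<ominus>\<^bsub>cmod Z (j - 1)\<^esub> hZ j (diff Z (j - 1) ?w)"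
    proof -
      note a = cm_closed[OF l0(1) Q.e_closed[OF y]]
      note c = Z.e_closed[OF a] Z.d_closed'[OF lin_closed[OF \<tau> y]] lin_closed[OF \<tau>' dy]
      have "hZ j (l j y) = hZ j (Z.e j (l0 j (Q.e j y))) \<oplus>\<^bsub>cmod Z (j - 1)\<^esub> (hZ j (diff Z (j - 1) (\<tau> j y)) \<oplus>\<^bsub>cmod Z (j - 1)\<^esub> hZ j (\<tau> (j + 1) (diff Q j y)))"
        unfolding l_def using c by (simp add: lin_add[OF Z.h_lin] mod_add[OF Z.mod])
      moreover have "hZ j (diff Z (j - 1) (\<tau> j y)) = \<ominus>\<^bsub>cmod Z (j - 1)\<^esub> hZ j (diff Z (j - 1) ?w)"
        unfolding \<tau>_def by (rule Z.h_d_h[OF dw])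
      moreover have "hZ j (\<tau> (j + 1) (diff Q j y)) = \<zero>\<^bsub>cmod Z (j - 1)\<^esub>"
        unfolding \<tau>_def by (rule Z.h_h', rule lin_closed[OF complex_diff'[OF Z.complex]], rule cm_closed[OF l0(1)], rule Q.h_closed[OF dy])
      ultimately show ?thesis using Z.h_e[OF a] hdw by simp
    qed
    ultimately show ?thesis by simp
  qed
  \<comment> \<open>\<open>e\<close> is natural for maps that commute with the differentials and the
    homotopies; the four sides of the square are treated one after the other.\<close>
  have Ie: "Q.e j (mor i j x) = mor i j (N.e j x)" and Ue: "Z.e j (mor u j x) = mor u j (N.e j x)" if x: "x \<in> carrier (cmod N j)" for j x
  proof -
    note c = N.h_closed[OF x] N.d_closed'[OF N.h_closed[OF x]] N.h_closed'[OF N.d_closed[OF x]]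
    have h': "mor i j (hN (j + 1) (diff N j x)) = hQ (j + 1) (mor i (j + 1) (diff N j x))"
      "mor u j (hN (j + 1) (diff N j x)) = hZ (j + 1) (mor u (j + 1) (diff N j x))"
      using Ih[OF N.d_closed[OF x]] Uh[OF N.d_closed[OF x]] by simp_all
    show "Q.e j (mor i j x) = mor i j (N.e j x)"
      using c x mod_add[OF N.mod c(2,3)] h' by (simp add: Q.e_def N.e_def lin_add[OF cm_lin[OF I]] cm_diff'[OF I] cm_diff[OF I] Ih)
    show "Z.e j (mor u j x) = mor u j (N.e j x)"
      using c x mod_add[OF N.mod c(2,3)] h' by (simp add: Z.e_def N.e_def lin_add[OF cm_lin[OF U]] cm_diff'[OF U] cm_diff[OF U] Uh)
  qed
  have Ve: "B.e j (mor v j x) = mor v j (Q.e j x)" if x: "x \<in> carrier (cmod Q j)" for j x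
  proof -
    note c = Q.h_closed[OF x] Q.d_closed'[OF Q.h_closed[OF x]] Q.h_closed'[OF Q.d_closed[OF x]]
    have h': "mor v j (hQ (j + 1) (diff Q j x)) = hB (j + 1) (mor v (j + 1) (diff Q j x))"
      using Vh[OF Q.d_closed[OF x]] by simp
    show ?thesis
      using c x mod_add[OF Q.mod c(2,3)] h' by (simp add: B.e_def Q.e_def lin_add[OF cm_lin[OF V]] cm_diff'[OF V] cm_diff[OF V] Vh)
  qed
  have Pe: "B.e j (mor p j x) = mor p j (Z.e j x)" if x: "x \<in> carrier (cmod Z j)" for j x
  proof -
    note c = Z.h_closed[OF x] Z.d_closed'[OF Z.h_closed[OF x]] Z.h_closed'[OF Z.d_closed[OF x]]
    have h': "mor p j (hZ (j + 1) (diff Z j x)) = hB (j + 1) (mor p (j + 1) (diff Z j x))"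
      using Ph[OF Z.d_closed[OF x]] by simp
    show ?thesis
      using c x mod_add[OF Z.mod c(2,3)] h' by (simp add: B.e_def Z.e_def lin_add[OF cm_lin[OF P]] cm_diff'[OF P] cm_diff[OF P] Ph)
  qed
  have \<tau>i: "\<tau> j (mor i j x) = \<ominus>\<^bsub>cmod Z (j - 1)\<^esub> mor u (j - 1) (hN j x)" if x: "x \<in> carrier (cmod N j)" for j x
  proof -
    note c = N.h_closed[OF x] N.d_closed'[OF N.h_closed[OF x]]
    have "\<tau> j (mor i j x) = hZ j (diff Z (j - 1) (l0 (j - 1) (mor i (j - 1) (hN j x))))"
      unfolding \<tau>_def Ih[OF x] ..
    also have "\<dots> = mor u (j - 1) (hN j (diff N (j - 1) (hN j x)))"
      by (simp only: l0(2)[OF c(1)] cm_diff'[OF U c(1), symmetric] Uh[OF c(2)])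
    finally show ?thesis by (simp only: N.h_d_h[OF x] lin_neg[OF cm_lin[OF U] c(1)])
  qed
  have p\<tau>: "mor p (j - 1) (\<tau> j y) = \<ominus>\<^bsub>cmod B (j - 1)\<^esub> mor v (j - 1) (hQ j y)" if y: "y \<in> carrier (cmod Q j)" for j y
  proof -
    note c = Q.h_closed[OF y] Q.d_closed'[OF Q.h_closed[OF y]]
    note w = cm_closed[OF l0(1) c(1)]
    have "mor p (j - 1) (\<tau> j y) = mor v (j - 1) (hQ j (diff Q (j - 1) (hQ j y)))"
      by (simp only: \<tau>_def Ph[OF Z.d_closed'[OF w]] cm_diff'[OF P w] l0(3)[OF c(1)] cm_diff'[OF V c(1), symmetric] Vh[OF c(2)])
    then show ?thesis by (simp only: Q.h_d_h[OF y] lin_neg[OF cm_lin[OF V] c(1)])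
  qed
  have li: "l j (mor i j x) = mor u j x" if x: "x \<in> carrier (cmod N j)" for j x
  proof -
    note c = N.e_closed[OF x] N.d_closed[OF x]
    have "Z.e j (l0 j (Q.e j (mor i j x))) = mor u j (N.e j x)"
      by (simp only: Ie[OF x] l0(2)[OF c(1)] Ue[OF c(1)] N.e_e[OF x])
    moreover have "\<tau> (j + 1) (diff Q j (mor i j x)) = \<ominus>\<^bsub>cmod Z j\<^esub> mor u j (hN (j + 1) (diff N j x))"
      using \<tau>i[OF c(2)] by (simp add: cm_diff[OF I x])
    ultimately show ?thesis unfolding l_def \<tau>i[OF x] using N.e_decomp[OF U x] by simp
  qed
  have pl: "mor p j (l j y) = mor v j y" if y: "y \<in> carrier (cmod Q j)" for j y
  proof -
    note c = Q.e_closed[OF y] Q.d_closed[OF y]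
    note a = cm_closed[OF l0(1) c(1)]
    note b = Z.e_closed[OF a] Z.d_closed'[OF lin_closed[OF \<tau> y]] lin_closed[OF \<tau>' c(2)]
    have "mor p j (Z.e j (l0 j (Q.e j y))) = mor v j (Q.e j y)"
      by (simp only: Pe[OF a, symmetric] l0(3)[OF c(1)] Ve[OF c(1)] Q.e_e[OF y])
    moreover have "mor p j (\<tau> (j + 1) (diff Q j y)) = \<ominus>\<^bsub>cmod B j\<^esub> mor v j (hQ (j + 1) (diff Q j y))"
      using p\<tau>[OF c(2)] by simp
    moreover have "mor p j (diff Z (j - 1) (\<tau> j y)) = diff B (j - 1) (\<ominus>\<^bsub>cmod B (j - 1)\<^esub> mor v (j - 1) (hQ j y))"
      by (simp only: cm_diff'[OF P lin_closed[OF \<tau> y]] p\<tau>[OF y])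
    moreover have "mor p j (l j y) = mor p j (Z.e j (l0 j (Q.e j y))) \<oplus>\<^bsub>cmod B j\<^esub>
       (mor p j (diff Z (j - 1) (\<tau> j y)) \<oplus>\<^bsub>cmod B j\<^esub> mor p j (\<tau> (j + 1) (diff Q j y)))"
      unfolding l_def by (simp only: lin_add[OF cm_lin[OF P]] b mod_add[OF Z.mod])
    ultimately show ?thesis using Q.e_decomp[OF V y] by simp
  qed
  let ?l = "Arrow (tgt i) (restr Q l) (src p)"
  have LA: "?l \<in> Ar (Contr R)"
    unfolding Q_def by (rule Contr_arrI[OF Contr_obs(2)[OF i] Contr_obs(1)[OF p]]) (use L Lh in \<open>simp_all add: defs\<close>)
  note C = category.Cmp_closed[OF category_Contr]
  show "\<exists>l \<in> Ar (Contr R). Dom (Contr R) l = Cod (Contr R) i \<and> Cod (Contr R) l = Dom (Contr R) p \<and> l \<cdot>\<^bsub>Contr R\<^esub> i = u \<and> p \<cdot>\<^bsub>Contr R\<^esub> l = v"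
  proof (intro bexI[OF _ LA] conjI)
    show "?l \<cdot>\<^bsub>Contr R\<^esub> i = u"
      by (rule Contr_eqI[OF C[OF i LA] u(1)]) (use su li cm_closed[OF I] in \<open>simp_all add: N_def\<close>)
    show "p \<cdot>\<^bsub>Contr R\<^esub> ?l = v"
      by (rule Contr_eqI[OF C[OF LA p] v(1)]) (use su pl in \<open>simp_all add: Q_def\<close>)
  qed simp_all
qed


section \<open>Pushing out along the free complex with homotopy\<close>

lemma h_complex_img:
  assumes "h_complex R L k" and q: "complex_cong R L q"
    and kq: "\<And>i x x'. \<lbrakk>x \<in> carrier (cmod L i); x' \<in> carrier (cmod L i); q i x = q i x'\<rbrakk> \<Longrightarrow> q (i - 1) (k i x) = q (i - 1) (k i x')"
  shows "h_complex R (img_complex L q) (descend L q (\<lambda>i x. q (i - 1) (k i x)))"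
proof -
  interpret L: h_complex R L k by fact
  let ?I = "img_complex L q" and ?k = "descend L q (\<lambda>i x. q (i - 1) (k i x))"
  note Q = cm_img_complex[OF q]
  note I = cm_complex(2)[OF Q]
  have eq: "?k i (q i x) = q (i - 1) (k i x)" if "x \<in> carrier (cmod L i)" for i x
    by (rule descend_eq[where f = "\<lambda>i x. q (i - 1) (k i x)", OF kq that])
  have mc: "mod_cong R (cmod L i) (q i)" for i using q unfolding complex_cong_def by blast
  show ?thesis
  proof (rule h_complex.intro[OF I])
    fix i
    have "lin R (cmod L i) (cmod ?I (i - 1)) (\<lambda>x. q (i - 1) (k i x))" by (rule lin_comp[OF L.h_lin cm_lin[OF Q]])
    then show "lin R (cmod ?I i) (cmod ?I (i - 1)) (?k i)"
      unfolding descend_def cmod_img_complex[of L q i] by (rule lin_induced[OF _ mc kq])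
    fix a assume "a \<in> carrier (cmod ?I i)"
    then obtain x where x: "a = q i x" "x \<in> carrier (cmod L i)" by auto
    show "?k (i - 1) (?k i a) = \<zero>\<^bsub>cmod ?I (i - 1 - 1)\<^esub>"
      by (simp only: x(1) eq[OF x(2)] eq[OF L.h_closed[OF x(2)]] L.h_h[OF x(2)] lin_zero[OF cm_lin[OF Q]])
    have "diff ?I (i - 1) (?k i a) = q i (diff L (i - 1) (k i x))"
      by (simp only: x(1) eq[OF x(2)] cm_diff'[OF Q L.h_closed[OF x(2)]])
    then show "?k i (diff ?I (i - 1) (?k i a)) = \<ominus>\<^bsub>cmod ?I (i - 1)\<^esub> ?k i a"
      by (simp only: x(1) eq[OF x(2)] eq[OF L.d_closed'[OF L.h_closed[OF x(2)]]] L.h_d_h[OF x(2)] lin_neg[OF cm_lin[OF Q] L.h_closed[OF x(2)]])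
  qed
qed

text \<open>For a complex \<open>Q\<close>, the complex \<open>add_disks Q (cmod Q)\<close> underlies the free contraction on \<open>Q\<close>: its element
  \<open>(x, y, z)\<close> now stands for \<open>x + h y + d h z\<close>, whence \<open>h (x, y, z) = (0, x - z, 0)\<close>.\<close>

definition free_homot :: "('r, 'a) cochain \<Rightarrow> int \<Rightarrow> 'a \<times> 'a \<times> 'a \<Rightarrow> 'a \<times> 'a \<times> 'a" where
  "free_homot Q i = (\<lambda>(x, y, z). (\<zero>\<^bsub>cmod Q (i - 1)\<^esub>, x \<ominus>\<^bsub>cmod Q i\<^esub> z, \<zero>\<^bsub>cmod Q (i - 1)\<^esub>))"

text \<open>For a contraction with big complex \<open>N\<close> and a map \<open>H\<close> from \<open>N\<close> to \<open>Q\<close>, the relations identify \<open>h (H n)\<close>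
  with \<open>H (h n)\<close>, and hence \<open>d h (H m)\<close> with \<open>H (d h m)\<close>. The quotient is the pushout in contractions of the free
  contraction on \<open>H\<close> along the counit of \<open>N\<close>.\<close>

definition rel_map :: "('r, 'a) cochain \<Rightarrow> 'a graded_map \<Rightarrow> ('r, 'a) cochain \<Rightarrow> 'a graded_map \<Rightarrow> int \<Rightarrow> 'a \<times> 'a \<Rightarrow> 'a \<times> 'a \<times> 'a" where
  "rel_map N h Q H i = (\<lambda>(n, m). (\<ominus>\<^bsub>cmod Q i\<^esub> H i (h (i + 1) n \<oplus>\<^bsub>cmod N i\<^esub> diff N (i - 1) (h i m)), H (i + 1) n, H i m))"

definition rels :: "('r, 'a) cochain \<Rightarrow> 'a graded_map \<Rightarrow> ('r, 'a) cochain \<Rightarrow> 'a graded_map \<Rightarrow> int \<Rightarrow> ('a \<times> 'a \<times> 'a) set" where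
  "rels N h Q H i = rel_map N h Q H i ` (carrier (cmod N (i + 1)) \<times> carrier (cmod N i))"

text \<open>A chosen representative of the coset, coded as a single element, so that the quotient
  has its elements in the universe again.\<close>

definition quo :: "('a \<times> 'a \<Rightarrow> 'a) \<Rightarrow> ('r, 'a) cochain \<Rightarrow> 'a graded_map \<Rightarrow> ('r, 'a) cochain \<Rightarrow> 'a graded_map \<Rightarrow> int \<Rightarrow> 'a \<times> 'a \<times> 'a \<Rightarrow> 'a" where
  "quo pr N h Q H i x = (case rep (cmod (add_disks Q (cmod Q)) i) (rels N h Q H i) x of (a, b, c) \<Rightarrow> pr (a, pr (b, c)))"

definition po :: "('a \<times> 'a \<Rightarrow> 'a) \<Rightarrow> ('r, 'a) cochain \<Rightarrow> 'a graded_map \<Rightarrow> ('r, 'a) cochain \<Rightarrow> 'a graded_map \<Rightarrow> ('r, 'a) cochain" where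
  "po pr N h Q H = img_complex (add_disks Q (cmod Q)) (quo pr N h Q H)"

definition po_homot :: "('a \<times> 'a \<Rightarrow> 'a) \<Rightarrow> ('r, 'a) cochain \<Rightarrow> 'a graded_map \<Rightarrow> ('r, 'a) cochain \<Rightarrow> 'a graded_map \<Rightarrow> 'a graded_map" where
  "po_homot pr N h Q H = descend (add_disks Q (cmod Q)) (quo pr N h Q H) (\<lambda>i x. quo pr N h Q H (i - 1) (free_homot Q i x))"

lemma free_minus:
  assumes Q: "cochain_complex R Q"
    and "x \<in> carrier (cmod Q i)" "y \<in> carrier (cmod Q (i + 1))" "z \<in> carrier (cmod Q i)"
      "x' \<in> carrier (cmod Q i)" "y' \<in> carrier (cmod Q (i + 1))" "z' \<in> carrier (cmod Q i)"
  shows "(x, y, z) \<ominus>\<^bsub>cmod (add_disks Q (cmod Q)) i\<^esub> (x', y', z') = (x \<ominus>\<^bsub>cmod Q i\<^esub> x', y \<ominus>\<^bsub>cmod Q (i + 1)\<^esub> y', z \<ominus>\<^bsub>cmod Q i\<^esub> z')"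
  using assms(2-) by (simp add: dsum_minus[OF complex_module[OF Q] module_dsum[OF complex_module[OF Q] complex_module[OF Q]]]
    dsum_minus[OF complex_module[OF Q] complex_module[OF Q]])

lemma diff_free':
  assumes "a \<in> carrier (cmod Q (i - 1))" "b \<in> carrier (cmod Q i)" "c \<in> carrier (cmod Q (i - 1))"
  shows "diff (add_disks Q (cmod Q)) (i - 1) (a, b, c) = (diff Q (i - 1) a, \<zero>\<^bsub>cmod Q (i + 1)\<^esub>, b)"
  using diff_add_disks[of a Q "i - 1" b "cmod Q" c] assms by simp

text \<open>The sign in \<open>x - z\<close> is what yields \<open>h d h = -h\<close>:
  \<open>d h (x, y, z)\<close> is \<open>(0, 0, x - z)\<close>, and \<open>h\<close> of this is
  minus \<open>h (x, y, z)\<close>.\<close>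

lemma h_complex_free:
  assumes Q: "cochain_complex R Q"
  shows "h_complex R (add_disks Q (cmod Q)) (free_homot Q)"
proof (rule h_complex.intro)
  let ?L = "add_disks Q (cmod Q)"
  note mQ = complex_module[OF Q]
  show C: "cochain_complex R ?L" by (rule complex_add_disks[OF Q mQ])
  fix i
  interpret Qi: module R "cmod Q i" by (rule mQ)
  interpret Qk: module R "cmod Q (i - 1)" by (rule mQ)
  interpret Ql: module R "cmod Q (i - 1 - 1)" by (rule mQ)
  have G2: "module R (dsum (cmod Q (i + 1)) (cmod Q i))" by (rule module_dsum[OF mQ mQ])
  note f = lin_fst[OF mQ G2, of i] and s = lin_comp[OF lin_snd[OF mQ G2, of i] lin_snd[OF mQ mQ]]
  have "lin R (dsum (cmod Q i) (dsum (cmod Q (i + 1)) (cmod Q i))) (dsum (cmod Q (i - 1)) (dsum (cmod Q i) (cmod Q (i - 1))))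
    (\<lambda>x. (\<zero>\<^bsub>cmod Q (i - 1)\<^esub>, fst x \<ominus>\<^bsub>cmod Q i\<^esub> snd (snd x), \<zero>\<^bsub>cmod Q (i - 1)\<^esub>))"
    by (intro lin_pair lin_diff[OF f s] lin_const_zero module_dsum mQ)
  then show "lin R (cmod ?L i) (cmod ?L (i - 1)) (free_homot Q i)"
    by (simp add: free_homot_def case_prod_unfold)
  fix a assume "a \<in> carrier (cmod ?L i)"
  then obtain x y z where a: "a = (x, y, z)" "x \<in> carrier (cmod Q i)" "y \<in> carrier (cmod Q (i + 1))" "z \<in> carrier (cmod Q i)" by auto
  have ha: "free_homot Q i a = (\<zero>\<^bsub>cmod Q (i - 1)\<^esub>, x \<ominus>\<^bsub>cmod Q i\<^esub> z, \<zero>\<^bsub>cmod Q (i - 1)\<^esub>)" by (simp add: a free_homot_def)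
  show "free_homot Q (i - 1) (free_homot Q i a) = \<zero>\<^bsub>cmod ?L (i - 1 - 1)\<^esub>"
    unfolding ha by (simp add: free_homot_def a_minus_def)
  have "diff ?L (i - 1) (free_homot Q i a) = (\<zero>\<^bsub>cmod Q i\<^esub>, \<zero>\<^bsub>cmod Q (i + 1)\<^esub>, x \<ominus>\<^bsub>cmod Q i\<^esub> z)"
    unfolding ha using a by (simp add: diff_free' lin_zero[OF complex_diff'[OF Q]])
  moreover have "\<ominus>\<^bsub>cmod ?L (i - 1)\<^esub> (\<zero>\<^bsub>cmod Q (i - 1)\<^esub>, x \<ominus>\<^bsub>cmod Q i\<^esub> z, \<zero>\<^bsub>cmod Q (i - 1)\<^esub>) =
     (\<zero>\<^bsub>cmod Q (i - 1)\<^esub>, \<ominus>\<^bsub>cmod Q i\<^esub> (x \<ominus>\<^bsub>cmod Q i\<^esub> z), \<zero>\<^bsub>cmod Q (i - 1)\<^esub>)"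
    using a by (simp add: dsum_neg[OF mQ module_dsum[OF mQ mQ]] dsum_neg[OF mQ mQ])
  moreover have "\<zero>\<^bsub>cmod Q i\<^esub> \<ominus>\<^bsub>cmod Q i\<^esub> (x \<ominus>\<^bsub>cmod Q i\<^esub> z) = \<ominus>\<^bsub>cmod Q i\<^esub> (x \<ominus>\<^bsub>cmod Q i\<^esub> z)"
    using a by algebra
  ultimately show "free_homot Q i (diff ?L (i - 1) (free_homot Q i a)) = \<ominus>\<^bsub>cmod ?L (i - 1)\<^esub> free_homot Q i a"
    unfolding ha by (simp add: free_homot_def)
qed

section \<open>The pushout and the maps out of it\<close>

locale pushout = h_complex R N h for R :: "('r, 'x) ring_scheme" and N :: "('r, 'a) cochain" and h +
  fixes Q :: "('r, 'a) cochain" and H :: "'a graded_map" and pr :: "'a \<times> 'a \<Rightarrow> 'a"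
  assumes H: "cm R N Q H" and inj_pr: "inj pr"
begin

abbreviation "L \<equiv> add_disks Q (cmod Q)"
abbreviation "q \<equiv> quo pr N h Q H"
abbreviation "P \<equiv> po pr N h Q H"
abbreviation "hP \<equiv> po_homot pr N h Q H"

lemmas Q = cm_complex(2)[OF H]
lemmas mQ = complex_module[OF Q]

sublocale L: h_complex R L "free_homot Q"
  by (rule h_complex_free[OF Q])

lemma lin_rel_map: "lin R (dsum (cmod N (i + 1)) (cmod N i)) (cmod L i) (rel_map N h Q H i)"
proof -
  note f = lin_fst[OF mod mod, of "i + 1" i] and s = lin_snd[OF mod mod, of "i + 1" i]
  have "lin R (dsum (cmod N (i + 1)) (cmod N i)) (cmod Q i) (\<lambda>x. \<ominus>\<^bsub>cmod Q i\<^esub> H i (h (i + 1) (fst x) \<oplus>\<^bsub>cmod N i\<^esub> diff N (i - 1) (h i (snd x))))"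
    by (intro lin_uminus lin_comp[OF lin_plus[OF lin_comp[OF f h_lin'] lin_comp[OF lin_comp[OF s h_lin] d_lin']] cm_lin[OF H]])
  then show ?thesis
    unfolding rel_map_def case_prod_unfold cmod_add_disks
    by (intro lin_pair lin_comp[OF f cm_lin[OF H]] lin_comp[OF s cm_lin[OF H]])
qed

lemma submodule_rels: "submodule (rels N h Q H i) R (cmod L i)"
  using submodule_image[OF lin_rel_map[of i]] by (simp add: rels_def)

lemma quo_eq_iff:
  assumes "x \<in> carrier (cmod L i)" "x' \<in> carrier (cmod L i)"
  shows "q i x = q i x' \<longleftrightarrow> x \<ominus>\<^bsub>cmod L i\<^esub> x' \<in> rels N h Q H i"
proof -
  have pr: "\<And>a b. pr a = pr b \<Longrightarrow> a = b" using inj_pr by (auto dest: injD)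
  have "q i x = q i x' \<longleftrightarrow> rep (cmod L i) (rels N h Q H i) x = rep (cmod L i) (rels N h Q H i) x'"
    unfolding quo_def by (auto split: prod.splits dest!: pr)
  then show ?thesis using rep_eq_iff[OF L.mod submodule_rels assms] by simp
qed

lemma rels_cases:
  assumes "r \<in> rels N h Q H i"
  obtains n m where "n \<in> carrier (cmod N (i + 1))" "m \<in> carrier (cmod N i)"
    "r = (\<ominus>\<^bsub>cmod Q i\<^esub> H i (h (i + 1) n \<oplus>\<^bsub>cmod N i\<^esub> diff N (i - 1) (h i m)), H (i + 1) n, H i m)"
  using assms by (auto simp: rels_def rel_map_def)

lemma relsI:
  assumes "n \<in> carrier (cmod N (i + 1))" "m \<in> carrier (cmod N i)"
    "r = (\<ominus>\<^bsub>cmod Q i\<^esub> H i (h (i + 1) n \<oplus>\<^bsub>cmod N i\<^esub> diff N (i - 1) (h i m)), H (i + 1) n, H i m)"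
  shows "r \<in> rels N h Q H i"
  unfolding rels_def by (rule image_eqI[of _ _ "(n, m)"]) (use assms in \<open>auto simp: rel_map_def\<close>)

lemma quo_kill:
  assumes T: "lin R (cmod L i) B T" and kill: "\<And>r. r \<in> rels N h Q H i \<Longrightarrow> T r = \<zero>\<^bsub>B\<^esub>"
    and x: "x \<in> carrier (cmod L i)" "x' \<in> carrier (cmod L i)" "q i x = q i x'"
  shows "T x = T x'"
proof -
  interpret B: module R B using lin_modules[OF T] by simp
  have "T x \<ominus>\<^bsub>B\<^esub> T x' = \<zero>\<^bsub>B\<^esub>"
    using kill[of "x \<ominus>\<^bsub>cmod L i\<^esub> x'"] x quo_eq_iff[OF x(1,2)] lin_minus[OF T x(1,2)] by simp
  moreover note lin_closed[OF T x(1)] lin_closed[OF T x(2)]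
  moreover from this have "T x = (T x \<ominus>\<^bsub>B\<^esub> T x') \<oplus>\<^bsub>B\<^esub> T x'" by algebra
  ultimately show ?thesis by simp
qed

lemma quo_rel:
  assumes r: "r \<in> rels N h Q H i" shows "q i r = \<zero>\<^bsub>cmod P i\<^esub>"
proof -
  interpret Li: module R "cmod L i" by (rule L.mod)
  have rc: "r \<in> carrier (cmod L i)" using Li.submoduleE(1)[OF submodule_rels] r by blast
  then have "r \<ominus>\<^bsub>cmod L i\<^esub> \<zero>\<^bsub>cmod L i\<^esub> = r" using Li.zero_closed by algebra
  then have "q i r = q i \<zero>\<^bsub>cmod L i\<^esub>" using r quo_eq_iff[OF rc Li.zero_closed] by simp
  then show ?thesis by (simp add: po_def)
qed

text \<open>The differential of the relation with parameters \<open>(n, m)\<close> is the relation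
  with parameters \<open>(0, n)\<close>.\<close>

lemma diff_rel:
  assumes r: "r \<in> rels N h Q H i" shows "diff L i r \<in> rels N h Q H (i + 1)"
proof -
  interpret Ni: module R "cmod N i" by (rule mod)
  interpret Nj: module R "cmod N (i + 1)" by (rule mod)
  interpret Nl: module R "cmod N (i + 1 + 1)" by (rule mod)
  obtain n m where nm: "n \<in> carrier (cmod N (i + 1))" "m \<in> carrier (cmod N i)"
    and r': "r = (\<ominus>\<^bsub>cmod Q i\<^esub> H i (h (i + 1) n \<oplus>\<^bsub>cmod N i\<^esub> diff N (i - 1) (h i m)), H (i + 1) n, H i m)"
    using r by (rule rels_cases)
  note c = h_closed'[OF nm(1)] d_closed'[OF h_closed[OF nm(2)]]
  have s: "h (i + 1) n \<oplus>\<^bsub>cmod N i\<^esub> diff N (i - 1) (h i m) \<in> carrier (cmod N i)" using c by simp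
  have "diff N i (h (i + 1) n \<oplus>\<^bsub>cmod N i\<^esub> diff N (i - 1) (h i m)) = diff N i (h (i + 1) n)"
    using d_closed[OF c(1)] by (simp add: lin_add[OF d_lin c] complex_dd'[OF complex h_closed[OF nm(2)]])
  then have d: "diff Q i (\<ominus>\<^bsub>cmod Q i\<^esub> H i (h (i + 1) n \<oplus>\<^bsub>cmod N i\<^esub> diff N (i - 1) (h i m))) = \<ominus>\<^bsub>cmod Q (i + 1)\<^esub> H (i + 1) (diff N i (h (i + 1) n))"
    by (simp only: lin_neg[OF complex_diff[OF Q] cm_closed[OF H s]] cm_diff[OF H s, symmetric])
  have "diff L i r = (\<ominus>\<^bsub>cmod Q (i + 1)\<^esub> H (i + 1) (diff N i (h (i + 1) n)), \<zero>\<^bsub>cmod Q (i + 1 + 1)\<^esub>, H (i + 1) n)"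
    unfolding r' d[symmetric] by (rule diff_add_disks) (use cm_closed[OF H s] cm_closed[OF H nm(1)] cm_closed[OF H nm(2)] mod_neg[OF mQ] in auto)
  also have "\<dots> = (\<ominus>\<^bsub>cmod Q (i + 1)\<^esub> H (i + 1) (h (i + 1 + 1) \<zero>\<^bsub>cmod N (i + 1 + 1)\<^esub> \<oplus>\<^bsub>cmod N (i + 1)\<^esub> diff N (i + 1 - 1) (h (i + 1) n)),
      H (i + 1 + 1) \<zero>\<^bsub>cmod N (i + 1 + 1)\<^esub>, H (i + 1) n)"
    unfolding lin_zero[OF h_lin'] lin_zero[OF cm_lin[OF H]] using d_closed[OF c(1)] by simp
  finally show ?thesis by (rule relsI[OF Nl.zero_closed nm(1)])
qed

lemma homot_rel:
  assumes r: "r \<in> rels N h Q H i" shows "free_homot Q i r \<in> rels N h Q H (i - 1)"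
proof -
  interpret Ni: module R "cmod N i" by (rule mod)
  interpret Nk: module R "cmod N (i - 1)" by (rule mod)
  interpret Nm: module R "cmod N (i - 1 - 1)" by (rule mod)
  interpret Qi: module R "cmod Q i" by (rule mQ)
  interpret Qk: module R "cmod Q (i - 1)" by (rule mQ)
  obtain n m where nm: "n \<in> carrier (cmod N (i + 1))" "m \<in> carrier (cmod N i)"
    and r': "r = (\<ominus>\<^bsub>cmod Q i\<^esub> H i (h (i + 1) n \<oplus>\<^bsub>cmod N i\<^esub> diff N (i - 1) (h i m)), H (i + 1) n, H i m)"
    using r by (rule rels_cases)
  note c = h_closed'[OF nm(1)] d_closed'[OF h_closed[OF nm(2)]]
  define s where "s = h (i + 1) n \<oplus>\<^bsub>cmod N i\<^esub> diff N (i - 1) (h i m)"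
  have s: "s \<in> carrier (cmod N i)" using c by (simp add: s_def)
  have "h i s = \<zero>\<^bsub>cmod N (i - 1)\<^esub> \<oplus>\<^bsub>cmod N (i - 1)\<^esub> \<ominus>\<^bsub>cmod N (i - 1)\<^esub> h i m"
    unfolding s_def by (simp only: lin_add[OF h_lin c] h_h'[OF nm(1)] h_d_h[OF nm(2)])
  then have hs: "h i (s \<oplus>\<^bsub>cmod N i\<^esub> m) = \<zero>\<^bsub>cmod N (i - 1)\<^esub>"
    using h_closed[OF nm(2)] by (simp add: lin_add[OF h_lin s nm(2)] Nk.l_neg)
  \<comment> \<open>The parameter of the new relation is read off its middle component, which is
    \<open>-H s - H m\<close>. Its first component vanishes as it should because
    \<open>h ?w = 0\<close>, by \<open>h s = -h m\<close>.\<close>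
  let ?w = "\<ominus>\<^bsub>cmod N i\<^esub> (s \<oplus>\<^bsub>cmod N i\<^esub> m)"
  have w: "?w \<in> carrier (cmod N i)" using s nm by simp
  have hw: "h i ?w = \<zero>\<^bsub>cmod N (i - 1)\<^esub>"
    using s nm(2) hs by (simp add: lin_neg[OF h_lin])
  note Hc = cm_closed[OF H s] cm_closed[OF H nm(2)]
  have Hw: "H i ?w = (\<ominus>\<^bsub>cmod Q i\<^esub> H i s) \<ominus>\<^bsub>cmod Q i\<^esub> H i m"
  proof -
    have "H i ?w = \<ominus>\<^bsub>cmod Q i\<^esub> (H i s \<oplus>\<^bsub>cmod Q i\<^esub> H i m)"
      using s nm(2) by (simp add: lin_neg[OF cm_lin[OF H]] lin_add[OF cm_lin[OF H]])
    also have "\<dots> = (\<ominus>\<^bsub>cmod Q i\<^esub> H i s) \<ominus>\<^bsub>cmod Q i\<^esub> H i m" using Hc by algebra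
    finally show ?thesis .
  qed
  show ?thesis
  proof (rule relsI[of ?w "i - 1" "\<zero>\<^bsub>cmod N (i - 1)\<^esub>"])
    show "free_homot Q i r = (\<ominus>\<^bsub>cmod Q (i - 1)\<^esub> H (i - 1) (h (i - 1 + 1) ?w \<oplus>\<^bsub>cmod N (i - 1)\<^esub> diff N (i - 1 - 1) (h (i - 1) \<zero>\<^bsub>cmod N (i - 1)\<^esub>)),
       H (i - 1 + 1) ?w, H (i - 1) \<zero>\<^bsub>cmod N (i - 1)\<^esub>)"
      unfolding r' s_def[symmetric] lin_zero[OF h_lin] lin_zero[OF d_lin'] lin_zero[OF cm_lin[OF H]]
      using hw Hw by (simp add: free_homot_def lin_zero[OF cm_lin[OF H]])
  qed (use w in simp_all)
qed

lemma complex_cong_quo: "complex_cong R L q"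
  unfolding complex_cong_def
proof (intro conjI allI ballI impI)
  show "cochain_complex R L" by (rule L.complex)
  fix i
  have r: "mod_cong R (cmod L i) (rep (cmod L i) (rels N h Q H i))" by (rule mod_cong_rep[OF L.mod submodule_rels])
  have iff: "q i x = q i x' \<longleftrightarrow> rep (cmod L i) (rels N h Q H i) x = rep (cmod L i) (rels N h Q H i) x'"
    if "x \<in> carrier (cmod L i)" "x' \<in> carrier (cmod L i)" for x x'
    using quo_eq_iff[OF that] rep_eq_iff[OF L.mod submodule_rels that] by simp
  show "mod_cong R (cmod L i) (q i)"
    unfolding mod_cong_def
  proof (intro conjI ballI impI)
    fix x x' y assume x: "x \<in> carrier (cmod L i)" "x' \<in> carrier (cmod L i)" "y \<in> carrier (cmod L i)" and e: "q i x = q i x'"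
    show "q i (x \<oplus>\<^bsub>cmod L i\<^esub> y) = q i (x' \<oplus>\<^bsub>cmod L i\<^esub> y)"
      using r[unfolded mod_cong_def, THEN conjunct1, rule_format, OF x] e
      unfolding iff[OF x(1,2)] iff[OF mod_add[OF L.mod x(1,3)] mod_add[OF L.mod x(2,3)]] .
  next
    fix r' x x' assume r': "r' \<in> carrier R" and x: "x \<in> carrier (cmod L i)" "x' \<in> carrier (cmod L i)" and e: "q i x = q i x'"
    show "q i (r' \<odot>\<^bsub>cmod L i\<^esub> x) = q i (r' \<odot>\<^bsub>cmod L i\<^esub> x')"
      using r[unfolded mod_cong_def, THEN conjunct2, rule_format, OF r' x] e
      unfolding iff[OF x] iff[OF mod_smult[OF L.mod r' x(1)] mod_smult[OF L.mod r' x(2)]] .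
  qed
  fix x x' assume x: "x \<in> carrier (cmod L i)" "x' \<in> carrier (cmod L i)" and "q i x = q i x'"
  then have "diff L i (x \<ominus>\<^bsub>cmod L i\<^esub> x') \<in> rels N h Q H (i + 1)" using diff_rel quo_eq_iff[OF x] by blast
  then show "q (i + 1) (diff L i x) = q (i + 1) (diff L i x')"
    using quo_eq_iff[OF L.d_closed[OF x(1)] L.d_closed[OF x(2)]] by (simp only: lin_minus[OF L.d_lin x])
qed

lemma homot_quo:
  assumes x: "x \<in> carrier (cmod L i)" "x' \<in> carrier (cmod L i)" and "q i x = q i x'"
  shows "q (i - 1) (free_homot Q i x) = q (i - 1) (free_homot Q i x')"
proof -
  have "free_homot Q i (x \<ominus>\<^bsub>cmod L i\<^esub> x') \<in> rels N h Q H (i - 1)" using homot_rel quo_eq_iff[OF x] assms(3) by blast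
  then show ?thesis
    using quo_eq_iff[OF L.h_closed[OF x(1)] L.h_closed[OF x(2)]] by (simp only: lin_minus[OF L.h_lin x])
qed

lemma cm_quo: "cm R L P q"
  unfolding po_def by (rule cm_img_complex[OF complex_cong_quo])

sublocale P: h_complex R P hP
  unfolding po_def po_homot_def by (rule h_complex_img[OF L.h_complex_axioms complex_cong_quo homot_quo])

lemma hP_quo: "x \<in> carrier (cmod L i) \<Longrightarrow> hP i (q i x) = q (i - 1) (free_homot Q i x)"
  unfolding po_homot_def by (rule descend_eq[where f = "\<lambda>i x. q (i - 1) (free_homot Q i x)", OF homot_quo])

lemma poE: assumes "a \<in> carrier (cmod P i)" obtains x where "x \<in> carrier (cmod L i)" "a = q i x"
  using assms by (auto simp: po_def)

text \<open>The unit of the free contraction on \<open>Q\<close>, followed by the quotient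
  map.\<close>

definition eta :: "'a graded_map" where
  "eta i x = q i (x, \<zero>\<^bsub>cmod Q (i + 1)\<^esub>, \<zero>\<^bsub>cmod Q i\<^esub>)"

definition po_incl :: "'a graded_map" where
  "po_incl i n = eta i (H i n)"

lemma cm_eta: "cm R Q P eta"
  unfolding eta_def[abs_def] by (rule cm_comp[OF cm_disk_incl[where G = "cmod Q", OF Q mQ] cm_quo])

lemma cm_po_incl: "cm R N P po_incl"
  unfolding po_incl_def[abs_def] by (rule cm_comp[OF H cm_eta])

lemma eta_in: "x \<in> carrier (cmod Q i) \<Longrightarrow> (x, \<zero>\<^bsub>cmod Q (i + 1)\<^esub>, \<zero>\<^bsub>cmod Q i\<^esub>) \<in> carrier (cmod L i)"
  using mod_zero[OF mQ] by simp

lemma theta_in: "y \<in> carrier (cmod Q (i + 1)) \<Longrightarrow> (\<zero>\<^bsub>cmod Q i\<^esub>, y, \<zero>\<^bsub>cmod Q i\<^esub>) \<in> carrier (cmod L i)"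
  using mod_zero[OF mQ] by simp

text \<open>The relation with parameters \<open>(n, 0)\<close>, up to sign conventions the statement
  that \<open>h\<close> of \<open>H n\<close> is \<open>H\<close> of \<open>h n\<close> in the
  quotient; compatibility of \<open>po_incl\<close> with the homotopies rests on it.\<close>

lemma quo_relation:
  assumes n: "n \<in> carrier (cmod N (i + 1))"
  shows "q i (\<zero>\<^bsub>cmod Q i\<^esub>, H (i + 1) n, \<zero>\<^bsub>cmod Q i\<^esub>) = eta i (H i (h (i + 1) n))"
proof -
  interpret Ni: module R "cmod N i" by (rule mod)
  interpret Qi: module R "cmod Q i" by (rule mQ)
  interpret Qj: module R "cmod Q (i + 1)" by (rule mQ)
  note c = cm_closed[OF H n] cm_closed[OF H h_closed'[OF n]]
  have "(\<zero>\<^bsub>cmod Q i\<^esub>, H (i + 1) n, \<zero>\<^bsub>cmod Q i\<^esub>) \<ominus>\<^bsub>cmod L i\<^esub> (H i (h (i + 1) n), \<zero>\<^bsub>cmod Q (i + 1)\<^esub>, \<zero>\<^bsub>cmod Q i\<^esub>) =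
    (\<zero>\<^bsub>cmod Q i\<^esub> \<ominus>\<^bsub>cmod Q i\<^esub> H i (h (i + 1) n), H (i + 1) n \<ominus>\<^bsub>cmod Q (i + 1)\<^esub> \<zero>\<^bsub>cmod Q (i + 1)\<^esub>, \<zero>\<^bsub>cmod Q i\<^esub> \<ominus>\<^bsub>cmod Q i\<^esub> \<zero>\<^bsub>cmod Q i\<^esub>)"
    by (rule free_minus[OF Q]) (use c in auto)
  also have "\<dots> = (\<ominus>\<^bsub>cmod Q i\<^esub> H i (h (i + 1) n \<oplus>\<^bsub>cmod N i\<^esub> diff N (i - 1) (h i \<zero>\<^bsub>cmod N i\<^esub>)), H (i + 1) n, H i \<zero>\<^bsub>cmod N i\<^esub>)"
    unfolding lin_zero[OF h_lin] lin_zero[OF d_lin'] lin_zero[OF cm_lin[OF H]] using c h_closed'[OF n] by (simp add: a_minus_def)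
  finally have "(\<zero>\<^bsub>cmod Q i\<^esub>, H (i + 1) n, \<zero>\<^bsub>cmod Q i\<^esub>) \<ominus>\<^bsub>cmod L i\<^esub> (H i (h (i + 1) n), \<zero>\<^bsub>cmod Q (i + 1)\<^esub>, \<zero>\<^bsub>cmod Q i\<^esub>) \<in> rels N h Q H i"
    by (rule relsI[OF n Ni.zero_closed])
  then show ?thesis unfolding eta_def using quo_eq_iff[OF theta_in[OF c(1)] eta_in[OF c(2)]] by simp
qed

lemma po_incl_h:
  assumes n: "n \<in> carrier (cmod N i)"
  shows "po_incl (i - 1) (h i n) = hP i (po_incl i n)"
proof -
  interpret Qi: module R "cmod Q i" by (rule mQ)
  note c = cm_closed[OF H n]
  have "hP i (po_incl i n) = q (i - 1) (\<zero>\<^bsub>cmod Q (i - 1)\<^esub>, H i n, \<zero>\<^bsub>cmod Q (i - 1)\<^esub>)"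
    unfolding po_incl_def eta_def hP_quo[OF eta_in[OF c]] using c by (simp add: free_homot_def a_minus_def)
  also have "\<dots> = po_incl (i - 1) (h i n)"
    using quo_relation[of n "i - 1"] n by (simp add: po_incl_def)
  finally show ?thesis by simp
qed

lemma rel_out:
  assumes l: "cm R Q Z l" and g: "cm R N Z g" and s: "\<And>i. lin R (cmod Q (i + 1)) (cmod Z i) (s i)"
    and lH: "\<And>i n. n \<in> carrier (cmod N i) \<Longrightarrow> l i (H i n) = g i n"
    and sH: "\<And>i n. n \<in> carrier (cmod N (i + 1)) \<Longrightarrow> s i (H (i + 1) n) = g i (h (i + 1) n)"
    and r: "r \<in> rels N h Q H i"
  shows "disk_out Z l s i r = \<zero>\<^bsub>cmod Z i\<^esub>"
proof -
  note Z = cm_complex(2)[OF g]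
  interpret Zi: module R "cmod Z i" by (rule complex_module[OF Z])
  obtain n m where nm: "n \<in> carrier (cmod N (i + 1))" "m \<in> carrier (cmod N i)"
    and r': "r = (\<ominus>\<^bsub>cmod Q i\<^esub> H i (h (i + 1) n \<oplus>\<^bsub>cmod N i\<^esub> diff N (i - 1) (h i m)), H (i + 1) n, H i m)"
    using r by (rule rels_cases)
  note c = h_closed'[OF nm(1)] d_closed'[OF h_closed[OF nm(2)]]
  have s: "h (i + 1) n \<oplus>\<^bsub>cmod N i\<^esub> diff N (i - 1) (h i m) \<in> carrier (cmod N i)" using c mod_add[OF mod] by blast
  note gc = cm_closed[OF g c(1)] cm_closed[OF g c(2)]
  have "s (i - 1) (H i m) = g (i - 1) (h i m)" using sH[of m "i - 1"] nm(2) by simp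
  then have 1: "diff Z (i - 1) (s (i - 1) (H i m)) = g i (diff N (i - 1) (h i m))"
    by (simp only: cm_diff'[OF g h_closed[OF nm(2)]])
  have 2: "l i (\<ominus>\<^bsub>cmod Q i\<^esub> H i (h (i + 1) n \<oplus>\<^bsub>cmod N i\<^esub> diff N (i - 1) (h i m))) =
      \<ominus>\<^bsub>cmod Z i\<^esub> (g i (h (i + 1) n) \<oplus>\<^bsub>cmod Z i\<^esub> g i (diff N (i - 1) (h i m)))"
    by (simp only: lin_neg[OF cm_lin[OF l] cm_closed[OF H s]] lH[OF s] lin_add[OF cm_lin[OF g] c])
  show ?thesis
    unfolding r' disk_out_def prod.case 1 2 sH[OF nm(1)] using gc by (simp add: Zi.l_neg)
qed

definition po_out :: "('r, 'a) cochain \<Rightarrow> 'a graded_map \<Rightarrow> (int \<Rightarrow> 'a \<Rightarrow> 'a) \<Rightarrow> 'a graded_map" where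
  "po_out Z l s = descend L q (disk_out Z l s)"

text \<open>Universal property of the pushout with respect to mere complexes: \<open>s\<close>
  prescribes the values at \<open>h y\<close>, and the condition \<open>s H = g h\<close> is what
  kills the relations. It serves both for lifting in complexes and for the second factor
  \<open>kout\<close>.\<close>

lemma
  assumes l: "cm R Q Z l" and g: "cm R N Z g" and s: "\<And>i. lin R (cmod Q (i + 1)) (cmod Z i) (s i)"
    and lH: "\<And>i n. n \<in> carrier (cmod N i) \<Longrightarrow> l i (H i n) = g i n"
    and sH: "\<And>i n. n \<in> carrier (cmod N (i + 1)) \<Longrightarrow> s i (H (i + 1) n) = g i (h (i + 1) n)"
  shows cm_po_out: "cm R P Z (po_out Z l s)"
    and po_out_quo: "x \<in> carrier (cmod L i) \<Longrightarrow> po_out Z l s i (q i x) = disk_out Z l s i x"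
    and po_out_eta: "y \<in> carrier (cmod Q i) \<Longrightarrow> po_out Z l s i (eta i y) = l i y"
proof -
  note O = cm_disk_out[where G = "cmod Q" and s = s, OF l mQ s]
  have k: "disk_out Z l s i x = disk_out Z l s i x'" if "x \<in> carrier (cmod L i)" "x' \<in> carrier (cmod L i)" "q i x = q i x'" for i x x'
    by (rule quo_kill[OF cm_lin[OF O] rel_out[OF l g s lH sH] that])
  show "cm R P Z (po_out Z l s)"
    unfolding po_out_def po_def by (rule cm_descend[OF complex_cong_quo O k])
  show e: "x \<in> carrier (cmod L i) \<Longrightarrow> po_out Z l s i (q i x) = disk_out Z l s i x" for i x
    unfolding po_out_def by (rule descend_eq[where f = "disk_out Z l s", OF k])
  show "y \<in> carrier (cmod Q i) \<Longrightarrow> po_out Z l s i (eta i y) = l i y"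
    unfolding eta_def using e[OF eta_in] disk_out_incl[where G = "cmod Q" and s = s, OF l mQ s] by simp
qed

text \<open>\<open>P\<close> is the extension of \<open>Q\<close> by a contractible complex.\<close>

lemma coh_bij_eta:
  assumes inj: "\<And>i x x'. \<lbrakk>x \<in> carrier (cmod N i); x' \<in> carrier (cmod N i); H i x = H i x'\<rbrakk> \<Longrightarrow> x = x'"
  shows "coh_bij Q P eta"
  unfolding coh_bij_def
proof (intro allI conjI ballI impI)
  have H0: "n = \<zero>\<^bsub>cmod N i\<^esub>" if "n \<in> carrier (cmod N i)" "H i n = \<zero>\<^bsub>cmod Q i\<^esub>" for i n
    using inj[OF that(1) mod_zero[OF mod]] that(2) lin_zero[OF cm_lin[OF H]] by simp
  fix i
  interpret Ni: module R "cmod N i" by (rule mod)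
  interpret Qi: module R "cmod Q i" by (rule mQ)
  interpret Qj: module R "cmod Q (i + 1)" by (rule mQ)
  interpret Qk: module R "cmod Q (i - 1)" by (rule mQ)
  {
    fix x x' assume x: "x \<in> cocycles Q i" "x' \<in> cocycles Q i" and "cohomologous P i (eta i x) (eta i x')"
    then obtain w where w: "w \<in> carrier (cmod P (i - 1))" "eta i x \<ominus>\<^bsub>cmod P i\<^esub> eta i x' = diff P (i - 1) w"
      unfolding cohomologous_def coboundary_iff by blast
    obtain v where v: "v \<in> carrier (cmod L (i - 1))" "w = q (i - 1) v" using w(1) by (rule poE)
    obtain a b c where abc: "v = (a, b, c)" "a \<in> carrier (cmod Q (i - 1))" "b \<in> carrier (cmod Q i)" "c \<in> carrier (cmod Q (i - 1))"
      using v(1) by auto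
    have xc: "x \<in> carrier (cmod Q i)" "x' \<in> carrier (cmod Q i)" using x by (simp_all add: cocycle_closed)
    have dv: "diff L (i - 1) v = (diff Q (i - 1) a, \<zero>\<^bsub>cmod Q (i + 1)\<^esub>, b)" unfolding abc(1) by (rule diff_free'[OF abc(2-4)])
    have da: "diff Q (i - 1) a \<in> carrier (cmod Q i)" by (rule lin_closed[OF complex_diff'[OF Q] abc(2)])
    have "eta i (x \<ominus>\<^bsub>cmod Q i\<^esub> x') = q i (diff L (i - 1) v)"
      using w(2) v by (simp add: lin_minus[OF cm_lin[OF cm_eta] xc] cm_diff'[OF cm_quo v(1)])
    then have "(x \<ominus>\<^bsub>cmod Q i\<^esub> x', \<zero>\<^bsub>cmod Q (i + 1)\<^esub>, \<zero>\<^bsub>cmod Q i\<^esub>) \<ominus>\<^bsub>cmod L i\<^esub> (diff Q (i - 1) a, \<zero>\<^bsub>cmod Q (i + 1)\<^esub>, b) \<in> rels N h Q H i"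
      unfolding eta_def dv using quo_eq_iff[OF eta_in] xc da abc(3) by simp
    then have "(x \<ominus>\<^bsub>cmod Q i\<^esub> x' \<ominus>\<^bsub>cmod Q i\<^esub> diff Q (i - 1) a, \<zero>\<^bsub>cmod Q (i + 1)\<^esub> \<ominus>\<^bsub>cmod Q (i + 1)\<^esub> \<zero>\<^bsub>cmod Q (i + 1)\<^esub>, \<zero>\<^bsub>cmod Q i\<^esub> \<ominus>\<^bsub>cmod Q i\<^esub> b) \<in> rels N h Q H i"
      using free_minus[OF Q, of "x \<ominus>\<^bsub>cmod Q i\<^esub> x'" i "\<zero>\<^bsub>cmod Q (i + 1)\<^esub>" "\<zero>\<^bsub>cmod Q i\<^esub>" "diff Q (i - 1) a" "\<zero>\<^bsub>cmod Q (i + 1)\<^esub>" b] xc da abc(3) by simp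
    then obtain n m where nm: "n \<in> carrier (cmod N (i + 1))" "m \<in> carrier (cmod N i)"
      and e: "x \<ominus>\<^bsub>cmod Q i\<^esub> x' \<ominus>\<^bsub>cmod Q i\<^esub> diff Q (i - 1) a = \<ominus>\<^bsub>cmod Q i\<^esub> H i (h (i + 1) n \<oplus>\<^bsub>cmod N i\<^esub> diff N (i - 1) (h i m))"
        "\<zero>\<^bsub>cmod Q (i + 1)\<^esub> \<ominus>\<^bsub>cmod Q (i + 1)\<^esub> \<zero>\<^bsub>cmod Q (i + 1)\<^esub> = H (i + 1) n"
      by (elim rels_cases) auto
    \<comment> \<open>Injectivity of \<open>H\<close> is used here: the middle component of the
      relation says \<open>H n = 0\<close>.\<close>
    have n: "n = \<zero>\<^bsub>cmod N (i + 1)\<^esub>" by (rule H0[OF nm(1)]) (use e(2) in \<open>simp add: a_minus_def\<close>)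
    \<comment> \<open>The first component of the relation now reads
      \<open>x - x' - d a = -H (d h m)\<close>, so \<open>x - x'\<close> is the boundary of
      \<open>a - H (h m)\<close>.\<close>
    let ?b = "a \<ominus>\<^bsub>cmod Q (i - 1)\<^esub> H (i - 1) (h i m)"
    have hm: "H (i - 1) (h i m) \<in> carrier (cmod Q (i - 1))" by (rule cm_closed[OF H h_closed[OF nm(2)]])
    note dhm = d_closed'[OF h_closed[OF nm(2)]]
    have u: "H i (diff N (i - 1) (h i m)) \<in> carrier (cmod Q i)" by (rule cm_closed[OF H dhm])
    have "x \<ominus>\<^bsub>cmod Q i\<^esub> x' \<ominus>\<^bsub>cmod Q i\<^esub> diff Q (i - 1) a = \<ominus>\<^bsub>cmod Q i\<^esub> H i (diff N (i - 1) (h i m))"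
      unfolding e(1) n lin_zero[OF h_lin'] using dhm by simp
    then have "diff Q (i - 1) a \<oplus>\<^bsub>cmod Q i\<^esub> (x \<ominus>\<^bsub>cmod Q i\<^esub> x' \<ominus>\<^bsub>cmod Q i\<^esub> diff Q (i - 1) a) = diff Q (i - 1) a \<oplus>\<^bsub>cmod Q i\<^esub> \<ominus>\<^bsub>cmod Q i\<^esub> H i (diff N (i - 1) (h i m))"
      by simp
    moreover have "diff Q (i - 1) a \<oplus>\<^bsub>cmod Q i\<^esub> (x \<ominus>\<^bsub>cmod Q i\<^esub> x' \<ominus>\<^bsub>cmod Q i\<^esub> diff Q (i - 1) a) = x \<ominus>\<^bsub>cmod Q i\<^esub> x'"
      using xc da by algebra
    moreover have "diff Q (i - 1) ?b = diff Q (i - 1) a \<oplus>\<^bsub>cmod Q i\<^esub> \<ominus>\<^bsub>cmod Q i\<^esub> H i (diff N (i - 1) (h i m))"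
      unfolding lin_minus[OF complex_diff'[OF Q] abc(2) hm] cm_diff'[OF H h_closed[OF nm(2)]] by (simp only: a_minus_def)
    ultimately have "x \<ominus>\<^bsub>cmod Q i\<^esub> x' = diff Q (i - 1) ?b" by simp
    then show "cohomologous Q i x x'" unfolding cohomologous_def coboundary_iff using abc(2) hm by blast
  next
    fix w assume w: "w \<in> cocycles P i"
    obtain v where v: "v \<in> carrier (cmod L i)" "w = q i v" by (rule poE[OF cocycle_closed[OF w]])
    obtain x y z where xyz: "v = (x, y, z)" "x \<in> carrier (cmod Q i)" "y \<in> carrier (cmod Q (i + 1))" "z \<in> carrier (cmod Q i)"
      using v(1) by auto
    interpret Ql: module R "cmod Q (i + 1 + 1)" by (rule mQ)
    interpret Nj: module R "cmod N (i + 1)" by (rule mod)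
    have dv: "diff L i v = (diff Q i x, \<zero>\<^bsub>cmod Q (i + 1 + 1)\<^esub>, y)" unfolding xyz(1) by (rule diff_add_disks[OF xyz(2-4)])
    have dx: "diff Q i x \<in> carrier (cmod Q (i + 1))" by (rule lin_closed[OF complex_diff[OF Q] xyz(2)])
    have "q (i + 1) (diff L i v) = \<zero>\<^bsub>cmod P (i + 1)\<^esub>"
      using w v by (simp add: cocycle_iff cm_diff[OF cm_quo])
    then have "q (i + 1) (diff L i v) = q (i + 1) \<zero>\<^bsub>cmod L (i + 1)\<^esub>" by (simp only: lin_zero[OF cm_lin[OF cm_quo]])
    then have "diff L i v \<ominus>\<^bsub>cmod L (i + 1)\<^esub> \<zero>\<^bsub>cmod L (i + 1)\<^esub> \<in> rels N h Q H (i + 1)"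
      using quo_eq_iff[OF L.d_closed[OF v(1)] mod_zero[OF L.mod]] by blast
    then have "(diff Q i x \<ominus>\<^bsub>cmod Q (i + 1)\<^esub> \<zero>\<^bsub>cmod Q (i + 1)\<^esub>, \<zero>\<^bsub>cmod Q (i + 1 + 1)\<^esub> \<ominus>\<^bsub>cmod Q (i + 1 + 1)\<^esub> \<zero>\<^bsub>cmod Q (i + 1 + 1)\<^esub>,
       y \<ominus>\<^bsub>cmod Q (i + 1)\<^esub> \<zero>\<^bsub>cmod Q (i + 1)\<^esub>) \<in> rels N h Q H (i + 1)"
      unfolding dv using free_minus[OF Q dx Ql.zero_closed xyz(3) Qj.zero_closed Ql.zero_closed Qj.zero_closed] by simp
    then obtain n m where nm: "n \<in> carrier (cmod N (i + 1 + 1))" "m \<in> carrier (cmod N (i + 1))"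
      and e: "diff Q i x \<ominus>\<^bsub>cmod Q (i + 1)\<^esub> \<zero>\<^bsub>cmod Q (i + 1)\<^esub> =
          \<ominus>\<^bsub>cmod Q (i + 1)\<^esub> H (i + 1) (h (i + 1 + 1) n \<oplus>\<^bsub>cmod N (i + 1)\<^esub> diff N (i + 1 - 1) (h (i + 1) m))"
        "\<zero>\<^bsub>cmod Q (i + 1 + 1)\<^esub> \<ominus>\<^bsub>cmod Q (i + 1 + 1)\<^esub> \<zero>\<^bsub>cmod Q (i + 1 + 1)\<^esub> = H (i + 1 + 1) n"
        "y \<ominus>\<^bsub>cmod Q (i + 1)\<^esub> \<zero>\<^bsub>cmod Q (i + 1)\<^esub> = H (i + 1) m"
      by (elim rels_cases) auto
    have n: "n = \<zero>\<^bsub>cmod N (i + 1 + 1)\<^esub>" proof (rule H0[OF nm(1)])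
      have "\<zero>\<^bsub>cmod Q (i + 1 + 1)\<^esub> \<ominus>\<^bsub>cmod Q (i + 1 + 1)\<^esub> \<zero>\<^bsub>cmod Q (i + 1 + 1)\<^esub> = \<zero>\<^bsub>cmod Q (i + 1 + 1)\<^esub>"
        using Ql.zero_closed by algebra
      then show "H (i + 1 + 1) n = \<zero>\<^bsub>cmod Q (i + 1 + 1)\<^esub>" unfolding e(2) .
    qed
    have y: "y = H (i + 1) m" using e(3) xyz(3) by (simp add: a_minus_def)
    note hm = h_closed'[OF nm(2)]
    note Hhm = cm_closed[OF H hm]
    have dhm: "diff N i (h (i + 1) m) \<in> carrier (cmod N (i + 1))" by (rule d_closed[OF hm])
    have e1: "diff Q i x = \<ominus>\<^bsub>cmod Q (i + 1)\<^esub> H (i + 1) (diff N i (h (i + 1) m))"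
      using e(1) dx dhm unfolding n lin_zero[OF h_lin'] by (simp add: a_minus_def)
    \<comment> \<open>That \<open>d (x, y, z)\<close> is a relation gives \<open>y = H m\<close> and
      \<open>d x = -H (d h m)\<close>, so adding \<open>H (h m)\<close> to \<open>x\<close> makes it
      a cocycle. Its difference from \<open>v\<close> is the relation with parameters
      \<open>(-m, 0)\<close> plus the boundary of \<open>(0, -z, 0)\<close>.\<close>
    let ?c = "x \<oplus>\<^bsub>cmod Q i\<^esub> H i (h (i + 1) m)"
    have c: "?c \<in> cocycles Q i"
      using xyz(2) Hhm cm_closed[OF H dhm]
      by (simp add: cocycle_iff lin_add[OF complex_diff[OF Q]] e1 cm_diff[OF H hm, symmetric] Qj.l_neg)
    have cc: "?c \<in> carrier (cmod Q i)" by (rule cocycle_closed[OF c])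
    have b: "(\<zero>\<^bsub>cmod Q (i - 1)\<^esub>, \<ominus>\<^bsub>cmod Q i\<^esub> z, \<zero>\<^bsub>cmod Q (i - 1)\<^esub>) \<in> carrier (cmod L (i - 1))" using xyz by simp
    have db: "diff L (i - 1) (\<zero>\<^bsub>cmod Q (i - 1)\<^esub>, \<ominus>\<^bsub>cmod Q i\<^esub> z, \<zero>\<^bsub>cmod Q (i - 1)\<^esub>) = (\<zero>\<^bsub>cmod Q i\<^esub>, \<zero>\<^bsub>cmod Q (i + 1)\<^esub>, \<ominus>\<^bsub>cmod Q i\<^esub> z)"
      using xyz by (simp add: diff_free' lin_zero[OF complex_diff'[OF Q]])
    have "(?c, \<zero>\<^bsub>cmod Q (i + 1)\<^esub>, \<zero>\<^bsub>cmod Q i\<^esub>) \<ominus>\<^bsub>cmod L i\<^esub> v = (?c \<ominus>\<^bsub>cmod Q i\<^esub> x, \<zero>\<^bsub>cmod Q (i + 1)\<^esub> \<ominus>\<^bsub>cmod Q (i + 1)\<^esub> y, \<zero>\<^bsub>cmod Q i\<^esub> \<ominus>\<^bsub>cmod Q i\<^esub> z)"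
      unfolding xyz(1) by (rule free_minus[OF Q cc Qj.zero_closed Qi.zero_closed xyz(2-4)])
    also have "\<dots> = (H i (h (i + 1) m), \<ominus>\<^bsub>cmod Q (i + 1)\<^esub> y, \<ominus>\<^bsub>cmod Q i\<^esub> z)"
    proof -
      have "?c \<ominus>\<^bsub>cmod Q i\<^esub> x = H i (h (i + 1) m)" using xyz(2) Hhm by algebra
      moreover have "\<zero>\<^bsub>cmod Q (i + 1)\<^esub> \<ominus>\<^bsub>cmod Q (i + 1)\<^esub> y = \<ominus>\<^bsub>cmod Q (i + 1)\<^esub> y" using xyz(3) by (simp add: a_minus_def)
      moreover have "\<zero>\<^bsub>cmod Q i\<^esub> \<ominus>\<^bsub>cmod Q i\<^esub> z = \<ominus>\<^bsub>cmod Q i\<^esub> z" using xyz(4) by (simp add: a_minus_def)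
      ultimately show ?thesis by simp
    qed
    finally have 1: "(?c, \<zero>\<^bsub>cmod Q (i + 1)\<^esub>, \<zero>\<^bsub>cmod Q i\<^esub>) \<ominus>\<^bsub>cmod L i\<^esub> v = (H i (h (i + 1) m), \<ominus>\<^bsub>cmod Q (i + 1)\<^esub> y, \<ominus>\<^bsub>cmod Q i\<^esub> z)" .
    have "(H i (h (i + 1) m), \<ominus>\<^bsub>cmod Q (i + 1)\<^esub> y, \<ominus>\<^bsub>cmod Q i\<^esub> z) \<ominus>\<^bsub>cmod L i\<^esub> (\<zero>\<^bsub>cmod Q i\<^esub>, \<zero>\<^bsub>cmod Q (i + 1)\<^esub>, \<ominus>\<^bsub>cmod Q i\<^esub> z) =
      (H i (h (i + 1) m) \<ominus>\<^bsub>cmod Q i\<^esub> \<zero>\<^bsub>cmod Q i\<^esub>, (\<ominus>\<^bsub>cmod Q (i + 1)\<^esub> y) \<ominus>\<^bsub>cmod Q (i + 1)\<^esub> \<zero>\<^bsub>cmod Q (i + 1)\<^esub>, (\<ominus>\<^bsub>cmod Q i\<^esub> z) \<ominus>\<^bsub>cmod Q i\<^esub> (\<ominus>\<^bsub>cmod Q i\<^esub> z))"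
      by (rule free_minus[OF Q]) (use Hhm xyz in auto)
    also have "\<dots> = (H i (h (i + 1) m), \<ominus>\<^bsub>cmod Q (i + 1)\<^esub> y, \<zero>\<^bsub>cmod Q i\<^esub>)"
      using Hhm xyz by (simp add: a_minus_def Qi.r_neg Qi.l_neg)
    also have "\<dots> = (\<ominus>\<^bsub>cmod Q i\<^esub> H i (h (i + 1) (\<ominus>\<^bsub>cmod N (i + 1)\<^esub> m) \<oplus>\<^bsub>cmod N i\<^esub> diff N (i - 1) (h i \<zero>\<^bsub>cmod N i\<^esub>)), H (i + 1) (\<ominus>\<^bsub>cmod N (i + 1)\<^esub> m), H i \<zero>\<^bsub>cmod N i\<^esub>)"
      unfolding lin_zero[OF h_lin] lin_zero[OF d_lin'] lin_zero[OF cm_lin[OF H]] lin_neg[OF h_lin' nm(2)] lin_neg[OF cm_lin[OF H] nm(2)] y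
      using hm Hhm by (simp add: lin_neg[OF cm_lin[OF H]])
    finally have "(H i (h (i + 1) m), \<ominus>\<^bsub>cmod Q (i + 1)\<^esub> y, \<ominus>\<^bsub>cmod Q i\<^esub> z) \<ominus>\<^bsub>cmod L i\<^esub> (\<zero>\<^bsub>cmod Q i\<^esub>, \<zero>\<^bsub>cmod Q (i + 1)\<^esub>, \<ominus>\<^bsub>cmod Q i\<^esub> z) \<in> rels N h Q H i"
      by (rule relsI[OF Nj.a_inv_closed[OF nm(2)] Ni.zero_closed])
    then have "q i (H i (h (i + 1) m), \<ominus>\<^bsub>cmod Q (i + 1)\<^esub> y, \<ominus>\<^bsub>cmod Q i\<^esub> z) = q i (\<zero>\<^bsub>cmod Q i\<^esub>, \<zero>\<^bsub>cmod Q (i + 1)\<^esub>, \<ominus>\<^bsub>cmod Q i\<^esub> z)"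
      by (subst quo_eq_iff) (use Hhm xyz in auto)
    then have "eta i ?c \<ominus>\<^bsub>cmod P i\<^esub> w = q i (diff L (i - 1) (\<zero>\<^bsub>cmod Q (i - 1)\<^esub>, \<ominus>\<^bsub>cmod Q i\<^esub> z, \<zero>\<^bsub>cmod Q (i - 1)\<^esub>))"
      unfolding v(2) eta_def db by (simp only: lin_minus[OF cm_lin[OF cm_quo] eta_in[OF cc] v(1), symmetric] 1)
    also have "\<dots> = diff P (i - 1) (q (i - 1) (\<zero>\<^bsub>cmod Q (i - 1)\<^esub>, \<ominus>\<^bsub>cmod Q i\<^esub> z, \<zero>\<^bsub>cmod Q (i - 1)\<^esub>))"
      by (rule cm_diff'[OF cm_quo b])
    finally have "cohomologous P i (eta i ?c) w"
      unfolding cohomologous_def coboundary_iff using cm_closed[OF cm_quo b] by blast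
    then show "\<exists>z \<in> cocycles Q i. cohomologous P i (eta i z) w" using c by blast
  }
qed

end


section \<open>The model structure on contractions\<close>

text \<open>A lift out of the pushout splits into a cochain map \<open>l\<close> on
  \<open>tgt H\<close>, found by the lifting property of \<open>H\<close>, and linear maps
  \<open>s\<close>, found degree by degree with \<open>cof_lift\<close>. For \<open>s\<close> only
  linearity matters, so the surjectivity of \<open>p\<close> in each degree is enough.\<close>

lemma (in universe) po_incl_cof:
  assumes "h_complex R N h" and H: "H \<in> proj_cof R" and N: "src H = N"
  shows "Arrow N (restr N (pushout.po_incl N h (tgt H) (mor H) pr)) (po pr N h (tgt H) (mor H)) \<in> proj_cof R"
proof -
  interpret h_complex R N h by fact
  have HA: "H \<in> Ar (coCh R)" using H by (simp add: proj_cof_def)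
  have HC: "cm R N (tgt H) (mor H)" using coCh_cm[OF HA] N by simp
  interpret po: pushout R N h "tgt H" "mor H" pr
    by unfold_locales (rule HC inj_pr)+
  let ?i = "Arrow N (restr N po.po_incl) po.P"
  have iA: "?i \<in> Ar (coCh R)" by (rule coCh_arrI[OF po.cm_po_incl])
  have "llp (coCh R) ?i p" if p: "p \<in> proj_fib R \<inter> qis R" for p
  proof (rule coCh_llpI[OF iA], unfold arrow.sel)
    show pA: "p \<in> Ar (coCh R)" using p by (simp add: proj_fib_iff)
    note pC = coCh_cm[OF pA]
    fix u v assume u: "cm R N (src p) u" and v: "cm R po.P (tgt p) v"
      and sq: "\<And>j x. x \<in> carrier (cmod N j) \<Longrightarrow> v j (restr N po.po_incl j x) = mor p j (u j x)"
    have sq': "v j (po.po_incl j x) = mor p j (u j x)" if "x \<in> carrier (cmod N j)" for j x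
      using sq[OF that] that by simp
    have llpH: "llp (coCh R) H p" using H p unfolding proj_cof_def by blast
    obtain l where l: "cm R (tgt H) (src p) l" "\<And>j x. x \<in> carrier (cmod N j) \<Longrightarrow> l j (mor H j x) = u j x"
      "\<And>j y. y \<in> carrier (cmod (tgt H) j) \<Longrightarrow> mor p j (l j y) = v j (po.eta j y)"
      by (rule coCh_llpE[OF llpH HA pA, of u "\<lambda>j y. v j (po.eta j y)"])
        (use u cm_comp[OF po.cm_eta v] sq' in \<open>simp_all add: N po.po_incl_def\<close>)
    \<comment> \<open>The values of \<open>v\<close> at the elements \<open>h y\<close>, to be
      lifted by \<open>s\<close>. By \<open>quo_relation\<close> they are compatible with the values
      \<open>u (h n)\<close> prescribed on the image of \<open>H\<close>.\<close>
    let ?t = "\<lambda>j y. v j (po.q j (\<zero>\<^bsub>cmod (tgt H) j\<^esub>, y, \<zero>\<^bsub>cmod (tgt H) j\<^esub>))"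
    have tl: "lin R (cmod (tgt H) (j + 1)) (cmod (tgt p) j) (?t j)" for j
    proof (rule lin_comp[OF lin_comp[OF _ cm_lin[OF po.cm_quo]] cm_lin[OF v]])
      show "lin R (cmod (tgt H) (j + 1)) (cmod po.L j) (\<lambda>y. (\<zero>\<^bsub>cmod (tgt H) j\<^esub>, y, \<zero>\<^bsub>cmod (tgt H) j\<^esub>))"
        unfolding cmod_add_disks by (intro lin_pair lin_const_zero lin_ident po.mQ)
    qed
    have surj: "mor p j ` carrier (cmod (src p) j) = carrier (cmod (tgt p) j)" for j using p by (simp add: proj_fib_iff)
    have "\<exists>s. lin R (cmod (tgt H) (j + 1)) (cmod (src p) j) s \<and>
        (\<forall>n \<in> carrier (cmod N (j + 1)). s (mor H (j + 1) n) = u j (h (j + 1) n)) \<and>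
        (\<forall>y \<in> carrier (cmod (tgt H) (j + 1)). mor p j (s y) = ?t j y)" for j
    proof (rule cof_lift[OF H _ tl cm_lin[OF pC] surj, unfolded N])
      show "lin R (cmod N (j + 1)) (cmod (src p) j) (\<lambda>n. u j (h (j + 1) n))" by (rule lin_comp[OF h_lin' cm_lin[OF u]])
      show "?t j (mor H (j + 1) n) = mor p j (u j (h (j + 1) n))" if n: "n \<in> carrier (cmod N (j + 1))" for n
        using sq'[OF h_closed'[OF n]] by (simp only: po.quo_relation[OF n] po.po_incl_def)
    qed
    then obtain s where s: "\<And>j. lin R (cmod (tgt H) (j + 1)) (cmod (src p) j) (s j)"
      "\<And>j n. n \<in> carrier (cmod N (j + 1)) \<Longrightarrow> s j (mor H (j + 1) n) = u j (h (j + 1) n)"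
      "\<And>j y. y \<in> carrier (cmod (tgt H) (j + 1)) \<Longrightarrow> mor p j (s j y) = ?t j y"
      by metis
    have O: "cm R po.P (src p) (po.po_out (src p) l s)"
      and Oq: "\<And>j x. x \<in> carrier (cmod po.L j) \<Longrightarrow> po.po_out (src p) l s j (po.q j x) = disk_out (src p) l s j x"
      and Oe: "\<And>j y. y \<in> carrier (cmod (tgt H) j) \<Longrightarrow> po.po_out (src p) l s j (po.eta j y) = l j y"
      using po.cm_po_out[OF l(1) u s(1) l(2) s(2)] po.po_out_quo[OF l(1) u s(1) l(2) s(2)]
        po.po_out_eta[OF l(1) u s(1) l(2) s(2)] by blast+
    note D = cm_disk_out[where G = "cmod (tgt H)" and s = s, OF l(1) po.mQ s(1)]
    have "mor p j (disk_out (src p) l s j x) = v j (po.q j x)" if x: "x \<in> carrier (cmod po.L j)" for j x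
    proof (rule add_disks_eqI[where f = "\<lambda>j x. mor p j (disk_out (src p) l s j x)" and g = "\<lambda>j x. v j (po.q j x)",
        OF cm_comp[OF D pC] cm_comp[OF po.cm_quo v] po.Q po.mQ _ _ x])
      fix i y assume y: "y \<in> carrier (cmod (tgt H) i)"
      show "mor p i (disk_out (src p) l s i (y, \<zero>\<^bsub>cmod (tgt H) (i + 1)\<^esub>, \<zero>\<^bsub>cmod (tgt H) i\<^esub>)) =
         v i (po.q i (y, \<zero>\<^bsub>cmod (tgt H) (i + 1)\<^esub>, \<zero>\<^bsub>cmod (tgt H) i\<^esub>))"
        using l(3)[OF y] by (simp only: disk_out_incl[where G = "cmod (tgt H)" and s = s, OF l(1) po.mQ s(1) y] po.eta_def)
    next
      fix i y assume y: "y \<in> carrier (cmod (tgt H) (i + 1))"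
      show "mor p i (disk_out (src p) l s i (\<zero>\<^bsub>cmod (tgt H) i\<^esub>, y, \<zero>\<^bsub>cmod (tgt H) i\<^esub>)) = ?t i y"
        by (simp only: disk_out_gen[where G = "cmod (tgt H)" and s = s, OF l(1) po.mQ s(1) y] s(3)[OF y])
    qed
    then have po_v: "mor p j (po.po_out (src p) l s j a) = v j a" if "a \<in> carrier (cmod po.P j)" for j a
      using that Oq by (auto elim!: po.poE)
    show "\<exists>l. cm R po.P (src p) l \<and> (\<forall>j. \<forall>x \<in> carrier (cmod N j). l j (restr N po.po_incl j x) = u j x) \<and>
        (\<forall>j. \<forall>y \<in> carrier (cmod po.P j). mor p j (l j y) = v j y)"
    proof (intro exI conjI allI ballI)
      show "cm R po.P (src p) (po.po_out (src p) l s)" by (rule O)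
      show "po.po_out (src p) l s j (restr N po.po_incl j x) = u j x" if x: "x \<in> carrier (cmod N j)" for j x
        unfolding restr_apply[OF x] po.po_incl_def Oe[OF cm_closed[OF HC x]] by (rule l(2)[OF x])
      show "mor p j (po.po_out (src p) l s j y) = v j y" if "y \<in> carrier (cmod po.P j)" for j y by (rule po_v[OF that])
    qed
  qed
  then show ?thesis using iA by (simp add: proj_cof_def)
qed

section \<open>Factoring a map of contractions\<close>

locale factored_contr =
  fixes R :: "('r, 'x) ring_scheme" and f :: "(('r, 'a) contraction, 'a graded_map) arrow"
    and H K :: "(('r, 'a) cochain, 'a graded_map) arrow" and pr :: "'a \<times> 'a \<Rightarrow> 'a"
  assumes f: "f \<in> Ar (Contr R)" and HA: "H \<in> Ar (coCh R)" and KA: "K \<in> Ar (coCh R)" and HK: "tgt H = src K"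
    and KH: "K \<cdot>\<^bsub>coCh R\<^esub> H = far \<beta>\<alpha> f" and inj_pr: "inj pr"
begin

lemma src_H: "src H = big (src f)" and tgt_K: "tgt K = big (tgt f)"
  using KH by simp_all

lemma cm_H: "cm R (big (src f)) (tgt H) (mor H)" and cm_K: "cm R (tgt H) (big (tgt f)) (mor K)"
  using coCh_cm[OF HA] coCh_cm[OF KA] by (simp_all add: src_H tgt_K HK)

lemmas cm_f = Contr_cm[OF f]

lemma K_H: "n \<in> carrier (cmod (big (src f)) i) \<Longrightarrow> mor K i (mor H i n) = mor f i n"
proof -
  assume n: "n \<in> carrier (cmod (big (src f)) i)"
  have "restr (big (src f)) (\<lambda>i x. mor K i (mor H i x)) = mor f"
    using KH by (simp add: src_H)
  then have "mor f i n = restr (big (src f)) (\<lambda>i x. mor K i (mor H i x)) i n" by simp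
  then show "mor K i (mor H i n) = mor f i n" using n by simp
qed

sublocale X: h_complex R "big (src f)" "homot (src f)"
  by (rule h_complex_contraction[OF Contr_obs(1)[OF f]])

sublocale Y: h_complex R "big (tgt f)" "homot (tgt f)"
  by (rule h_complex_contraction[OF Contr_obs(2)[OF f]])

sublocale po: pushout R "big (src f)" "homot (src f)" "tgt H" "mor H" pr
  by unfold_locales (rule cm_H inj_pr)+

text \<open>The value at \<open>h y\<close> that is forced if \<open>kout\<close> is to commute with
  the homotopies and to extend \<open>K\<close>.\<close>

definition s :: "int \<Rightarrow> 'a \<Rightarrow> 'a" where
  "s i y = homot (tgt f) (i + 1) (mor K (i + 1) y)"

definition kout :: "'a graded_map" where
  "kout = po.po_out (big (tgt f)) (mor K) s"

lemma lin_s: "lin R (cmod (tgt H) (i + 1)) (cmod (big (tgt f)) i) (s i)"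
  unfolding s_def by (rule lin_comp[OF cm_lin[OF cm_K] Y.h_lin'])

lemma s_H: "n \<in> carrier (cmod (big (src f)) (i + 1)) \<Longrightarrow> s i (mor H (i + 1) n) = mor f i (homot (src f) (i + 1) n)"
  using Contr_h[OF f, of n "i + 1"] by (simp add: s_def K_H)

lemma cm_kout: "cm R po.P (big (tgt f)) kout"
  and kout_quo: "x \<in> carrier (cmod po.L i) \<Longrightarrow> kout i (po.q i x) = disk_out (big (tgt f)) (mor K) s i x"
  and kout_eta: "y \<in> carrier (cmod (tgt H) i) \<Longrightarrow> kout i (po.eta i y) = mor K i y"
  unfolding kout_def using po.cm_po_out[OF cm_K cm_f lin_s K_H s_H] po.po_out_quo[OF cm_K cm_f lin_s K_H s_H]
    po.po_out_eta[OF cm_K cm_f lin_s K_H s_H] by blast+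

lemma kout_incl: "n \<in> carrier (cmod (big (src f)) i) \<Longrightarrow> kout i (po.po_incl i n) = mor f i n"
  by (simp add: po.po_incl_def kout_eta cm_closed[OF cm_H] K_H)

text \<open>At a representative \<open>(x, y, z)\<close> both sides are
  \<open>h K x - h K z\<close>; the right side is brought to this form by \<open>h h = 0\<close> and
  \<open>h d h = -h\<close> in the target.\<close>

lemma kout_h:
  assumes "a \<in> carrier (cmod po.P i)"
  shows "kout (i - 1) (po.hP i a) = homot (tgt f) i (kout i a)"
proof -
  obtain v where v: "v \<in> carrier (cmod po.L i)" "a = po.q i v" using assms by (rule po.poE)
  obtain x y z where xyz: "v = (x, y, z)" "x \<in> carrier (cmod (tgt H) i)" "y \<in> carrier (cmod (tgt H) (i + 1))" "z \<in> carrier (cmod (tgt H) i)"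
    using v(1) by auto
  interpret Qi: module R "cmod (tgt H) i" by (rule po.mQ)
  interpret Yk: module R "cmod (big (tgt f)) (i - 1)" by (rule Y.mod)
  note Kc = cm_closed[OF cm_K xyz(2)] cm_closed[OF cm_K xyz(3)] cm_closed[OF cm_K xyz(4)]
  note kc = Y.h_closed[OF Kc(1)] Y.h_closed'[OF Kc(2)] Y.h_closed[OF Kc(3)]
  have xz: "x \<ominus>\<^bsub>cmod (tgt H) i\<^esub> z \<in> carrier (cmod (tgt H) i)" using xyz by simp
  have fh: "free_homot (tgt H) i v = (\<zero>\<^bsub>cmod (tgt H) (i - 1)\<^esub>, x \<ominus>\<^bsub>cmod (tgt H) i\<^esub> z, \<zero>\<^bsub>cmod (tgt H) (i - 1)\<^esub>)"
    by (simp add: xyz(1) free_homot_def)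
  have "kout (i - 1) (po.hP i a) = disk_out (big (tgt f)) (mor K) s (i - 1) (free_homot (tgt H) i v)"
    unfolding v(2) po.hP_quo[OF v(1)] by (rule kout_quo[OF po.L.h_closed[OF v(1)]])
  also have "\<dots> = s (i - 1) (x \<ominus>\<^bsub>cmod (tgt H) i\<^esub> z)"
    unfolding fh using disk_out_gen[where G = "cmod (tgt H)" and s = s and i = "i - 1", OF cm_K po.mQ lin_s] xz by simp
  also have "\<dots> = homot (tgt f) i (mor K i x) \<ominus>\<^bsub>cmod (big (tgt f)) (i - 1)\<^esub> homot (tgt f) i (mor K i z)"
    by (simp add: s_def lin_minus[OF cm_lin[OF cm_K] xyz(2,4)] lin_minus[OF Y.h_lin Kc(1,3)])
  finally have 1: "kout (i - 1) (po.hP i a) = homot (tgt f) i (mor K i x) \<ominus>\<^bsub>cmod (big (tgt f)) (i - 1)\<^esub> homot (tgt f) i (mor K i z)" .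
  have "kout i a = mor K i x \<oplus>\<^bsub>cmod (big (tgt f)) i\<^esub> (homot (tgt f) (i + 1) (mor K (i + 1) y) \<oplus>\<^bsub>cmod (big (tgt f)) i\<^esub> diff (big (tgt f)) (i - 1) (homot (tgt f) i (mor K i z)))"
    unfolding v(2) kout_quo[OF v(1)] by (simp add: xyz(1) disk_out_def s_def)
  then have "homot (tgt f) i (kout i a) = homot (tgt f) i (mor K i x) \<oplus>\<^bsub>cmod (big (tgt f)) (i - 1)\<^esub>
     (homot (tgt f) i (homot (tgt f) (i + 1) (mor K (i + 1) y)) \<oplus>\<^bsub>cmod (big (tgt f)) (i - 1)\<^esub> homot (tgt f) i (diff (big (tgt f)) (i - 1) (homot (tgt f) i (mor K i z))))"
    using Kc kc Y.d_closed'[OF kc(3)] by (simp add: lin_add[OF Y.h_lin] mod_add[OF Y.mod])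
  also have "\<dots> = homot (tgt f) i (mor K i x) \<ominus>\<^bsub>cmod (big (tgt f)) (i - 1)\<^esub> homot (tgt f) i (mor K i z)"
    unfolding Y.h_h'[OF Kc(2)] Y.h_d_h[OF Kc(3)] using kc by (simp add: a_minus_def)
  finally show ?thesis using 1 by simp
qed

definition mid :: "('r, 'a) contraction" where
  "mid = h_complex.contr po.P po.hP"

lemma mid_simps: "big mid = po.P" "homot mid = restr po.P po.hP" "contraction R mid"
  unfolding mid_def using po.P.contr_simps po.P.contraction_contr by simp_all

definition harr :: "(('r, 'a) contraction, 'a graded_map) arrow" where
  "harr = Arrow (src f) (restr (big (src f)) po.po_incl) mid"

definition karr :: "(('r, 'a) contraction, 'a graded_map) arrow" where
  "karr = Arrow mid (restr po.P kout) (tgt f)"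

lemma harr: "harr \<in> Ar (Contr R)"
  unfolding harr_def
  by (rule Contr_arrI[OF Contr_obs(1)[OF f]]) (simp_all add: mid_simps po.cm_po_incl po.po_incl_h cm_closed[OF po.cm_po_incl])

lemma karr: "karr \<in> Ar (Contr R)"
  using Contr_arrI[OF mid_simps(3) Contr_obs(2)[OF f], unfolded mid_simps(1,2), OF cm_kout] kout_h
  unfolding karr_def by simp

lemma karr_harr: "karr \<cdot>\<^bsub>Contr R\<^esub> harr = f"
proof (rule Contr_eqI[OF _ f])
  show "karr \<cdot>\<^bsub>Contr R\<^esub> harr \<in> Ar (Contr R)"
    by (rule category.Cmp_closed[OF category_Contr harr karr]) (simp add: harr_def karr_def)
qed (simp_all add: harr_def karr_def cm_closed[OF po.cm_po_incl] kout_incl)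

text \<open>\<open>kout\<close> extends \<open>K\<close> along \<open>eta\<close>, so it is
  surjective wherever \<open>K\<close> is.\<close>

lemma karr_fib:
  assumes K: "K \<in> proj_fib R" shows "far \<beta>\<alpha> karr \<in> proj_fib R"
proof -
  have "\<exists>a \<in> carrier (cmod po.P i). kout i a = y" if "y \<in> carrier (cmod (big (tgt f)) i)" for i y
  proof -
    have "y \<in> mor K i ` carrier (cmod (tgt H) i)" using K that by (simp add: proj_fib_iff HK tgt_K)
    then obtain x where "x \<in> carrier (cmod (tgt H) i)" "mor K i x = y" by auto
    then show ?thesis using kout_eta cm_closed[OF po.cm_eta] by metis
  qed
  moreover have "restr po.P kout i ` carrier (cmod po.P i) = kout i ` carrier (cmod po.P i)" for i by (rule image_cong) simp_all
  ultimately have "restr po.P kout i ` carrier (cmod po.P i) = carrier (cmod (big (tgt f)) i)" for i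
    using cm_closed[OF cm_kout] by auto
  then show ?thesis using Contr_coCh[OF karr] by (simp add: proj_fib_iff karr_def mid_simps)
qed

text \<open>\<open>K\<close> is \<open>kout\<close> after \<open>eta\<close>, and
  \<open>po_incl\<close> is \<open>eta\<close> after \<open>H\<close>. For injective
  \<open>H\<close> the map \<open>eta\<close> is a quasi-isomorphism, so cancellation gives the
  first claim and composition the second.\<close>

lemma
  assumes inj: "\<And>i x x'. \<lbrakk>x \<in> carrier (cmod (big (src f)) i); x' \<in> carrier (cmod (big (src f)) i); mor H i x = mor H i x'\<rbrakk> \<Longrightarrow> x = x'"
  shows karr_qis: "K \<in> qis R \<Longrightarrow> far \<beta>\<alpha> karr \<in> qis R"
    and harr_qis: "H \<in> qis R \<Longrightarrow> far \<beta>\<alpha> harr \<in> qis R"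
proof -
  have E: "coh_bij (tgt H) po.P po.eta" by (rule po.coh_bij_eta) (rule inj)
  {
    assume "K \<in> qis R"
    then have "coh_bij (tgt H) (big (tgt f)) (mor K)" by (simp add: qis_iff HK tgt_K)
    then have "coh_bij (tgt H) (big (tgt f)) (\<lambda>i x. kout i (po.eta i x))"
      by (subst coh_bij_cong[where g = "mor K"]) (simp_all add: kout_eta)
    then have "coh_bij po.P (big (tgt f)) kout" by (rule coh_bij_cancel_right[OF po.cm_eta cm_kout E])
    then have "coh_bij po.P (big (tgt f)) (restr po.P kout)" by (subst coh_bij_cong[where g = kout]) simp_all
    then show "far \<beta>\<alpha> karr \<in> qis R" using Contr_coCh[OF karr] by (simp add: qis_iff karr_def mid_simps)
  next
    assume "H \<in> qis R"
    then have "coh_bij (big (src f)) (tgt H) (mor H)" by (simp add: qis_iff src_H)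
    then have "coh_bij (big (src f)) po.P po.po_incl"
      unfolding po.po_incl_def[abs_def] by (rule coh_bij_comp[OF cm_H po.cm_eta _ E])
    then have "coh_bij (big (src f)) po.P (restr (big (src f)) po.po_incl)" by (subst coh_bij_cong[where g = po.po_incl]) simp_all
    then show "far \<beta>\<alpha> harr \<in> qis R" using Contr_coCh[OF harr] by (simp add: qis_iff harr_def mid_simps)
  }
qed

end

section \<open>Functoriality of the pushout\<close>

definition po_map :: "('a \<times> 'a \<Rightarrow> 'a) \<Rightarrow> ('r, 'a) contraction \<Rightarrow> (('r, 'a) cochain, 'a graded_map) arrow \<Rightarrow>
    ('r, 'a) contraction \<Rightarrow> (('r, 'a) cochain, 'a graded_map) arrow \<Rightarrow> 'a graded_map \<Rightarrow> 'a graded_map" where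
  "po_map pr X H X' H' t = descend (add_disks (tgt H) (cmod (tgt H))) (quo pr (big X) (homot X) (tgt H) (mor H))
     (\<lambda>i (x, y, z). quo pr (big X') (homot X') (tgt H') (mor H') i (t i x, t (i + 1) y, t i z))"

text \<open>All maps are induced by \<open>t\<close> acting on the three components. As
  \<open>u\<close> commutes with the differentials and the homotopies, the relation with parameters
  \<open>(n, m)\<close> goes to the one with parameters \<open>(u n, u m)\<close>; the remaining
  claims are then verified on representatives.\<close>

lemma
  fixes f u v g :: "(('r, 'a) contraction, 'a graded_map) arrow"
  assumes "factored_contr R f H K pr" "factored_contr R g H' K' pr"
    and a: "Arrow f (u, v) g \<in> Ar (map_cat (Contr R))" and b: "Arrow H (far \<beta>\<alpha> u, t) H' \<in> Ar (map_cat (coCh R))"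
    and c: "Arrow K (t, far \<beta>\<alpha> v) K' \<in> Ar (map_cat (coCh R))"
  shows cm_po_map: "cm R (big (factored_contr.mid f H pr)) (big (factored_contr.mid g H' pr)) (po_map pr (src f) H (src g) H' (mor t))"
    and po_map_h: "x \<in> carrier (cmod (big (factored_contr.mid f H pr)) i) \<Longrightarrow>
      po_map pr (src f) H (src g) H' (mor t) (i - 1) (homot (factored_contr.mid f H pr) i x) =
      homot (factored_contr.mid g H' pr) i (po_map pr (src f) H (src g) H' (mor t) i x)"
    and po_map_quo: "z \<in> carrier (cmod (add_disks (tgt H) (cmod (tgt H))) i) \<Longrightarrow>
      po_map pr (src f) H (src g) H' (mor t) i (quo pr (big (src f)) (homot (src f)) (tgt H) (mor H) i z) =
      quo pr (big (src g)) (homot (src g)) (tgt H') (mor H') i (case z of (x, y, z) \<Rightarrow> (mor t i x, mor t (i + 1) y, mor t i z))"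
    and po_map_incl: "n \<in> carrier (cmod (big (src f)) i) \<Longrightarrow>
      po_map pr (src f) H (src g) H' (mor t) i (mor (factored_contr.harr f H pr) i n) = mor (factored_contr.harr g H' pr) i (mor u i n)"
    and po_map_out: "x \<in> carrier (cmod (big (factored_contr.mid f H pr)) i) \<Longrightarrow>
      mor (factored_contr.karr g H' K' pr) i (po_map pr (src f) H (src g) H' (mor t) i x) = mor v i (mor (factored_contr.karr f H K pr) i x)"
proof -
  interpret A: factored_contr R f H K pr by fact
  interpret B: factored_contr R g H' K' pr by fact
  have uv: "u \<in> Ar (Contr R)" "v \<in> Ar (Contr R)" "src u = src f" "tgt u = src g" "src v = tgt f" "tgt v = tgt g"
    using a by (simp_all del: Contr_simps(5) add: Contr_simps(1-4))
  note b' = map_coChE[OF b, unfolded \<beta>\<alpha>_simps arrow.sel] and c' = map_coChE[OF c, unfolded \<beta>\<alpha>_simps arrow.sel]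
  have tC: "cm R (tgt H) (tgt H') (mor t)" using b'(4) .
  have uC: "cm R (big (src f)) (big (src g)) (mor u)" and vC: "cm R (big (tgt f)) (big (tgt g)) (mor v)"
    using Contr_cm[OF uv(1)] Contr_cm[OF uv(2)] uv by simp_all
  have uh: "mor u (i - 1) (homot (src f) i x) = homot (src g) i (mor u i x)" if "x \<in> carrier (cmod (big (src f)) i)" for i x
    using Contr_h[OF uv(1), of x i] uv that by simp
  have vh: "mor v (i - 1) (homot (tgt f) i x) = homot (tgt g) i (mor v i x)" if "x \<in> carrier (cmod (big (tgt f)) i)" for i x
    using Contr_h[OF uv(2), of x i] uv that by simp
  have tH: "mor t i (mor H i n) = mor H' i (mor u i n)" if "n \<in> carrier (cmod (big (src f)) i)" for i n
    using b'(9)[of n i] that by (simp add: A.src_H)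
  have Kt: "mor K' i (mor t i x) = mor v i (mor K i x)" if "x \<in> carrier (cmod (tgt H) i)" for i x
    using c'(9)[of x i] that by (simp add: A.HK)
  let ?T = "\<lambda>i (x, y, z). (mor t i x, mor t (i + 1) y, mor t i z)"
  have T: "cm R A.po.L B.po.L ?T" by (rule cm_disk_map[OF tC cm_lin[OF tC]])
  have Tr: "?T i r \<in> rels (big (src g)) (homot (src g)) (tgt H') (mor H') i"
    if r: "r \<in> rels (big (src f)) (homot (src f)) (tgt H) (mor H) i" for i r
  proof -
    obtain n m where nm: "n \<in> carrier (cmod (big (src f)) (i + 1))" "m \<in> carrier (cmod (big (src f)) i)"
      and r': "r = (\<ominus>\<^bsub>cmod (tgt H) i\<^esub> mor H i (homot (src f) (i + 1) n \<oplus>\<^bsub>cmod (big (src f)) i\<^esub> diff (big (src f)) (i - 1) (homot (src f) i m)),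
        mor H (i + 1) n, mor H i m)" using r by (rule A.po.rels_cases)
    note c = A.X.h_closed'[OF nm(1)] A.X.d_closed'[OF A.X.h_closed[OF nm(2)]]
    have s: "homot (src f) (i + 1) n \<oplus>\<^bsub>cmod (big (src f)) i\<^esub> diff (big (src f)) (i - 1) (homot (src f) i m) \<in> carrier (cmod (big (src f)) i)"
      using c mod_add[OF A.X.mod] by blast
    have "mor u i (homot (src f) (i + 1) n) = homot (src g) (i + 1) (mor u (i + 1) n)" using uh[OF nm(1)] by simp
    then have us: "mor u i (homot (src f) (i + 1) n \<oplus>\<^bsub>cmod (big (src f)) i\<^esub> diff (big (src f)) (i - 1) (homot (src f) i m)) =
       homot (src g) (i + 1) (mor u (i + 1) n) \<oplus>\<^bsub>cmod (big (src g)) i\<^esub> diff (big (src g)) (i - 1) (homot (src g) i (mor u i m))"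
      by (simp only: lin_add[OF cm_lin[OF uC] c] cm_diff'[OF uC A.X.h_closed[OF nm(2)]] uh[OF nm(2)])
    have t1: "mor t i (\<ominus>\<^bsub>cmod (tgt H) i\<^esub> mor H i (homot (src f) (i + 1) n \<oplus>\<^bsub>cmod (big (src f)) i\<^esub> diff (big (src f)) (i - 1) (homot (src f) i m))) =
      \<ominus>\<^bsub>cmod (tgt H') i\<^esub> mor H' i (homot (src g) (i + 1) (mor u (i + 1) n) \<oplus>\<^bsub>cmod (big (src g)) i\<^esub> diff (big (src g)) (i - 1) (homot (src g) i (mor u i m)))"
      by (simp only: lin_neg[OF cm_lin[OF tC] cm_closed[OF A.cm_H s]] tH[OF s] us)
    show ?thesis
      by (rule B.po.relsI[OF cm_closed[OF uC nm(1)] cm_closed[OF uC nm(2)]])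
        (simp only: r' prod.case t1 tH[OF nm(1)] tH[OF nm(2)])
  qed
  let ?F = "\<lambda>i x. B.po.q i (?T i x)"
  have F: "cm R A.po.L B.po.P ?F" by (rule cm_comp[OF T B.po.cm_quo])
  have resp: "?F i x = ?F i x'" if "x \<in> carrier (cmod A.po.L i)" "x' \<in> carrier (cmod A.po.L i)" "A.po.q i x = A.po.q i x'" for i x x'
    by (rule A.po.quo_kill[OF cm_lin[OF F] B.po.quo_rel[OF Tr] that])
  have W_def: "po_map pr (src f) H (src g) H' (mor t) = descend A.po.L A.po.q ?F"
    by (simp add: po_map_def case_prod_unfold)
  let ?W = "po_map pr (src f) H (src g) H' (mor t)"
  have W: "cm R A.po.P B.po.P ?W"
    unfolding W_def po_def[of pr "big (src f)"] by (rule cm_descend[OF A.po.complex_cong_quo F resp])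
  then show "cm R (big A.mid) (big B.mid) ?W" by (simp add: A.mid_simps B.mid_simps)
  have Wq: "?W i (A.po.q i z) = B.po.q i (?T i z)" if "z \<in> carrier (cmod A.po.L i)" for i z
    unfolding W_def by (rule descend_eq[where f = ?F, OF resp that])
  then show "z \<in> carrier (cmod A.po.L i) \<Longrightarrow> ?W i (A.po.q i z) = B.po.q i (?T i z)" .
  show "?W (i - 1) (homot A.mid i x) = homot B.mid i (?W i x)" if x: "x \<in> carrier (cmod (big A.mid) i)" for i x
  proof -
    have xP: "x \<in> carrier (cmod A.po.P i)" using x by (simp add: A.mid_simps)
    then obtain w where w: "w \<in> carrier (cmod A.po.L i)" "x = A.po.q i w" by (rule A.po.poE)
    have "?T (i - 1) (free_homot (tgt H) i w) = free_homot (tgt H') i (?T i w)"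
      using w(1) by (auto simp: free_homot_def lin_zero[OF cm_lin[OF tC]] lin_minus[OF cm_lin[OF tC]])
    then have "?W (i - 1) (A.po.hP i x) = B.po.hP i (?W i x)"
      by (simp only: w(2) A.po.hP_quo[OF w(1)] Wq[OF A.po.L.h_closed[OF w(1)]] Wq[OF w(1)] B.po.hP_quo[OF cm_closed[OF T w(1)]])
    then show ?thesis using xP cm_closed[OF W xP] by (simp add: A.mid_simps B.mid_simps)
  qed
  show "?W i (mor A.harr i n) = mor B.harr i (mor u i n)" if n: "n \<in> carrier (cmod (big (src f)) i)" for i n
  proof -
    have "?W i (A.po.po_incl i n) = B.po.po_incl i (mor u i n)"
      unfolding A.po.po_incl_def B.po.po_incl_def A.po.eta_def B.po.eta_def Wq[OF A.po.eta_in[OF cm_closed[OF A.cm_H n]]]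
      by (simp only: prod.case lin_zero[OF cm_lin[OF tC]] tH[OF n])
    then show ?thesis using n cm_closed[OF uC n] by (simp add: A.harr_def B.harr_def)
  qed
  show "mor B.karr i (?W i x) = mor v i (mor A.karr i x)" if x: "x \<in> carrier (cmod (big A.mid) i)" for i x
  proof -
    have xP: "x \<in> carrier (cmod A.po.P i)" using x by (simp add: A.mid_simps)
    then obtain w where w: "w \<in> carrier (cmod A.po.L i)" "x = A.po.q i w" by (rule A.po.poE)
    note DA = cm_disk_out[where G = "cmod (tgt H)" and s = A.s, OF A.cm_K A.po.mQ A.lin_s]
    note DB = cm_disk_out[where G = "cmod (tgt H')" and s = B.s, OF B.cm_K B.po.mQ B.lin_s]
    have "disk_out (big (tgt g)) (mor K') B.s i (?T i w) = mor v i (disk_out (big (tgt f)) (mor K) A.s i w)"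
    proof (rule add_disks_eqI[where f = "\<lambda>i w. disk_out (big (tgt g)) (mor K') B.s i (?T i w)" and g = "\<lambda>i w. mor v i (disk_out (big (tgt f)) (mor K) A.s i w)",
        OF cm_comp[OF T DB] cm_comp[OF DA vC] A.po.Q A.po.mQ _ _ w(1)])
      fix i x assume x: "x \<in> carrier (cmod (tgt H) i)"
      show "disk_out (big (tgt g)) (mor K') B.s i (?T i (x, \<zero>\<^bsub>cmod (tgt H) (i + 1)\<^esub>, \<zero>\<^bsub>cmod (tgt H) i\<^esub>)) =
        mor v i (disk_out (big (tgt f)) (mor K) A.s i (x, \<zero>\<^bsub>cmod (tgt H) (i + 1)\<^esub>, \<zero>\<^bsub>cmod (tgt H) i\<^esub>))"
        by (simp only: prod.case lin_zero[OF cm_lin[OF tC]] disk_out_incl[where G = "cmod (tgt H)" and s = A.s, OF A.cm_K A.po.mQ A.lin_s x]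
          disk_out_incl[where G = "cmod (tgt H')" and s = B.s, OF B.cm_K B.po.mQ B.lin_s cm_closed[OF tC x]] Kt[OF x])
    next
      fix i y assume y: "y \<in> carrier (cmod (tgt H) (i + 1))"
      have "B.s i (mor t (i + 1) y) = mor v i (A.s i y)"
        using vh[OF cm_closed[OF A.cm_K y]] by (simp add: A.s_def B.s_def Kt[OF y])
      then show "disk_out (big (tgt g)) (mor K') B.s i (?T i (\<zero>\<^bsub>cmod (tgt H) i\<^esub>, y, \<zero>\<^bsub>cmod (tgt H) i\<^esub>)) =
        mor v i (disk_out (big (tgt f)) (mor K) A.s i (\<zero>\<^bsub>cmod (tgt H) i\<^esub>, y, \<zero>\<^bsub>cmod (tgt H) i\<^esub>))"
        by (simp only: prod.case lin_zero[OF cm_lin[OF tC]] disk_out_gen[where G = "cmod (tgt H)" and s = A.s, OF A.cm_K A.po.mQ A.lin_s y]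
          disk_out_gen[where G = "cmod (tgt H')" and s = B.s, OF B.cm_K B.po.mQ B.lin_s cm_closed[OF tC y]])
    qed
    then have "B.kout i (?W i x) = mor v i (A.kout i x)"
      by (simp only: w(2) Wq[OF w(1)] A.kout_quo[OF w(1)] B.kout_quo[OF cm_closed[OF T w(1)]])
    then show ?thesis using xP cm_closed[OF W xP] by (simp add: A.karr_def B.karr_def)
  qed
qed


text \<open>The conclusion fixes the object parts explicitly, with \<open>pr\<close> as the only
  auxiliary datum, so that the model axioms can be checked afterwards for any factorization of
  complexes.\<close>

lemma exists_transfer:
  fixes R :: "('r, 'x) ring_scheme" and pr :: "'a \<times> 'a \<Rightarrow> 'a"
  assumes pr: "inj pr"
  shows "\<exists>\<Psi>. factorization_transfer (Contr R :: (('r, 'a) contraction, _) cat) (coCh R) \<beta>\<alpha> \<Psi> \<and>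
     fob (fst \<Psi>) = (\<lambda>(f, H, K). factored_contr.harr f H pr) \<and> fob (snd \<Psi>) = (\<lambda>(f, H, K). factored_contr.karr f H K pr)"
proof (rule factorization_transferI[OF category_Contr category_coCh functor_\<beta>\<alpha>, where
    w = "\<lambda>(f, H, K) t (g, H', K'). Arrow (factored_contr.mid f H pr)
      (restr (big (factored_contr.mid f H pr)) (po_map pr (src f) H (src g) H' (mor t))) (factored_contr.mid g H' pr)"])
  interpret C: category "Contr R" by (rule category_Contr)
  interpret D: category "coCh R" by (rule category_coCh)
  fix f :: "(('r, 'a) contraction, 'a graded_map) arrow" and H K :: "(('r, 'a) cochain, 'a graded_map) arrow"
  {
    assume f: "f \<in> Ar (Contr R)" and H: "H \<in> Ar (coCh R)" and K: "K \<in> Ar (coCh R)"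
      and HK: "Cod (coCh R) H = Dom (coCh R) K" and KH: "K \<cdot>\<^bsub>coCh R\<^esub> H = far \<beta>\<alpha> f"
    then interpret A: factored_contr R f H K pr
      by unfold_locales (simp_all only: coCh_simps(2,3) pr)
    have h: "A.harr \<in> Ar (Contr R)" and k: "A.karr \<in> Ar (Contr R)" and d: "src A.karr = A.mid" "tgt A.harr = A.mid"
      using A.harr A.karr by (simp_all add: A.harr_def A.karr_def)
    show "(case (f, H, K) of (f, H, K) \<Rightarrow> factored_contr.harr f H pr) \<in> Ar (Contr R) \<and>
       (case (f, H, K) of (f, H, K) \<Rightarrow> factored_contr.karr f H K pr) \<in> Ar (Contr R) \<and>
       Cod (Contr R) (case (f, H, K) of (f, H, K) \<Rightarrow> factored_contr.harr f H pr) = Dom (Contr R) (case (f, H, K) of (f, H, K) \<Rightarrow> factored_contr.karr f H K pr) \<and>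
       (case (f, H, K) of (f, H, K) \<Rightarrow> factored_contr.karr f H K pr) \<cdot>\<^bsub>Contr R\<^esub> (case (f, H, K) of (f, H, K) \<Rightarrow> factored_contr.harr f H pr) = f"
      unfolding prod.case by (intro conjI h k A.karr_harr) (simp only: d Contr_simps(2,3))
    let ?I = "Ide (coCh R) (Cod (coCh R) H)"
    have i1: "Arrow f (Ide (Contr R) (src f), Ide (Contr R) (tgt f)) f \<in> Ar (map_cat (Contr R))"
      using C.Ide_in_map_cat[OF f] by (simp only: map_cat_simps(4) Contr_simps(2,3))
    have far_Ide: "far \<beta>\<alpha> (Ide (Contr R) (src f)) = Ide (coCh R) (src H)" "far \<beta>\<alpha> (Ide (Contr R) (tgt f)) = Ide (coCh R) (tgt K)"
      by (simp_all add: A.src_H A.tgt_K)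
    have i2: "Arrow H (far \<beta>\<alpha> (Ide (Contr R) (src f)), ?I) H \<in> Ar (map_cat (coCh R))"
      using D.Ide_in_map_cat[OF H] unfolding far_Ide by (simp only: map_cat_simps(4) coCh_simps(2,3))
    have i3: "Arrow K (?I, far \<beta>\<alpha> (Ide (Contr R) (tgt f))) K \<in> Ar (map_cat (coCh R))"
      using D.Ide_in_map_cat[OF K] HK unfolding far_Ide by (simp only: map_cat_simps(4) coCh_simps(2,3))
    note P = A.factored_contr_axioms
    note W = cm_po_map[OF P P i1 i2 i3] and Wh = po_map_h[OF P P i1 i2 i3] and Wq = po_map_quo[OF P P i1 i2 i3]
    let ?w = "Arrow A.mid (restr (big A.mid) (po_map pr (src f) H (src f) H (mor ?I))) A.mid"
    have wA: "?w \<in> Ar (Contr R)" by (rule Contr_arrI[OF A.mid_simps(3) A.mid_simps(3) W Wh])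
    have "Ide (Contr R) A.mid \<in> Ar (Contr R)" using C.Ide_closed[of A.mid] A.mid_simps(3) by simp
    then have "?w = Ide (Contr R) A.mid"
    proof (rule Contr_eqI[OF wA])
      fix i x assume "x \<in> carrier (cmod (big (src ?w)) i)"
      then have x: "x \<in> carrier (cmod A.po.P i)" by (simp add: A.mid_simps)
      then obtain v where v: "v \<in> carrier (cmod A.po.L i)" "x = A.po.q i v" by (rule A.po.poE)
      have "po_map pr (src f) H (src f) H (mor ?I) i x = x"
        using Wq[OF v(1)] v by auto
      then show "mor ?w i x = mor (Ide (Contr R) A.mid) i x" using x by (simp add: A.mid_simps)
    qed simp_all
    then show "(case (f, H, K) of (f, H, K) \<Rightarrow> \<lambda>t (g, H', K'). Arrow (factored_contr.mid f H pr)
      (restr (big (factored_contr.mid f H pr)) (po_map pr (src f) H (src g) H' (mor t))) (factored_contr.mid g H' pr)) ?I (f, H, K) =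
      Ide (Contr R) (Cod (Contr R) (case (f, H, K) of (f, H, K) \<Rightarrow> factored_contr.harr f H pr))"
      unfolding prod.case Contr_simps(3) d .
  }
  fix u v g :: "(('r, 'a) contraction, 'a graded_map) arrow" and t H' K' :: "(('r, 'a) cochain, 'a graded_map) arrow"
  assume a: "Arrow f (u, v) g \<in> Ar (map_cat (Contr R))" and b: "Arrow H (far \<beta>\<alpha> u, t) H' \<in> Ar (map_cat (coCh R))"
    and c: "Arrow K (t, far \<beta>\<alpha> v) K' \<in> Ar (map_cat (coCh R))"
    and HK: "Cod (coCh R) H = Dom (coCh R) K" and HK': "Cod (coCh R) H' = Dom (coCh R) K'"
    and KH: "K \<cdot>\<^bsub>coCh R\<^esub> H = far \<beta>\<alpha> f" and KH': "K' \<cdot>\<^bsub>coCh R\<^esub> H' = far \<beta>\<alpha> g"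
  have ar: "f \<in> Ar (Contr R)" "g \<in> Ar (Contr R)" "u \<in> Ar (Contr R)" "v \<in> Ar (Contr R)" "H \<in> Ar (coCh R)" "H' \<in> Ar (coCh R)" "K \<in> Ar (coCh R)" "K' \<in> Ar (coCh R)"
    using a b c unfolding Arrow_in_map_cat by blast+
  have uv: "src u = src f" "tgt u = src g" "src v = tgt f" "tgt v = tgt g"
    using a unfolding Arrow_in_map_cat Contr_simps(2,3) by blast+
  interpret A: factored_contr R f H K pr by unfold_locales (use ar HK KH pr in \<open>simp_all only: coCh_simps(2,3)\<close>)
  interpret B: factored_contr R g H' K' pr by unfold_locales (use ar HK' KH' pr in \<open>simp_all only: coCh_simps(2,3)\<close>)
  note P = A.factored_contr_axioms and P' = B.factored_contr_axioms
  note W = cm_po_map[OF P P' a b c] and Wh = po_map_h[OF P P' a b c] and Wq = po_map_quo[OF P P' a b c]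
  let ?w = "Arrow A.mid (restr (big A.mid) (po_map pr (src f) H (src g) H' (mor t))) B.mid"
  have wA: "?w \<in> Ar (Contr R)" by (rule Contr_arrI[OF A.mid_simps(3) B.mid_simps(3) W Wh])
  have s: "src A.harr = src f" "tgt A.harr = A.mid" "src A.karr = A.mid" "tgt A.karr = tgt f"
    "src B.harr = src g" "tgt B.harr = B.mid" "src B.karr = B.mid" "tgt B.karr = tgt g"
    by (simp_all add: A.harr_def A.karr_def B.harr_def B.karr_def)
  have hC: "cm R (big (src f)) (big A.mid) (mor A.harr)" using Contr_cm[OF A.harr] s by simp
  have e1: "?w \<cdot>\<^bsub>Contr R\<^esub> A.harr = B.harr \<cdot>\<^bsub>Contr R\<^esub> u"
  proof (rule Contr_eqI)
    show "?w \<cdot>\<^bsub>Contr R\<^esub> A.harr \<in> Ar (Contr R)" by (rule C.Cmp_closed[OF A.harr wA]) (simp add: s)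
    show "B.harr \<cdot>\<^bsub>Contr R\<^esub> u \<in> Ar (Contr R)" by (rule C.Cmp_closed[OF ar(3) B.harr]) (simp add: s uv)
    fix i x assume "x \<in> carrier (cmod (big (src (?w \<cdot>\<^bsub>Contr R\<^esub> A.harr))) i)"
    then have x: "x \<in> carrier (cmod (big (src f)) i)" by (simp add: s)
    show "mor (?w \<cdot>\<^bsub>Contr R\<^esub> A.harr) i x = mor (B.harr \<cdot>\<^bsub>Contr R\<^esub> u) i x"
      using x cm_closed[OF hC x] po_map_incl[OF P P' a b c x] by (simp add: s uv)
  qed (simp_all add: s uv)
  have e2: "B.karr \<cdot>\<^bsub>Contr R\<^esub> ?w = v \<cdot>\<^bsub>Contr R\<^esub> A.karr"
  proof (rule Contr_eqI)
    show "B.karr \<cdot>\<^bsub>Contr R\<^esub> ?w \<in> Ar (Contr R)" by (rule C.Cmp_closed[OF wA B.karr]) (simp add: s)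
    show "v \<cdot>\<^bsub>Contr R\<^esub> A.karr \<in> Ar (Contr R)" by (rule C.Cmp_closed[OF A.karr ar(4)]) (simp add: s uv)
    fix i x assume "x \<in> carrier (cmod (big (src (B.karr \<cdot>\<^bsub>Contr R\<^esub> ?w))) i)"
    then have x: "x \<in> carrier (cmod (big A.mid) i)" by simp
    show "mor (B.karr \<cdot>\<^bsub>Contr R\<^esub> ?w) i x = mor (v \<cdot>\<^bsub>Contr R\<^esub> A.karr) i x"
      using x po_map_out[OF P P' a b c x] by (simp add: s uv)
  qed (simp_all add: s uv)
  show "(case (f, H, K) of (f, H, K) \<Rightarrow> \<lambda>t (g, H', K'). Arrow (factored_contr.mid f H pr)
      (restr (big (factored_contr.mid f H pr)) (po_map pr (src f) H (src g) H' (mor t))) (factored_contr.mid g H' pr)) t (g, H', K') \<in> Ar (Contr R) \<and>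
    Dom (Contr R) ((case (f, H, K) of (f, H, K) \<Rightarrow> \<lambda>t (g, H', K'). Arrow (factored_contr.mid f H pr)
      (restr (big (factored_contr.mid f H pr)) (po_map pr (src f) H (src g) H' (mor t))) (factored_contr.mid g H' pr)) t (g, H', K')) =
      Cod (Contr R) (case (f, H, K) of (f, H, K) \<Rightarrow> factored_contr.harr f H pr) \<and>
    Cod (Contr R) ((case (f, H, K) of (f, H, K) \<Rightarrow> \<lambda>t (g, H', K'). Arrow (factored_contr.mid f H pr)
      (restr (big (factored_contr.mid f H pr)) (po_map pr (src f) H (src g) H' (mor t))) (factored_contr.mid g H' pr)) t (g, H', K')) =
      Cod (Contr R) (case (g, H', K') of (f, H, K) \<Rightarrow> factored_contr.harr f H pr) \<and>
    ((case (f, H, K) of (f, H, K) \<Rightarrow> \<lambda>t (g, H', K'). Arrow (factored_contr.mid f H pr)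
      (restr (big (factored_contr.mid f H pr)) (po_map pr (src f) H (src g) H' (mor t))) (factored_contr.mid g H' pr)) t (g, H', K')) \<cdot>\<^bsub>Contr R\<^esub>
      (case (f, H, K) of (f, H, K) \<Rightarrow> factored_contr.harr f H pr) = (case (g, H', K') of (f, H, K) \<Rightarrow> factored_contr.harr f H pr) \<cdot>\<^bsub>Contr R\<^esub> u \<and>
    (case (g, H', K') of (f, H, K) \<Rightarrow> factored_contr.karr f H K pr) \<cdot>\<^bsub>Contr R\<^esub>
      ((case (f, H, K) of (f, H, K) \<Rightarrow> \<lambda>t (g, H', K'). Arrow (factored_contr.mid f H pr)
      (restr (big (factored_contr.mid f H pr)) (po_map pr (src f) H (src g) H' (mor t))) (factored_contr.mid g H' pr)) t (g, H', K')) =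
      v \<cdot>\<^bsub>Contr R\<^esub> (case (f, H, K) of (f, H, K) \<Rightarrow> factored_contr.karr f H K pr)"
    unfolding prod.case by (intro conjI wA e1 e2) (simp_all only: Contr_simps(2,3) arrow.sel s)
  fix u' v' g' :: "(('r, 'a) contraction, 'a graded_map) arrow" and t' H'' K'' :: "(('r, 'a) cochain, 'a graded_map) arrow"
  assume a': "Arrow g (u', v') g' \<in> Ar (map_cat (Contr R))" and b': "Arrow H' (far \<beta>\<alpha> u', t') H'' \<in> Ar (map_cat (coCh R))"
    and c': "Arrow K' (t', far \<beta>\<alpha> v') K'' \<in> Ar (map_cat (coCh R))"
    and HK'': "Cod (coCh R) H'' = Dom (coCh R) K''" and KH'': "K'' \<cdot>\<^bsub>coCh R\<^esub> H'' = far \<beta>\<alpha> g'"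
  have ar': "g' \<in> Ar (Contr R)" "H'' \<in> Ar (coCh R)" "K'' \<in> Ar (coCh R)"
    using a' b' c' unfolding Arrow_in_map_cat by blast+
  interpret B': factored_contr R g' H'' K'' pr by unfold_locales (use ar' HK'' KH'' pr in \<open>simp_all only: coCh_simps(2,3)\<close>)
  note P'' = B'.factored_contr_axioms
  have F: "far \<beta>\<alpha> (u' \<cdot>\<^bsub>Contr R\<^esub> u) = far \<beta>\<alpha> u' \<cdot>\<^bsub>coCh R\<^esub> far \<beta>\<alpha> u" "far \<beta>\<alpha> (v' \<cdot>\<^bsub>Contr R\<^esub> v) = far \<beta>\<alpha> v' \<cdot>\<^bsub>coCh R\<^esub> far \<beta>\<alpha> v"
    by simp_all
  have a2: "Arrow f (u' \<cdot>\<^bsub>Contr R\<^esub> u, v' \<cdot>\<^bsub>Contr R\<^esub> v) g' \<in> Ar (map_cat (Contr R))"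
    using C.map_cat_Cmp_closed[OF a a'] by (simp only: map_cat_simps(5) arrow.sel fst_conv snd_conv simp_thms)
  have b2: "Arrow H (far \<beta>\<alpha> (u' \<cdot>\<^bsub>Contr R\<^esub> u), t' \<cdot>\<^bsub>coCh R\<^esub> t) H'' \<in> Ar (map_cat (coCh R))"
    unfolding F using D.map_cat_Cmp_closed[OF b b'] by (simp only: map_cat_simps(5) arrow.sel fst_conv snd_conv simp_thms)
  have c2: "Arrow K (t' \<cdot>\<^bsub>coCh R\<^esub> t, far \<beta>\<alpha> (v' \<cdot>\<^bsub>Contr R\<^esub> v)) K'' \<in> Ar (map_cat (coCh R))"
    unfolding F using D.map_cat_Cmp_closed[OF c c'] by (simp only: map_cat_simps(5) arrow.sel fst_conv snd_conv simp_thms)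
  note t = map_coChE(4,7,8)[OF b] 
  let ?w' = "Arrow B.mid (restr (big B.mid) (po_map pr (src g) H' (src g') H'' (mor t'))) B'.mid"
  have wA': "?w' \<in> Ar (Contr R)"
    by (rule Contr_arrI[OF B.mid_simps(3) B'.mid_simps(3) cm_po_map[OF P' P'' a' b' c'] po_map_h[OF P' P'' a' b' c']])
  let ?w'' = "Arrow A.mid (restr (big A.mid) (po_map pr (src f) H (src g') H'' (mor (t' \<cdot>\<^bsub>coCh R\<^esub> t)))) B'.mid"
  have wA'': "?w'' \<in> Ar (Contr R)"
    by (rule Contr_arrI[OF A.mid_simps(3) B'.mid_simps(3) cm_po_map[OF P P'' a2 b2 c2] po_map_h[OF P P'' a2 b2 c2]])
  have "?w'' = ?w' \<cdot>\<^bsub>Contr R\<^esub> ?w"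
  proof (rule Contr_eqI[OF wA''])
    show "?w' \<cdot>\<^bsub>Contr R\<^esub> ?w \<in> Ar (Contr R)" by (rule C.Cmp_closed[OF wA wA']) simp
    fix i x assume "x \<in> carrier (cmod (big (src ?w'')) i)"
    then have x: "x \<in> carrier (cmod A.po.P i)" by (simp add: A.mid_simps)
    then obtain z where z: "z \<in> carrier (cmod A.po.L i)" "x = A.po.q i z" by (rule A.po.poE)
    obtain z1 z2 z3 where z': "z = (z1, z2, z3)" "z1 \<in> carrier (cmod (tgt H) i)" "z2 \<in> carrier (cmod (tgt H) (i + 1))" "z3 \<in> carrier (cmod (tgt H) i)"
      using z(1) by auto
    have tz: "(mor t i z1, mor t (i + 1) z2, mor t i z3) \<in> carrier (cmod B.po.L i)"
      using z' cm_closed[OF t(1)] by simp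
    have e: "po_map pr (src f) H (src g) H' (mor t) i x = B.po.q i (mor t i z1, mor t (i + 1) z2, mor t i z3)"
      using Wq[OF z(1)] by (simp add: z(2) z'(1))
    have "po_map pr (src f) H (src g') H'' (mor (t' \<cdot>\<^bsub>coCh R\<^esub> t)) i x = po_map pr (src g) H' (src g') H'' (mor t') i (po_map pr (src f) H (src g) H' (mor t) i x)"
      unfolding e using po_map_quo[OF P P'' a2 b2 c2 z(1)] po_map_quo[OF P' P'' a' b' c' tz] z'(2-) t(2)
      by (simp add: z(2) z'(1))
    moreover have "po_map pr (src f) H (src g) H' (mor t) i x \<in> carrier (cmod (big B.mid) i)"
      using cm_closed[OF W] x by (simp add: A.mid_simps)
    ultimately show "mor ?w'' i x = mor (?w' \<cdot>\<^bsub>Contr R\<^esub> ?w) i x" using x by (simp add: A.mid_simps)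
  qed simp_all
  then show "(case (f, H, K) of (f, H, K) \<Rightarrow> \<lambda>t (g, H', K'). Arrow (factored_contr.mid f H pr)
      (restr (big (factored_contr.mid f H pr)) (po_map pr (src f) H (src g) H' (mor t))) (factored_contr.mid g H' pr)) (t' \<cdot>\<^bsub>coCh R\<^esub> t) (g', H'', K'') =
    (case (g, H', K') of (f, H, K) \<Rightarrow> \<lambda>t (g, H', K'). Arrow (factored_contr.mid f H pr)
      (restr (big (factored_contr.mid f H pr)) (po_map pr (src f) H (src g) H' (mor t))) (factored_contr.mid g H' pr)) t' (g', H'', K'') \<cdot>\<^bsub>Contr R\<^esub>
    (case (f, H, K) of (f, H, K) \<Rightarrow> \<lambda>t (g, H', K'). Arrow (factored_contr.mid f H pr)
      (restr (big (factored_contr.mid f H pr)) (po_map pr (src f) H (src g) H' (mor t))) (factored_contr.mid g H' pr)) t (g, H', K')"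
    unfolding prod.case .
qed

text \<open>Two-out-of-three and retracts are pulled back along the functor and lifting is
  \<open>llp_Contr\<close>; the pushout enters through the factorization axiom.\<close>

lemma (in universe) model_structure_transferred:
  fixes \<Psi> :: "((('r, 'a) contraction, 'a graded_map) arrow \<times> ((('r, 'a) cochain, 'a graded_map) arrow \<times> (('r, 'a) cochain, 'a graded_map) arrow),
      ((('r, 'a) contraction, 'a graded_map) arrow, (('r, 'a) contraction, 'a graded_map) arrow \<times> (('r, 'a) contraction, 'a graded_map) arrow) arrow \<times>
      (((('r, 'a) cochain, 'a graded_map) arrow, (('r, 'a) cochain, 'a graded_map) arrow \<times> (('r, 'a) cochain, 'a graded_map) arrow) arrow \<times>
       ((('r, 'a) cochain, 'a graded_map) arrow, (('r, 'a) cochain, 'a graded_map) arrow \<times> (('r, 'a) cochain, 'a graded_map) arrow) arrow),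
      (('r, 'a) contraction, 'a graded_map) arrow) functor_pair"
  assumes \<Psi>: "factorization_transfer (Contr R) (coCh R) \<beta>\<alpha> \<Psi>"
    and fst_\<Psi>: "fob (fst \<Psi>) = (\<lambda>(f, H, K). factored_contr.harr f H pr)"
    and snd_\<Psi>: "fob (snd \<Psi>) = (\<lambda>(f, H, K). factored_contr.karr f H K pr)"
    and M: "model_structure (coCh R) (qis R) (proj_cof R) (proj_fib R) \<phi> \<psi>"
  shows "model_structure (Contr R) (preimage_class (Contr R) \<beta>\<alpha> (qis R)) (preimage_class (Contr R) \<beta>\<alpha> (proj_cof R))
     (preimage_class (Contr R) \<beta>\<alpha> (proj_fib R)) (transferred \<Psi> \<beta>\<alpha> \<phi>) (transferred \<Psi> \<beta>\<alpha> \<psi>)"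
proof -
  interpret M: model_structure "coCh R" "qis R" "proj_cof R" "proj_fib R" \<phi> \<psi> by (rule M)
  interpret C: category "Contr R" by (rule category_Contr)
  have comp: "far \<beta>\<alpha> (g \<cdot>\<^bsub>Contr R\<^esub> f) = far \<beta>\<alpha> g \<cdot>\<^bsub>coCh R\<^esub> far \<beta>\<alpha> f" for f g :: "(('r, 'a) contraction, 'a graded_map) arrow"
    by simp
  have fact: "factored_contr R f (fob (fst \<chi>) (far \<beta>\<alpha> f)) (fob (snd \<chi>) (far \<beta>\<alpha> f)) pr"
    if f: "f \<in> Ar (Contr R)" and \<chi>: "functorial_factorization (coCh R) \<chi>"
    for f :: "(('r, 'a) contraction, 'a graded_map) arrow" and \<chi>
  proof -
    obtain H K where HK: "\<chi> = (H, K)" by (cases \<chi>)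
    have "(fob H (far \<beta>\<alpha> f), fob K (far \<beta>\<alpha> f)) \<in> Ob (fact_cat (coCh R)) \<and> fob (recompose (coCh R)) (fob H (far \<beta>\<alpha> f), fob K (far \<beta>\<alpha> f)) = far \<beta>\<alpha> f"
      using \<chi> Contr_coCh[OF f]
      unfolding functorial_factorization_def factorization_of_def HK prod.case map_cat_simps(1) id_functor_def functr.select_convs by blast
    then show ?thesis
      unfolding HK fst_conv snd_conv
      by (intro factored_contr.intro f inj_pr)
        (simp_all only: fact_cat_def recompose_def id_functor_def cat.select_convs functr.select_convs mem_Collect_eq prod.case coCh_simps(2,3))
  qed
  have fob_tr: "fob (fst (transferred \<Psi> \<beta>\<alpha> \<chi>)) f = factored_contr.harr f (fob (fst \<chi>) (far \<beta>\<alpha> f)) pr"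
    "fob (snd (transferred \<Psi> \<beta>\<alpha> \<chi>)) f = factored_contr.karr f (fob (fst \<chi>) (far \<beta>\<alpha> f)) (fob (snd \<chi>) (far \<beta>\<alpha> f)) pr" for f \<chi>
    by (simp_all only: transferred_def functor_comp_def factor_image_def fst_\<Psi> snd_\<Psi> functr.select_convs fst_conv snd_conv comp_apply prod.case case_prod_unfold map_functor_def)
  have cof: "far \<beta>\<alpha> (factored_contr.harr f H pr) \<in> proj_cof R"
    if "factored_contr R f H K pr" and H: "H \<in> proj_cof R" for f H K
  proof -
    interpret A: factored_contr R f H K pr by fact
    show ?thesis
      using po_incl_cof[OF A.X.h_complex_axioms H A.src_H] by (simp add: A.harr_def A.mid_simps)
  qed
  let ?C = "Contr R :: (('r, 'a) contraction, (('r, 'a) contraction, 'a graded_map) arrow) cat"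
  show ?thesis
  proof (rule model_structure.intro[OF category_Contr], unfold_locales)
    show "preimage_class ?C \<beta>\<alpha> (qis R) \<subseteq> Ar ?C" "preimage_class ?C \<beta>\<alpha> (proj_cof R) \<subseteq> Ar ?C"
      "preimage_class ?C \<beta>\<alpha> (proj_fib R) \<subseteq> Ar ?C"
      by (auto simp: preimage_class_def)
    show "functorial_factorization ?C (transferred \<Psi> \<beta>\<alpha> \<phi>)" "functorial_factorization ?C (transferred \<Psi> \<beta>\<alpha> \<psi>)"
      by (rule functorial_factorization_transferred[OF category_Contr category_coCh functor_\<beta>\<alpha> \<Psi>], rule M.functorial_\<phi> M.functorial_\<psi>)+
    show "retract_closed ?C (preimage_class ?C \<beta>\<alpha> (qis R))" "retract_closed ?C (preimage_class ?C \<beta>\<alpha> (proj_cof R))"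
      "retract_closed ?C (preimage_class ?C \<beta>\<alpha> (proj_fib R))"
      using M.retracts by (simp_all only: retract_closed_preimage[OF category_Contr category_coCh functor_\<beta>\<alpha>])
    show "llp ?C i p" if "i \<in> preimage_class ?C \<beta>\<alpha> (proj_cof R) \<inter> preimage_class ?C \<beta>\<alpha> (qis R)"
      "p \<in> preimage_class ?C \<beta>\<alpha> (proj_fib R)" for i p
      by (rule llp_Contr) (use that M.trivial_cofibration_lifting[of "far \<beta>\<alpha> i" "far \<beta>\<alpha> p"] in \<open>auto simp: preimage_class_def simp del: \<beta>\<alpha>_simps\<close>)
    show "llp ?C i p" if "i \<in> preimage_class ?C \<beta>\<alpha> (proj_cof R)"
      "p \<in> preimage_class ?C \<beta>\<alpha> (proj_fib R) \<inter> preimage_class ?C \<beta>\<alpha> (qis R)" for i p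
      by (rule llp_Contr) (use that M.trivial_fibration_lifting[of "far \<beta>\<alpha> i" "far \<beta>\<alpha> p"] in \<open>auto simp: preimage_class_def simp del: \<beta>\<alpha>_simps\<close>)
    fix f :: "(('r, 'a) contraction, 'a graded_map) arrow" assume f: "f \<in> Ar (Contr R)"
    {
      interpret A: factored_contr R f "fob (fst \<phi>) (far \<beta>\<alpha> f)" "fob (snd \<phi>) (far \<beta>\<alpha> f)" pr by (rule fact[OF f M.functorial_\<phi>])
      have c: "fob (fst \<phi>) (far \<beta>\<alpha> f) \<in> proj_cof R" and k: "fob (snd \<phi>) (far \<beta>\<alpha> f) \<in> proj_fib R" "fob (snd \<phi>) (far \<beta>\<alpha> f) \<in> qis R"
        using M.factorization_\<phi>[OF Contr_coCh[OF f]] by blast+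
      \<comment> \<open>The left factor is a cofibration, hence injective in each degree, as the
        comparison of its target with the pushout requires.\<close>
      have q: "far \<beta>\<alpha> A.karr \<in> qis R"
        by (rule A.karr_qis[OF _ k(2)]) (rule cof_inj[OF c], simp_all only: A.src_H)
      show "fob (fst (transferred \<Psi> \<beta>\<alpha> \<phi>)) f \<in> preimage_class (Contr R) \<beta>\<alpha> (proj_cof R) \<and>
        fob (snd (transferred \<Psi> \<beta>\<alpha> \<phi>)) f \<in> preimage_class (Contr R) \<beta>\<alpha> (proj_fib R) \<inter> preimage_class (Contr R) \<beta>\<alpha> (qis R)"
        unfolding fob_tr preimage_class_def
        using cof[OF A.factored_contr_axioms c] A.karr_fib[OF k(1)] q A.harr A.karr by blast
    next
      interpret A: factored_contr R f "fob (fst \<psi>) (far \<beta>\<alpha> f)" "fob (snd \<psi>) (far \<beta>\<alpha> f)" pr by (rule fact[OF f M.functorial_\<psi>])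
      have c: "fob (fst \<psi>) (far \<beta>\<alpha> f) \<in> proj_cof R" "fob (fst \<psi>) (far \<beta>\<alpha> f) \<in> qis R" and k: "fob (snd \<psi>) (far \<beta>\<alpha> f) \<in> proj_fib R"
        using M.factorization_\<psi>[OF Contr_coCh[OF f]] by blast+
      have q: "far \<beta>\<alpha> A.harr \<in> qis R"
        by (rule A.harr_qis[OF _ c(2)]) (rule cof_inj[OF c(1)], simp_all only: A.src_H)
      show "fob (fst (transferred \<Psi> \<beta>\<alpha> \<psi>)) f \<in> preimage_class (Contr R) \<beta>\<alpha> (proj_cof R) \<inter> preimage_class (Contr R) \<beta>\<alpha> (qis R) \<and>
        fob (snd (transferred \<Psi> \<beta>\<alpha> \<psi>)) f \<in> preimage_class (Contr R) \<beta>\<alpha> (proj_fib R)"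
        unfolding fob_tr preimage_class_def
        using cof[OF A.factored_contr_axioms c(1)] A.karr_fib[OF k] q A.harr A.karr by blast
    }
    fix g :: "(('r, 'a) contraction, 'a graded_map) arrow" assume g: "g \<in> Ar (Contr R)" and fg: "Cod (Contr R) f = Dom (Contr R) g"
    have fg': "Cod (coCh R) (far \<beta>\<alpha> f) = Dom (coCh R) (far \<beta>\<alpha> g)" using fg by simp
    show "(f \<in> preimage_class (Contr R) \<beta>\<alpha> (qis R) \<and> g \<in> preimage_class (Contr R) \<beta>\<alpha> (qis R) \<longrightarrow> g \<cdot>\<^bsub>Contr R\<^esub> f \<in> preimage_class (Contr R) \<beta>\<alpha> (qis R)) \<and>
         (f \<in> preimage_class (Contr R) \<beta>\<alpha> (qis R) \<and> g \<cdot>\<^bsub>Contr R\<^esub> f \<in> preimage_class (Contr R) \<beta>\<alpha> (qis R) \<longrightarrow> g \<in> preimage_class (Contr R) \<beta>\<alpha> (qis R)) \<and>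
         (g \<in> preimage_class (Contr R) \<beta>\<alpha> (qis R) \<and> g \<cdot>\<^bsub>Contr R\<^esub> f \<in> preimage_class (Contr R) \<beta>\<alpha> (qis R) \<longrightarrow> f \<in> preimage_class (Contr R) \<beta>\<alpha> (qis R))"
      using M.two_out_of_three[OF Contr_coCh[OF f] Contr_coCh[OF g] fg'] f g C.Cmp_closed[OF f g fg]
      unfolding preimage_class_def mem_Collect_eq comp by blast
  qed
qed

text \<open>Pairs are coded by an injection of the square of an infinite set into the set, lists of
  pairs by iterated pairing, and a finitely supported function by a list of arguments and
  coefficients, the latter embedded by \<open>\<iota>\<close>.\<close>

lemma exists_universe:
  fixes R :: "('r, 'x) ring_scheme" and \<iota> :: "'r \<Rightarrow> 'a"
  assumes R: "cring R" and inf: "infinite (UNIV :: 'a set)" and \<iota>: "inj_on \<iota> (carrier R)"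
  obtains pr :: "'a \<times> 'a \<Rightarrow> 'a" and fr where "universe R pr fr"
proof -
  have "(card_of ((UNIV :: 'a set) \<times> (UNIV :: 'a set)), card_of (UNIV :: 'a set)) \<in> ordLeq"
    using card_of_Times_same_infinite[OF inf] by (rule ordIso_imp_ordLeq)
  then obtain pr :: "'a \<times> 'a \<Rightarrow> 'a" where pr: "inj pr"
    unfolding card_of_ordLeq[symmetric] UNIV_Times_UNIV by blast
  have pr': "pr x = pr y \<longleftrightarrow> x = y" for x y using pr by (auto dest: injD)
  obtain a0 a1 :: 'a where a: "a0 \<noteq> a1" using inf by (metis (full_types) UNIV_I ex_new_if_finite finite.emptyI finite_insert insertI1)
  \<comment> \<open>The tags \<open>a0\<close> and \<open>a1\<close> tell the code of the empty list
    from that of a nonempty one.\<close>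
  define code :: "('a \<times> 'a) list \<Rightarrow> 'a" where "code = rec_list (pr (a0, a0)) (\<lambda>p _ c. pr (a1, pr (pr p, c)))"
  have code: "code [] = pr (a0, a0)" "code (p # ps) = pr (a1, pr (pr p, code ps))" for p ps by (simp_all add: code_def)
  have inj_code: "xs = ys" if "code xs = code ys" for xs ys
    using that
  proof (induction xs arbitrary: ys)
    case Nil then show ?case using a by (cases ys) (auto simp: code pr')
  next
    case (Cons x xs) then show ?case using a by (cases ys) (auto simp: code pr')
  qed
  define dec where "dec l x = (case map_of l x of None \<Rightarrow> \<zero>\<^bsub>R\<^esub> | Some r \<Rightarrow> r)" for l :: "('a \<times> 'r) list" and x
  have ex: "\<exists>l. dec l = \<phi> \<and> snd ` set l \<subseteq> carrier R" if \<phi>: "\<phi> \<in> carrier (free R UNIV)" for \<phi> :: "'a \<Rightarrow> 'r"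
  proof -
    obtain xs where xs: "set xs = supp R \<phi>" using \<phi> finite_list[of "supp R \<phi>"] by (auto simp: free_simps)
    have "dec (zip xs (map \<phi> xs)) = \<phi>"
      using xs by (auto simp: dec_def map_of_zip_map supp_def fun_eq_iff)
    moreover have "snd ` set (zip xs (map \<phi> xs)) \<subseteq> carrier R"
      using \<phi> by (auto simp: free_simps set_zip)
    ultimately show ?thesis by blast
  qed
  \<comment> \<open>The listing is arbitrary; the coding is injective because \<open>dec\<close>
    recovers the function from any such list.\<close>
  define ls where "ls \<phi> = (SOME l. dec l = \<phi> \<and> snd ` set l \<subseteq> carrier R)" for \<phi> :: "'a \<Rightarrow> 'r"
  have ls: "dec (ls \<phi>) = \<phi> \<and> snd ` set (ls \<phi>) \<subseteq> carrier R" if "\<phi> \<in> carrier (free R UNIV)" for \<phi> :: "'a \<Rightarrow> 'r"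
    unfolding ls_def by (rule someI_ex[OF ex[OF that]])
  define fr where "fr \<phi> = code (map (\<lambda>(x, r). (x, \<iota> r)) (ls \<phi>))" for \<phi> :: "'a \<Rightarrow> 'r"
  have "inj_on fr (carrier (free R UNIV))"
  proof (rule inj_onI)
    fix \<phi> \<psi> :: "'a \<Rightarrow> 'r" assume c: "\<phi> \<in> carrier (free R UNIV)" "\<psi> \<in> carrier (free R UNIV)" and "fr \<phi> = fr \<psi>"
    then have "map (\<lambda>(x, r). (x, \<iota> r)) (ls \<phi>) = map (\<lambda>(x, r). (x, \<iota> r)) (ls \<psi>)" by (intro inj_code) (simp add: fr_def)
    moreover have "inj_on (\<lambda>(x, r). (x, \<iota> r)) (set (ls \<phi>) \<union> set (ls \<psi>))"
    proof (rule inj_onI)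
      fix p p' assume p: "p \<in> set (ls \<phi>) \<union> set (ls \<psi>)" "p' \<in> set (ls \<phi>) \<union> set (ls \<psi>)"
        and e: "(case p of (x, r) \<Rightarrow> (x, \<iota> r)) = (case p' of (x, r) \<Rightarrow> (x, \<iota> r))"
      have "snd p \<in> carrier R" "snd p' \<in> carrier R" using p ls[OF c(1)] ls[OF c(2)] by auto
      then show "p = p'" using e inj_onD[OF \<iota>, of "snd p" "snd p'"] by (auto simp: case_prod_unfold prod_eq_iff)
    qed
    ultimately have "ls \<phi> = ls \<psi>" by (simp only: inj_on_map_eq_map)
    then show "\<phi> = \<psi>" using ls[OF c(1)] ls[OF c(2)] by metis
  qed
  then have "universe R pr fr" using R pr by (simp add: universe_def universe_axioms_def)
  then show thesis by (rule that)
qed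

theorem theorem2p4:
  fixes R :: "('r, 'x) ring_scheme" and \<iota> :: "'r \<Rightarrow> 'a"
  assumes "cring R"
    and "infinite (UNIV :: 'a set)" and "inj_on \<iota> (carrier R)"
  shows "(\<exists>\<phi> \<psi>. model_structure (Contr R :: (('r, 'a) contraction, _) cat)
              (preimage_class (Contr R) \<beta>\<alpha> (qis R))
              (preimage_class (Contr R) \<beta>\<alpha> (proj_cof R))
              (preimage_class (Contr R) \<beta>\<alpha> (proj_fib R)) \<phi> \<psi>) \<and>
         (\<exists>\<Psi>. factorization_transfer (Contr R :: (('r, 'a) contraction, _) cat) (coCh R) \<beta>\<alpha> \<Psi> \<and>
            (\<forall>\<phi> \<psi>. model_structure (coCh R) (qis R) (proj_cof R) (proj_fib R) \<phi> \<psi> \<longrightarrow>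
               model_structure (Contr R)
                 (preimage_class (Contr R) \<beta>\<alpha> (qis R))
                 (preimage_class (Contr R) \<beta>\<alpha> (proj_cof R))
                 (preimage_class (Contr R) \<beta>\<alpha> (proj_fib R))
                 (transferred \<Psi> \<beta>\<alpha> \<phi>) (transferred \<Psi> \<beta>\<alpha> \<psi>)))"
proof -
  obtain pr :: "'a \<times> 'a \<Rightarrow> 'a" and fr where "universe R pr fr" by (rule exists_universe[OF assms])
  then interpret universe R pr fr .
  obtain \<Psi> where \<Psi>: "factorization_transfer (Contr R :: (('r, 'a) contraction, _) cat) (coCh R) \<beta>\<alpha> \<Psi>"
    "fob (fst \<Psi>) = (\<lambda>(f, H, K). factored_contr.harr f H pr)" "fob (snd \<Psi>) = (\<lambda>(f, H, K). factored_contr.karr f H K pr)"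
    using exists_transfer[OF inj_pr] by blast
  \<comment> \<open>The transfer gives the second half as an implication; an actual model structure
    on complexes turns it into the existence asserted in the first half.\<close>
  obtain \<phi> \<psi> where "model_structure (coCh R :: (('r, 'a) cochain, _) cat) (qis R) (proj_cof R) (proj_fib R) \<phi> \<psi>"
    using coCh_model by blast
  then show ?thesis using model_structure_transferred[OF \<Psi>] \<Psi>(1) by blast
qed

end
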